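(* Let $\mathcal{R}$ be a strict bimonoidal category and $\mathcal{M}(\mathcal{R})$ its bicategory of finite dimensional free modules. The bicategory $\mathcal{M}(\mathcal{R})$ is strict symmetric monoidal with the monoidal operation given by block sum of matrices: $$\boxplus:\mathcal{M}(\mathcal{R})\times\mathcal{M}(\mathcal{R})\to\mathcal{M}(\mathcal{R}),\qquad (\mathbf{n},\mathbf{m})\mapsto\mathbf{n+m},$$ $$(U,V)\mapsto\begin{bmatrix}U&0\\0&V\end{bmatrix},\qquad (\varphi,\psi)\mapsto\begin{bmatrix}\varphi&0\\0&\psi\end{bmatrix},$$ where $[0]$ is the matrix with all entries equal to $0$, the unit of $\oplus$ in $\mathcal{R}$.
   Context: **Conventions.** Categories and bicategories are small and implicitly enriched over simplicial sets. In a bicategory, $*$ is horizontal composition and $I_A$ the identity 1-morphism of $A$. A transformation of pseudofunctors has 1-morphism components and invertible naturality 2-morphisms satisfying the usual axioms. **Strict symmetric monoidal bicategory** $(\mathcal{C},\boxplus,1,\beta)$: a bicategory $\mathcal{C}$, a pseudofunctor $\boxplus:\mathcal{C}\times\mathcal{C}\to\mathcal{C}$, a unit object $1$, and a transformation $\beta:\boxplus\to\boxplus\circ\tau$ ($\tau$ the twist), with $\boxplus$ strictly associative, $1$ a strict unit, and commuting diagrams $(I_B\boxplus\beta_{A,C})*(\beta_{A,B}\boxplus I_C)=\beta_{A,B\boxplus C}$, $(\beta_{A,C}\boxplus I_B)*(I_A\boxplus\beta_{B,C})=\beta_{A\boxplus B,C}$, $\beta_{B,A}*\beta_{A,B}=I_{A\boxplus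 B}$. **Strict bimonoidal category** $(\mathcal{R},\oplus,0,\gamma_\oplus,\otimes,1,\delta)$: a permutative category $(\mathcal{R},\oplus,0,\gamma_\oplus)$ together with a strict monoidal structure $(\otimes,1)$, such that right distributivity $(a\oplus b)\otimes c=(a\otimes c)\oplus(b\otimes c)$ and nullity $0\otimes a=0=a\otimes0$ hold strictly, and a left distributivity natural isomorphism $\delta:a\otimes(b\oplus c)\to(a\otimes b)\oplus(a\otimes c)$, satisfying the usual coherence axioms (Laplaza's axioms, without symmetry of $\otimes$, in which the other structure isomorphisms are identities): $\delta$ is compatible with $\gamma_\oplus$, with associativity of $\oplus$ (distributing over triple sums), with $0$ and $1$, and with products ($\delta_{a\otimes a',b,c}$ is the composite of $a\otimes\delta_{a',b,c}$ and $\delta_{a,a'\otimes b,a'\otimes c}$; $\delta_{a,b,c}\otimes d=\delta_{a,b\otimes d,c\otimes d}$); $\gamma_\oplus\otimes c=\gamma_\oplus$; and the two ways of expanding $(a\oplus a')\otimes(b\oplus b')$ agree up to $\gamma_\oplus$. **Matrices.** $M_n(\mathcal{R})$ is the category of $n\times n$ matrices $V=(V_{i,j})$ of objects of $\mathcal{R}$, with morphisms matrices of isomorphisms in $\mathcal{R}$ between corresponding entries; it is monoidal under $(U\cdot V)_{ik}=\bigoplus_jU_{ij}\otimes V_{jk}$ with strict unit $I_n$ ($1$ on the diagonal, $0$ elsewhere), and with associativity isomorphism $U\cdot(V\cdot W)\to(U\cdot V)\cdot W$ given entrywise by $\gamma_\oplus$ and $\delta$. For a semiring $A$, $GL_n(A)\subset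 M_n(A)$ consists of the matrices whose determinant is a unit in the ring completion $Gr_+(A)$ (i.e. which become invertible over $Gr_+(A)$). $GL_n(\mathcal{R})\subset M_n(\mathcal{R})$ is the full (monoidal) subcategory of matrices whose matrix of path components lies in $GL_n(\pi_0(\mathcal{R}))$; $GL_0(\mathcal{R})$ is the unit category. **$\mathcal{M}(\mathcal{R})$.** The bicategory with objects $\mathbf{n}$, $n\ge0$, with $\mathcal{M}(\mathcal{R})(\mathbf n,\mathbf n)=GL_n(\mathcal{R})$ and $\mathcal{M}(\mathcal{R})(\mathbf n,\mathbf m)=\emptyset$ for $n\ne m$, and composition given by matrix multiplication. *)

theory Defs
  imports "HOL-Algebra.Ring" "Jordan_Normal_Form.Matrix"
begin

section \<open>Small simplicially enriched categories\<close>

text \<open>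
  \<open>sHom C k x y\<close> is the set of \<open>k\<close>-simplices of the simplicial set of morphisms \<open>x \<rightarrow> y\<close>;
  \<open>sFace C k i\<close> goes from dimension \<open>k + 1\<close> to \<open>k\<close> and \<open>sDegen C k i\<close> from \<open>k\<close> to \<open>k + 1\<close>.
  \<open>sId C k x\<close> is the \<open>k\<close>-simplex of the identity of \<open>x\<close>, and \<open>sComp C k g f\<close> is \<open>g\<close> after \<open>f\<close>.
  Hom sets are not required to be disjoint. Ordinary categories are the case in which
  \<open>sHom C k x y\<close> does not depend on \<open>k\<close> and all faces and degeneracies are identities.
\<close>

record ('o, 'm) scat =
  sObj :: "'o set"
  sHom :: "nat \<Rightarrow> 'o \<Rightarrow> 'o \<Rightarrow> 'm set"
  sId :: "nat \<Rightarrow> 'o \<Rightarrow> 'm"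
  sComp :: "nat \<Rightarrow> 'm \<Rightarrow> 'm \<Rightarrow> 'm"
  sFace :: "nat \<Rightarrow> nat \<Rightarrow> 'm \<Rightarrow> 'm"
  sDegen :: "nat \<Rightarrow> nat \<Rightarrow> 'm \<Rightarrow> 'm"

locale scategory =
  fixes C :: "('o, 'm, 'z) scat_scheme"
  assumes id_in: "x \<in> sObj C \<Longrightarrow> sId C k x \<in> sHom C k x x"
    and comp_in: "\<lbrakk>x \<in> sObj C; y \<in> sObj C; z \<in> sObj C; f \<in> sHom C k x y; g \<in> sHom C k y z\<rbrakk>
      \<Longrightarrow> sComp C k g f \<in> sHom C k x z"
    and comp_id_left: "\<lbrakk>x \<in> sObj C; y \<in> sObj C; f \<in> sHom C k x y\<rbrakk>
      \<Longrightarrow> sComp C k (sId C k y) f = f"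
    and comp_id_right: "\<lbrakk>x \<in> sObj C; y \<in> sObj C; f \<in> sHom C k x y\<rbrakk>
      \<Longrightarrow> sComp C k f (sId C k x) = f"
    and comp_assoc: "\<lbrakk>w \<in> sObj C; x \<in> sObj C; y \<in> sObj C; z \<in> sObj C;
        f \<in> sHom C k w x; g \<in> sHom C k x y; h \<in> sHom C k y z\<rbrakk>
      \<Longrightarrow> sComp C k h (sComp C k g f) = sComp C k (sComp C k h g) f"
    and face_in: "\<lbrakk>x \<in> sObj C; y \<in> sObj C; f \<in> sHom C (Suc k) x y; i \<le> Suc k\<rbrakk>
      \<Longrightarrow> sFace C k i f \<in> sHom C k x y"
    and degen_in: "\<lbrakk>x \<in> sObj C; y \<in> sObj C; f \<in> sHom C k x y; i \<le> k\<rbrakk>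
      \<Longrightarrow> sDegen C k i f \<in> sHom C (Suc k) x y"
    and face_face: "\<lbrakk>x \<in> sObj C; y \<in> sObj C; f \<in> sHom C (Suc (Suc k)) x y;
        i < j; j \<le> Suc (Suc k)\<rbrakk>
      \<Longrightarrow> sFace C k i (sFace C (Suc k) j f) = sFace C k (j - 1) (sFace C (Suc k) i f)"
    and face_degen_less: "\<lbrakk>x \<in> sObj C; y \<in> sObj C; f \<in> sHom C (Suc k) x y; i < j; j \<le> Suc k\<rbrakk>
      \<Longrightarrow> sFace C (Suc k) i (sDegen C (Suc k) j f) = sDegen C k (j - 1) (sFace C k i f)"
    and face_degen_eq: "\<lbrakk>x \<in> sObj C; y \<in> sObj C; f \<in> sHom C k x y; j \<le> k; i = j \<or> i = Suc j\<rbrakk>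
      \<Longrightarrow> sFace C k i (sDegen C k j f) = f"
    and face_degen_greater: "\<lbrakk>x \<in> sObj C; y \<in> sObj C; f \<in> sHom C (Suc k) x y;
        Suc j < i; i \<le> Suc (Suc k)\<rbrakk>
      \<Longrightarrow> sFace C (Suc k) i (sDegen C (Suc k) j f) = sDegen C k j (sFace C k (i - 1) f)"
    and degen_degen: "\<lbrakk>x \<in> sObj C; y \<in> sObj C; f \<in> sHom C k x y; i \<le> j; j \<le> k\<rbrakk>
      \<Longrightarrow> sDegen C (Suc k) i (sDegen C k j f) = sDegen C (Suc k) (Suc j) (sDegen C k i f)"
    and face_id: "\<lbrakk>x \<in> sObj C; i \<le> Suc k\<rbrakk> \<Longrightarrow> sFace C k i (sId C (Suc k) x) = sId C k x"
    and degen_id: "\<lbrakk>x \<in> sObj C; i \<le> k\<rbrakk> \<Longrightarrow> sDegen C k i (sId C k x) = sId C (Suc k) x"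
    and face_comp: "\<lbrakk>x \<in> sObj C; y \<in> sObj C; z \<in> sObj C;
        f \<in> sHom C (Suc k) x y; g \<in> sHom C (Suc k) y z; i \<le> Suc k\<rbrakk>
      \<Longrightarrow> sFace C k i (sComp C (Suc k) g f) = sComp C k (sFace C k i g) (sFace C k i f)"
    and degen_comp: "\<lbrakk>x \<in> sObj C; y \<in> sObj C; z \<in> sObj C;
        f \<in> sHom C k x y; g \<in> sHom C k y z; i \<le> k\<rbrakk>
      \<Longrightarrow> sDegen C k i (sComp C k g f) = sComp C (Suc k) (sDegen C k i g) (sDegen C k i f)"

text \<open>The \<open>k\<close>-simplex obtained from a 0-simplex by iterated degeneracies.\<close>

primrec degens :: "('o, 'm, 'z) scat_scheme \<Rightarrow> nat \<Rightarrow> 'm \<Rightarrow> 'm" where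
  "degens C 0 f = f"
| "degens C (Suc k) f = sDegen C k 0 (degens C k f)"

definition siso :: "('o, 'm, 'z) scat_scheme \<Rightarrow> nat \<Rightarrow> 'o \<Rightarrow> 'o \<Rightarrow> 'm \<Rightarrow> bool" where
  "siso C k x y f \<longleftrightarrow> f \<in> sHom C k x y \<and>
    (\<exists>g \<in> sHom C k y x. sComp C k g f = sId C k x \<and> sComp C k f g = sId C k y)"

definition sinv :: "('o, 'm, 'z) scat_scheme \<Rightarrow> 'o \<Rightarrow> 'o \<Rightarrow> 'm \<Rightarrow> 'm" where
  "sinv C x y f = (THE g. g \<in> sHom C 0 y x \<and> sComp C 0 g f = sId C 0 x \<and> sComp C 0 f g = sId C 0 y)"

definition prod_cat :: "('o, 'm, 'z) scat_scheme \<Rightarrow> ('p, 'n, 'y) scat_scheme \<Rightarrow> ('o \<times> 'p, 'm \<times> 'n) scat"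
  where "prod_cat C D =
    \<lparr>sObj = sObj C \<times> sObj D,
     sHom = (\<lambda>k (x, x') (y, y'). sHom C k x y \<times> sHom D k x' y'),
     sId = (\<lambda>k (x, x'). (sId C k x, sId D k x')),
     sComp = (\<lambda>k (g, g') (f, f'). (sComp C k g f, sComp D k g' f')),
     sFace = (\<lambda>k i (f, f'). (sFace C k i f, sFace D k i f')),
     sDegen = (\<lambda>k i (f, f'). (sDegen C k i f, sDegen D k i f'))\<rparr>"

locale sfunctor =
  fixes C :: "('o, 'm, 'z) scat_scheme" and D :: "('p, 'n, 'y) scat_scheme"
    and Fo :: "'o \<Rightarrow> 'p" and Fm :: "nat \<Rightarrow> 'm \<Rightarrow> 'n"
  assumes obj_in: "x \<in> sObj C \<Longrightarrow> Fo x \<in> sObj D"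
    and hom_in: "\<lbrakk>x \<in> sObj C; y \<in> sObj C; f \<in> sHom C k x y\<rbrakk> \<Longrightarrow> Fm k f \<in> sHom D k (Fo x) (Fo y)"
    and map_id: "x \<in> sObj C \<Longrightarrow> Fm k (sId C k x) = sId D k (Fo x)"
    and map_comp: "\<lbrakk>x \<in> sObj C; y \<in> sObj C; z \<in> sObj C; f \<in> sHom C k x y; g \<in> sHom C k y z\<rbrakk>
      \<Longrightarrow> Fm k (sComp C k g f) = sComp D k (Fm k g) (Fm k f)"
    and map_face: "\<lbrakk>x \<in> sObj C; y \<in> sObj C; f \<in> sHom C (Suc k) x y; i \<le> Suc k\<rbrakk>
      \<Longrightarrow> Fm k (sFace C k i f) = sFace D k i (Fm (Suc k) f)"
    and map_degen: "\<lbrakk>x \<in> sObj C; y \<in> sObj C; f \<in> sHom C k x y; i \<le> k\<rbrakk>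
      \<Longrightarrow> Fm (Suc k) (sDegen C k i f) = sDegen D k i (Fm k f)"

text \<open>
  In an enriched natural isomorphism the components are 0-simplices, and naturality is required for
  simplices of every dimension.
\<close>

locale snat_iso =
  fixes C :: "('o, 'm, 'z) scat_scheme" and D :: "('p, 'n, 'y) scat_scheme"
    and Fo :: "'o \<Rightarrow> 'p" and Fm :: "nat \<Rightarrow> 'm \<Rightarrow> 'n"
    and Go :: "'o \<Rightarrow> 'p" and Gm :: "nat \<Rightarrow> 'm \<Rightarrow> 'n"
    and \<eta> :: "'o \<Rightarrow> 'n"
  assumes component_iso: "x \<in> sObj C \<Longrightarrow> siso D 0 (Fo x) (Go x) (\<eta> x)"
    and natural: "\<lbrakk>x \<in> sObj C; y \<in> sObj C; f \<in> sHom C k x y\<rbrakk>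
      \<Longrightarrow> sComp D k (degens D k (\<eta> y)) (Fm k f) = sComp D k (Gm k f) (degens D k (\<eta> x))"


section \<open>Bicategories, pseudofunctors and transformations\<close>

text \<open>
  For \<open>f : A \<rightarrow> B\<close>, \<open>g : B \<rightarrow> C\<close> and \<open>h : C \<rightarrow> D\<close>, \<open>bComp \<B> A B C g f\<close> is the horizontal composite
  \<open>g * f\<close>, \<open>bComp2 \<B> A B C k\<close> is horizontal composition of \<open>k\<close>-simplices of 2-morphisms,
  \<open>bAssoc \<B> A B C D h g f\<close> is the associator \<open>h * (g * f) \<rightarrow> (h * g) * f\<close>, and \<open>bLeft\<close>, \<open>bRight\<close> are
  the unitors \<open>I * f \<rightarrow> f\<close> and \<open>f * I \<rightarrow> f\<close>.
\<close>

record ('o, 'f, 'm) bicat =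
  bObj :: "'o set"
  bHom :: "'o \<Rightarrow> 'o \<Rightarrow> ('f, 'm) scat"
  bId :: "'o \<Rightarrow> 'f"
  bComp :: "'o \<Rightarrow> 'o \<Rightarrow> 'o \<Rightarrow> 'f \<Rightarrow> 'f \<Rightarrow> 'f"
  bComp2 :: "'o \<Rightarrow> 'o \<Rightarrow> 'o \<Rightarrow> nat \<Rightarrow> 'm \<Rightarrow> 'm \<Rightarrow> 'm"
  bAssoc :: "'o \<Rightarrow> 'o \<Rightarrow> 'o \<Rightarrow> 'o \<Rightarrow> 'f \<Rightarrow> 'f \<Rightarrow> 'f \<Rightarrow> 'm"
  bLeft :: "'o \<Rightarrow> 'o \<Rightarrow> 'f \<Rightarrow> 'm"
  bRight :: "'o \<Rightarrow> 'o \<Rightarrow> 'f \<Rightarrow> 'm"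

abbreviation bMor :: "('o, 'f, 'm) bicat \<Rightarrow> 'o \<Rightarrow> 'o \<Rightarrow> 'f set" where
  "bMor \<B> A B \<equiv> sObj (bHom \<B> A B)"

abbreviation bId2 :: "('o, 'f, 'm) bicat \<Rightarrow> 'o \<Rightarrow> 'o \<Rightarrow> 'f \<Rightarrow> 'm" where
  "bId2 \<B> A B f \<equiv> sId (bHom \<B> A B) 0 f"

abbreviation bVert :: "('o, 'f, 'm) bicat \<Rightarrow> 'o \<Rightarrow> 'o \<Rightarrow> 'm \<Rightarrow> 'm \<Rightarrow> 'm" where
  "bVert \<B> A B \<psi> \<phi> \<equiv> sComp (bHom \<B> A B) 0 \<psi> \<phi>"

locale bicategory =
  fixes \<B> :: "('o, 'f, 'm) bicat"
  assumes hom_category: "\<lbrakk>A \<in> bObj \<B>; B \<in> bObj \<B>\<rbrakk> \<Longrightarrow> scategory (bHom \<B> A B)"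
    and id_in: "A \<in> bObj \<B> \<Longrightarrow> bId \<B> A \<in> bMor \<B> A A"
    and comp_functor: "\<lbrakk>A \<in> bObj \<B>; B \<in> bObj \<B>; C \<in> bObj \<B>\<rbrakk> \<Longrightarrow>
      sfunctor (prod_cat (bHom \<B> B C) (bHom \<B> A B)) (bHom \<B> A C)
        (\<lambda>(g, f). bComp \<B> A B C g f) (\<lambda>k (\<psi>, \<phi>). bComp2 \<B> A B C k \<psi> \<phi>)"
    and assoc_iso: "\<lbrakk>A \<in> bObj \<B>; B \<in> bObj \<B>; C \<in> bObj \<B>; D \<in> bObj \<B>\<rbrakk> \<Longrightarrow>
      snat_iso (prod_cat (bHom \<B> C D) (prod_cat (bHom \<B> B C) (bHom \<B> A B))) (bHom \<B> A D)
        (\<lambda>(h, g, f). bComp \<B> A C D h (bComp \<B> A B C g f))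
        (\<lambda>k (\<chi>, \<psi>, \<phi>). bComp2 \<B> A C D k \<chi> (bComp2 \<B> A B C k \<psi> \<phi>))
        (\<lambda>(h, g, f). bComp \<B> A B D (bComp \<B> B C D h g) f)
        (\<lambda>k (\<chi>, \<psi>, \<phi>). bComp2 \<B> A B D k (bComp2 \<B> B C D k \<chi> \<psi>) \<phi>)
        (\<lambda>(h, g, f). bAssoc \<B> A B C D h g f)"
    and left_iso: "\<lbrakk>A \<in> bObj \<B>; B \<in> bObj \<B>\<rbrakk> \<Longrightarrow>
      snat_iso (bHom \<B> A B) (bHom \<B> A B)
        (\<lambda>f. bComp \<B> A B B (bId \<B> B) f)
        (\<lambda>k \<phi>. bComp2 \<B> A B B k (sId (bHom \<B> B B) k (bId \<B> B)) \<phi>)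
        (\<lambda>f. f) (\<lambda>k \<phi>. \<phi>) (bLeft \<B> A B)"
    and right_iso: "\<lbrakk>A \<in> bObj \<B>; B \<in> bObj \<B>\<rbrakk> \<Longrightarrow>
      snat_iso (bHom \<B> A B) (bHom \<B> A B)
        (\<lambda>f. bComp \<B> A A B f (bId \<B> A))
        (\<lambda>k \<phi>. bComp2 \<B> A A B k \<phi> (sId (bHom \<B> A A) k (bId \<B> A)))
        (\<lambda>f. f) (\<lambda>k \<phi>. \<phi>) (bRight \<B> A B)"
    and pentagon: "\<lbrakk>A \<in> bObj \<B>; B \<in> bObj \<B>; C \<in> bObj \<B>; D \<in> bObj \<B>; E \<in> bObj \<B>;
        f \<in> bMor \<B> A B; g \<in> bMor \<B> B C; h \<in> bMor \<B> C D; j \<in> bMor \<B> D E\<rbrakk> \<Longrightarrow>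
      bVert \<B> A E (bAssoc \<B> A B C E (bComp \<B> C D E j h) g f)
                  (bAssoc \<B> A C D E j h (bComp \<B> A B C g f)) =
      bVert \<B> A E (bComp2 \<B> A B E 0 (bAssoc \<B> B C D E j h g) (bId2 \<B> A B f))
        (bVert \<B> A E (bAssoc \<B> A B D E j (bComp \<B> B C D h g) f)
                     (bComp2 \<B> A D E 0 (bId2 \<B> D E j) (bAssoc \<B> A B C D h g f)))"
    and triangle: "\<lbrakk>A \<in> bObj \<B>; B \<in> bObj \<B>; C \<in> bObj \<B>; f \<in> bMor \<B> A B; g \<in> bMor \<B> B C\<rbrakk> \<Longrightarrow>
      bVert \<B> A C (bComp2 \<B> A B C 0 (bRight \<B> B C g) (bId2 \<B> A B f))
                  (bAssoc \<B> A B B C g (bId \<B> B) f) =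
      bComp2 \<B> A B C 0 (bId2 \<B> B C g) (bLeft \<B> A B f)"

definition prod_bicat :: "('o, 'f, 'm) bicat \<Rightarrow> ('p, 'g, 'n) bicat \<Rightarrow> ('o \<times> 'p, 'f \<times> 'g, 'm \<times> 'n) bicat"
  where "prod_bicat \<B> \<C> =
    \<lparr>bObj = bObj \<B> \<times> bObj \<C>,
     bHom = (\<lambda>(A, A') (B, B'). prod_cat (bHom \<B> A B) (bHom \<C> A' B')),
     bId = (\<lambda>(A, A'). (bId \<B> A, bId \<C> A')),
     bComp = (\<lambda>(A, A') (B, B') (C, C') (g, g') (f, f'). (bComp \<B> A B C g f, bComp \<C> A' B' C' g' f')),
     bComp2 = (\<lambda>(A, A') (B, B') (C, C') k (\<psi>, \<psi>') (\<phi>, \<phi>').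
        (bComp2 \<B> A B C k \<psi> \<phi>, bComp2 \<C> A' B' C' k \<psi>' \<phi>')),
     bAssoc = (\<lambda>(A, A') (B, B') (C, C') (D, D') (h, h') (g, g') (f, f').
        (bAssoc \<B> A B C D h g f, bAssoc \<C> A' B' C' D' h' g' f')),
     bLeft = (\<lambda>(A, A') (B, B') (f, f'). (bLeft \<B> A B f, bLeft \<C> A' B' f')),
     bRight = (\<lambda>(A, A') (B, B') (f, f'). (bRight \<B> A B f, bRight \<C> A' B' f'))\<rparr>"

text \<open>
  For a pseudofunctor \<open>P\<close>, \<open>pComp P A B C g f\<close> is the constraint \<open>P g * P f \<rightarrow> P (g * f)\<close> and
  \<open>pUnit P A\<close> is the constraint \<open>I \<rightarrow> P I\<close> at \<open>A\<close>.
\<close>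

record ('o, 'f, 'm, 'p, 'g, 'n) pfun =
  p0 :: "'o \<Rightarrow> 'p"
  p1 :: "'o \<Rightarrow> 'o \<Rightarrow> 'f \<Rightarrow> 'g"
  p2 :: "'o \<Rightarrow> 'o \<Rightarrow> nat \<Rightarrow> 'm \<Rightarrow> 'n"
  pComp :: "'o \<Rightarrow> 'o \<Rightarrow> 'o \<Rightarrow> 'f \<Rightarrow> 'f \<Rightarrow> 'n"
  pUnit :: "'o \<Rightarrow> 'n"

locale pseudofunctor =
  fixes \<B> :: "('o, 'f, 'm) bicat" and \<C> :: "('p, 'g, 'n) bicat"
    and P :: "('o, 'f, 'm, 'p, 'g, 'n) pfun"
  assumes obj_in: "A \<in> bObj \<B> \<Longrightarrow> p0 P A \<in> bObj \<C>"
    and hom_functor: "\<lbrakk>A \<in> bObj \<B>; B \<in> bObj \<B>\<rbrakk> \<Longrightarrow>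
      sfunctor (bHom \<B> A B) (bHom \<C> (p0 P A) (p0 P B)) (p1 P A B) (p2 P A B)"
    and comp_iso: "\<lbrakk>A \<in> bObj \<B>; B \<in> bObj \<B>; C \<in> bObj \<B>\<rbrakk> \<Longrightarrow>
      snat_iso (prod_cat (bHom \<B> B C) (bHom \<B> A B)) (bHom \<C> (p0 P A) (p0 P C))
        (\<lambda>(g, f). bComp \<C> (p0 P A) (p0 P B) (p0 P C) (p1 P B C g) (p1 P A B f))
        (\<lambda>k (\<psi>, \<phi>). bComp2 \<C> (p0 P A) (p0 P B) (p0 P C) k (p2 P B C k \<psi>) (p2 P A B k \<phi>))
        (\<lambda>(g, f). p1 P A C (bComp \<B> A B C g f))
        (\<lambda>k (\<psi>, \<phi>). p2 P A C k (bComp2 \<B> A B C k \<psi> \<phi>))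
        (\<lambda>(g, f). pComp P A B C g f)"
    and unit_iso: "A \<in> bObj \<B> \<Longrightarrow>
      siso (bHom \<C> (p0 P A) (p0 P A)) 0 (bId \<C> (p0 P A)) (p1 P A A (bId \<B> A)) (pUnit P A)"
    and assoc_coherence: "\<lbrakk>A \<in> bObj \<B>; B \<in> bObj \<B>; C \<in> bObj \<B>; D \<in> bObj \<B>;
        f \<in> bMor \<B> A B; g \<in> bMor \<B> B C; h \<in> bMor \<B> C D\<rbrakk> \<Longrightarrow>
      bVert \<C> (p0 P A) (p0 P D) (pComp P A B D (bComp \<B> B C D h g) f)
        (bVert \<C> (p0 P A) (p0 P D)
          (bComp2 \<C> (p0 P A) (p0 P B) (p0 P D) 0
             (pComp P B C D h g) (bId2 \<C> (p0 P A) (p0 P B) (p1 P A B f)))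
          (bAssoc \<C> (p0 P A) (p0 P B) (p0 P C) (p0 P D) (p1 P C D h) (p1 P B C g) (p1 P A B f))) =
      bVert \<C> (p0 P A) (p0 P D) (p2 P A D 0 (bAssoc \<B> A B C D h g f))
        (bVert \<C> (p0 P A) (p0 P D) (pComp P A C D h (bComp \<B> A B C g f))
          (bComp2 \<C> (p0 P A) (p0 P C) (p0 P D) 0
             (bId2 \<C> (p0 P C) (p0 P D) (p1 P C D h)) (pComp P A B C g f)))"
    and left_coherence: "\<lbrakk>A \<in> bObj \<B>; B \<in> bObj \<B>; f \<in> bMor \<B> A B\<rbrakk> \<Longrightarrow>
      bVert \<C> (p0 P A) (p0 P B) (p2 P A B 0 (bLeft \<B> A B f))
        (bVert \<C> (p0 P A) (p0 P B) (pComp P A B B (bId \<B> B) f)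
          (bComp2 \<C> (p0 P A) (p0 P B) (p0 P B) 0
             (pUnit P B) (bId2 \<C> (p0 P A) (p0 P B) (p1 P A B f)))) =
      bLeft \<C> (p0 P A) (p0 P B) (p1 P A B f)"
    and right_coherence: "\<lbrakk>A \<in> bObj \<B>; B \<in> bObj \<B>; f \<in> bMor \<B> A B\<rbrakk> \<Longrightarrow>
      bVert \<C> (p0 P A) (p0 P B) (p2 P A B 0 (bRight \<B> A B f))
        (bVert \<C> (p0 P A) (p0 P B) (pComp P A A B f (bId \<B> A))
          (bComp2 \<C> (p0 P A) (p0 P A) (p0 P B) 0
             (bId2 \<C> (p0 P A) (p0 P B) (p1 P A B f)) (pUnit P A))) =
      bRight \<C> (p0 P A) (p0 P B) (p1 P A B f)"

text \<open>Equality of pseudofunctors with source \<open>\<B>\<close>, including their constraint 2-morphisms.\<close>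

definition pfun_eq ::
  "('o, 'f, 'm) bicat \<Rightarrow> ('o, 'f, 'm, 'p, 'g, 'n) pfun \<Rightarrow> ('o, 'f, 'm, 'p, 'g, 'n) pfun \<Rightarrow> bool" where
  "pfun_eq \<B> P Q \<longleftrightarrow>
    (\<forall>A \<in> bObj \<B>. p0 P A = p0 Q A \<and> pUnit P A = pUnit Q A) \<and>
    (\<forall>A \<in> bObj \<B>. \<forall>B \<in> bObj \<B>. \<forall>f \<in> bMor \<B> A B. p1 P A B f = p1 Q A B f) \<and>
    (\<forall>A \<in> bObj \<B>. \<forall>B \<in> bObj \<B>. \<forall>f \<in> bMor \<B> A B. \<forall>f' \<in> bMor \<B> A B.
      \<forall>k. \<forall>\<phi> \<in> sHom (bHom \<B> A B) k f f'. p2 P A B k \<phi> = p2 Q A B k \<phi>) \<and>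
    (\<forall>A \<in> bObj \<B>. \<forall>B \<in> bObj \<B>. \<forall>C \<in> bObj \<B>. \<forall>f \<in> bMor \<B> A B. \<forall>g \<in> bMor \<B> B C.
      pComp P A B C g f = pComp Q A B C g f)"

definition pfun_id :: "('o, 'f, 'm) bicat \<Rightarrow> ('o, 'f, 'm, 'o, 'f, 'm) pfun" where
  "pfun_id \<B> =
    \<lparr>p0 = (\<lambda>A. A), p1 = (\<lambda>A B f. f), p2 = (\<lambda>A B k \<phi>. \<phi>),
     pComp = (\<lambda>A B C g f. bId2 \<B> A C (bComp \<B> A B C g f)),
     pUnit = (\<lambda>A. bId2 \<B> A A (bId \<B> A))\<rparr>"

text \<open>The composite of \<open>P\<close> followed by \<open>Q\<close>, where \<open>\<D>\<close> is the target of \<open>Q\<close>.\<close>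

definition pfun_comp ::
  "('q, 'h, 'l) bicat \<Rightarrow> ('p, 'g, 'n, 'q, 'h, 'l) pfun \<Rightarrow> ('o, 'f, 'm, 'p, 'g, 'n) pfun
    \<Rightarrow> ('o, 'f, 'm, 'q, 'h, 'l) pfun" where
  "pfun_comp \<D> Q P =
    \<lparr>p0 = (\<lambda>A. p0 Q (p0 P A)),
     p1 = (\<lambda>A B f. p1 Q (p0 P A) (p0 P B) (p1 P A B f)),
     p2 = (\<lambda>A B k \<phi>. p2 Q (p0 P A) (p0 P B) k (p2 P A B k \<phi>)),
     pComp = (\<lambda>A B C g f. bVert \<D> (p0 Q (p0 P A)) (p0 Q (p0 P C))
        (p2 Q (p0 P A) (p0 P C) 0 (pComp P A B C g f))
        (pComp Q (p0 P A) (p0 P B) (p0 P C) (p1 P B C g) (p1 P A B f))),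
     pUnit = (\<lambda>A. bVert \<D> (p0 Q (p0 P A)) (p0 Q (p0 P A))
        (p2 Q (p0 P A) (p0 P A) 0 (pUnit P A)) (pUnit Q (p0 P A)))\<rparr>"

definition pfun_prod ::
  "('o, 'f, 'm, 'p, 'g, 'n) pfun \<Rightarrow> ('o2, 'f2, 'm2, 'p2, 'g2, 'n2) pfun
    \<Rightarrow> ('o \<times> 'o2, 'f \<times> 'f2, 'm \<times> 'm2, 'p \<times> 'p2, 'g \<times> 'g2, 'n \<times> 'n2) pfun" where
  "pfun_prod P Q =
    \<lparr>p0 = (\<lambda>(A, A'). (p0 P A, p0 Q A')),
     p1 = (\<lambda>(A, A') (B, B') (f, f'). (p1 P A B f, p1 Q A' B' f')),
     p2 = (\<lambda>(A, A') (B, B') k (\<phi>, \<phi>'). (p2 P A B k \<phi>, p2 Q A' B' k \<phi>')),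
     pComp = (\<lambda>(A, A') (B, B') (C, C') (g, g') (f, f'). (pComp P A B C g f, pComp Q A' B' C' g' f')),
     pUnit = (\<lambda>(A, A'). (pUnit P A, pUnit Q A'))\<rparr>"

text \<open>The twist \<open>\<B> \<times> \<B> \<rightarrow> \<B> \<times> \<B>\<close>, and the rebracketing \<open>(\<B> \<times> \<B>) \<times> \<B> \<rightarrow> \<B> \<times> (\<B> \<times> \<B>)\<close>.\<close>

definition pfun_twist ::
  "('o, 'f, 'm) bicat \<Rightarrow> ('o \<times> 'o, 'f \<times> 'f, 'm \<times> 'm, 'o \<times> 'o, 'f \<times> 'f, 'm \<times> 'm) pfun" where
  "pfun_twist \<B> =
    \<lparr>p0 = (\<lambda>(A, A'). (A', A)),
     p1 = (\<lambda>_ _ (f, f'). (f', f)),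
     p2 = (\<lambda>_ _ k (\<phi>, \<phi>'). (\<phi>', \<phi>)),
     pComp = (\<lambda>(A, A') (B, B') (C, C') (g, g') (f, f').
        (bId2 \<B> A' C' (bComp \<B> A' B' C' g' f'), bId2 \<B> A C (bComp \<B> A B C g f))),
     pUnit = (\<lambda>(A, A'). (bId2 \<B> A' A' (bId \<B> A'), bId2 \<B> A A (bId \<B> A)))\<rparr>"

definition pfun_rebracket ::
  "('o, 'f, 'm) bicat \<Rightarrow> (('o \<times> 'o) \<times> 'o, ('f \<times> 'f) \<times> 'f, ('m \<times> 'm) \<times> 'm,
                          'o \<times> 'o \<times> 'o, 'f \<times> 'f \<times> 'f, 'm \<times> 'm \<times> 'm) pfun" where
  "pfun_rebracket \<B> =
    \<lparr>p0 = (\<lambda>((A, A'), A''). (A, A', A'')),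
     p1 = (\<lambda>_ _ ((f, f'), f''). (f, f', f'')),
     p2 = (\<lambda>_ _ k ((\<phi>, \<phi>'), \<phi>''). (\<phi>, \<phi>', \<phi>'')),
     pComp = (\<lambda>((A, A'), A'') ((B, B'), B'') ((C, C'), C'') ((g, g'), g'') ((f, f'), f'').
        (bId2 \<B> A C (bComp \<B> A B C g f), bId2 \<B> A' C' (bComp \<B> A' B' C' g' f'),
         bId2 \<B> A'' C'' (bComp \<B> A'' B'' C'' g'' f''))),
     pUnit = (\<lambda>((A, A'), A''). (bId2 \<B> A A (bId \<B> A), bId2 \<B> A' A' (bId \<B> A'),
        bId2 \<B> A'' A'' (bId \<B> A'')))\<rparr>"

text \<open>
  The pseudofunctors \<open>A \<mapsto> (u, A)\<close> and \<open>A \<mapsto> (A, u)\<close> from \<open>\<B>\<close> to \<open>\<B> \<times> \<B>\<close>, constant at \<open>u\<close> in one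
  coordinate. Their composition constraint there is the unitor \<open>I * I \<rightarrow> I\<close> at \<open>u\<close>.
\<close>

definition pfun_insert_left ::
  "('o, 'f, 'm) bicat \<Rightarrow> 'o \<Rightarrow> ('o, 'f, 'm, 'o \<times> 'o, 'f \<times> 'f, 'm \<times> 'm) pfun" where
  "pfun_insert_left \<B> u =
    \<lparr>p0 = (\<lambda>A. (u, A)),
     p1 = (\<lambda>A B f. (bId \<B> u, f)),
     p2 = (\<lambda>A B k \<phi>. (sId (bHom \<B> u u) k (bId \<B> u), \<phi>)),
     pComp = (\<lambda>A B C g f. (bLeft \<B> u u (bId \<B> u), bId2 \<B> A C (bComp \<B> A B C g f))),
     pUnit = (\<lambda>A. (bId2 \<B> u u (bId \<B> u), bId2 \<B> A A (bId \<B> A)))\<rparr>"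

definition pfun_insert_right ::
  "('o, 'f, 'm) bicat \<Rightarrow> 'o \<Rightarrow> ('o, 'f, 'm, 'o \<times> 'o, 'f \<times> 'f, 'm \<times> 'm) pfun" where
  "pfun_insert_right \<B> u =
    \<lparr>p0 = (\<lambda>A. (A, u)),
     p1 = (\<lambda>A B f. (f, bId \<B> u)),
     p2 = (\<lambda>A B k \<phi>. (\<phi>, sId (bHom \<B> u u) k (bId \<B> u))),
     pComp = (\<lambda>A B C g f. (bId2 \<B> A C (bComp \<B> A B C g f), bLeft \<B> u u (bId \<B> u))),
     pUnit = (\<lambda>A. (bId2 \<B> A A (bId \<B> A), bId2 \<B> u u (bId \<B> u)))\<rparr>"

text \<open>
  For a transformation \<open>\<sigma> : F \<rightarrow> G\<close> and \<open>f : A \<rightarrow> B\<close>, \<open>t1 \<sigma> A : F A \<rightarrow> G A\<close> is the component at \<open>A\<close> and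
  \<open>t2 \<sigma> A B f : G f * t1 \<sigma> A \<rightarrow> t1 \<sigma> B * F f\<close> is the invertible naturality 2-morphism.
\<close>

record ('o, 'f, 'g, 'n) trafo =
  t1 :: "'o \<Rightarrow> 'g"
  t2 :: "'o \<Rightarrow> 'o \<Rightarrow> 'f \<Rightarrow> 'n"

locale transformation =
  fixes \<B> :: "('o, 'f, 'm) bicat" and \<C> :: "('p, 'g, 'n) bicat"
    and F G :: "('o, 'f, 'm, 'p, 'g, 'n) pfun"
    and \<sigma> :: "('o, 'f, 'g, 'n) trafo"
  assumes component_in: "A \<in> bObj \<B> \<Longrightarrow> t1 \<sigma> A \<in> bMor \<C> (p0 F A) (p0 G A)"
    and naturality_iso: "\<lbrakk>A \<in> bObj \<B>; B \<in> bObj \<B>\<rbrakk> \<Longrightarrow>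
      snat_iso (bHom \<B> A B) (bHom \<C> (p0 F A) (p0 G B))
        (\<lambda>f. bComp \<C> (p0 F A) (p0 G A) (p0 G B) (p1 G A B f) (t1 \<sigma> A))
        (\<lambda>k \<phi>. bComp2 \<C> (p0 F A) (p0 G A) (p0 G B) k (p2 G A B k \<phi>)
           (sId (bHom \<C> (p0 F A) (p0 G A)) k (t1 \<sigma> A)))
        (\<lambda>f. bComp \<C> (p0 F A) (p0 F B) (p0 G B) (t1 \<sigma> B) (p1 F A B f))
        (\<lambda>k \<phi>. bComp2 \<C> (p0 F A) (p0 F B) (p0 G B) k
           (sId (bHom \<C> (p0 F B) (p0 G B)) k (t1 \<sigma> B)) (p2 F A B k \<phi>))
        (t2 \<sigma> A B)"
    and comp_coherence: "\<lbrakk>A \<in> bObj \<B>; B \<in> bObj \<B>; C \<in> bObj \<B>; f \<in> bMor \<B> A B; g \<in> bMor \<B> B C\<rbrakk> \<Longrightarrow>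
      bVert \<C> (p0 F A) (p0 G C) (t2 \<sigma> A C (bComp \<B> A B C g f))
        (bVert \<C> (p0 F A) (p0 G C)
          (bComp2 \<C> (p0 F A) (p0 G A) (p0 G C) 0
             (pComp G A B C g f) (bId2 \<C> (p0 F A) (p0 G A) (t1 \<sigma> A)))
          (bAssoc \<C> (p0 F A) (p0 G A) (p0 G B) (p0 G C) (p1 G B C g) (p1 G A B f) (t1 \<sigma> A))) =
      bVert \<C> (p0 F A) (p0 G C)
        (bComp2 \<C> (p0 F A) (p0 F C) (p0 G C) 0
           (bId2 \<C> (p0 F C) (p0 G C) (t1 \<sigma> C)) (pComp F A B C g f))
        (bVert \<C> (p0 F A) (p0 G C)
          (sinv (bHom \<C> (p0 F A) (p0 G C))
            (bComp \<C> (p0 F A) (p0 F C) (p0 G C) (t1 \<sigma> C)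
               (bComp \<C> (p0 F A) (p0 F B) (p0 F C) (p1 F B C g) (p1 F A B f)))
            (bComp \<C> (p0 F A) (p0 F B) (p0 G C)
               (bComp \<C> (p0 F B) (p0 F C) (p0 G C) (t1 \<sigma> C) (p1 F B C g)) (p1 F A B f))
            (bAssoc \<C> (p0 F A) (p0 F B) (p0 F C) (p0 G C) (t1 \<sigma> C) (p1 F B C g) (p1 F A B f)))
          (bVert \<C> (p0 F A) (p0 G C)
            (bComp2 \<C> (p0 F A) (p0 F B) (p0 G C) 0
               (t2 \<sigma> B C g) (bId2 \<C> (p0 F A) (p0 F B) (p1 F A B f)))
            (bVert \<C> (p0 F A) (p0 G C)
              (bAssoc \<C> (p0 F A) (p0 F B) (p0 G B) (p0 G C) (p1 G B C g) (t1 \<sigma> B) (p1 F A B f))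
              (bComp2 \<C> (p0 F A) (p0 G B) (p0 G C) 0
                 (bId2 \<C> (p0 G B) (p0 G C) (p1 G B C g)) (t2 \<sigma> A B f)))))"
    and unit_coherence: "A \<in> bObj \<B> \<Longrightarrow>
      bVert \<C> (p0 F A) (p0 G A) (t2 \<sigma> A A (bId \<B> A))
        (bComp2 \<C> (p0 F A) (p0 G A) (p0 G A) 0
           (pUnit G A) (bId2 \<C> (p0 F A) (p0 G A) (t1 \<sigma> A))) =
      bVert \<C> (p0 F A) (p0 G A)
        (bComp2 \<C> (p0 F A) (p0 F A) (p0 G A) 0
           (bId2 \<C> (p0 F A) (p0 G A) (t1 \<sigma> A)) (pUnit F A))
        (bVert \<C> (p0 F A) (p0 G A)
          (sinv (bHom \<C> (p0 F A) (p0 G A))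
            (bComp \<C> (p0 F A) (p0 F A) (p0 G A) (t1 \<sigma> A) (bId \<C> (p0 F A)))
            (t1 \<sigma> A)
            (bRight \<C> (p0 F A) (p0 G A) (t1 \<sigma> A)))
          (bLeft \<C> (p0 F A) (p0 G A) (t1 \<sigma> A)))"


section \<open>Strict symmetric monoidal bicategories\<close>

locale strict_symmetric_monoidal_bicategory = bicategory \<B>
  for \<B> :: "('o, 'f, 'm) bicat" +
  fixes P :: "('o \<times> 'o, 'f \<times> 'f, 'm \<times> 'm, 'o, 'f, 'm) pfun"
    and u :: 'o
    and \<beta> :: "('o \<times> 'o, 'f \<times> 'f, 'f, 'm) trafo"
  assumes box_pseudofunctor: "pseudofunctor (prod_bicat \<B> \<B>) \<B> P"
    and unit_in: "u \<in> bObj \<B>"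
    and braiding_transformation:
      "transformation (prod_bicat \<B> \<B>) \<B> P (pfun_comp \<B> P (pfun_twist \<B>)) \<beta>"
    and strict_assoc: "pfun_eq (prod_bicat (prod_bicat \<B> \<B>) \<B>)
      (pfun_comp \<B> P (pfun_prod P (pfun_id \<B>)))
      (pfun_comp \<B> (pfun_comp \<B> P (pfun_prod (pfun_id \<B>) P)) (pfun_rebracket \<B>))"
    and strict_unit_left: "pfun_eq \<B> (pfun_comp \<B> P (pfun_insert_left \<B> u)) (pfun_id \<B>)"
    and strict_unit_right: "pfun_eq \<B> (pfun_comp \<B> P (pfun_insert_right \<B> u)) (pfun_id \<B>)"
    and braiding_left: "\<lbrakk>A \<in> bObj \<B>; B \<in> bObj \<B>; C \<in> bObj \<B>\<rbrakk> \<Longrightarrow>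
      bComp \<B> (p0 P (p0 P (A, B), C)) (p0 P (p0 P (B, A), C)) (p0 P (B, p0 P (C, A)))
        (p1 P (B, p0 P (A, C)) (B, p0 P (C, A)) (bId \<B> B, t1 \<beta> (A, C)))
        (p1 P (p0 P (A, B), C) (p0 P (B, A), C) (t1 \<beta> (A, B), bId \<B> C))
      = t1 \<beta> (A, p0 P (B, C))"
    and braiding_right: "\<lbrakk>A \<in> bObj \<B>; B \<in> bObj \<B>; C \<in> bObj \<B>\<rbrakk> \<Longrightarrow>
      bComp \<B> (p0 P (A, p0 P (B, C))) (p0 P (A, p0 P (C, B))) (p0 P (p0 P (C, A), B))
        (p1 P (p0 P (A, C), B) (p0 P (C, A), B) (t1 \<beta> (A, C), bId \<B> B))
        (p1 P (A, p0 P (B, C)) (A, p0 P (C, B)) (bId \<B> A, t1 \<beta> (B, C)))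
      = t1 \<beta> (p0 P (A, B), C)"
    and braiding_symmetric: "\<lbrakk>A \<in> bObj \<B>; B \<in> bObj \<B>\<rbrakk> \<Longrightarrow>
      bComp \<B> (p0 P (A, B)) (p0 P (B, A)) (p0 P (A, B)) (t1 \<beta> (B, A)) (t1 \<beta> (A, B))
      = bId \<B> (p0 P (A, B))"


section \<open>Strict bimonoidal categories\<close>

text \<open>
  \<open>rgam R a b : a \<oplus> b \<rightarrow> b \<oplus> a\<close> is the symmetry of \<open>\<oplus>\<close> and
  \<open>rdelta R a b c : a \<otimes> (b \<oplus> c) \<rightarrow> (a \<otimes> b) \<oplus> (a \<otimes> c)\<close> is left distributivity.
\<close>

record ('o, 'm) bimon = "('o, 'm) scat" +
  rplus :: "'o \<Rightarrow> 'o \<Rightarrow> 'o" (infixl "[+]\<index>" 65)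
  rplusM :: "nat \<Rightarrow> 'm \<Rightarrow> 'm \<Rightarrow> 'm"
  rzero :: 'o
  rgam :: "'o \<Rightarrow> 'o \<Rightarrow> 'm"
  rtimes :: "'o \<Rightarrow> 'o \<Rightarrow> 'o" (infixl "[*]\<index>" 70)
  rtimesM :: "nat \<Rightarrow> 'm \<Rightarrow> 'm \<Rightarrow> 'm"
  rone :: 'o
  rdelta :: "'o \<Rightarrow> 'o \<Rightarrow> 'o \<Rightarrow> 'm"

locale permutative_category = scategory R
  for R :: "('o, 'm, 'z) bimon_scheme" (structure) +
  assumes plus_functor: "sfunctor (prod_cat R R) R (\<lambda>(a, b). a [+] b) (\<lambda>k (f, g). rplusM R k f g)"
    and zero_in: "rzero R \<in> sObj R"
    and plus_assoc: "\<lbrakk>a \<in> sObj R; b \<in> sObj R; c \<in> sObj R\<rbrakk> \<Longrightarrow> (a [+] b) [+] c = a [+] (b [+] c)"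
    and plus_assocM: "\<lbrakk>a \<in> sObj R; a' \<in> sObj R; b \<in> sObj R; b' \<in> sObj R; c \<in> sObj R; c' \<in> sObj R;
        f \<in> sHom R k a a'; g \<in> sHom R k b b'; h \<in> sHom R k c c'\<rbrakk>
      \<Longrightarrow> rplusM R k (rplusM R k f g) h = rplusM R k f (rplusM R k g h)"
    and zero_plus: "a \<in> sObj R \<Longrightarrow> rzero R [+] a = a"
    and plus_zero: "a \<in> sObj R \<Longrightarrow> a [+] rzero R = a"
    and zero_plusM: "\<lbrakk>a \<in> sObj R; b \<in> sObj R; f \<in> sHom R k a b\<rbrakk>
      \<Longrightarrow> rplusM R k (sId R k (rzero R)) f = f"
    and plus_zeroM: "\<lbrakk>a \<in> sObj R; b \<in> sObj R; f \<in> sHom R k a b\<rbrakk>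
      \<Longrightarrow> rplusM R k f (sId R k (rzero R)) = f"
    and gam_iso: "snat_iso (prod_cat R R) R
      (\<lambda>(a, b). a [+] b) (\<lambda>k (f, g). rplusM R k f g)
      (\<lambda>(a, b). b [+] a) (\<lambda>k (f, g). rplusM R k g f)
      (\<lambda>(a, b). rgam R a b)"
    and gam_gam: "\<lbrakk>a \<in> sObj R; b \<in> sObj R\<rbrakk>
      \<Longrightarrow> sComp R 0 (rgam R b a) (rgam R a b) = sId R 0 (a [+] b)"
    and gam_zero: "a \<in> sObj R \<Longrightarrow> rgam R a (rzero R) = sId R 0 a"
    and gam_plus: "\<lbrakk>a \<in> sObj R; b \<in> sObj R; c \<in> sObj R\<rbrakk>
      \<Longrightarrow> rgam R a (b [+] c) =
          sComp R 0 (rplusM R 0 (sId R 0 b) (rgam R a c)) (rplusM R 0 (rgam R a b) (sId R 0 c))"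

locale strict_bimonoidal_category = permutative_category R
  for R :: "('o, 'm, 'z) bimon_scheme" (structure) +
  assumes times_functor: "sfunctor (prod_cat R R) R (\<lambda>(a, b). a [*] b) (\<lambda>k (f, g). rtimesM R k f g)"
    and one_in: "rone R \<in> sObj R"
    and times_assoc: "\<lbrakk>a \<in> sObj R; b \<in> sObj R; c \<in> sObj R\<rbrakk> \<Longrightarrow> (a [*] b) [*] c = a [*] (b [*] c)"
    and times_assocM: "\<lbrakk>a \<in> sObj R; a' \<in> sObj R; b \<in> sObj R; b' \<in> sObj R; c \<in> sObj R; c' \<in> sObj R;
        f \<in> sHom R k a a'; g \<in> sHom R k b b'; h \<in> sHom R k c c'\<rbrakk>
      \<Longrightarrow> rtimesM R k (rtimesM R k f g) h = rtimesM R k f (rtimesM R k g h)"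
    and one_times: "a \<in> sObj R \<Longrightarrow> rone R [*] a = a"
    and times_one: "a \<in> sObj R \<Longrightarrow> a [*] rone R = a"
    and one_timesM: "\<lbrakk>a \<in> sObj R; b \<in> sObj R; f \<in> sHom R k a b\<rbrakk>
      \<Longrightarrow> rtimesM R k (sId R k (rone R)) f = f"
    and times_oneM: "\<lbrakk>a \<in> sObj R; b \<in> sObj R; f \<in> sHom R k a b\<rbrakk>
      \<Longrightarrow> rtimesM R k f (sId R k (rone R)) = f"
    and right_distrib: "\<lbrakk>a \<in> sObj R; b \<in> sObj R; c \<in> sObj R\<rbrakk>
      \<Longrightarrow> (a [+] b) [*] c = (a [*] c) [+] (b [*] c)"
    and right_distribM: "\<lbrakk>a \<in> sObj R; a' \<in> sObj R; b \<in> sObj R; b' \<in> sObj R; c \<in> sObj R; c' \<in> sObj R;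
        f \<in> sHom R k a a'; g \<in> sHom R k b b'; h \<in> sHom R k c c'\<rbrakk>
      \<Longrightarrow> rtimesM R k (rplusM R k f g) h = rplusM R k (rtimesM R k f h) (rtimesM R k g h)"
    and zero_times: "a \<in> sObj R \<Longrightarrow> rzero R [*] a = rzero R"
    and times_zero: "a \<in> sObj R \<Longrightarrow> a [*] rzero R = rzero R"
    and zero_timesM: "\<lbrakk>a \<in> sObj R; b \<in> sObj R; f \<in> sHom R k a b\<rbrakk>
      \<Longrightarrow> rtimesM R k (sId R k (rzero R)) f = sId R k (rzero R)"
    and times_zeroM: "\<lbrakk>a \<in> sObj R; b \<in> sObj R; f \<in> sHom R k a b\<rbrakk>
      \<Longrightarrow> rtimesM R k f (sId R k (rzero R)) = sId R k (rzero R)"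
    and delta_iso: "snat_iso (prod_cat R (prod_cat R R)) R
      (\<lambda>(a, b, c). a [*] (b [+] c))
      (\<lambda>k (f, g, h). rtimesM R k f (rplusM R k g h))
      (\<lambda>(a, b, c). (a [*] b) [+] (a [*] c))
      (\<lambda>k (f, g, h). rplusM R k (rtimesM R k f g) (rtimesM R k f h))
      (\<lambda>(a, b, c). rdelta R a b c)"
    and delta_gam: "\<lbrakk>a \<in> sObj R; b \<in> sObj R; c \<in> sObj R\<rbrakk>
      \<Longrightarrow> sComp R 0 (rgam R (a [*] b) (a [*] c)) (rdelta R a b c) =
          sComp R 0 (rdelta R a c b) (rtimesM R 0 (sId R 0 a) (rgam R b c))"
    and gam_times: "\<lbrakk>a \<in> sObj R; b \<in> sObj R; c \<in> sObj R\<rbrakk>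
      \<Longrightarrow> rtimesM R 0 (rgam R a b) (sId R 0 c) = rgam R (a [*] c) (b [*] c)"
    and delta_plus: "\<lbrakk>a \<in> sObj R; b \<in> sObj R; c \<in> sObj R; d \<in> sObj R\<rbrakk>
      \<Longrightarrow> sComp R 0 (rplusM R 0 (rdelta R a b c) (sId R 0 (a [*] d))) (rdelta R a (b [+] c) d) =
          sComp R 0 (rplusM R 0 (sId R 0 (a [*] b)) (rdelta R a c d)) (rdelta R a b (c [+] d))"
    and delta_zero1: "\<lbrakk>b \<in> sObj R; c \<in> sObj R\<rbrakk> \<Longrightarrow> rdelta R (rzero R) b c = sId R 0 (rzero R)"
    and delta_zero2: "\<lbrakk>a \<in> sObj R; c \<in> sObj R\<rbrakk> \<Longrightarrow> rdelta R a (rzero R) c = sId R 0 (a [*] c)"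
    and delta_zero3: "\<lbrakk>a \<in> sObj R; b \<in> sObj R\<rbrakk> \<Longrightarrow> rdelta R a b (rzero R) = sId R 0 (a [*] b)"
    and delta_one: "\<lbrakk>b \<in> sObj R; c \<in> sObj R\<rbrakk> \<Longrightarrow> rdelta R (rone R) b c = sId R 0 (b [+] c)"
    and delta_times_left: "\<lbrakk>a \<in> sObj R; a' \<in> sObj R; b \<in> sObj R; c \<in> sObj R\<rbrakk>
      \<Longrightarrow> rdelta R (a [*] a') b c =
          sComp R 0 (rdelta R a (a' [*] b) (a' [*] c)) (rtimesM R 0 (sId R 0 a) (rdelta R a' b c))"
    and delta_times_right: "\<lbrakk>a \<in> sObj R; b \<in> sObj R; c \<in> sObj R; d \<in> sObj R\<rbrakk>
      \<Longrightarrow> rtimesM R 0 (rdelta R a b c) (sId R 0 d) = rdelta R a (b [*] d) (c [*] d)"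
    and delta_plus_plus: "\<lbrakk>a \<in> sObj R; a' \<in> sObj R; b \<in> sObj R; b' \<in> sObj R\<rbrakk>
      \<Longrightarrow> rdelta R (a [+] a') b b' =
          sComp R 0
            (rplusM R 0 (rplusM R 0 (sId R 0 (a [*] b)) (rgam R (a [*] b') (a' [*] b)))
               (sId R 0 (a' [*] b')))
            (rplusM R 0 (rdelta R a b b') (rdelta R a' b b'))"


section \<open>Matrices over a strict bimonoidal category\<close>

definition osum :: "('o, 'm, 'z) bimon_scheme \<Rightarrow> 'o list \<Rightarrow> 'o" where
  "osum R as = foldr (rplus R) as (rzero R)"

definition msum :: "('o, 'm, 'z) bimon_scheme \<Rightarrow> nat \<Rightarrow> 'm list \<Rightarrow> 'm" where
  "msum R k fs = foldr (rplusM R k) fs (sId R k (rzero R))"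

definition mat_prod :: "('o, 'm, 'z) bimon_scheme \<Rightarrow> 'o mat \<Rightarrow> 'o mat \<Rightarrow> 'o mat" where
  "mat_prod R U V = mat (dim_row U) (dim_col V)
    (\<lambda>(i, l). osum R (map (\<lambda>j. rtimes R (U $$ (i, j)) (V $$ (j, l))) [0..<dim_col U]))"

definition mat_prodM :: "('o, 'm, 'z) bimon_scheme \<Rightarrow> nat \<Rightarrow> 'm mat \<Rightarrow> 'm mat \<Rightarrow> 'm mat" where
  "mat_prodM R k \<phi> \<psi> = mat (dim_row \<phi>) (dim_col \<psi>)
    (\<lambda>(i, l). msum R k (map (\<lambda>j. rtimesM R k (\<phi> $$ (i, j)) (\<psi> $$ (j, l))) [0..<dim_col \<phi>]))"

definition id_mat :: "('o, 'm, 'z) bimon_scheme \<Rightarrow> nat \<Rightarrow> 'o mat" where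
  "id_mat R n = mat n n (\<lambda>(i, j). if i = j then rone R else rzero R)"

definition mat_cat :: "('o, 'm, 'z) bimon_scheme \<Rightarrow> nat \<Rightarrow> ('o mat, 'm mat) scat" where
  "mat_cat R n =
    \<lparr>sObj = {U \<in> carrier_mat n n. \<forall>i<n. \<forall>j<n. U $$ (i, j) \<in> sObj R},
     sHom = (\<lambda>k U V. {\<phi> \<in> carrier_mat n n. \<forall>i<n. \<forall>j<n. siso R k (U $$ (i, j)) (V $$ (i, j)) (\<phi> $$ (i, j))}),
     sId = (\<lambda>k U. map_mat (sId R k) U),
     sComp = (\<lambda>k \<psi> \<phi>. mat n n (\<lambda>ij. sComp R k (\<psi> $$ ij) (\<phi> $$ ij))),
     sFace = (\<lambda>k i \<phi>. map_mat (sFace R k i) \<phi>),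
     sDegen = (\<lambda>k i \<phi>. map_mat (sDegen R k i) \<phi>)\<rparr>"

text \<open>
  The isomorphism \<open>a \<otimes> (b\<^sub>1 \<oplus> \<dots> \<oplus> b\<^sub>n) \<rightarrow> (a \<otimes> b\<^sub>1) \<oplus> \<dots> \<oplus> (a \<otimes> b\<^sub>n)\<close> built from \<open>\<delta>\<close>.
\<close>

primrec dist_iso :: "('o, 'm, 'z) bimon_scheme \<Rightarrow> 'o \<Rightarrow> 'o list \<Rightarrow> 'm" where
  "dist_iso R a [] = sId R 0 (rzero R)"
| "dist_iso R a (b # bs) =
    sComp R 0 (rplusM R 0 (sId R 0 (rtimes R a b)) (dist_iso R a bs)) (rdelta R a b (osum R bs))"

text \<open>
  The isomorphism
  \<open>(x\<^sub>1 \<oplus> \<dots> \<oplus> x\<^sub>n) \<oplus> (y\<^sub>1 \<oplus> \<dots> \<oplus> y\<^sub>n) \<rightarrow> (x\<^sub>1 \<oplus> y\<^sub>1) \<oplus> \<dots> \<oplus> (x\<^sub>n \<oplus> y\<^sub>n)\<close> built from the symmetry of \<open>\<oplus>\<close>;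
  it is used only for lists of equal length.
\<close>

fun merge_iso :: "('o, 'm, 'z) bimon_scheme \<Rightarrow> 'o list \<Rightarrow> 'o list \<Rightarrow> 'm" where
  "merge_iso R (x # xs) (y # ys) =
    sComp R 0
      (rplusM R 0 (sId R 0 (rplus R x y)) (merge_iso R xs ys))
      (rplusM R 0 (rplusM R 0 (sId R 0 x) (rgam R (osum R xs) y)) (sId R 0 (osum R ys)))"
| "merge_iso R xs ys = sId R 0 (rzero R)"

text \<open>
  The isomorphism exchanging two summations, from the sum over \<open>j\<close> in \<open>js\<close> of the sums over \<open>k\<close> in \<open>ks\<close>
  of \<open>x j k\<close> to the sum over \<open>k\<close> of the sums over \<open>j\<close>.
\<close>

primrec interchange_iso ::
  "('o, 'm, 'z) bimon_scheme \<Rightarrow> ('i \<Rightarrow> 'k \<Rightarrow> 'o) \<Rightarrow> 'i list \<Rightarrow> 'k list \<Rightarrow> 'm" where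
  "interchange_iso R x [] ks = sId R 0 (rzero R)"
| "interchange_iso R x (j # js) ks =
    sComp R 0
      (merge_iso R (map (x j) ks) (map (\<lambda>k. osum R (map (\<lambda>j. x j k) js)) ks))
      (rplusM R 0 (sId R 0 (osum R (map (x j) ks))) (interchange_iso R x js ks))"

text \<open>
  The associativity isomorphism \<open>U \<cdot> (V \<cdot> W) \<rightarrow> (U \<cdot> V) \<cdot> W\<close>. The target of an entry is the sum over \<open>k\<close>
  of the sums over \<open>j\<close> of \<open>U\<^sub>i\<^sub>j \<otimes> V\<^sub>j\<^sub>k \<otimes> W\<^sub>k\<^sub>l\<close>, which by strict right distributivity is the corresponding
  entry of \<open>(U \<cdot> V) \<cdot> W\<close>.
\<close>

definition mat_assoc ::
  "('o, 'm, 'z) bimon_scheme \<Rightarrow> 'o mat \<Rightarrow> 'o mat \<Rightarrow> 'o mat \<Rightarrow> 'm mat" where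
  "mat_assoc R U V W = mat (dim_row U) (dim_col W) (\<lambda>(i, l).
    sComp R 0
      (interchange_iso R
        (\<lambda>j k. rtimes R (rtimes R (U $$ (i, j)) (V $$ (j, k))) (W $$ (k, l)))
        [0..<dim_col U] [0..<dim_col V])
      (msum R 0 (map (\<lambda>j. dist_iso R (U $$ (i, j))
          (map (\<lambda>k. rtimes R (V $$ (j, k)) (W $$ (k, l))) [0..<dim_col V]))
        [0..<dim_col U])))"


section \<open>Path components, ring completion and invertible matrices\<close>

text \<open>
  Path components of the classifying space: two objects are related if they are joined by a zigzag
  of morphisms.
\<close>

definition path_rel :: "('o, 'm, 'z) scat_scheme \<Rightarrow> ('o \<times> 'o) set" where
  "path_rel C =
    (let E = {(x, y). x \<in> sObj C \<and> y \<in> sObj C \<and> sHom C 0 x y \<noteq> {}}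
     in (E \<union> E\<inverse>)\<^sup>* \<inter> sObj C \<times> sObj C)"

definition pi0 :: "('o, 'm, 'z) bimon_scheme \<Rightarrow> 'o set ring" where
  "pi0 R =
    \<lparr>carrier = sObj R // path_rel R,
     mult = (\<lambda>X Y. \<Union>a\<in>X. \<Union>b\<in>Y. path_rel R `` {rtimes R a b}),
     one = path_rel R `` {rone R},
     zero = path_rel R `` {rzero R},
     add = (\<lambda>X Y. \<Union>a\<in>X. \<Union>b\<in>Y. path_rel R `` {rplus R a b})\<rparr>"

text \<open>
  The ring completion of a semiring, with \<open>(a, b)\<close> representing the formal difference \<open>a - b\<close>.
\<close>

definition gr_rel :: "('a, 'b) ring_scheme \<Rightarrow> (('a \<times> 'a) \<times> ('a \<times> 'a)) set" where
  "gr_rel S = {((a, b), (c, d)). a \<in> carrier S \<and> b \<in> carrier S \<and> c \<in> carrier S \<and> d \<in> carrier S \<and>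
    (\<exists>e \<in> carrier S. (a \<oplus>\<^bsub>S\<^esub> d) \<oplus>\<^bsub>S\<^esub> e = (c \<oplus>\<^bsub>S\<^esub> b) \<oplus>\<^bsub>S\<^esub> e)}"

definition ring_completion :: "('a, 'b) ring_scheme \<Rightarrow> ('a \<times> 'a) set ring" where
  "ring_completion S =
    \<lparr>carrier = (carrier S \<times> carrier S) // gr_rel S,
     mult = (\<lambda>X Y. \<Union>(a, b)\<in>X. \<Union>(c, d)\<in>Y.
        gr_rel S `` {((a \<otimes>\<^bsub>S\<^esub> c) \<oplus>\<^bsub>S\<^esub> (b \<otimes>\<^bsub>S\<^esub> d), (a \<otimes>\<^bsub>S\<^esub> d) \<oplus>\<^bsub>S\<^esub> (b \<otimes>\<^bsub>S\<^esub> c))}),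
     one = gr_rel S `` {(\<one>\<^bsub>S\<^esub>, \<zero>\<^bsub>S\<^esub>)},
     zero = gr_rel S `` {(\<zero>\<^bsub>S\<^esub>, \<zero>\<^bsub>S\<^esub>)},
     add = (\<lambda>X Y. \<Union>(a, b)\<in>X. \<Union>(c, d)\<in>Y. gr_rel S `` {(a \<oplus>\<^bsub>S\<^esub> c, b \<oplus>\<^bsub>S\<^esub> d)})\<rparr>"

definition to_completion :: "('a, 'b) ring_scheme \<Rightarrow> 'a \<Rightarrow> ('a \<times> 'a) set" where
  "to_completion S a = gr_rel S `` {(a, \<zero>\<^bsub>S\<^esub>)}"

definition ring_mat_prod :: "('a, 'b) ring_scheme \<Rightarrow> 'a mat \<Rightarrow> 'a mat \<Rightarrow> 'a mat" where
  "ring_mat_prod S A B = mat (dim_row A) (dim_col B)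
    (\<lambda>(i, l). \<Oplus>\<^bsub>S\<^esub>j\<in>{..<dim_col A}. A $$ (i, j) \<otimes>\<^bsub>S\<^esub> B $$ (j, l))"

definition ring_id_mat :: "('a, 'b) ring_scheme \<Rightarrow> nat \<Rightarrow> 'a mat" where
  "ring_id_mat S n = mat n n (\<lambda>(i, j). if i = j then \<one>\<^bsub>S\<^esub> else \<zero>\<^bsub>S\<^esub>)"

definition ring_invertible_mat :: "('a, 'b) ring_scheme \<Rightarrow> nat \<Rightarrow> 'a mat \<Rightarrow> bool" where
  "ring_invertible_mat S n A \<longleftrightarrow>
    (\<exists>B \<in> carrier_mat n n. (\<forall>i<n. \<forall>j<n. B $$ (i, j) \<in> carrier S) \<and>
      ring_mat_prod S A B = ring_id_mat S n \<and> ring_mat_prod S B A = ring_id_mat S n)"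

text \<open>
  The semiring need not be commutative, so there is no determinant in general; the condition
  is that the matrix becomes invertible over the ring completion.
\<close>

definition GL_semiring :: "('a, 'b) ring_scheme \<Rightarrow> nat \<Rightarrow> 'a mat set" where
  "GL_semiring S n = {A \<in> carrier_mat n n. (\<forall>i<n. \<forall>j<n. A $$ (i, j) \<in> carrier S) \<and>
    ring_invertible_mat (ring_completion S) n (map_mat (to_completion S) A)}"

definition GL_cat :: "('o, 'm, 'z) bimon_scheme \<Rightarrow> nat \<Rightarrow> ('o mat, 'm mat) scat" where
  "GL_cat R n = (mat_cat R n)
    \<lparr>sObj := {U \<in> sObj (mat_cat R n). map_mat (\<lambda>a. path_rel R `` {a}) U \<in> GL_semiring (pi0 R) n}\<rparr>"


section \<open>The bicategory of finite dimensional free modules\<close>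

text \<open>
  The object \<open>\<^bold>n\<close> is the natural number \<open>n\<close>. Since the hom categories between different objects are
  empty, the object arguments of the composition operations carry no information.
\<close>

definition empty_cat :: "('o, 'm) scat" where
  "empty_cat =
    \<lparr>sObj = {}, sHom = (\<lambda>_ _ _. {}), sId = undefined, sComp = undefined, sFace = undefined,
     sDegen = undefined\<rparr>"

definition module_bicat :: "('o, 'm, 'z) bimon_scheme \<Rightarrow> (nat, 'o mat, 'm mat) bicat" where
  "module_bicat R =
    \<lparr>bObj = UNIV,
     bHom = (\<lambda>n m. if n = m then GL_cat R n else empty_cat),
     bId = id_mat R,
     bComp = (\<lambda>_ _ _ U V. mat_prod R U V),
     bComp2 = (\<lambda>_ _ _ k \<phi> \<psi>. mat_prodM R k \<phi> \<psi>),
     bAssoc = (\<lambda>_ _ _ _ U V W. mat_assoc R U V W),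
     bLeft = (\<lambda>_ _ U. map_mat (sId R 0) U),
     bRight = (\<lambda>_ _ U. map_mat (sId R 0) U)\<rparr>"

definition block_sum :: "('o, 'm, 'z) bimon_scheme \<Rightarrow> 'o mat \<Rightarrow> 'o mat \<Rightarrow> 'o mat" where
  "block_sum R U V = four_block_mat
    U (mat (dim_row U) (dim_col V) (\<lambda>_. rzero R))
    (mat (dim_row V) (dim_col U) (\<lambda>_. rzero R)) V"

text \<open>On \<open>k\<close>-simplices of morphisms, \<open>0\<close> denotes the identity of the object \<open>0\<close>.\<close>

definition block_sumM :: "('o, 'm, 'z) bimon_scheme \<Rightarrow> nat \<Rightarrow> 'm mat \<Rightarrow> 'm mat \<Rightarrow> 'm mat" where
  "block_sumM R k \<phi> \<psi> = four_block_mat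
    \<phi> (mat (dim_row \<phi>) (dim_col \<psi>) (\<lambda>_. sId R k (rzero R)))
    (mat (dim_row \<psi>) (dim_col \<phi>) (\<lambda>_. sId R k (rzero R))) \<psi>"

end

theory Submission
  imports Defs "HOL-Library.Multiset"
begin

text \<open>
  A product of two block diagonal matrices is equal, not just isomorphic, to the block diagonal
  matrix of the products: every summand that mixes the blocks is \<open>0\<close>, and \<open>0\<close> is strict for \<open>\<oplus>\<close> and
  \<open>\<otimes>\<close>. Products with permutation matrices are equally strict. Hence the constraints of \<open>\<boxplus>\<close> and the
  naturality 2-cells of the braiding, whose components are the block permutation matrices, can all
  be taken to be identities. What remains of the axioms are equations between matrices, which hold
  by inspection of the entries, and equations that involve the associativity isomorphisms of matrix
  multiplication.

  An entry of such an isomorphism \<open>U \<cdot> (V \<cdot> W) \<rightarrow> (U \<cdot> V) \<cdot> W\<close> first distributes each \<open>U\<^sub>i\<^sub>p\<close> over a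
  sum and then interchanges a sum over \<open>p\<close> with a sum over \<open>q\<close>. Terms that are \<open>0\<close> can be dropped
  from both steps (\<open>assoc_entry_filter\<close>), so the associativity isomorphism of block sums is the
  block sum of the associativity isomorphisms (\<open>mat_assoc_block_sum\<close>). If all the distributivities
  are trivial and no two nonzero terms change their order, the entry is an identity
  (\<open>assoc_entry_idn\<close>). This happens when one of the outer factors is a permutation matrix, and when
  a block permutation matrix stands to the right of a block sum of matching sizes; these are the
  associativity isomorphisms in the axiom for the braiding and horizontal composition
  (\<open>braiding_transformation\<close>).

  That the matrices form a bicategory at all is the harder part, because of the pentagon. By
  Laplaza's axioms, distributivity commutes with every reordering of terms and with iterated sums
  and products, so that on both sides of the pentagon all distributivities can be carried out first,
  and in the same way (\<open>assoc_entry_pentagon\<close>). Two composites of interchanges of a triple sum are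
  left over. They agree because a symmetry \<open>\<gamma>\<close> that satisfies the hexagon and squares to the
  identity gives, for every permutation of labelled terms, a canonical isomorphism; these compose
  (\<open>can_trans\<close>), and an interchange of summations is one of them (\<open>interchange_eq_can\<close>).

  The enrichment adds little: the arrows of each simplicial dimension form an ordinary category with
  sums and products, coherence is a statement about dimension \<open>0\<close>, and naturality can be checked in
  each dimension separately. The restriction to \<open>GL\<^sub>n\<close> is harmless since invertible matrices over
  the ring completion of \<open>\<pi>\<^sub>0\<close> are closed under products and block sums and contain the permutation
  matrices.
\<close>

section \<open>Finite sums and their reorderings\<close>

text \<open>
  A category in single-sorted form with a strictly associative and unital sum and a natural family
  \<open>gam a b : a + b \<rightarrow> b + a\<close>. The coherence of \<open>gam\<close> is split off into a later locale, because
  naturality is needed for the arrows of every simplicial dimension whereas coherence concerns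
  dimension \<open>0\<close> only; moreover a commutative monoid, seen as a category whose only arrows are
  identities, is an instance.
\<close>

locale sum_category =
  fixes Ob :: "'o set" and Ar :: "'a set" and dom cod :: "'a \<Rightarrow> 'o" and idn :: "'o \<Rightarrow> 'a"
    and cmp :: "'a \<Rightarrow> 'a \<Rightarrow> 'a" (infixr "\<cdot>" 67)
    and sum_ob :: "'o \<Rightarrow> 'o \<Rightarrow> 'o" (infixr "\<^bold>+" 65)
    and sum_ar :: "'a \<Rightarrow> 'a \<Rightarrow> 'a" (infixr "\<boxplus>" 65)
    and zero :: 'o
    and gam :: "'o \<Rightarrow> 'o \<Rightarrow> 'a"
  assumes dom_Ob [simp]: "f \<in> Ar \<Longrightarrow> dom f \<in> Ob"
    and cod_Ob [simp]: "f \<in> Ar \<Longrightarrow> cod f \<in> Ob"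
    and idn_Ar [simp]: "a \<in> Ob \<Longrightarrow> idn a \<in> Ar"
    and dom_idn [simp]: "a \<in> Ob \<Longrightarrow> dom (idn a) = a"
    and cod_idn [simp]: "a \<in> Ob \<Longrightarrow> cod (idn a) = a"
    and cmp_Ar [simp]: "f \<in> Ar \<Longrightarrow> g \<in> Ar \<Longrightarrow> dom g = cod f \<Longrightarrow> g \<cdot> f \<in> Ar"
    and dom_cmp [simp]: "f \<in> Ar \<Longrightarrow> g \<in> Ar \<Longrightarrow> dom g = cod f \<Longrightarrow> dom (g \<cdot> f) = dom f"
    and cod_cmp [simp]: "f \<in> Ar \<Longrightarrow> g \<in> Ar \<Longrightarrow> dom g = cod f \<Longrightarrow> cod (g \<cdot> f) = cod g"
    and idn_cmp [simp]: "f \<in> Ar \<Longrightarrow> cod f = b \<Longrightarrow> idn b \<cdot> f = f"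
    and cmp_idn [simp]: "f \<in> Ar \<Longrightarrow> dom f = a \<Longrightarrow> f \<cdot> idn a = f"
    and cmp_assoc: "f \<in> Ar \<Longrightarrow> g \<in> Ar \<Longrightarrow> h \<in> Ar \<Longrightarrow> dom g = cod f \<Longrightarrow> dom h = cod g
      \<Longrightarrow> (h \<cdot> g) \<cdot> f = h \<cdot> g \<cdot> f"
    and zero_Ob [simp]: "zero \<in> Ob"
    and sum_Ob [simp]: "a \<in> Ob \<Longrightarrow> b \<in> Ob \<Longrightarrow> a \<^bold>+ b \<in> Ob"
    and sum_Ar [simp]: "f \<in> Ar \<Longrightarrow> g \<in> Ar \<Longrightarrow> f \<boxplus> g \<in> Ar"
    and dom_sum [simp]: "f \<in> Ar \<Longrightarrow> g \<in> Ar \<Longrightarrow> dom (f \<boxplus> g) = dom f \<^bold>+ dom g"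
    and cod_sum [simp]: "f \<in> Ar \<Longrightarrow> g \<in> Ar \<Longrightarrow> cod (f \<boxplus> g) = cod f \<^bold>+ cod g"
    and idn_sum: "a \<in> Ob \<Longrightarrow> b \<in> Ob \<Longrightarrow> idn (a \<^bold>+ b) = idn a \<boxplus> idn b"
    and sum_cmp: "f \<in> Ar \<Longrightarrow> g \<in> Ar \<Longrightarrow> f' \<in> Ar \<Longrightarrow> g' \<in> Ar \<Longrightarrow> dom g = cod f \<Longrightarrow> dom g' = cod f'
      \<Longrightarrow> (g \<boxplus> g') \<cdot> (f \<boxplus> f') = (g \<cdot> f) \<boxplus> (g' \<cdot> f')"
    and sum_assoc [simp]: "a \<in> Ob \<Longrightarrow> b \<in> Ob \<Longrightarrow> c \<in> Ob \<Longrightarrow> (a \<^bold>+ b) \<^bold>+ c = a \<^bold>+ b \<^bold>+ c"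
    and sum_assoc_ar: "f \<in> Ar \<Longrightarrow> g \<in> Ar \<Longrightarrow> h \<in> Ar \<Longrightarrow> (f \<boxplus> g) \<boxplus> h = f \<boxplus> g \<boxplus> h"
    and zero_sum [simp]: "a \<in> Ob \<Longrightarrow> zero \<^bold>+ a = a"
    and sum_zero [simp]: "a \<in> Ob \<Longrightarrow> a \<^bold>+ zero = a"
    and zero_sum_ar [simp]: "f \<in> Ar \<Longrightarrow> idn zero \<boxplus> f = f"
    and sum_zero_ar [simp]: "f \<in> Ar \<Longrightarrow> f \<boxplus> idn zero = f"
    and gam_Ar [simp]: "a \<in> Ob \<Longrightarrow> b \<in> Ob \<Longrightarrow> gam a b \<in> Ar"
    and dom_gam [simp]: "a \<in> Ob \<Longrightarrow> b \<in> Ob \<Longrightarrow> dom (gam a b) = a \<^bold>+ b"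
    and cod_gam [simp]: "a \<in> Ob \<Longrightarrow> b \<in> Ob \<Longrightarrow> cod (gam a b) = b \<^bold>+ a"
    and gam_natural: "f \<in> Ar \<Longrightarrow> g \<in> Ar
      \<Longrightarrow> gam (cod f) (cod g) \<cdot> (f \<boxplus> g) = (g \<boxplus> f) \<cdot> gam (dom f) (dom g)"
begin

context
  notes image_subset_iff [simp]
begin

definition Tot :: "'o list \<Rightarrow> 'o" where "Tot as = foldr sum_ob as zero"
definition Tot_ar :: "'a list \<Rightarrow> 'a" where "Tot_ar fs = foldr sum_ar fs (idn zero)"

lemma Tot_simps [simp]: "Tot [] = zero" "Tot (a # as) = a \<^bold>+ Tot as"
  by (simp_all add: Tot_def)
lemma Tot_ar_simps [simp]:
  "Tot_ar [] = idn zero" "Tot_ar (f # fs) = f \<boxplus> Tot_ar fs"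
  by (simp_all add: Tot_ar_def)

lemma Tot_Ob [simp]: "set as \<subseteq> Ob \<Longrightarrow> Tot as \<in> Ob"
  by (induction as) auto

lemma Tot_append [simp]:
  "set as \<subseteq> Ob \<Longrightarrow> set bs \<subseteq> Ob \<Longrightarrow> Tot (as @ bs) = Tot as \<^bold>+ Tot bs"
  by (induction as) auto

lemma Tot_ar_type [simp]:
  assumes "set fs \<subseteq> Ar"
  shows "Tot_ar fs \<in> Ar" "dom (Tot_ar fs) = Tot (map dom fs)"
    "cod (Tot_ar fs) = Tot (map cod fs)"
  using assms by (induction fs) auto

lemma Tot_ar_idn [simp]:
  "(\<And>i. a i \<in> Ob) \<Longrightarrow> Tot_ar (map (\<lambda>i. idn (a i)) is) = idn (Tot (map a is))"
  by (induction "is") (auto simp: idn_sum)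

lemma Tot_ar_cmp:
  "(\<And>i. f i \<in> Ar) \<Longrightarrow> (\<And>i. g i \<in> Ar) \<Longrightarrow> (\<And>i. dom (g i) = cod (f i)) \<Longrightarrow>
   Tot_ar (map g is) \<cdot> Tot_ar (map f is) = Tot_ar (map (\<lambda>i. g i \<cdot> f i) is)"
  by (induction "is") (auto simp: sum_cmp comp_def)

lemma Tot_zero: "set as \<subseteq> {zero} \<Longrightarrow> Tot as = zero"
  by (induction as) auto

fun merge :: "'o list \<Rightarrow> 'o list \<Rightarrow> 'a" where
  "merge (x # xs) (y # ys) =
    (idn (x \<^bold>+ y) \<boxplus> merge xs ys) \<cdot> ((idn x \<boxplus> gam (Tot xs) y) \<boxplus> idn (Tot ys))"
| "merge xs ys = idn zero"

primrec interchange :: "('i \<Rightarrow> 'k \<Rightarrow> 'o) \<Rightarrow> 'i list \<Rightarrow> 'k list \<Rightarrow> 'a" where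
  "interchange x [] ks = idn zero"
| "interchange x (j # js) ks =
    merge (map (x j) ks) (map (\<lambda>k. Tot (map (\<lambda>j. x j k) js)) ks)
    \<cdot> (idn (Tot (map (x j) ks)) \<boxplus> interchange x js ks)"

lemma merge_type [simp]:
  assumes "\<And>k. f k \<in> Ob" "\<And>k. g k \<in> Ob"
  shows "merge (map f ks) (map g ks) \<in> Ar"
    and "dom (merge (map f ks) (map g ks)) = Tot (map f ks) \<^bold>+ Tot (map g ks)"
    and "cod (merge (map f ks) (map g ks)) = Tot (map (\<lambda>k. f k \<^bold>+ g k) ks)"
proof -
  have "merge (map f ks) (map g ks) \<in> Ar \<and>
     dom (merge (map f ks) (map g ks)) = Tot (map f ks) \<^bold>+ Tot (map g ks) \<and>
     cod (merge (map f ks) (map g ks)) = Tot (map (\<lambda>k. f k \<^bold>+ g k) ks)"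
    using assms by (induction ks) auto
  then show "merge (map f ks) (map g ks) \<in> Ar"
    and "dom (merge (map f ks) (map g ks)) = Tot (map f ks) \<^bold>+ Tot (map g ks)"
    and "cod (merge (map f ks) (map g ks)) = Tot (map (\<lambda>k. f k \<^bold>+ g k) ks)" by auto
qed

text \<open>
  Only the naturality of \<open>gam\<close> enters: the one occurrence of \<open>gam\<close> in each step of the recursion
  is slid past the arrows that it exchanges.
\<close>

lemma merge_natural:
  assumes [simp]: "\<And>k. f k \<in> Ar" "\<And>k. g k \<in> Ar"
  shows "merge (map (\<lambda>k. cod (f k)) ks) (map (\<lambda>k. cod (g k)) ks)
     \<cdot> (Tot_ar (map f ks) \<boxplus> Tot_ar (map g ks))
   = Tot_ar (map (\<lambda>k. f k \<boxplus> g k) ks) \<cdot> merge (map (\<lambda>k. dom (f k)) ks) (map (\<lambda>k. dom (g k)) ks)"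
proof (induction ks)
  case (Cons k ks)
  note [simp] = comp_def
  let ?F = "Tot_ar (map f ks)" and ?G = "Tot_ar (map g ks)"
  let ?mc = "merge (map (\<lambda>k. cod (f k)) ks) (map (\<lambda>k. cod (g k)) ks)"
  let ?md = "merge (map (\<lambda>k. dom (f k)) ks) (map (\<lambda>k. dom (g k)) ks)"
  let ?gc = "gam (Tot (map (\<lambda>k. cod (f k)) ks)) (cod (g k))"
  let ?gd = "gam (Tot (map (\<lambda>k. dom (f k)) ks)) (dom (g k))"
  have g: "?gc \<cdot> (?F \<boxplus> g k) = (g k \<boxplus> ?F) \<cdot> ?gd"
    using gam_natural[of ?F "g k"] by simp
  \<comment> \<open>Strict associativity regroups the four summands so that the middle two are adjacent.\<close>
  have "((idn (cod (f k)) \<boxplus> ?gc) \<boxplus> idn (Tot (map (\<lambda>k. cod (g k)) ks))) \<cdot> ((f k \<boxplus> ?F) \<boxplus> g k \<boxplus> ?G)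
     = ((idn (cod (f k)) \<boxplus> ?gc) \<boxplus> idn (Tot (map (\<lambda>k. cod (g k)) ks))) \<cdot> ((f k \<boxplus> ?F \<boxplus> g k) \<boxplus> ?G)"
    by (simp add: sum_assoc_ar)
  also have "\<dots> = (f k \<boxplus> (?gc \<cdot> (?F \<boxplus> g k))) \<boxplus> ?G" by (simp add: sum_cmp)
  also have "\<dots> = (f k \<boxplus> ((g k \<boxplus> ?F) \<cdot> ?gd)) \<boxplus> ?G" by (simp only: g)
  also have "\<dots> = ((f k \<boxplus> g k \<boxplus> ?F) \<boxplus> ?G) \<cdot> ((idn (dom (f k)) \<boxplus> ?gd) \<boxplus> idn (Tot (map (\<lambda>k. dom (g k)) ks)))"
    by (simp add: sum_cmp)
  also have "(f k \<boxplus> g k \<boxplus> ?F) \<boxplus> ?G = (f k \<boxplus> g k) \<boxplus> ?F \<boxplus> ?G" by (simp add: sum_assoc_ar)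
  finally have 1: "((idn (cod (f k)) \<boxplus> ?gc) \<boxplus> idn (Tot (map (\<lambda>k. cod (g k)) ks))) \<cdot> ((f k \<boxplus> ?F) \<boxplus> g k \<boxplus> ?G) =
    ((f k \<boxplus> g k) \<boxplus> ?F \<boxplus> ?G) \<cdot> ((idn (dom (f k)) \<boxplus> ?gd) \<boxplus> idn (Tot (map (\<lambda>k. dom (g k)) ks)))" .
  have 2: "(idn (cod (f k) \<^bold>+ cod (g k)) \<boxplus> ?mc) \<cdot> ((f k \<boxplus> g k) \<boxplus> ?F \<boxplus> ?G) =
    ((f k \<boxplus> g k) \<boxplus> Tot_ar (map (\<lambda>k. f k \<boxplus> g k) ks)) \<cdot> (idn (dom (f k) \<^bold>+ dom (g k)) \<boxplus> ?md)"
    by (simp add: sum_cmp Cons)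
  show ?case
    by (simp add: cmp_assoc 1) (simp add: 2 flip: cmp_assoc)
qed simp

lemma interchange_type [simp]:
  assumes [simp]: "\<And>j k. x j k \<in> Ob"
  shows "interchange x js ks \<in> Ar"
    and "dom (interchange x js ks) = Tot (map (\<lambda>j. Tot (map (x j) ks)) js)"
    and "cod (interchange x js ks) = Tot (map (\<lambda>k. Tot (map (\<lambda>j. x j k) js)) ks)"
proof -
  have "interchange x js ks \<in> Ar \<and>
     dom (interchange x js ks) = Tot (map (\<lambda>j. Tot (map (x j) ks)) js) \<and>
     cod (interchange x js ks) = Tot (map (\<lambda>k. Tot (map (\<lambda>j. x j k) js)) ks)"
    by (induction js) (auto simp: Tot_zero)
  then show "interchange x js ks \<in> Ar"
    and "dom (interchange x js ks) = Tot (map (\<lambda>j. Tot (map (x j) ks)) js)"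
    and "cod (interchange x js ks) = Tot (map (\<lambda>k. Tot (map (\<lambda>j. x j k) js)) ks)" by auto
qed

lemma interchange_natural:
  assumes [simp]: "\<And>j k. f j k \<in> Ar"
  shows "interchange (\<lambda>j k. cod (f j k)) js ks \<cdot> Tot_ar (map (\<lambda>j. Tot_ar (map (f j) ks)) js)
   = Tot_ar (map (\<lambda>k. Tot_ar (map (\<lambda>j. f j k) js)) ks) \<cdot> interchange (\<lambda>j k. dom (f j k)) js ks"
proof (induction js)
  case Nil then show ?case by (simp add: Tot_zero)
next
  case (Cons j js)
  note [simp] = comp_def
  let ?s = "\<lambda>d. Tot (map (\<lambda>k. d (f j k)) ks)"
  let ?m = "\<lambda>d. merge (map (\<lambda>k. d (f j k)) ks) (map (\<lambda>k. Tot (map (\<lambda>j. d (f j k)) js)) ks)"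
  let ?i = "\<lambda>d. interchange (\<lambda>j k. d (f j k)) js ks"
  let ?c = "Tot_ar (map (\<lambda>k. Tot_ar (map (\<lambda>j. f j k) js)) ks)"
  let ?r = "Tot_ar (map (\<lambda>j. Tot_ar (map (f j) ks)) js)"
  have m: "?m cod \<cdot> (Tot_ar (map (f j) ks) \<boxplus> ?c) =
     Tot_ar (map (\<lambda>k. f j k \<boxplus> Tot_ar (map (\<lambda>j. f j k) js)) ks) \<cdot> ?m dom"
    using merge_natural[of "f j" "\<lambda>k. Tot_ar (map (\<lambda>j. f j k) js)" ks] by simp
  have "(idn (?s cod) \<boxplus> ?i cod) \<cdot> (Tot_ar (map (f j) ks) \<boxplus> ?r)
     = (Tot_ar (map (f j) ks) \<boxplus> ?c) \<cdot> (idn (?s dom) \<boxplus> ?i dom)"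
    by (simp add: sum_cmp Cons)
  then show ?case
    by (simp add: cmp_assoc) (simp add: m flip: cmp_assoc)
qed

end

end

section \<open>Coherence for permutations of the terms of a sum\<close>

lemma mset_concat_cong:
  "(\<And>k. mset (F k) = mset (G k)) \<Longrightarrow> mset (concat (map F ks)) = mset (concat (map G ks))"
  by (induction ks) auto

lemma remove1_mset: "mset is = mset (j # js) \<Longrightarrow> j \<in> set is \<and> mset (remove1 j is) = mset js"
  by (metis add_mset_remove_trivial list.set_intros(1) mset.simps(2) mset_eq_setD mset_remove1)

text \<open>
  The combinatorial shadow of interchanging two summations: the row-wise and the column-wise
  reading of a matrix of words have the same letters.
\<close>

lemma mset_interchange:
  fixes L :: "'j \<Rightarrow> 'k \<Rightarrow> 'l list"
  shows "mset (concat (map (\<lambda>j. concat (map (L j) ks)) js)) = mset (concat (map (\<lambda>k. concat (map (\<lambda>j. L j k) js)) ks))"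
proof (induction js)
  case (Cons j js)
  have "mset (concat (map (\<lambda>k. A k @ B k) ks)) = mset (concat (map A ks)) + mset (concat (map B ks))" for A B :: "'k \<Rightarrow> 'l list"
    by (induction ks) auto
  with Cons show ?case by simp
qed (induction ks, auto)

locale perm_category = sum_category Ob Ar dom cod idn cmp sum_ob sum_ar zero gam
  for Ob :: "'o set" and Ar :: "'a set" and dom cod :: "'a \<Rightarrow> 'o" and idn :: "'o \<Rightarrow> 'a"
    and cmp :: "'a \<Rightarrow> 'a \<Rightarrow> 'a" (infixr "\<cdot>" 67)
    and sum_ob :: "'o \<Rightarrow> 'o \<Rightarrow> 'o" (infixr "\<^bold>+" 65)
    and sum_ar :: "'a \<Rightarrow> 'a \<Rightarrow> 'a" (infixr "\<boxplus>" 65)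
    and zero :: 'o
    and gam :: "'o \<Rightarrow> 'o \<Rightarrow> 'a" +
  assumes gam_gam: "a \<in> Ob \<Longrightarrow> b \<in> Ob \<Longrightarrow> gam b a \<cdot> gam a b = idn (a \<^bold>+ b)"
    and gam_zero [simp]: "a \<in> Ob \<Longrightarrow> gam a zero = idn a"
    and gam_sum: "a \<in> Ob \<Longrightarrow> b \<in> Ob \<Longrightarrow> c \<in> Ob \<Longrightarrow>
      gam a (b \<^bold>+ c) = (idn b \<boxplus> gam a c) \<cdot> (gam a b \<boxplus> idn c)"
begin

context
  notes image_subset_iff [simp]
begin

lemma zero_gam [simp]:
  assumes "a \<in> Ob" shows "gam zero a = idn a"
  using gam_gam[of zero a] assms by simp

text \<open>
  The second hexagon: both sides are right inverse to \<open>gam c (a + b)\<close>, the left one by symmetry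
  and the right one by the first hexagon.
\<close>

lemma sum_gam:
  assumes [simp]: "a \<in> Ob" "b \<in> Ob" "c \<in> Ob"
  shows "gam (a \<^bold>+ b) c = (gam a c \<boxplus> idn b) \<cdot> (idn a \<boxplus> gam b c)"
proof -
  let ?X = "(gam a c \<boxplus> idn b) \<cdot> (idn a \<boxplus> gam b c)"
  have "gam c (a \<^bold>+ b) \<cdot> ?X = (idn a \<boxplus> gam c b) \<cdot> ((gam c a \<boxplus> idn b) \<cdot> (gam a c \<boxplus> idn b)) \<cdot> (idn a \<boxplus> gam b c)"
    by (simp add: gam_sum cmp_assoc)
  also have "(gam c a \<boxplus> idn b) \<cdot> (gam a c \<boxplus> idn b) = idn (a \<^bold>+ c \<^bold>+ b)"
    by (simp add: sum_cmp gam_gam flip: idn_sum)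
  also have "(idn a \<boxplus> gam c b) \<cdot> \<dots> \<cdot> (idn a \<boxplus> gam b c) = idn (a \<^bold>+ b \<^bold>+ c)"
    by (simp add: sum_cmp gam_gam flip: idn_sum)
  finally have 1: "gam c (a \<^bold>+ b) \<cdot> ?X = idn (a \<^bold>+ b \<^bold>+ c)" .
  have "gam (a \<^bold>+ b) c = gam (a \<^bold>+ b) c \<cdot> (gam c (a \<^bold>+ b) \<cdot> ?X)" by (simp add: 1)
  also have "\<dots> = (gam (a \<^bold>+ b) c \<cdot> gam c (a \<^bold>+ b)) \<cdot> ?X" by (simp add: cmp_assoc)
  also have "\<dots> = ?X" by (simp add: gam_gam)
  finally show ?thesis .
qed

text \<open>
  The braid relation is naturality of \<open>gam a\<close> in the arrow \<open>gam b c\<close>, expanded by the hexagon.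
\<close>

lemma gam_braid:
  assumes [simp]: "a \<in> Ob" "b \<in> Ob" "c \<in> Ob"
  shows "(gam b c \<boxplus> idn a) \<cdot> (idn b \<boxplus> gam a c) \<cdot> (gam a b \<boxplus> idn c)
       = (idn c \<boxplus> gam a b) \<cdot> (gam a c \<boxplus> idn b) \<cdot> (idn a \<boxplus> gam b c)"
  using gam_natural[of "idn a" "gam b c"] by (simp add: gam_sum cmp_assoc)

text \<open>
  Terms of a sum are indexed by a word of labels, with \<open>x i\<close> the term of the label \<open>i\<close>. The arrow
  \<open>pull x i js\<close> moves the first occurrence of \<open>i\<close> to the front, past the terms before it one at a
  time. If \<open>i\<close> does not occur, the value is a default without meaning.
\<close>

primrec pull :: "('i \<Rightarrow> 'o) \<Rightarrow> 'i \<Rightarrow> 'i list \<Rightarrow> 'a" where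
  "pull x i [] = idn zero"
| "pull x i (j # js) = (if j = i then idn (Tot (map x (j # js)))
    else (gam (x j) (x i) \<boxplus> idn (Tot (map x (remove1 i js)))) \<cdot> (idn (x j) \<boxplus> pull x i js))"

text \<open>
  The canonical isomorphism from the sum over a word to the sum over a rearrangement of it: the
  letters of the target are pulled to the front in turn. This normal form is tied to a particular
  factorization into transpositions; that the factorization does not matter is the content of
  \<open>can_trans\<close>.
\<close>

primrec can :: "('i \<Rightarrow> 'o) \<Rightarrow> 'i list \<Rightarrow> 'i list \<Rightarrow> 'a" where
  "can x is [] = idn zero"
| "can x is (j # js) = (idn (x j) \<boxplus> can x (remove1 j is) js) \<cdot> pull x j is"

lemma Tot_concat:
  "(\<And>i. x i \<in> Ob) \<Longrightarrow> Tot (map x (concat (map F ks))) = Tot (map (\<lambda>k. Tot (map x (F k))) ks)"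
  by (induction ks) auto

context
  fixes x :: "'i \<Rightarrow> 'o"
  assumes x_Ob [simp]: "\<And>i. x i \<in> Ob"
begin

lemma pull_type [simp]:
  assumes "i \<in> set js"
  shows "pull x i js \<in> Ar" "dom (pull x i js) = Tot (map x js)"
    "cod (pull x i js) = x i \<^bold>+ Tot (map x (remove1 i js))"
proof -
  have "pull x i js \<in> Ar \<and> dom (pull x i js) = Tot (map x js) \<and>
    cod (pull x i js) = x i \<^bold>+ Tot (map x (remove1 i js))"
    using assms by (induction js) auto
  then show "pull x i js \<in> Ar" "dom (pull x i js) = Tot (map x js)"
    "cod (pull x i js) = x i \<^bold>+ Tot (map x (remove1 i js))" by auto
qed

lemma can_type [simp]:
  assumes "mset is = mset js"
  shows "can x is js \<in> Ar" "dom (can x is js) = Tot (map x is)" "cod (can x is js) = Tot (map x js)"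
proof -
  have "can x is js \<in> Ar \<and> dom (can x is js) = Tot (map x is) \<and> cod (can x is js) = Tot (map x js)"
    using assms
  proof (induction js arbitrary: "is")
    case (Cons j js)
    from remove1_mset[OF this(2)] Cons.IH[of "remove1 j is"] show ?case by simp
  qed simp
  then show "can x is js \<in> Ar" "dom (can x is js) = Tot (map x is)" "cod (can x is js) = Tot (map x js)"
    by auto
qed

text \<open>
  The one place where the symmetric group relations are used. If \<open>i\<close> or \<open>j\<close> is the first letter,
  the claim reduces to \<open>gam_gam\<close>; if another letter \<open>k\<close> comes first, both \<open>i\<close> and \<open>j\<close> have to pass
  it, and the two ways of doing so differ by the braid relation.
\<close>

lemma pull_pull:
  assumes "i \<in> set ks" "j \<in> set ks" "i \<noteq> j"
  shows "(gam (x i) (x j) \<boxplus> idn (Tot (map x (remove1 j (remove1 i ks)))))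
      \<cdot> (idn (x i) \<boxplus> pull x j (remove1 i ks)) \<cdot> pull x i ks
    = (idn (x j) \<boxplus> pull x i (remove1 j ks)) \<cdot> pull x j ks"
  using assms
proof (induction ks)
  case (Cons k ks)
  consider "k = i" | "k = j" | "k \<noteq> i" "k \<noteq> j" by blast
  then show ?case
  proof cases
    case 1
    with Cons.prems have "j \<in> set ks" "j \<noteq> i" by auto
    then show ?thesis using 1 by (simp flip: idn_sum)
  next
    case 2
    with Cons.prems have m: "i \<in> set ks" "j \<noteq> i" by auto
    then have "(gam (x i) (x j) \<boxplus> idn (Tot (map x (remove1 i ks)))) \<cdot>
       ((gam (x j) (x i) \<boxplus> idn (Tot (map x (remove1 i ks)))) \<cdot> (idn (x j) \<boxplus> pull x i ks))
       = (idn (x j) \<boxplus> pull x i ks)"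
      by (simp add: sum_cmp gam_gam flip: cmp_assoc idn_sum)
    then show ?thesis using 2 m by (simp flip: idn_sum)
  next
    case 3
    with Cons.prems have [simp]: "i \<in> set ks" "j \<in> set ks" "i \<noteq> j" "j \<noteq> i" "k \<noteq> i" "k \<noteq> j" "i \<noteq> k" "j \<noteq> k" by auto
    have [simp]: "i \<in> set (remove1 j ks)" "j \<in> set (remove1 i ks)" by (auto simp: in_set_remove1)
    note IH = Cons.IH[OF \<open>i \<in> set ks\<close> \<open>j \<in> set ks\<close> \<open>i \<noteq> j\<close>]
    let ?R = "Tot (map x (remove1 j (remove1 i ks)))" and ?r = "remove1 j (remove1 i ks)"
    have [simp]: "remove1 i (remove1 j ks) = ?r" by (rule remove1_commute)
    have s1: "(idn (x i) \<boxplus> (gam (x k) (x j) \<boxplus> idn ?R) \<cdot> (idn (x k) \<boxplus> pull x j (remove1 i ks)))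
      = (idn (x i) \<boxplus> gam (x k) (x j) \<boxplus> idn ?R) \<cdot> (idn (x i) \<boxplus> idn (x k) \<boxplus> pull x j (remove1 i ks))"
      by (simp add: sum_cmp)
    have s2: "(idn (x i) \<boxplus> idn (x k) \<boxplus> pull x j (remove1 i ks)) \<cdot> (gam (x k) (x i) \<boxplus> idn (Tot (map x (remove1 i ks))))
      = (gam (x k) (x i) \<boxplus> idn (x j) \<boxplus> idn ?R) \<cdot> (idn (x k) \<boxplus> idn (x i) \<boxplus> pull x j (remove1 i ks))"
      by (simp add: sum_cmp flip: idn_sum sum_assoc_ar)
    \<comment> \<open>The braid relation for \<open>k\<close>, \<open>i\<close> and \<open>j\<close>, in front of the remaining terms.\<close>
    have b: "(gam (x i) (x j) \<boxplus> idn (x k) \<boxplus> idn ?R) \<cdot> (idn (x i) \<boxplus> gam (x k) (x j) \<boxplus> idn ?R) \<cdot> (gam (x k) (x i) \<boxplus> idn (x j) \<boxplus> idn ?R)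
      = (idn (x j) \<boxplus> gam (x k) (x i) \<boxplus> idn ?R) \<cdot> (gam (x k) (x j) \<boxplus> idn (x i) \<boxplus> idn ?R) \<cdot> (idn (x k) \<boxplus> gam (x i) (x j) \<boxplus> idn ?R)"
      using arg_cong[OF gam_braid[of "x k" "x i" "x j"], of "\<lambda>f. f \<boxplus> idn ?R"]
      by (simp add: sum_cmp flip: sum_assoc_ar)
    have s3: "(idn (x k) \<boxplus> idn (x j) \<boxplus> pull x i (remove1 j ks))
       = idn (x k \<^bold>+ x j) \<boxplus> pull x i (remove1 j ks)" by (simp add: idn_sum sum_assoc_ar)
    have s4: "(idn (x j) \<boxplus> (gam (x k) (x i) \<boxplus> idn ?R) \<cdot> (idn (x k) \<boxplus> pull x i (remove1 j ks)))
      = (idn (x j) \<boxplus> gam (x k) (x i) \<boxplus> idn ?R) \<cdot> (idn (x j) \<boxplus> idn (x k) \<boxplus> pull x i (remove1 j ks))"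
      by (simp add: sum_cmp)
    have s5: "(idn (x j) \<boxplus> idn (x k) \<boxplus> pull x i (remove1 j ks)) \<cdot> (gam (x k) (x j) \<boxplus> idn (Tot (map x (remove1 j ks))))
      = (gam (x k) (x j) \<boxplus> idn (x i) \<boxplus> idn ?R) \<cdot> (idn (x k) \<boxplus> idn (x j) \<boxplus> pull x i (remove1 j ks))"
      by (simp add: sum_cmp flip: idn_sum sum_assoc_ar)
    let ?G = "gam (x i) (x j) \<boxplus> idn (x k) \<boxplus> idn ?R"
    let ?K = "idn (x i) \<boxplus> gam (x k) (x j) \<boxplus> idn ?R"
    let ?P = "idn (x i) \<boxplus> idn (x k) \<boxplus> pull x j (remove1 i ks)"
    let ?Q = "gam (x k) (x i) \<boxplus> idn (Tot (map x (remove1 i ks)))"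
    let ?S = "idn (x k) \<boxplus> pull x i ks"
    have "(gam (x i) (x j) \<boxplus> idn (Tot (map x (remove1 j (remove1 i (k # ks))))))
      \<cdot> (idn (x i) \<boxplus> pull x j (remove1 i (k # ks))) \<cdot> pull x i (k # ks)
      = ?G \<cdot> (?K \<cdot> ?P) \<cdot> ?Q \<cdot> ?S"
      by (simp add: idn_sum s1 del: idn_cmp)
    also have "\<dots> = ?G \<cdot> ?K \<cdot> (?P \<cdot> ?Q) \<cdot> ?S" by (simp add: cmp_assoc)
    also have "\<dots> = (?G \<cdot> ?K \<cdot> (gam (x k) (x i) \<boxplus> idn (x j) \<boxplus> idn ?R)) \<cdot> (idn (x k) \<boxplus> idn (x i) \<boxplus> pull x j (remove1 i ks)) \<cdot> ?S"
      by (simp add: s2 cmp_assoc)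
    also have "\<dots> = (idn (x j) \<boxplus> gam (x k) (x i) \<boxplus> idn ?R) \<cdot> (gam (x k) (x j) \<boxplus> idn (x i) \<boxplus> idn ?R) \<cdot>
        ((idn (x k) \<boxplus> gam (x i) (x j) \<boxplus> idn ?R) \<cdot> (idn (x k) \<boxplus> idn (x i) \<boxplus> pull x j (remove1 i ks)) \<cdot> ?S)"
      by (simp only: b) (simp add: cmp_assoc)
    also have "(idn (x k) \<boxplus> gam (x i) (x j) \<boxplus> idn ?R) \<cdot> (idn (x k) \<boxplus> idn (x i) \<boxplus> pull x j (remove1 i ks)) \<cdot> ?S
      = idn (x k) \<boxplus> ((gam (x i) (x j) \<boxplus> idn ?R) \<cdot> (idn (x i) \<boxplus> pull x j (remove1 i ks)) \<cdot> pull x i ks)"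
      by (simp add: sum_cmp)
    also have "\<dots> = (idn (x k) \<boxplus> idn (x j) \<boxplus> pull x i (remove1 j ks)) \<cdot> (idn (x k) \<boxplus> pull x j ks)"
      by (simp only: IH) (simp add: sum_cmp)
    also have "(idn (x j) \<boxplus> gam (x k) (x i) \<boxplus> idn ?R) \<cdot> (gam (x k) (x j) \<boxplus> idn (x i) \<boxplus> idn ?R) \<cdot> \<dots>
      = (idn (x j) \<boxplus> gam (x k) (x i) \<boxplus> idn ?R) \<cdot> ((gam (x k) (x j) \<boxplus> idn (x i) \<boxplus> idn ?R) \<cdot> (idn (x k) \<boxplus> idn (x j) \<boxplus> pull x i (remove1 j ks))) \<cdot> (idn (x k) \<boxplus> pull x j ks)"
      by (simp add: cmp_assoc)
    also have "\<dots> = ((idn (x j) \<boxplus> gam (x k) (x i) \<boxplus> idn ?R) \<cdot> (idn (x j) \<boxplus> idn (x k) \<boxplus> pull x i (remove1 j ks))) \<cdot> (gam (x k) (x j) \<boxplus> idn (Tot (map x (remove1 j ks)))) \<cdot> (idn (x k) \<boxplus> pull x j ks)"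
      by (simp only: s5[symmetric]) (simp add: cmp_assoc)
    also have "\<dots> = (idn (x j) \<boxplus> pull x i (remove1 j (k # ks))) \<cdot> pull x j (k # ks)"
      by (simp add: s4)
    finally show ?thesis .
  qed
qed simp

text \<open>
  Pulling a letter to the front commutes with a rearrangement. The induction is over the target
  word; its head \<open>j\<close> and the letter \<open>i\<close> are exchanged by \<open>pull_pull\<close>.
\<close>

lemma pull_can:
  assumes "mset is = mset js" "i \<in> set js"
  shows "pull x i js \<cdot> can x is js = (idn (x i) \<boxplus> can x (remove1 i is) (remove1 i js)) \<cdot> pull x i is"
  using assms
proof (induction js arbitrary: "is")
  case (Cons j js)
  from remove1_mset[OF Cons.prems(1)] have [simp]: "j \<in> set is" "mset (remove1 j is) = mset js" by auto
  show ?case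
  proof (cases "i = j")
    case True
    have "mset is - {#j#} = mset js" using Cons.prems by simp
    with True show ?thesis by simp
  next
    case False
    then have [simp]: "i \<in> set js" "i \<noteq> j" "j \<noteq> i" using Cons.prems by auto
    have mi [simp]: "i \<in> set is" using Cons.prems mset_eq_setD by (metis)
    have [simp]: "i \<in> set (remove1 j is)" "j \<in> set (remove1 i is)" by (auto simp: in_set_remove1)
    have c [simp]: "remove1 j (remove1 i is) = remove1 i (remove1 j is)" by (rule remove1_commute)
    have [simp]: "mset is - {#j#} = mset js" using Cons.prems(1) by simp
    have "mset is - {#i, j#} = mset js - {#i#}"
      using Cons.prems(1) by (simp add: add_mset_commute[of i j])
    note m1 [simp] = this this[unfolded add_mset_commute[of i j]]
    let ?c = "can x (remove1 i (remove1 j is)) (remove1 i js)"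
    let ?t = "idn (Tot (map x (remove1 i js)))" and ?t' = "idn (Tot (map x (remove1 i (remove1 j is))))"
    have "pull x i (j # js) \<cdot> can x is (j # js)
      = ((gam (x j) (x i) \<boxplus> ?t) \<cdot> (idn (x j) \<boxplus> pull x i js)) \<cdot> (idn (x j) \<boxplus> can x (remove1 j is) js) \<cdot> pull x j is" by simp
    also have "\<dots> = (gam (x j) (x i) \<boxplus> ?t) \<cdot> ((idn (x j) \<boxplus> pull x i js) \<cdot> (idn (x j) \<boxplus> can x (remove1 j is) js)) \<cdot> pull x j is"
      by (simp add: cmp_assoc)
    also have "(idn (x j) \<boxplus> pull x i js) \<cdot> (idn (x j) \<boxplus> can x (remove1 j is) js) = idn (x j) \<boxplus> pull x i js \<cdot> can x (remove1 j is) js"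
      by (simp add: sum_cmp)
    also have "\<dots> = idn (x j) \<boxplus> (idn (x i) \<boxplus> ?c) \<cdot> pull x i (remove1 j is)"
      by (subst Cons.IH) simp_all
    also have "\<dots> = (idn (x j) \<boxplus> idn (x i) \<boxplus> ?c) \<cdot> (idn (x j) \<boxplus> pull x i (remove1 j is))"
      by (simp add: sum_cmp)
    also have "(gam (x j) (x i) \<boxplus> ?t) \<cdot> \<dots> \<cdot> pull x j is =
       ((gam (x j) (x i) \<boxplus> ?t) \<cdot> (idn (x j) \<boxplus> idn (x i) \<boxplus> ?c)) \<cdot> (idn (x j) \<boxplus> pull x i (remove1 j is)) \<cdot> pull x j is"
      by (simp add: cmp_assoc)
    also have "(gam (x j) (x i) \<boxplus> ?t) \<cdot> (idn (x j) \<boxplus> idn (x i) \<boxplus> ?c) = (idn (x i) \<boxplus> idn (x j) \<boxplus> ?c) \<cdot> (gam (x j) (x i) \<boxplus> ?t')"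
      by (simp add: sum_cmp flip: idn_sum sum_assoc_ar)
    also have "\<dots> \<cdot> (idn (x j) \<boxplus> pull x i (remove1 j is)) \<cdot> pull x j is
       = (idn (x i) \<boxplus> idn (x j) \<boxplus> ?c) \<cdot> (gam (x j) (x i) \<boxplus> ?t') \<cdot> (idn (x j) \<boxplus> pull x i (remove1 j is)) \<cdot> pull x j is"
      by (simp add: cmp_assoc)
    also have "(gam (x j) (x i) \<boxplus> ?t') \<cdot> (idn (x j) \<boxplus> pull x i (remove1 j is)) \<cdot> pull x j is =
       (idn (x i) \<boxplus> pull x j (remove1 i is)) \<cdot> pull x i is"
      by (rule pull_pull) auto
    also have "(idn (x i) \<boxplus> idn (x j) \<boxplus> ?c) \<cdot> \<dots> = (idn (x i) \<boxplus> can x (remove1 i is) (remove1 i (j # js))) \<cdot> pull x i is"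
      by (simp add: sum_cmp flip: cmp_assoc)
    finally show ?thesis .
  qed
qed simp

text \<open>
  Coherence: the canonical isomorphisms compose, so any two composites of them between the same
  words of labels are equal.
\<close>

lemma can_trans:
  assumes "mset is = mset js" "mset js = mset ks"
  shows "can x js ks \<cdot> can x is js = can x is ks"
  using assms
proof (induction ks arbitrary: "is" js)
  case (Cons k ks)
  from remove1_mset[OF Cons.prems(2)] have [simp]: "k \<in> set js" "mset (remove1 k js) = mset ks" by auto
  then have [simp]: "k \<in> set is" using Cons.prems mset_eq_setD by metis
  have [simp]: "mset is - {#k#} = mset ks" "mset js - {#k#} = mset ks" using Cons.prems by simp_all
  note [simp] = Cons.prems(1)
  have "can x js (k # ks) \<cdot> can x is js = (idn (x k) \<boxplus> can x (remove1 k js) ks) \<cdot> pull x k js \<cdot> can x is js"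
    by (simp add: cmp_assoc)
  also have "\<dots> = ((idn (x k) \<boxplus> can x (remove1 k js) ks) \<cdot> (idn (x k) \<boxplus> can x (remove1 k is) (remove1 k js))) \<cdot> pull x k is"
    by (simp add: pull_can cmp_assoc)
  also have "\<dots> = can x is (k # ks)"
    by (simp add: sum_cmp Cons.IH)
  finally show ?case .
qed simp

lemma can_refl [simp]: "can x is is = idn (Tot (map x is))"
  by (induction "is") (auto simp flip: idn_sum)

lemma can_Cons [simp]: "mset is = mset js \<Longrightarrow> can x (i # is) (i # js) = idn (x i) \<boxplus> can x is js"
  by (simp del: can_refl)

lemma can_append_left: "mset is = mset js \<Longrightarrow> can x (ks @ is) (ks @ js) = idn (Tot (map x ks)) \<boxplus> can x is js"
  by (induction ks) (auto simp del: can.simps simp: idn_sum sum_assoc_ar)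

lemma pull_append: "i \<in> set js \<Longrightarrow> pull x i (js @ ks) = pull x i js \<boxplus> idn (Tot (map x ks))"
proof (induction js)
  case (Cons j js)
  show ?case
  proof (cases "j = i")
    case False
    with Cons have m: "i \<in> set js" by auto
    have "remove1 i (js @ ks) = remove1 i js @ ks" using m by (simp add: remove1_append)
    with False m Cons.IH show ?thesis by (simp add: idn_sum sum_cmp flip: sum_assoc_ar)
  qed (simp add: idn_sum sum_assoc_ar)
qed simp

lemma can_append_right: "mset is = mset js \<Longrightarrow> can x (is @ ks) (js @ ks) = can x is js \<boxplus> idn (Tot (map x ks))"
proof (induction js arbitrary: "is")
  case (Cons j js)
  from remove1_mset[OF Cons.prems] have m: "j \<in> set is" "mset (remove1 j is) = mset js" by auto
  then have "remove1 j (is @ ks) = remove1 j is @ ks" by (simp add: remove1_append)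
  with m Cons.IH[of "remove1 j is"] show ?case by (simp add: pull_append sum_cmp flip: sum_assoc_ar)
qed simp

lemma can_append:
  assumes [simp]: "mset is = mset js" "mset is' = mset js'"
  shows "can x (is @ is') (js @ js') = can x is js \<boxplus> can x is' js'"
proof -
  have "can x (is @ is') (js @ js') = can x (js @ is') (js @ js') \<cdot> can x (is @ is') (js @ is')"
    by (rule can_trans[symmetric]) auto
  then show ?thesis by (simp add: can_append_left can_append_right sum_cmp)
qed

lemma can_concat:
  assumes "\<And>k. mset (F k) = mset (G k)"
  shows "can x (concat (map F ks)) (concat (map G ks)) = Tot_ar (map (\<lambda>k. can x (F k) (G k)) ks)"
proof (induction ks)
  case (Cons k ks)
  have "mset (concat (map F ks)) = mset (concat (map G ks))" using assms by (induction ks) auto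
  with Cons show ?case by (simp add: can_append assms)
qed simp

lemma pull_middle: "i \<notin> set js \<Longrightarrow> pull x i (js @ i # ks) = gam (Tot (map x js)) (x i) \<boxplus> idn (Tot (map x ks))"
proof (induction js)
  case (Cons j js)
  then have "remove1 i (js @ i # ks) = js @ ks" "j \<noteq> i" by (auto simp: remove1_append)
  with Cons show ?case
    by (simp add: idn_sum sum_gam sum_cmp flip: sum_assoc_ar)
qed (simp flip: idn_sum)

text \<open>
  A single symmetry between two sums is canonical. Disjointness is essential, as \<open>can\<close> matches
  equal labels in their given order.
\<close>

lemma can_swap:
  assumes "set is \<inter> set js = {}"
  shows "can x (is @ js) (js @ is) = gam (Tot (map x is)) (Tot (map x js))"
  using assms
proof (induction js)
  case (Cons j js)
  then have m: "j \<notin> set is" "set is \<inter> set js = {}" by auto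
  then have "remove1 j (is @ j # js) = is @ js" by (simp add: remove1_append)
  with m Cons.IH show ?case by (simp add: pull_middle gam_sum)
qed simp

text \<open>
  The labels of the two sums have to be disjoint for the same reason as in \<open>can_swap\<close>. Each term
  may itself be the sum over a word; the empty word covers terms that are \<open>zero\<close>.
\<close>

lemma merge_eq_can:
  assumes "\<And>k k'. set (F k) \<inter> set (G k') = {}"
  shows "merge (map (\<lambda>k. Tot (map x (F k))) ks) (map (\<lambda>k. Tot (map x (G k))) ks)
    = can x (concat (map F ks) @ concat (map G ks)) (concat (map (\<lambda>k. F k @ G k) ks))"
proof (induction ks)
  case (Cons k ks)
  let ?F = "concat (map F ks)" and ?G = "concat (map G ks)" and ?H = "concat (map (\<lambda>k. F k @ G k) ks)"
  have d: "set ?F \<inter> set (G k) = {}" using assms by fastforce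
  have m: "mset (?F @ ?G) = mset ?H" by (induction ks) auto
  \<comment> \<open>The word \<open>G k\<close> first moves in front of the tail \<open>?F\<close>; then the tails are merged.\<close>
  have "can x ((F k @ ?F) @ (G k @ ?G)) ((F k @ G k) @ ?H)
    = can x ((F k @ G k) @ (?F @ ?G)) ((F k @ G k) @ ?H) \<cdot> can x ((F k @ ?F) @ (G k @ ?G)) ((F k @ G k) @ (?F @ ?G))"
    by (rule can_trans[symmetric]) (use m in auto)
  also have "can x ((F k @ ?F) @ (G k @ ?G)) ((F k @ G k) @ (?F @ ?G)) =
     can x ((F k @ (?F @ G k)) @ ?G) ((F k @ (G k @ ?F)) @ ?G)" by simp
  also have "\<dots> = (idn (Tot (map x (F k))) \<boxplus> gam (Tot (map x ?F)) (Tot (map x (G k)))) \<boxplus> idn (Tot (map x ?G))"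
    by (subst can_append_right, simp, subst can_append_left, simp, subst can_swap) (use d in auto)
  also have "can x ((F k @ G k) @ (?F @ ?G)) ((F k @ G k) @ ?H) = idn (Tot (map x (F k)) \<^bold>+ Tot (map x (G k))) \<boxplus> can x (?F @ ?G) ?H"
    using m by (subst can_append_left) auto
  finally show ?case using Cons by (simp add: Tot_concat)
qed simp

lemma interchange_eq_can:
  assumes "distinct js" "\<And>j j' k k'. j \<noteq> j' \<Longrightarrow> set (L j k) \<inter> set (L j' k') = {}"
  shows "interchange (\<lambda>j k. Tot (map x (L j k))) js ks
    = can x (concat (map (\<lambda>j. concat (map (L j) ks)) js)) (concat (map (\<lambda>k. concat (map (\<lambda>j. L j k) js)) ks))"
  using assms(1)
proof (induction js)
  case Nil
  have "concat (map (\<lambda>k. []) ks) = ([] :: 'i list)" by (induction ks) auto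
  show ?case by (simp add: \<open>concat (map (\<lambda>k. []) ks) = []\<close>)
next
  case (Cons j js)
  let ?A = "concat (map (L j) ks)" and ?B = "concat (map (\<lambda>j. concat (map (L j) ks)) js)"
  let ?B' = "concat (map (\<lambda>k. concat (map (\<lambda>j. L j k) js)) ks)"
  let ?C = "concat (map (\<lambda>k. L j k @ concat (map (\<lambda>j. L j k) js)) ks)"
  note m = mset_interchange[of L ks js]
  have m2: "mset (?A @ ?B') = mset ?C" by (induction ks) auto
  have *: "interchange (\<lambda>j k. Tot (map x (L j k))) js ks = can x ?B ?B'"
    using Cons by auto
  have "set (L j k) \<inter> set (concat (map (\<lambda>j. L j k') js)) = {}" for k k'
  proof -
    have "set (L j k) \<inter> set (L j' k') = {}" if "j' \<in> set js" for j'
      using that Cons.prems by (intro assms(2)) auto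
    then show ?thesis by auto
  qed
  then have "merge (map (\<lambda>k. Tot (map x (L j k))) ks) (map (\<lambda>k. Tot (map x (concat (map (\<lambda>j. L j k) js)))) ks) = can x (?A @ ?B') ?C"
    by (rule merge_eq_can)
  moreover have "can x (?A @ ?B') ?C \<cdot> can x (?A @ ?B) (?A @ ?B') = can x (?A @ ?B) ?C"
    by (rule can_trans) (use m m2 in auto)
  ultimately show ?case using m by (simp add: * can_append_left Tot_concat)
qed

end

text \<open>
  Both sides transform the sum in the order \<open>p\<close>, \<open>q\<close>, \<open>r\<close> into the sum in the order \<open>r\<close>, \<open>q\<close>, \<open>p\<close>,
  by exchanging adjacent summations: this is the braid relation for summations. Labelling the
  terms by triples makes every factor a canonical isomorphism, and \<open>can_trans\<close> applies.
\<close>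

lemma interchange_triple:
  fixes t :: "'p \<Rightarrow> 'q \<Rightarrow> 'r \<Rightarrow> 'o"
  assumes [simp]: "\<And>p q r. t p q r \<in> Ob" and d [simp]: "distinct ps" "distinct qs" "distinct rs"
  shows "interchange (\<lambda>q r. Tot (map (\<lambda>p. t p q r) ps)) qs rs
      \<cdot> Tot_ar (map (\<lambda>q. interchange (\<lambda>p r. t p q r) ps rs) qs)
      \<cdot> interchange (\<lambda>p q. Tot (map (\<lambda>r. t p q r) rs)) ps qs
    = Tot_ar (map (\<lambda>r. interchange (\<lambda>p q. t p q r) ps qs) rs)
      \<cdot> interchange (\<lambda>p r. Tot (map (\<lambda>q. t p q r) qs)) ps rs
      \<cdot> Tot_ar (map (\<lambda>p. interchange (\<lambda>q r. t p q r) qs rs) ps)"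
proof -
  define x where "x = (\<lambda>(p, q, r). t p q r)"
  have x [simp]: "x i \<in> Ob" for i by (cases i) (simp add: x_def)
  \<comment> \<open>A word of triples is read off by three nested concatenations, whose nesting gives the order of
    summation.\<close>
  define P where "P L = concat (map L ps)" for L :: "'p \<Rightarrow> ('p \<times> 'q \<times> 'r) list"
  define Q where "Q L = concat (map L qs)" for L :: "'q \<Rightarrow> ('p \<times> 'q \<times> 'r) list"
  define R where "R L = concat (map L rs)" for L :: "'r \<Rightarrow> ('p \<times> 'q \<times> 'r) list"
  let ?l = "\<lambda>p q r. [(p, q, r)]"
  have t [simp]: "Tot (map x (?l p q r)) = t p q r" for p q r by (simp add: x_def)
  have T: "Tot (map (\<lambda>p. t p q r) ps) = Tot (map x (P (\<lambda>p. ?l p q r)))"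
    "Tot (map (\<lambda>q. t p q r) qs) = Tot (map x (Q (\<lambda>q. ?l p q r)))"
    "Tot (map (\<lambda>r. t p q r) rs) = Tot (map x (R (\<lambda>r. ?l p q r)))" for p q r
    unfolding P_def Q_def R_def by (simp_all only: Tot_concat[where x = x, OF x] t)
  have PQ: "mset (P (\<lambda>p. Q (\<lambda>q. L p q))) = mset (Q (\<lambda>q. P (\<lambda>p. L p q)))" for L
    unfolding P_def Q_def by (rule mset_interchange)
  have PR: "mset (P (\<lambda>p. R (\<lambda>q. L p q))) = mset (R (\<lambda>q. P (\<lambda>p. L p q)))" for L
    unfolding P_def R_def by (rule mset_interchange)
  have QR: "mset (Q (\<lambda>p. R (\<lambda>q. L p q))) = mset (R (\<lambda>q. Q (\<lambda>p. L p q)))" for L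
    unfolding R_def Q_def by (rule mset_interchange)
  have Pc: "mset (P F) = mset (P G)" "can x (P F) (P G) = Tot_ar (map (\<lambda>p. can x (F p) (G p)) ps)"
    if "\<And>p. mset (F p) = mset (G p)" for F G
    using can_concat[where x = x and F = F and G = G and ks = ps, OF x] that unfolding P_def
    by (simp_all add: mset_concat_cong[of F G])
  have Qc: "mset (Q F) = mset (Q G)" "can x (Q F) (Q G) = Tot_ar (map (\<lambda>p. can x (F p) (G p)) qs)"
    if "\<And>p. mset (F p) = mset (G p)" for F G
    using can_concat[where x = x and F = F and G = G and ks = qs, OF x] that unfolding Q_def
    by (simp_all add: mset_concat_cong[of F G])
  have Rc: "mset (R F) = mset (R G)" "can x (R F) (R G) = Tot_ar (map (\<lambda>p. can x (F p) (G p)) rs)"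
    if "\<And>p. mset (F p) = mset (G p)" for F G
    using can_concat[where x = x and F = F and G = G and ks = rs, OF x] that unfolding R_def
    by (simp_all add: mset_concat_cong[of F G])
  note I = interchange_eq_can[where x = x, OF x]
  have 1: "interchange (\<lambda>q r. Tot (map (\<lambda>p. t p q r) ps)) qs rs
     = can x (Q (\<lambda>q. R (\<lambda>r. P (\<lambda>p. ?l p q r)))) (R (\<lambda>r. Q (\<lambda>q. P (\<lambda>p. ?l p q r))))"
    unfolding T Q_def R_def by (rule I) (auto simp: P_def)
  have 2: "interchange (\<lambda>p q. Tot (map (\<lambda>r. t p q r) rs)) ps qs
     = can x (P (\<lambda>p. Q (\<lambda>q. R (\<lambda>r. ?l p q r)))) (Q (\<lambda>q. P (\<lambda>p. R (\<lambda>r. ?l p q r))))"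
    unfolding T Q_def P_def by (rule I) (auto simp: R_def)
  have 3: "interchange (\<lambda>p r. Tot (map (\<lambda>q. t p q r) qs)) ps rs
     = can x (P (\<lambda>p. R (\<lambda>r. Q (\<lambda>q. ?l p q r)))) (R (\<lambda>r. P (\<lambda>p. Q (\<lambda>q. ?l p q r))))"
    unfolding T R_def P_def by (rule I) (auto simp: Q_def)
  have "interchange (\<lambda>p r. t p q r) ps rs = can x (P (\<lambda>p. R (\<lambda>r. ?l p q r))) (R (\<lambda>r. P (\<lambda>p. ?l p q r)))" for q
    unfolding t[symmetric] R_def P_def by (rule I) auto
  then have 4: "Tot_ar (map (\<lambda>q. interchange (\<lambda>p r. t p q r) ps rs) qs)
     = can x (Q (\<lambda>q. P (\<lambda>p. R (\<lambda>r. ?l p q r)))) (Q (\<lambda>q. R (\<lambda>r. P (\<lambda>p. ?l p q r))))"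
    using PR by (simp add: Qc)
  have "interchange (\<lambda>p q. t p q r) ps qs = can x (P (\<lambda>p. Q (\<lambda>q. ?l p q r))) (Q (\<lambda>q. P (\<lambda>p. ?l p q r)))" for r
    unfolding t[symmetric] Q_def P_def by (rule I) auto
  then have 5: "Tot_ar (map (\<lambda>r. interchange (\<lambda>p q. t p q r) ps qs) rs)
     = can x (R (\<lambda>r. P (\<lambda>p. Q (\<lambda>q. ?l p q r)))) (R (\<lambda>r. Q (\<lambda>q. P (\<lambda>p. ?l p q r))))"
    using PQ by (simp add: Rc)
  have "interchange (\<lambda>q r. t p q r) qs rs = can x (Q (\<lambda>q. R (\<lambda>r. ?l p q r))) (R (\<lambda>r. Q (\<lambda>q. ?l p q r)))" for p
    unfolding t[symmetric] Q_def R_def by (rule I) auto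
  then have 6: "Tot_ar (map (\<lambda>p. interchange (\<lambda>q r. t p q r) qs rs) ps)
     = can x (P (\<lambda>p. Q (\<lambda>q. R (\<lambda>r. ?l p q r)))) (P (\<lambda>p. R (\<lambda>r. Q (\<lambda>q. ?l p q r))))"
    using QR by (simp add: Pc)
  \<comment> \<open>All six orders of summation have the same letters.\<close>
  have m: "mset (Q (\<lambda>q. P (\<lambda>p. R (\<lambda>r. ?l p q r)))) = mset (P (\<lambda>p. Q (\<lambda>q. R (\<lambda>r. ?l p q r))))"
    "mset (Q (\<lambda>q. R (\<lambda>r. P (\<lambda>p. ?l p q r)))) = mset (P (\<lambda>p. Q (\<lambda>q. R (\<lambda>r. ?l p q r))))"
    "mset (P (\<lambda>p. R (\<lambda>r. Q (\<lambda>q. ?l p q r)))) = mset (P (\<lambda>p. Q (\<lambda>q. R (\<lambda>r. ?l p q r))))"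
    "mset (R (\<lambda>r. P (\<lambda>p. Q (\<lambda>q. ?l p q r)))) = mset (P (\<lambda>p. Q (\<lambda>q. R (\<lambda>r. ?l p q r))))"
    "mset (R (\<lambda>r. Q (\<lambda>q. P (\<lambda>p. ?l p q r)))) = mset (P (\<lambda>p. Q (\<lambda>q. R (\<lambda>r. ?l p q r))))"
  proof -
    show 1: "mset (Q (\<lambda>q. P (\<lambda>p. R (\<lambda>r. ?l p q r)))) = mset (P (\<lambda>p. Q (\<lambda>q. R (\<lambda>r. ?l p q r))))"
      by (rule PQ[symmetric])
    show "mset (Q (\<lambda>q. R (\<lambda>r. P (\<lambda>p. ?l p q r)))) = mset (P (\<lambda>p. Q (\<lambda>q. R (\<lambda>r. ?l p q r))))"
      unfolding 1[symmetric] by (rule Qc, rule PR[symmetric])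
    show 3: "mset (P (\<lambda>p. R (\<lambda>r. Q (\<lambda>q. ?l p q r)))) = mset (P (\<lambda>p. Q (\<lambda>q. R (\<lambda>r. ?l p q r))))"
      by (rule Pc, rule QR[symmetric])
    show 4: "mset (R (\<lambda>r. P (\<lambda>p. Q (\<lambda>q. ?l p q r)))) = mset (P (\<lambda>p. Q (\<lambda>q. R (\<lambda>r. ?l p q r))))"
      unfolding 3[symmetric] by (rule PR[symmetric])
    show "mset (R (\<lambda>r. Q (\<lambda>q. P (\<lambda>p. ?l p q r)))) = mset (P (\<lambda>p. Q (\<lambda>q. R (\<lambda>r. ?l p q r))))"
      unfolding 4[symmetric] by (rule Rc, rule PQ[symmetric])
  qed
  show ?thesis unfolding 1 2 3 4 5 6 by (simp add: can_trans[where x = x] m)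
qed

end

end

section \<open>Distributivity over finite sums\<close>

text \<open>
  A product that distributes strictly from the right, and from the left up to a natural family
  \<open>del a b c : a * (b + c) \<rightarrow> a * b + a * c\<close>.
\<close>

locale times_category = sum_category Ob Ar dom cod idn cmp sum_ob sum_ar zero gam
  for Ob :: "'o set" and Ar :: "'a set" and dom cod :: "'a \<Rightarrow> 'o" and idn :: "'o \<Rightarrow> 'a"
    and cmp :: "'a \<Rightarrow> 'a \<Rightarrow> 'a" (infixr "\<cdot>" 67)
    and sum_ob :: "'o \<Rightarrow> 'o \<Rightarrow> 'o" (infixr "\<^bold>+" 65)
    and sum_ar :: "'a \<Rightarrow> 'a \<Rightarrow> 'a" (infixr "\<boxplus>" 65)
    and zero :: 'o
    and gam :: "'o \<Rightarrow> 'o \<Rightarrow> 'a" +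
  fixes prod_ob :: "'o \<Rightarrow> 'o \<Rightarrow> 'o" (infixr "\<^bold>*" 70)
    and prod_ar :: "'a \<Rightarrow> 'a \<Rightarrow> 'a" (infixr "\<boxtimes>" 70)
    and one :: 'o
    and del :: "'o \<Rightarrow> 'o \<Rightarrow> 'o \<Rightarrow> 'a"
  assumes one_Ob [simp]: "one \<in> Ob"
    and prod_Ob [simp]: "a \<in> Ob \<Longrightarrow> b \<in> Ob \<Longrightarrow> a \<^bold>* b \<in> Ob"
    and prod_Ar [simp]: "f \<in> Ar \<Longrightarrow> g \<in> Ar \<Longrightarrow> f \<boxtimes> g \<in> Ar"
    and dom_prod [simp]: "f \<in> Ar \<Longrightarrow> g \<in> Ar \<Longrightarrow> dom (f \<boxtimes> g) = dom f \<^bold>* dom g"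
    and cod_prod [simp]: "f \<in> Ar \<Longrightarrow> g \<in> Ar \<Longrightarrow> cod (f \<boxtimes> g) = cod f \<^bold>* cod g"
    and idn_prod: "a \<in> Ob \<Longrightarrow> b \<in> Ob \<Longrightarrow> idn (a \<^bold>* b) = idn a \<boxtimes> idn b"
    and prod_cmp: "f \<in> Ar \<Longrightarrow> g \<in> Ar \<Longrightarrow> f' \<in> Ar \<Longrightarrow> g' \<in> Ar \<Longrightarrow> dom g = cod f \<Longrightarrow> dom g' = cod f'
      \<Longrightarrow> (g \<boxtimes> g') \<cdot> (f \<boxtimes> f') = (g \<cdot> f) \<boxtimes> (g' \<cdot> f')"
    and prod_assoc [simp]: "a \<in> Ob \<Longrightarrow> b \<in> Ob \<Longrightarrow> c \<in> Ob \<Longrightarrow> (a \<^bold>* b) \<^bold>* c = a \<^bold>* b \<^bold>* c"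
    and prod_assoc_ar: "f \<in> Ar \<Longrightarrow> g \<in> Ar \<Longrightarrow> h \<in> Ar \<Longrightarrow> (f \<boxtimes> g) \<boxtimes> h = f \<boxtimes> g \<boxtimes> h"
    and one_prod [simp]: "a \<in> Ob \<Longrightarrow> one \<^bold>* a = a"
    and prod_one [simp]: "a \<in> Ob \<Longrightarrow> a \<^bold>* one = a"
    and one_prod_ar [simp]: "f \<in> Ar \<Longrightarrow> idn one \<boxtimes> f = f"
    and prod_one_ar [simp]: "f \<in> Ar \<Longrightarrow> f \<boxtimes> idn one = f"
    and zero_prod [simp]: "a \<in> Ob \<Longrightarrow> zero \<^bold>* a = zero"
    and prod_zero [simp]: "a \<in> Ob \<Longrightarrow> a \<^bold>* zero = zero"
    and zero_prod_ar [simp]: "f \<in> Ar \<Longrightarrow> idn zero \<boxtimes> f = idn zero"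
    and prod_zero_ar [simp]: "f \<in> Ar \<Longrightarrow> f \<boxtimes> idn zero = idn zero"
    and distrib_right [simp]: "a \<in> Ob \<Longrightarrow> b \<in> Ob \<Longrightarrow> c \<in> Ob \<Longrightarrow> (a \<^bold>+ b) \<^bold>* c = a \<^bold>* c \<^bold>+ b \<^bold>* c"
    and distrib_right_ar [simp]: "f \<in> Ar \<Longrightarrow> g \<in> Ar \<Longrightarrow> h \<in> Ar \<Longrightarrow> (f \<boxplus> g) \<boxtimes> h = f \<boxtimes> h \<boxplus> g \<boxtimes> h"
    and del_Ar [simp]: "a \<in> Ob \<Longrightarrow> b \<in> Ob \<Longrightarrow> c \<in> Ob \<Longrightarrow> del a b c \<in> Ar"
    and dom_del [simp]: "a \<in> Ob \<Longrightarrow> b \<in> Ob \<Longrightarrow> c \<in> Ob \<Longrightarrow> dom (del a b c) = a \<^bold>* (b \<^bold>+ c)"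
    and cod_del [simp]: "a \<in> Ob \<Longrightarrow> b \<in> Ob \<Longrightarrow> c \<in> Ob \<Longrightarrow> cod (del a b c) = a \<^bold>* b \<^bold>+ a \<^bold>* c"
    and del_natural: "f \<in> Ar \<Longrightarrow> g \<in> Ar \<Longrightarrow> h \<in> Ar \<Longrightarrow>
      del (cod f) (cod g) (cod h) \<cdot> f \<boxtimes> (g \<boxplus> h) = (f \<boxtimes> g \<boxplus> f \<boxtimes> h) \<cdot> del (dom f) (dom g) (dom h)"
begin

context
  notes image_subset_iff [simp]
begin

primrec distr :: "'o \<Rightarrow> 'o list \<Rightarrow> 'a" where
  "distr a [] = idn zero"
| "distr a (b # bs) = (idn (a \<^bold>* b) \<boxplus> distr a bs) \<cdot> del a b (Tot bs)"

lemma distr_type [simp]: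
  assumes "a \<in> Ob" "set bs \<subseteq> Ob"
  shows "distr a bs \<in> Ar" "dom (distr a bs) = a \<^bold>* Tot bs" "cod (distr a bs) = Tot (map (prod_ob a) bs)"
proof -
  have "distr a bs \<in> Ar \<and> dom (distr a bs) = a \<^bold>* Tot bs \<and> cod (distr a bs) = Tot (map (prod_ob a) bs)"
    using assms by (induction bs) auto
  then show "distr a bs \<in> Ar" "dom (distr a bs) = a \<^bold>* Tot bs" "cod (distr a bs) = Tot (map (prod_ob a) bs)"
    by auto
qed

lemma Tot_prod [simp]:
  assumes "set as \<subseteq> Ob" "c \<in> Ob"
  shows "Tot as \<^bold>* c = Tot (map (\<lambda>a. a \<^bold>* c) as)"
  using assms by (induction as) auto

lemma Tot_ar_prod [simp]:
  assumes "set fs \<subseteq> Ar" "h \<in> Ar"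
  shows "Tot_ar fs \<boxtimes> h = Tot_ar (map (\<lambda>f. f \<boxtimes> h) fs)"
  using assms by (induction fs) auto

lemma distr_natural:
  assumes [simp]: "f \<in> Ar" "\<And>i. g i \<in> Ar"
  shows "distr (cod f) (map (\<lambda>i. cod (g i)) is) \<cdot> f \<boxtimes> Tot_ar (map g is)
    = Tot_ar (map (\<lambda>i. f \<boxtimes> g i) is) \<cdot> distr (dom f) (map (\<lambda>i. dom (g i)) is)"
proof (induction "is")
  case (Cons i "is")
  note [simp] = comp_def
  let ?G = "Tot_ar (map g is)"
  have d: "del (cod f) (cod (g i)) (Tot (map (\<lambda>i. cod (g i)) is)) \<cdot> f \<boxtimes> (g i \<boxplus> ?G)
     = (f \<boxtimes> g i \<boxplus> f \<boxtimes> ?G) \<cdot> del (dom f) (dom (g i)) (Tot (map (\<lambda>i. dom (g i)) is))"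
    using del_natural[of f "g i" ?G] by simp
  have e: "(idn (cod f \<^bold>* cod (g i)) \<boxplus> distr (cod f) (map (\<lambda>i. cod (g i)) is)) \<cdot> (f \<boxtimes> g i \<boxplus> f \<boxtimes> ?G)
     = (f \<boxtimes> g i \<boxplus> Tot_ar (map (\<lambda>i. f \<boxtimes> g i) is)) \<cdot> (idn (dom f \<^bold>* dom (g i)) \<boxplus> distr (dom f) (map (\<lambda>i. dom (g i)) is))"
    by (simp add: sum_cmp Cons)
  show ?case by (simp add: d cmp_assoc) (simp add: e flip: cmp_assoc)
qed simp

section \<open>Entries of the associativity isomorphism\<close>

text \<open>
  For a row \<open>u\<close>, a matrix \<open>v\<close> and a column \<open>w\<close>, this is the arrow from \<open>u \<cdot> (v \<cdot> w)\<close> to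
  \<open>(u \<cdot> v) \<cdot> w\<close>. Rows and columns are indexed by lists so that index ranges can be filtered and
  reindexed.
\<close>

definition assoc_entry :: "('p \<Rightarrow> 'o) \<Rightarrow> ('p \<Rightarrow> 'q \<Rightarrow> 'o) \<Rightarrow> ('q \<Rightarrow> 'o) \<Rightarrow> 'p list \<Rightarrow> 'q list \<Rightarrow> 'a" where
  "assoc_entry u v w ps qs = interchange (\<lambda>p q. (u p \<^bold>* v p q) \<^bold>* w q) ps qs
     \<cdot> Tot_ar (map (\<lambda>p. distr (u p) (map (\<lambda>q. v p q \<^bold>* w q) qs)) ps)"

lemma assoc_entry_type [simp]:
  assumes [simp]: "\<And>p. u p \<in> Ob" "\<And>p q. v p q \<in> Ob" "\<And>q. w q \<in> Ob"
  shows "assoc_entry u v w ps qs \<in> Ar"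
    and "dom (assoc_entry u v w ps qs) = Tot (map (\<lambda>p. u p \<^bold>* Tot (map (\<lambda>q. v p q \<^bold>* w q) qs)) ps)"
    and "cod (assoc_entry u v w ps qs) = Tot (map (\<lambda>q. Tot (map (\<lambda>p. u p \<^bold>* v p q) ps) \<^bold>* w q) qs)"
  by (simp_all add: assoc_entry_def comp_def)

lemma assoc_entry_natural:
  assumes [simp]: "\<And>p. u p \<in> Ar" "\<And>p q. v p q \<in> Ar" "\<And>q. w q \<in> Ar"
  shows "assoc_entry (\<lambda>p. cod (u p)) (\<lambda>p q. cod (v p q)) (\<lambda>q. cod (w q)) ps qs
      \<cdot> Tot_ar (map (\<lambda>p. u p \<boxtimes> Tot_ar (map (\<lambda>q. v p q \<boxtimes> w q) qs)) ps)
    = Tot_ar (map (\<lambda>q. Tot_ar (map (\<lambda>p. u p \<boxtimes> v p q) ps) \<boxtimes> w q) qs)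
      \<cdot> assoc_entry (\<lambda>p. dom (u p)) (\<lambda>p q. dom (v p q)) (\<lambda>q. dom (w q)) ps qs"
proof -
  note [simp] = comp_def
  let ?i = "\<lambda>d. interchange (\<lambda>p q. (d (u p) \<^bold>* d (v p q)) \<^bold>* d (w q)) ps qs"
  let ?D = "\<lambda>d. Tot_ar (map (\<lambda>p. distr (d (u p)) (map (\<lambda>q. d (v p q) \<^bold>* d (w q)) qs)) ps)"
  let ?S = "Tot_ar (map (\<lambda>p. u p \<boxtimes> Tot_ar (map (\<lambda>q. v p q \<boxtimes> w q) qs)) ps)"
  let ?M = "Tot_ar (map (\<lambda>p. Tot_ar (map (\<lambda>q. u p \<boxtimes> v p q \<boxtimes> w q) qs)) ps)"
  let ?T = "Tot_ar (map (\<lambda>q. Tot_ar (map (\<lambda>p. u p \<boxtimes> v p q) ps) \<boxtimes> w q) qs)"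
  have "?D cod \<cdot> ?S = Tot_ar (map (\<lambda>p. distr (cod (u p)) (map (\<lambda>q. cod (v p q) \<^bold>* cod (w q)) qs)
     \<cdot> u p \<boxtimes> Tot_ar (map (\<lambda>q. v p q \<boxtimes> w q) qs)) ps)"
    by (rule Tot_ar_cmp) simp_all
  also have "\<dots> = Tot_ar (map (\<lambda>p. Tot_ar (map (\<lambda>q. u p \<boxtimes> v p q \<boxtimes> w q) qs)
     \<cdot> distr (dom (u p)) (map (\<lambda>q. dom (v p q) \<^bold>* dom (w q)) qs)) ps)"
    using distr_natural[of "u p" "\<lambda>q. v p q \<boxtimes> w q" qs for p] by simp
  also have "\<dots> = ?M \<cdot> ?D dom"
    by (rule Tot_ar_cmp[symmetric]) simp_all
  finally have 1: "?D cod \<cdot> ?S = ?M \<cdot> ?D dom" .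
  have 2: "?i cod \<cdot> ?M = ?T \<cdot> ?i dom"
    using interchange_natural[of "\<lambda>p q. (u p \<boxtimes> v p q) \<boxtimes> w q" ps qs] by (simp add: prod_assoc_ar)
  have "assoc_entry (\<lambda>p. cod (u p)) (\<lambda>p q. cod (v p q)) (\<lambda>q. cod (w q)) ps qs \<cdot> ?S = ?i cod \<cdot> ?D cod \<cdot> ?S"
    by (simp add: assoc_entry_def cmp_assoc)
  also have "\<dots> = (?i cod \<cdot> ?M) \<cdot> ?D dom" by (simp add: 1 cmp_assoc)
  also have "\<dots> = ?T \<cdot> assoc_entry (\<lambda>p. dom (u p)) (\<lambda>p q. dom (v p q)) (\<lambda>q. dom (w q)) ps qs"
    by (simp only: 2) (simp add: assoc_entry_def cmp_assoc)
  finally show ?thesis .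
qed

end

end

section \<open>Coherence of distributivity\<close>

text \<open>
  Laplaza's axioms for a product that need not be commutative, when all structure other than \<open>gam\<close>
  and \<open>del\<close> is strict.
\<close>

locale bimonoidal_coherence =
  perm_category Ob Ar dom cod idn cmp sum_ob sum_ar zero gam +
  times_category Ob Ar dom cod idn cmp sum_ob sum_ar zero gam prod_ob prod_ar one del
  for Ob :: "'o set" and Ar :: "'a set" and dom cod :: "'a \<Rightarrow> 'o" and idn :: "'o \<Rightarrow> 'a"
    and cmp :: "'a \<Rightarrow> 'a \<Rightarrow> 'a" (infixr "\<cdot>" 67)
    and sum_ob :: "'o \<Rightarrow> 'o \<Rightarrow> 'o" (infixr "\<^bold>+" 65)
    and sum_ar :: "'a \<Rightarrow> 'a \<Rightarrow> 'a" (infixr "\<boxplus>" 65)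
    and zero :: 'o
    and gam :: "'o \<Rightarrow> 'o \<Rightarrow> 'a"
    and prod_ob :: "'o \<Rightarrow> 'o \<Rightarrow> 'o" (infixr "\<^bold>*" 70)
    and prod_ar :: "'a \<Rightarrow> 'a \<Rightarrow> 'a" (infixr "\<boxtimes>" 70)
    and one :: 'o
    and del :: "'o \<Rightarrow> 'o \<Rightarrow> 'o \<Rightarrow> 'a" +
  assumes del_gam: "a \<in> Ob \<Longrightarrow> b \<in> Ob \<Longrightarrow> c \<in> Ob \<Longrightarrow>
      gam (a \<^bold>* b) (a \<^bold>* c) \<cdot> del a b c = del a c b \<cdot> idn a \<boxtimes> gam b c"
    and gam_prod: "a \<in> Ob \<Longrightarrow> b \<in> Ob \<Longrightarrow> c \<in> Ob \<Longrightarrow> gam a b \<boxtimes> idn c = gam (a \<^bold>* c) (b \<^bold>* c)"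
    and del_sum: "a \<in> Ob \<Longrightarrow> b \<in> Ob \<Longrightarrow> c \<in> Ob \<Longrightarrow> d \<in> Ob \<Longrightarrow>
      (del a b c \<boxplus> idn (a \<^bold>* d)) \<cdot> del a (b \<^bold>+ c) d = (idn (a \<^bold>* b) \<boxplus> del a c d) \<cdot> del a b (c \<^bold>+ d)"
    and zero_del [simp]: "b \<in> Ob \<Longrightarrow> c \<in> Ob \<Longrightarrow> del zero b c = idn zero"
    and del_zero_left [simp]: "a \<in> Ob \<Longrightarrow> c \<in> Ob \<Longrightarrow> del a zero c = idn (a \<^bold>* c)"
    and del_zero_right [simp]: "a \<in> Ob \<Longrightarrow> b \<in> Ob \<Longrightarrow> del a b zero = idn (a \<^bold>* b)"
    and one_del [simp]: "b \<in> Ob \<Longrightarrow> c \<in> Ob \<Longrightarrow> del one b c = idn (b \<^bold>+ c)"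
    and prod_del: "a \<in> Ob \<Longrightarrow> a' \<in> Ob \<Longrightarrow> b \<in> Ob \<Longrightarrow> c \<in> Ob \<Longrightarrow>
      del (a \<^bold>* a') b c = del a (a' \<^bold>* b) (a' \<^bold>* c) \<cdot> idn a \<boxtimes> del a' b c"
    and del_prod: "a \<in> Ob \<Longrightarrow> b \<in> Ob \<Longrightarrow> c \<in> Ob \<Longrightarrow> d \<in> Ob \<Longrightarrow>
      del a b c \<boxtimes> idn d = del a (b \<^bold>* d) (c \<^bold>* d)"
    and sum_del: "a \<in> Ob \<Longrightarrow> a' \<in> Ob \<Longrightarrow> b \<in> Ob \<Longrightarrow> b' \<in> Ob \<Longrightarrow>
      del (a \<^bold>+ a') b b' = ((idn (a \<^bold>* b) \<boxplus> gam (a \<^bold>* b') (a' \<^bold>* b)) \<boxplus> idn (a' \<^bold>* b'))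
        \<cdot> (del a b b' \<boxplus> del a' b b')"
begin

context
  notes image_subset_iff [simp]
begin

lemma distr_append:
  assumes [simp]: "a \<in> Ob" "set bs \<subseteq> Ob" "set cs \<subseteq> Ob"
  shows "distr a (bs @ cs) = (distr a bs \<boxplus> distr a cs) \<cdot> del a (Tot bs) (Tot cs)"
  using assms(2)
proof (induction bs)
  case (Cons b bs)
  then have [simp]: "b \<in> Ob" "set bs \<subseteq> Ob" by auto
  let ?B = "Tot bs" and ?C = "Tot cs"
  have "distr a ((b # bs) @ cs) = (idn (a \<^bold>* b) \<boxplus> (distr a bs \<boxplus> distr a cs) \<cdot> del a ?B ?C) \<cdot> del a b (?B \<^bold>+ ?C)"
    using Cons.IH by simp
  also have "\<dots> = (idn (a \<^bold>* b) \<boxplus> distr a bs \<boxplus> distr a cs) \<cdot> (idn (a \<^bold>* b) \<boxplus> del a ?B ?C) \<cdot> del a b (?B \<^bold>+ ?C)"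
    by (simp add: sum_cmp flip: cmp_assoc)
  also have "\<dots> = (idn (a \<^bold>* b) \<boxplus> distr a bs \<boxplus> distr a cs) \<cdot> (del a b ?B \<boxplus> idn (a \<^bold>* ?C)) \<cdot> del a (b \<^bold>+ ?B) ?C"
    by (simp add: del_sum)
  also have "\<dots> = (distr a (b # bs) \<boxplus> distr a cs) \<cdot> del a (b \<^bold>+ ?B) ?C"
    by (simp add: sum_cmp flip: cmp_assoc sum_assoc_ar)
  finally show ?case by simp
qed simp

lemma distr_concat:
  assumes [simp]: "a \<in> Ob" "\<And>k. set (F k) \<subseteq> Ob"
  shows "distr a (concat (map F ks)) = Tot_ar (map (\<lambda>k. distr a (F k)) ks) \<cdot> distr a (map (\<lambda>k. Tot (F k)) ks)"
proof (induction ks)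
  case (Cons k ks)
  note [simp] = UN_subset_iff
  have [simp]: "Tot (concat (map F ks)) = Tot (map (\<lambda>k. Tot (F k)) ks)" by (induction ks) auto
  show ?case
    using Cons by (simp add: distr_append sum_cmp comp_def flip: cmp_assoc)
qed simp

lemma distr_prod_left:
  assumes [simp]: "a \<in> Ob" "a' \<in> Ob" "set bs \<subseteq> Ob"
  shows "distr (a \<^bold>* a') bs = distr a (map (prod_ob a') bs) \<cdot> idn a \<boxtimes> distr a' bs"
  using assms(3)
proof (induction bs)
  case (Cons b bs)
  then have [simp]: "b \<in> Ob" "set bs \<subseteq> Ob" "\<And>c. c \<in> set bs \<Longrightarrow> c \<in> Ob" by auto
  let ?B = "Tot bs" and ?B' = "Tot (map (prod_ob a') bs)"
  have n: "(idn a \<boxtimes> idn (a' \<^bold>* b) \<boxplus> idn a \<boxtimes> distr a' bs) \<cdot> del a (a' \<^bold>* b) (a' \<^bold>* ?B)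
     = del a (a' \<^bold>* b) ?B' \<cdot> idn a \<boxtimes> (idn (a' \<^bold>* b) \<boxplus> distr a' bs)"
    using del_natural[of "idn a" "idn (a' \<^bold>* b)" "distr a' bs"] by simp
  have "distr (a \<^bold>* a') (b # bs) = (idn (a \<^bold>* a' \<^bold>* b) \<boxplus> distr a (map (prod_ob a') bs) \<cdot> idn a \<boxtimes> distr a' bs)
     \<cdot> del a (a' \<^bold>* b) (a' \<^bold>* ?B) \<cdot> idn a \<boxtimes> del a' b ?B"
    using Cons.IH by (simp add: prod_del)
  also have "\<dots> = (idn (a \<^bold>* a' \<^bold>* b) \<boxplus> distr a (map (prod_ob a') bs)) \<cdot>
     ((idn a \<boxtimes> idn (a' \<^bold>* b) \<boxplus> idn a \<boxtimes> distr a' bs) \<cdot> del a (a' \<^bold>* b) (a' \<^bold>* ?B)) \<cdot> idn a \<boxtimes> del a' b ?B"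
  proof -
    have "idn (a \<^bold>* a' \<^bold>* b) \<boxplus> distr a (map (prod_ob a') bs) \<cdot> idn a \<boxtimes> distr a' bs
      = (idn (a \<^bold>* a' \<^bold>* b) \<boxplus> distr a (map (prod_ob a') bs)) \<cdot> (idn a \<boxtimes> idn (a' \<^bold>* b) \<boxplus> idn a \<boxtimes> distr a' bs)"
      by (simp add: sum_cmp flip: idn_prod)
    then show ?thesis by (simp add: cmp_assoc)
  qed
  also have "\<dots> = distr a (map (prod_ob a') (b # bs)) \<cdot> idn a \<boxtimes> distr a' (b # bs)"
    by (simp only: n) (simp add: cmp_assoc prod_cmp)
  finally show ?case .
qed simp

lemma distr_prod_right:
  assumes [simp]: "a \<in> Ob" "c \<in> Ob" "set bs \<subseteq> Ob"
  shows "distr a bs \<boxtimes> idn c = distr a (map (\<lambda>b. b \<^bold>* c) bs)"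
  using assms(3)
proof (induction bs)
  case (Cons b bs)
  then have [simp]: "b \<in> Ob" "set bs \<subseteq> Ob" by auto
  have "distr a (b # bs) \<boxtimes> idn c = (idn (a \<^bold>* b) \<boxplus> distr a bs) \<boxtimes> idn c \<cdot> del a b (Tot bs) \<boxtimes> idn c"
    by (subst prod_cmp) simp_all
  also have "\<dots> = distr a (map (\<lambda>b. b \<^bold>* c) (b # bs))"
    using Cons by (simp add: del_prod idn_prod prod_assoc_ar)
  finally show ?case .
qed simp

text \<open>
  The axiom \<open>sum_del\<close>, iterated over the terms on the right: expanding a product of sums in the
  two possible orders gives results that differ by a merge.
\<close>

lemma distr_sum_left:
  assumes [simp]: "a \<in> Ob" "a' \<in> Ob" "\<And>i. b i \<in> Ob"
  shows "distr (a \<^bold>+ a') (map b is) = merge (map (\<lambda>i. a \<^bold>* b i) is) (map (\<lambda>i. a' \<^bold>* b i) is)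
    \<cdot> (distr a (map b is) \<boxplus> distr a' (map b is))"
proof (induction "is")
  case (Cons i "is")
  note [simp] = comp_def
  let ?b = "map b is" and ?B = "Tot (map b is)"
  let ?x = "Tot (map (\<lambda>i. a \<^bold>* b i) is)" and ?y = "Tot (map (\<lambda>i. a' \<^bold>* b i) is)"
  let ?m = "merge (map (\<lambda>i. a \<^bold>* b i) is) (map (\<lambda>i. a' \<^bold>* b i) is)"
  have g: "gam ?x (a' \<^bold>* b i) \<cdot> (distr a ?b \<boxplus> idn (a' \<^bold>* b i)) = (idn (a' \<^bold>* b i) \<boxplus> distr a ?b) \<cdot> gam (a \<^bold>* ?B) (a' \<^bold>* b i)"
    using gam_natural[of "distr a ?b" "idn (a' \<^bold>* b i)"] by simp
  \<comment> \<open>Naturality of \<open>gam\<close>: the distributivity over the tail may come before or after the exchange.\<close>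
  have "idn (a \<^bold>* b i \<^bold>+ a' \<^bold>* b i) \<boxplus> distr a ?b \<boxplus> distr a' ?b
    = (idn (a \<^bold>* b i) \<boxplus> idn (a' \<^bold>* b i) \<boxplus> distr a ?b) \<boxplus> distr a' ?b"
    by (simp add: idn_sum sum_assoc_ar)
  then have "(idn (a \<^bold>* b i \<^bold>+ a' \<^bold>* b i) \<boxplus> distr a ?b \<boxplus> distr a' ?b) \<cdot>
      ((idn (a \<^bold>* b i) \<boxplus> gam (a \<^bold>* ?B) (a' \<^bold>* b i)) \<boxplus> idn (a' \<^bold>* ?B))
    = (idn (a \<^bold>* b i) \<boxplus> ((idn (a' \<^bold>* b i) \<boxplus> distr a ?b) \<cdot> gam (a \<^bold>* ?B) (a' \<^bold>* b i))) \<boxplus> distr a' ?b"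
    by (simp add: sum_cmp)
  also have "\<dots> = (idn (a \<^bold>* b i) \<boxplus> (gam ?x (a' \<^bold>* b i) \<cdot> (distr a ?b \<boxplus> idn (a' \<^bold>* b i)))) \<boxplus> distr a' ?b"
    by (simp only: g)
  also have "\<dots> = ((idn (a \<^bold>* b i) \<boxplus> gam ?x (a' \<^bold>* b i)) \<boxplus> idn ?y) \<cdot> ((idn (a \<^bold>* b i) \<boxplus> distr a ?b \<boxplus> idn (a' \<^bold>* b i)) \<boxplus> distr a' ?b)"
    by (simp add: sum_cmp)
  also have "(idn (a \<^bold>* b i) \<boxplus> distr a ?b \<boxplus> idn (a' \<^bold>* b i)) \<boxplus> distr a' ?b
     = (idn (a \<^bold>* b i) \<boxplus> distr a ?b) \<boxplus> (idn (a' \<^bold>* b i) \<boxplus> distr a' ?b)" by (simp add: sum_assoc_ar)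
  finally have k: "(idn (a \<^bold>* b i \<^bold>+ a' \<^bold>* b i) \<boxplus> distr a ?b \<boxplus> distr a' ?b) \<cdot>
      ((idn (a \<^bold>* b i) \<boxplus> gam (a \<^bold>* ?B) (a' \<^bold>* b i)) \<boxplus> idn (a' \<^bold>* ?B))
    = ((idn (a \<^bold>* b i) \<boxplus> gam ?x (a' \<^bold>* b i)) \<boxplus> idn ?y)
      \<cdot> ((idn (a \<^bold>* b i) \<boxplus> distr a ?b) \<boxplus> (idn (a' \<^bold>* b i) \<boxplus> distr a' ?b))" .
  have "distr (a \<^bold>+ a') (map b (i # is)) =
    (idn (a \<^bold>* b i \<^bold>+ a' \<^bold>* b i) \<boxplus> ?m) \<cdot>
    ((idn (a \<^bold>* b i \<^bold>+ a' \<^bold>* b i) \<boxplus> distr a ?b \<boxplus> distr a' ?b) \<cdot>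
      ((idn (a \<^bold>* b i) \<boxplus> gam (a \<^bold>* ?B) (a' \<^bold>* b i)) \<boxplus> idn (a' \<^bold>* ?B)))
    \<cdot> (del a (b i) ?B \<boxplus> del a' (b i) ?B)"
  proof -
    have "idn (a \<^bold>* b i \<^bold>+ a' \<^bold>* b i) \<boxplus> ?m \<cdot> (distr a ?b \<boxplus> distr a' ?b)
      = (idn (a \<^bold>* b i \<^bold>+ a' \<^bold>* b i) \<boxplus> ?m) \<cdot> (idn (a \<^bold>* b i \<^bold>+ a' \<^bold>* b i) \<boxplus> distr a ?b \<boxplus> distr a' ?b)"
      by (simp add: sum_cmp)
    then show ?thesis by (simp add: Cons sum_del cmp_assoc)
  qed
  also have "\<dots> = (idn (a \<^bold>* b i \<^bold>+ a' \<^bold>* b i) \<boxplus> ?m) \<cdot> ((idn (a \<^bold>* b i) \<boxplus> gam ?x (a' \<^bold>* b i)) \<boxplus> idn ?y) \<cdot>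
      ((idn (a \<^bold>* b i) \<boxplus> distr a ?b) \<boxplus> (idn (a' \<^bold>* b i) \<boxplus> distr a' ?b)) \<cdot> (del a (b i) ?B \<boxplus> del a' (b i) ?B)"
    by (simp only: k) (simp add: cmp_assoc)
  also have "\<dots> = merge (map (\<lambda>i. a \<^bold>* b i) (i # is)) (map (\<lambda>i. a' \<^bold>* b i) (i # is))
    \<cdot> (distr a (map b (i # is)) \<boxplus> distr a' (map b (i # is)))"
    by (simp add: cmp_assoc) (simp add: sum_cmp)
  finally show ?case .
qed simp

lemma distr_Tot_left:
  assumes [simp]: "\<And>p. a p \<in> Ob" "\<And>i. b i \<in> Ob"
  shows "distr (Tot (map a ps)) (map b is) = interchange (\<lambda>p i. a p \<^bold>* b i) ps is
    \<cdot> Tot_ar (map (\<lambda>p. distr (a p) (map b is)) ps)"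
proof (induction ps)
  case Nil
  have "distr zero (map b is) = idn zero" by (induction "is") auto
  then show ?case by simp
next
  case (Cons p ps)
  note [simp] = comp_def
  show ?case by (simp add: distr_sum_left Cons cmp_assoc) (simp add: sum_cmp)
qed

text \<open>
  The axiom \<open>del_gam\<close> says this for an exchange of two adjacent terms; \<open>del_sum\<close> embeds it in a
  longer sum.
\<close>

lemma distr_pull:
  assumes [simp]: "a \<in> Ob" "\<And>i. x i \<in> Ob" and "i \<in> set js"
  shows "(idn (a \<^bold>* x i) \<boxplus> distr a (map x (remove1 i js))) \<cdot> del a (x i) (Tot (map x (remove1 i js))) \<cdot> idn a \<boxtimes> pull x i js
    = pull (\<lambda>j. a \<^bold>* x j) i js \<cdot> distr a (map x js)"
  using assms(3)
proof (induction js)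
  case (Cons j js)
  note [simp] = comp_def
  show ?case
  proof (cases "j = i")
    case True
    then show ?thesis by (simp flip: idn_prod)
  next
    case False
    with Cons have [simp]: "i \<in> set js" "i \<noteq> j" "j \<noteq> i" by auto
    let ?i = "idn (a \<^bold>* x i)" and ?j = "idn (a \<^bold>* x j)"
    let ?R = "Tot (map x (remove1 i js))" and ?R' = "Tot (map (\<lambda>j. a \<^bold>* x j) (remove1 i js))" and ?D = "distr a (map x (remove1 i js))"
    have n1: "del a (x i \<^bold>+ x j) ?R \<cdot> idn a \<boxtimes> (gam (x j) (x i) \<boxplus> idn ?R)
       = (idn a \<boxtimes> gam (x j) (x i) \<boxplus> idn (a \<^bold>* ?R)) \<cdot> del a (x j \<^bold>+ x i) ?R"
      using del_natural[of "idn a" "gam (x j) (x i)" "idn ?R"] by (simp add: idn_prod)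
    have n2: "del a (x j) (x i \<^bold>+ ?R) \<cdot> idn a \<boxtimes> (idn (x j) \<boxplus> pull x i js) = (?j \<boxplus> idn a \<boxtimes> pull x i js) \<cdot> del a (x j) (Tot (map x js))"
      using del_natural[of "idn a" "idn (x j)" "pull x i js"] by (simp add: idn_prod)
    have "(idn (a \<^bold>* x i) \<boxplus> distr a (map x (remove1 i (j # js)))) \<cdot> del a (x i) (Tot (map x (remove1 i (j # js)))) \<cdot> idn a \<boxtimes> pull x i (j # js)
      = (?i \<boxplus> ?j \<boxplus> ?D) \<cdot> ((?i \<boxplus> del a (x j) ?R) \<cdot> del a (x i) (x j \<^bold>+ ?R)) \<cdot> idn a \<boxtimes> (gam (x j) (x i) \<boxplus> idn ?R) \<cdot> idn a \<boxtimes> (idn (x j) \<boxplus> pull x i js)"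
    proof -
      have "?i \<boxplus> (?j \<boxplus> ?D) \<cdot> del a (x j) ?R = (?i \<boxplus> ?j \<boxplus> ?D) \<cdot> (?i \<boxplus> del a (x j) ?R)" by (simp add: sum_cmp)
      moreover have "idn a \<boxtimes> ((gam (x j) (x i) \<boxplus> idn ?R) \<cdot> (idn (x j) \<boxplus> pull x i js)) =
         idn a \<boxtimes> (gam (x j) (x i) \<boxplus> idn ?R) \<cdot> idn a \<boxtimes> (idn (x j) \<boxplus> pull x i js)" by (simp add: prod_cmp)
      ultimately show ?thesis by (simp add: cmp_assoc)
    qed
    also have "(?i \<boxplus> del a (x j) ?R) \<cdot> del a (x i) (x j \<^bold>+ ?R) = (del a (x i) (x j) \<boxplus> idn (a \<^bold>* ?R)) \<cdot> del a (x i \<^bold>+ x j) ?R"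
      by (simp add: del_sum)
    also have "(?i \<boxplus> ?j \<boxplus> ?D) \<cdot> \<dots> \<cdot> idn a \<boxtimes> (gam (x j) (x i) \<boxplus> idn ?R) \<cdot> idn a \<boxtimes> (idn (x j) \<boxplus> pull x i js)
      = (?i \<boxplus> ?j \<boxplus> ?D) \<cdot> (del a (x i) (x j) \<boxplus> idn (a \<^bold>* ?R)) \<cdot> (del a (x i \<^bold>+ x j) ?R \<cdot> idn a \<boxtimes> (gam (x j) (x i) \<boxplus> idn ?R)) \<cdot> idn a \<boxtimes> (idn (x j) \<boxplus> pull x i js)"
      by (simp add: cmp_assoc)
    also have "\<dots> = (?i \<boxplus> ?j \<boxplus> ?D) \<cdot> ((del a (x i) (x j) \<boxplus> idn (a \<^bold>* ?R)) \<cdot> (idn a \<boxtimes> gam (x j) (x i) \<boxplus> idn (a \<^bold>* ?R)))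
         \<cdot> del a (x j \<^bold>+ x i) ?R \<cdot> idn a \<boxtimes> (idn (x j) \<boxplus> pull x i js)"
      by (simp only: n1) (simp add: cmp_assoc)
    also have "(del a (x i) (x j) \<boxplus> idn (a \<^bold>* ?R)) \<cdot> (idn a \<boxtimes> gam (x j) (x i) \<boxplus> idn (a \<^bold>* ?R))
       = (gam (a \<^bold>* x j) (a \<^bold>* x i) \<boxplus> idn (a \<^bold>* ?R)) \<cdot> (del a (x j) (x i) \<boxplus> idn (a \<^bold>* ?R))"
      by (simp add: sum_cmp del_gam)
    also have "(?i \<boxplus> ?j \<boxplus> ?D) \<cdot> \<dots> \<cdot> del a (x j \<^bold>+ x i) ?R \<cdot> idn a \<boxtimes> (idn (x j) \<boxplus> pull x i js)
      = ((?i \<boxplus> ?j \<boxplus> ?D) \<cdot> (gam (a \<^bold>* x j) (a \<^bold>* x i) \<boxplus> idn (a \<^bold>* ?R))) \<cdot> ((del a (x j) (x i) \<boxplus> idn (a \<^bold>* ?R)) \<cdot> del a (x j \<^bold>+ x i) ?R) \<cdot> idn a \<boxtimes> (idn (x j) \<boxplus> pull x i js)"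
      by (simp add: cmp_assoc)
    also have "(?i \<boxplus> ?j \<boxplus> ?D) \<cdot> (gam (a \<^bold>* x j) (a \<^bold>* x i) \<boxplus> idn (a \<^bold>* ?R)) = (gam (a \<^bold>* x j) (a \<^bold>* x i) \<boxplus> idn ?R') \<cdot> (?j \<boxplus> ?i \<boxplus> ?D)"
      by (simp add: sum_cmp flip: idn_sum sum_assoc_ar)
    also have "(del a (x j) (x i) \<boxplus> idn (a \<^bold>* ?R)) \<cdot> del a (x j \<^bold>+ x i) ?R = (?j \<boxplus> del a (x i) ?R) \<cdot> del a (x j) (x i \<^bold>+ ?R)"
      by (simp add: del_sum)
    also have "((gam (a \<^bold>* x j) (a \<^bold>* x i) \<boxplus> idn ?R') \<cdot> (?j \<boxplus> ?i \<boxplus> ?D)) \<cdot> \<dots> \<cdot> idn a \<boxtimes> (idn (x j) \<boxplus> pull x i js)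
       = (gam (a \<^bold>* x j) (a \<^bold>* x i) \<boxplus> idn ?R') \<cdot> (?j \<boxplus> ?i \<boxplus> ?D) \<cdot> (?j \<boxplus> del a (x i) ?R) \<cdot> (del a (x j) (x i \<^bold>+ ?R) \<cdot> idn a \<boxtimes> (idn (x j) \<boxplus> pull x i js))"
      by (simp add: cmp_assoc)
    also have "\<dots> = (gam (a \<^bold>* x j) (a \<^bold>* x i) \<boxplus> idn ?R') \<cdot> ((?j \<boxplus> ?i \<boxplus> ?D) \<cdot> (?j \<boxplus> del a (x i) ?R) \<cdot> (?j \<boxplus> idn a \<boxtimes> pull x i js)) \<cdot> del a (x j) (Tot (map x js))"
      by (simp only: n2) (simp add: cmp_assoc)
    also have "(?j \<boxplus> ?i \<boxplus> ?D) \<cdot> (?j \<boxplus> del a (x i) ?R) \<cdot> (?j \<boxplus> idn a \<boxtimes> pull x i js) = ?j \<boxplus> ((?i \<boxplus> ?D) \<cdot> del a (x i) ?R \<cdot> idn a \<boxtimes> pull x i js)"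
      by (simp add: sum_cmp)
    also have "\<dots> = (?j \<boxplus> pull (\<lambda>j. a \<^bold>* x j) i js) \<cdot> (?j \<boxplus> distr a (map x js))"
      using Cons.IH by (simp add: sum_cmp)
    finally show ?thesis by (simp add: cmp_assoc)
  qed
qed simp

text \<open>
  Distributivity commutes with every rearrangement of terms, since it commutes with pulling out
  one term.
\<close>

lemma distr_can:
  assumes [simp]: "a \<in> Ob" "\<And>i. x i \<in> Ob" and "mset is = mset js"
  shows "distr a (map x js) \<cdot> idn a \<boxtimes> can x is js = can (\<lambda>i. a \<^bold>* x i) is js \<cdot> distr a (map x is)"
  using assms(3)
proof (induction js arbitrary: "is")
  case (Cons j js)
  note [simp] = comp_def
  from remove1_mset[OF Cons.prems] have m [simp]: "j \<in> set is" "mset (remove1 j is) = mset js" by auto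
  have [simp]: "mset is - {#j#} = mset js" using m by simp
  let ?j = "idn (a \<^bold>* x j)" and ?r = "remove1 j is"
  let ?c = "can x ?r js" and ?c' = "can (\<lambda>i. a \<^bold>* x i) ?r js"
  have n: "del a (x j) (Tot (map x js)) \<cdot> idn a \<boxtimes> (idn (x j) \<boxplus> ?c) = (?j \<boxplus> idn a \<boxtimes> ?c) \<cdot> del a (x j) (Tot (map x ?r))"
    using del_natural[of "idn a" "idn (x j)" ?c] by (simp add: idn_prod)
  have p: "idn a \<boxtimes> ((idn (x j) \<boxplus> ?c) \<cdot> pull x j is) = idn a \<boxtimes> (idn (x j) \<boxplus> ?c) \<cdot> idn a \<boxtimes> pull x j is"
    by (simp add: prod_cmp)
  have "distr a (map x (j # js)) \<cdot> idn a \<boxtimes> can x is (j # js) =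
    (?j \<boxplus> distr a (map x js)) \<cdot> (del a (x j) (Tot (map x js)) \<cdot> idn a \<boxtimes> (idn (x j) \<boxplus> ?c)) \<cdot> idn a \<boxtimes> pull x j is"
    by (simp add: p cmp_assoc)
  also have "\<dots> = ((?j \<boxplus> distr a (map x js)) \<cdot> (?j \<boxplus> idn a \<boxtimes> ?c)) \<cdot> del a (x j) (Tot (map x ?r)) \<cdot> idn a \<boxtimes> pull x j is"
    by (simp only: n) (simp add: cmp_assoc)
  also have "(?j \<boxplus> distr a (map x js)) \<cdot> (?j \<boxplus> idn a \<boxtimes> ?c) = (?j \<boxplus> ?c') \<cdot> (?j \<boxplus> distr a (map x ?r))"
    using Cons.IH[of ?r] by (simp add: sum_cmp)
  also have "\<dots> \<cdot> del a (x j) (Tot (map x ?r)) \<cdot> idn a \<boxtimes> pull x j is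
    = (?j \<boxplus> ?c') \<cdot> ((?j \<boxplus> distr a (map x ?r)) \<cdot> del a (x j) (Tot (map x ?r)) \<cdot> idn a \<boxtimes> pull x j is)"
    by (simp add: cmp_assoc)
  also have "\<dots> = can (\<lambda>i. a \<^bold>* x i) is (j # js) \<cdot> distr a (map x is)"
    by (subst distr_pull) (simp_all add: cmp_assoc)
  finally show ?case .
qed simp

lemma merge_prod:
  assumes [simp]: "\<And>k. f k \<in> Ob" "\<And>k. g k \<in> Ob" "c \<in> Ob"
  shows "merge (map f ks) (map g ks) \<boxtimes> idn c = merge (map (\<lambda>k. f k \<^bold>* c) ks) (map (\<lambda>k. g k \<^bold>* c) ks)"
proof (induction ks)
  case (Cons k ks)
  note [simp] = comp_def
  let ?A = "idn (f k \<^bold>+ g k) \<boxplus> merge (map f ks) (map g ks)"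
  let ?B = "(idn (f k) \<boxplus> gam (Tot (map f ks)) (g k)) \<boxplus> idn (Tot (map g ks))"
  have "(?A \<cdot> ?B) \<boxtimes> idn c = ?A \<boxtimes> idn c \<cdot> ?B \<boxtimes> idn c" by (subst prod_cmp) simp_all
  moreover have "?A \<boxtimes> idn c = idn (f k \<^bold>* c \<^bold>+ g k \<^bold>* c) \<boxplus> merge (map (\<lambda>k. f k \<^bold>* c) ks) (map (\<lambda>k. g k \<^bold>* c) ks)"
    by (simp add: Cons idn_sum idn_prod)
  moreover have "?B \<boxtimes> idn c = (idn (f k \<^bold>* c) \<boxplus> gam (Tot (map f ks) \<^bold>* c) (g k \<^bold>* c)) \<boxplus> idn (Tot (map g ks) \<^bold>* c)"
    by (simp add: gam_prod idn_prod del: Tot_prod)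
  ultimately show ?case by simp
qed simp

lemma interchange_prod:
  assumes [simp]: "\<And>j k. x j k \<in> Ob" "c \<in> Ob"
  shows "interchange x js ks \<boxtimes> idn c = interchange (\<lambda>j k. x j k \<^bold>* c) js ks"
proof (induction js)
  case (Cons j js)
  note [simp] = comp_def
  let ?A = "merge (map (x j) ks) (map (\<lambda>k. Tot (map (\<lambda>j. x j k) js)) ks)"
  let ?B = "idn (Tot (map (x j) ks)) \<boxplus> interchange x js ks"
  have "(?A \<cdot> ?B) \<boxtimes> idn c = ?A \<boxtimes> idn c \<cdot> ?B \<boxtimes> idn c" by (subst prod_cmp) simp_all
  moreover have "?B \<boxtimes> idn c = idn (Tot (map (x j) ks) \<^bold>* c) \<boxplus> interchange (\<lambda>j k. x j k \<^bold>* c) js ks"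
    by (simp add: Cons idn_prod del: Tot_prod)
  ultimately show ?case by (simp add: merge_prod)
qed simp

text \<open>
  Both sides distribute \<open>a\<close> over a double sum. Reading the double sum as a single sum over pairs,
  by \<open>distr_concat\<close>, turns the interchange into a rearrangement, to which \<open>distr_can\<close> applies.
\<close>

lemma distr_interchange:
  assumes [simp]: "a \<in> Ob" "\<And>j k. x j k \<in> Ob" "distinct js"
  shows "Tot_ar (map (\<lambda>k. distr a (map (\<lambda>j. x j k) js)) ks) \<cdot> distr a (map (\<lambda>k. Tot (map (\<lambda>j. x j k) js)) ks)
      \<cdot> idn a \<boxtimes> interchange x js ks
    = interchange (\<lambda>j k. a \<^bold>* x j k) js ks
      \<cdot> Tot_ar (map (\<lambda>j. distr a (map (x j) ks)) js) \<cdot> distr a (map (\<lambda>j. Tot (map (x j) ks)) js)"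
proof -
  note [simp] = comp_def
  define y where "y = (\<lambda>(j, k). x j k)"
  have y [simp]: "y i \<in> Ob" for i by (cases i) (simp add: y_def)
  let ?r = "concat (map (\<lambda>j. concat (map (\<lambda>k. [(j, k)]) ks)) js)"
  let ?c = "concat (map (\<lambda>k. concat (map (\<lambda>j. [(j, k)]) js)) ks)"
  have m: "mset ?r = mset ?c" by (rule mset_interchange)
  have s: "concat (map (\<lambda>p. [f p]) as) = map f as" for f :: "'y \<Rightarrow> 'z" and as
    by (induction as) auto
  have r: "map y ?r = concat (map (\<lambda>j. map (x j) ks) js)"
    by (simp add: map_concat s y_def)
  have c: "map y ?c = concat (map (\<lambda>k. map (\<lambda>j. x j k) js) ks)"
    by (simp add: map_concat s y_def)
  have 1: "interchange (\<lambda>j k. x j k) js ks = can y ?r ?c"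
    using interchange_eq_can[of y js "\<lambda>j k. [(j, k)]" ks] by (simp add: y_def split: prod.splits)
  have 2: "interchange (\<lambda>j k. a \<^bold>* x j k) js ks = can (\<lambda>i. a \<^bold>* y i) ?r ?c"
    using interchange_eq_can[of "\<lambda>i. a \<^bold>* y i" js "\<lambda>j k. [(j, k)]" ks] by (simp add: y_def split: prod.splits)
  have 3: "distr a (map y ?c) \<cdot> idn a \<boxtimes> can y ?r ?c = can (\<lambda>i. a \<^bold>* y i) ?r ?c \<cdot> distr a (map y ?r)"
    by (rule distr_can) (use m in auto)
  have 4: "distr a (map y ?c) = Tot_ar (map (\<lambda>k. distr a (map (\<lambda>j. x j k) js)) ks) \<cdot> distr a (map (\<lambda>k. Tot (map (\<lambda>j. x j k) js)) ks)"
    unfolding c by (rule distr_concat) auto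
  have 5: "distr a (map y ?r) = Tot_ar (map (\<lambda>j. distr a (map (x j) ks)) js) \<cdot> distr a (map (\<lambda>j. Tot (map (x j) ks)) js)"
    unfolding r by (rule distr_concat) auto
  show ?thesis
    using 3 unfolding 4 5 1[symmetric] 2[symmetric] by (simp add: cmp_assoc)
qed

text \<open>
  The pentagon, entry by entry. On either side all distributivities move to the right, where they
  combine to the same expansion \<open>?K p\<close> of \<open>J p * (\<Sum>q. H p q * (\<Sum>r. G q r * F r))\<close>; for the left
  side this uses \<open>distr_Tot_left\<close> and naturality of the interchange, for the right side
  \<open>distr_interchange\<close>. What remains in front of them are the two composites of interchanges that
  are equal by \<open>interchange_triple\<close>.
\<close>

theorem assoc_entry_pentagon:
  assumes [simp]: "\<And>p. J p \<in> Ob" "\<And>p q. H p q \<in> Ob" "\<And>q r. G q r \<in> Ob" "\<And>r. F r \<in> Ob"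
    and d [simp]: "distinct ps" "distinct qs" "distinct rs"
  shows "assoc_entry (\<lambda>q. Tot (map (\<lambda>p. J p \<^bold>* H p q) ps)) G F qs rs
      \<cdot> assoc_entry J H (\<lambda>q. Tot (map (\<lambda>r. G q r \<^bold>* F r) rs)) ps qs
    = Tot_ar (map (\<lambda>r. assoc_entry J H (\<lambda>q. G q r) ps qs \<boxtimes> idn (F r)) rs)
      \<cdot> assoc_entry J (\<lambda>p r. Tot (map (\<lambda>q. H p q \<^bold>* G q r) qs)) F ps rs
      \<cdot> Tot_ar (map (\<lambda>p. idn (J p) \<boxtimes> assoc_entry (H p) G F qs rs) ps)"
proof -
  note [simp] = comp_def
  let ?b = "\<lambda>q r. G q r \<^bold>* F r" and ?h = "\<lambda>p q r. H p q \<^bold>* G q r \<^bold>* F r"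
  let ?t = "\<lambda>p q r. J p \<^bold>* H p q \<^bold>* G q r \<^bold>* F r"
  \<comment> \<open>Partial expansions of \<open>J * H * (G * F)\<close>: \<open>E\<close> distributes \<open>H\<close> over \<open>r\<close>, \<open>X\<close> and \<open>Y\<close> distribute
    \<open>J\<close> over the innermost sum over \<open>r\<close> or \<open>q\<close>, and \<open>B\<close>, \<open>C\<close>, \<open>D\<close> distribute \<open>J\<close> over an outer
    sum.\<close>
  define E where "E p q = distr (H p q) (map (?b q) rs)" for p q
  define X where "X p q = distr (J p) (map (?h p q) rs)" for p q
  define Y where "Y p r = distr (J p) (map (\<lambda>q. ?h p q r) qs)" for p r
  define B where "B p = distr (J p) (map (\<lambda>q. Tot (map (?h p q) rs)) qs)" for p
  define C where "C p = distr (J p) (map (\<lambda>r. Tot (map (\<lambda>q. ?h p q r) qs)) rs)" for p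
  define D where "D p = distr (J p) (map (\<lambda>q. H p q \<^bold>* Tot (map (?b q) rs)) qs)" for p
  have E [simp]: "E p q \<in> Ar" "dom (E p q) = H p q \<^bold>* Tot (map (?b q) rs)" "cod (E p q) = Tot (map (?h p q) rs)" for p q
    by (simp_all add: E_def)
  have X [simp]: "X p q \<in> Ar" "dom (X p q) = J p \<^bold>* Tot (map (?h p q) rs)" "cod (X p q) = Tot (map (?t p q) rs)" for p q
    by (simp_all add: X_def)
  have Y [simp]: "Y p q \<in> Ar" "dom (Y p r) = J p \<^bold>* Tot (map (\<lambda>q. ?h p q r) qs)" "cod (Y p r) = Tot (map (\<lambda>q. ?t p q r) qs)" for p q r
    by (simp_all add: Y_def)
  have B [simp]: "B p \<in> Ar" "dom (B p) = J p \<^bold>* Tot (map (\<lambda>q. Tot (map (?h p q) rs)) qs)"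
    "cod (B p) = Tot (map (\<lambda>q. J p \<^bold>* Tot (map (?h p q) rs)) qs)" for p
    by (simp_all add: B_def)
  have C [simp]: "C p \<in> Ar" "dom (C p) = J p \<^bold>* Tot (map (\<lambda>r. Tot (map (\<lambda>q. ?h p q r) qs)) rs)"
    "cod (C p) = Tot (map (\<lambda>r. J p \<^bold>* Tot (map (\<lambda>q. ?h p q r) qs)) rs)" for p
    by (simp_all add: C_def)
  have D [simp]: "D p \<in> Ar" "dom (D p) = J p \<^bold>* Tot (map (\<lambda>q. H p q \<^bold>* Tot (map (?b q) rs)) qs)"
    "cod (D p) = Tot (map (\<lambda>q. J p \<^bold>* H p q \<^bold>* Tot (map (?b q) rs)) qs)" for p
    by (simp_all add: D_def)
  let ?\<tau>pq = "\<lambda>r. interchange (\<lambda>p q. ?t p q r) ps qs"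
  let ?\<tau>pr = "\<lambda>q. interchange (\<lambda>p r. ?t p q r) ps rs"
  let ?\<tau>qr = "\<lambda>p. interchange (\<lambda>q r. ?t p q r) qs rs"
  let ?K = "\<lambda>p. Tot_ar (map (X p) qs) \<cdot> B p \<cdot> idn (J p) \<boxtimes> Tot_ar (map (E p) qs)"
  have JE: "distr (J p \<^bold>* H p q) (map (?b q) rs) = X p q \<cdot> idn (J p) \<boxtimes> E p q" for p q
    by (simp add: distr_prod_left X_def E_def)
  have DE: "Tot_ar (map (\<lambda>q. idn (J p) \<boxtimes> E p q) qs) \<cdot> D p = B p \<cdot> idn (J p) \<boxtimes> Tot_ar (map (E p) qs)" for p
    using distr_natural[of "idn (J p)" "E p" qs] by (simp add: B_def D_def)
  have K: "Tot_ar (map (\<lambda>q. X p q \<cdot> idn (J p) \<boxtimes> E p q) qs) \<cdot> D p = ?K p" for p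
  proof -
    have "Tot_ar (map (\<lambda>q. X p q \<cdot> idn (J p) \<boxtimes> E p q) qs) = Tot_ar (map (X p) qs) \<cdot> Tot_ar (map (\<lambda>q. idn (J p) \<boxtimes> E p q) qs)"
      by (rule Tot_ar_cmp[symmetric]) simp_all
    then show ?thesis by (simp add: cmp_assoc DE)
  qed
  have L1: "assoc_entry (\<lambda>q. Tot (map (\<lambda>p. J p \<^bold>* H p q) ps)) G F qs rs
    = interchange (\<lambda>q r. Tot (map (\<lambda>p. ?t p q r) ps)) qs rs \<cdot> Tot_ar (map ?\<tau>pr qs)
      \<cdot> Tot_ar (map (\<lambda>q. Tot_ar (map (\<lambda>p. X p q \<cdot> idn (J p) \<boxtimes> E p q) ps)) qs)"
  proof -
    have "distr (Tot (map (\<lambda>p. J p \<^bold>* H p q) ps)) (map (?b q) rs) =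
      ?\<tau>pr q \<cdot> Tot_ar (map (\<lambda>p. X p q \<cdot> idn (J p) \<boxtimes> E p q) ps)" for q
      by (simp add: distr_Tot_left JE)
    moreover have "Tot_ar (map (\<lambda>q. ?\<tau>pr q \<cdot> Tot_ar (map (\<lambda>p. X p q \<cdot> idn (J p) \<boxtimes> E p q) ps)) qs)
      = Tot_ar (map ?\<tau>pr qs) \<cdot> Tot_ar (map (\<lambda>q. Tot_ar (map (\<lambda>p. X p q \<cdot> idn (J p) \<boxtimes> E p q) ps)) qs)"
      by (rule Tot_ar_cmp[symmetric]) simp_all
    ultimately show ?thesis by (simp add: assoc_entry_def)
  qed
  have L2: "assoc_entry J H (\<lambda>q. Tot (map (\<lambda>r. G q r \<^bold>* F r) rs)) ps qs
    = interchange (\<lambda>p q. J p \<^bold>* H p q \<^bold>* Tot (map (?b q) rs)) ps qs \<cdot> Tot_ar (map D ps)"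
    by (simp add: assoc_entry_def D_def[abs_def])
  have L3: "Tot_ar (map (\<lambda>q. Tot_ar (map (\<lambda>p. X p q \<cdot> idn (J p) \<boxtimes> E p q) ps)) qs) \<cdot> interchange (\<lambda>p q. J p \<^bold>* H p q \<^bold>* Tot (map (?b q) rs)) ps qs
     = interchange (\<lambda>p q. Tot (map (?t p q) rs)) ps qs \<cdot> Tot_ar (map (\<lambda>p. Tot_ar (map (\<lambda>q. X p q \<cdot> idn (J p) \<boxtimes> E p q) qs)) ps)"
    using interchange_natural[of "\<lambda>p q. X p q \<cdot> idn (J p) \<boxtimes> E p q" ps qs] by simp
  have L4: "Tot_ar (map (\<lambda>p. Tot_ar (map (\<lambda>q. X p q \<cdot> idn (J p) \<boxtimes> E p q) qs)) ps) \<cdot> Tot_ar (map D ps) = Tot_ar (map ?K ps)"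
    by (subst Tot_ar_cmp) (simp_all add: K)
  have R1: "Tot_ar (map (\<lambda>r. assoc_entry J H (\<lambda>q. G q r) ps qs \<boxtimes> idn (F r)) rs)
    = Tot_ar (map ?\<tau>pq rs) \<cdot> Tot_ar (map (\<lambda>r. Tot_ar (map (\<lambda>p. Y p r) ps)) rs)"
  proof -
    have "assoc_entry J H (\<lambda>q. G q r) ps qs \<boxtimes> idn (F r) =
      interchange (\<lambda>p q. (J p \<^bold>* H p q) \<^bold>* G q r) ps qs \<boxtimes> idn (F r) \<cdot>
      Tot_ar (map (\<lambda>p. distr (J p) (map (\<lambda>q. H p q \<^bold>* G q r) qs)) ps) \<boxtimes> idn (F r)" for r
      unfolding assoc_entry_def by (subst prod_cmp) simp_all
    then have "assoc_entry J H (\<lambda>q. G q r) ps qs \<boxtimes> idn (F r) = ?\<tau>pq r \<cdot> Tot_ar (map (\<lambda>p. Y p r) ps)" for r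
      by (simp add: interchange_prod distr_prod_right Y_def)
    then show ?thesis by (simp add: Tot_ar_cmp)
  qed
  have R2: "assoc_entry J (\<lambda>p r. Tot (map (\<lambda>q. H p q \<^bold>* G q r) qs)) F ps rs
     = interchange (\<lambda>p r. J p \<^bold>* Tot (map (\<lambda>q. ?h p q r) qs)) ps rs \<cdot> Tot_ar (map C ps)"
    by (simp add: assoc_entry_def C_def[abs_def])
  have R3: "Tot_ar (map (\<lambda>r. Tot_ar (map (\<lambda>p. Y p r) ps)) rs) \<cdot> interchange (\<lambda>p r. J p \<^bold>* Tot (map (\<lambda>q. ?h p q r) qs)) ps rs
     = interchange (\<lambda>p r. Tot (map (\<lambda>q. ?t p q r) qs)) ps rs \<cdot> Tot_ar (map (\<lambda>p. Tot_ar (map (Y p) rs)) ps)"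
    using interchange_natural[of Y ps rs] by simp
  have R4: "Tot_ar (map (\<lambda>p. Tot_ar (map (Y p) rs)) ps) \<cdot> Tot_ar (map C ps)
      \<cdot> Tot_ar (map (\<lambda>p. idn (J p) \<boxtimes> assoc_entry (H p) G F qs rs) ps)
    = Tot_ar (map ?\<tau>qr ps) \<cdot> Tot_ar (map ?K ps)"
  proof -
    have "Tot_ar (map (Y p) rs) \<cdot> C p \<cdot> idn (J p) \<boxtimes> assoc_entry (H p) G F qs rs = ?\<tau>qr p \<cdot> ?K p" for p
    proof -
      have "idn (J p) \<boxtimes> assoc_entry (H p) G F qs rs = idn (J p) \<boxtimes> interchange (?h p) qs rs \<cdot> idn (J p) \<boxtimes> Tot_ar (map (E p) qs)"
        by (subst prod_cmp) (simp_all add: assoc_entry_def E_def[abs_def])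
      moreover have "Tot_ar (map (Y p) rs) \<cdot> C p \<cdot> idn (J p) \<boxtimes> interchange (?h p) qs rs = ?\<tau>qr p \<cdot> Tot_ar (map (X p) qs) \<cdot> B p"
        using distr_interchange[of "J p" "?h p" qs rs] by (simp add: Y_def[abs_def] C_def X_def[abs_def] B_def)
      then have "(Tot_ar (map (Y p) rs) \<cdot> C p \<cdot> idn (J p) \<boxtimes> interchange (?h p) qs rs) \<cdot> idn (J p) \<boxtimes> Tot_ar (map (E p) qs)
         = (?\<tau>qr p \<cdot> Tot_ar (map (X p) qs) \<cdot> B p) \<cdot> idn (J p) \<boxtimes> Tot_ar (map (E p) qs)" by (rule arg_cong)
      ultimately show ?thesis by (simp add: cmp_assoc)
    qed
    then show ?thesis by (simp add: Tot_ar_cmp)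
  qed
  let ?I1 = "interchange (\<lambda>q r. Tot (map (\<lambda>p. ?t p q r) ps)) qs rs"
  let ?I2 = "interchange (\<lambda>p q. Tot (map (?t p q) rs)) ps qs"
  let ?I3 = "interchange (\<lambda>p r. Tot (map (\<lambda>q. ?t p q r) qs)) ps rs"
  let ?XE = "\<lambda>p q. X p q \<cdot> idn (J p) \<boxtimes> E p q"
  have "assoc_entry (\<lambda>q. Tot (map (\<lambda>p. J p \<^bold>* H p q) ps)) G F qs rs
      \<cdot> assoc_entry J H (\<lambda>q. Tot (map (\<lambda>r. G q r \<^bold>* F r) rs)) ps qs
    = ?I1 \<cdot> Tot_ar (map ?\<tau>pr qs) \<cdot> (Tot_ar (map (\<lambda>q. Tot_ar (map (\<lambda>p. ?XE p q) ps)) qs)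
      \<cdot> interchange (\<lambda>p q. J p \<^bold>* H p q \<^bold>* Tot (map (?b q) rs)) ps qs) \<cdot> Tot_ar (map D ps)"
    unfolding L1 L2 by (simp add: cmp_assoc)
  also have "\<dots> = ?I1 \<cdot> Tot_ar (map ?\<tau>pr qs) \<cdot> ?I2 \<cdot> (Tot_ar (map (\<lambda>p. Tot_ar (map (?XE p) qs)) ps) \<cdot> Tot_ar (map D ps))"
    unfolding L3 by (simp add: cmp_assoc)
  also have "\<dots> = (?I1 \<cdot> Tot_ar (map ?\<tau>pr qs) \<cdot> ?I2) \<cdot> Tot_ar (map ?K ps)"
    unfolding L4 by (simp add: cmp_assoc)
  also have "?I1 \<cdot> Tot_ar (map ?\<tau>pr qs) \<cdot> ?I2 = Tot_ar (map ?\<tau>pq rs) \<cdot> ?I3 \<cdot> Tot_ar (map ?\<tau>qr ps)"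
    by (rule interchange_triple) simp_all
  also have "\<dots> \<cdot> Tot_ar (map ?K ps) = Tot_ar (map ?\<tau>pq rs) \<cdot> ?I3 \<cdot> (Tot_ar (map ?\<tau>qr ps) \<cdot> Tot_ar (map ?K ps))"
    by (simp add: cmp_assoc)
  also have "\<dots> = Tot_ar (map ?\<tau>pq rs) \<cdot> (?I3 \<cdot> Tot_ar (map (\<lambda>p. Tot_ar (map (Y p) rs)) ps)) \<cdot> Tot_ar (map C ps)
      \<cdot> Tot_ar (map (\<lambda>p. idn (J p) \<boxtimes> assoc_entry (H p) G F qs rs) ps)"
    unfolding R4[symmetric] by (simp add: cmp_assoc)
  also have "\<dots> = Tot_ar (map (\<lambda>r. assoc_entry J H (\<lambda>q. G q r) ps qs \<boxtimes> idn (F r)) rs)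
      \<cdot> assoc_entry J (\<lambda>p r. Tot (map (\<lambda>q. H p q \<^bold>* G q r) qs)) F ps rs
      \<cdot> Tot_ar (map (\<lambda>p. idn (J p) \<boxtimes> assoc_entry (H p) G F qs rs) ps)"
    unfolding R3[symmetric] R1 R2 by (simp add: cmp_assoc)
  finally show ?thesis .
qed

end

end

section \<open>Zero terms, and associativity isomorphisms that are identities\<close>

lemma concat_map_filter2:
  assumes z: "\<And>j k. \<not> (P j \<and> Q k) \<Longrightarrow> f j k = []"
  shows "concat (map (\<lambda>j. concat (map (f j) ks)) js) = concat (map (\<lambda>j. concat (map (f j) (filter Q ks))) (filter P js))"
proof (induction js)
  case (Cons j js)
  have "concat (map (f j) ks) = (if P j then concat (map (f j) (filter Q ks)) else [])"
    using z by (induction ks) auto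
  with Cons show ?case by simp
qed simp

context sum_category
begin

context
  notes image_subset_iff [simp]
begin

lemma Tot_filter:
  "(\<And>i. a i \<in> Ob) \<Longrightarrow> (\<And>i. \<not> P i \<Longrightarrow> a i = zero) \<Longrightarrow> Tot (map a is) = Tot (map a (filter P is))"
  by (induction "is") auto

lemma Tot_ar_filter:
  "(\<And>i. f i \<in> Ar) \<Longrightarrow> (\<And>i. \<not> P i \<Longrightarrow> f i = idn zero) \<Longrightarrow> Tot_ar (map f is) = Tot_ar (map f (filter P is))"
  by (induction "is") auto

end

lemma interchange_cong:
  "(\<And>j k. j \<in> set js \<Longrightarrow> k \<in> set ks \<Longrightarrow> x j k = y j k) \<Longrightarrow> interchange x js ks = interchange y js ks"
proof (induction js)
  case (Cons j js)
  have "map (x j) ks = map (y j) ks" "map (\<lambda>k. Tot (map (\<lambda>j. x j k) js)) ks = map (\<lambda>k. Tot (map (\<lambda>j. y j k) js)) ks"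
    using Cons.prems by (auto intro!: arg_cong[of _ _ Tot])
  moreover have "interchange x js ks = interchange y js ks" using Cons by auto
  ultimately show ?case by (simp only: interchange.simps)
qed simp

lemma interchange_map:
  "interchange x (map f js) (map g ks) = interchange (\<lambda>j k. x (f j) (g k)) js ks"
  by (induction js) (auto simp: comp_def)

end

context bimonoidal_coherence
begin

context
  notes image_subset_iff [simp]
begin

text \<open>
  A zero term is the sum over the empty word. If only the remaining terms are labelled, both sides
  are the canonical isomorphism between the same two words.
\<close>

lemma interchange_filter:
  assumes [simp]: "\<And>j k. x j k \<in> Ob" "distinct js"
    and z: "\<And>j k. \<not> (P j \<and> Q k) \<Longrightarrow> x j k = zero"
  shows "interchange x js ks = interchange x (filter P js) (filter Q ks)"
proof -
  define y where "y = (\<lambda>(j, k). x j k)"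
  have y [simp]: "y i \<in> Ob" for i by (cases i) (simp add: y_def)
  let ?L = "\<lambda>j k. if P j \<and> Q k then [(j, k)] else []"
  have L: "x = (\<lambda>j k. Tot (map y (?L j k)))" using z by (auto simp: y_def fun_eq_iff)
  have d: "j \<noteq> j' \<Longrightarrow> set (?L j k) \<inter> set (?L j' k') = {}" for j j' k k' by auto
  have "interchange x js ks = can y (concat (map (\<lambda>j. concat (map (?L j) ks)) js)) (concat (map (\<lambda>k. concat (map (\<lambda>j. ?L j k) js)) ks))"
    by (subst L, rule interchange_eq_can) (use d in auto)
  also have "concat (map (\<lambda>j. concat (map (?L j) ks)) js) = concat (map (\<lambda>j. concat (map (?L j) (filter Q ks))) (filter P js))"
    by (rule concat_map_filter2) auto
  also have "concat (map (\<lambda>k. concat (map (\<lambda>j. ?L j k) js)) ks) = concat (map (\<lambda>k. concat (map (\<lambda>j. ?L j k) (filter P js))) (filter Q ks))"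
    by (rule concat_map_filter2) auto
  also have "can y (concat (map (\<lambda>j. concat (map (?L j) (filter Q ks))) (filter P js))) \<dots> = interchange x (filter P js) (filter Q ks)"
    by (subst L, rule interchange_eq_can[symmetric]) (use d in auto)
  finally show ?thesis .
qed

text \<open>
  The merge moves the terms \<open>g k\<close> past the terms \<open>f k'\<close> with \<open>k < k'\<close>; if one of the two is always
  zero, nothing moves.
\<close>

lemma merge_idn:
  fixes ks :: "'k::linorder list"
  assumes [simp]: "\<And>k. f k \<in> Ob" "\<And>k. g k \<in> Ob" and "sorted_wrt (<) ks"
    and z: "\<And>k k'. k < k' \<Longrightarrow> f k' = zero \<or> g k = zero"
  shows "merge (map f ks) (map g ks) = idn (Tot (map f ks) \<^bold>+ Tot (map g ks))"
  using assms(3)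
proof (induction ks)
  case (Cons k ks)
  have IH: "merge (map f ks) (map g ks) = idn (Tot (map f ks) \<^bold>+ Tot (map g ks))"
    using Cons by simp
  have "g k = zero \<or> Tot (map f ks) = zero"
    using z Cons.prems by (metis (no_types, lifting) Tot_zero image_subset_iff insertI1 list.set_map sorted_wrt.simps(2))
  then have "gam (Tot (map f ks)) (g k) = idn (Tot (map f ks) \<^bold>+ g k)"
    "g k \<^bold>+ Tot (map f ks) = Tot (map f ks) \<^bold>+ g k"
    "g k \<^bold>+ Tot (map f ks) \<^bold>+ Tot (map g ks) = Tot (map f ks) \<^bold>+ g k \<^bold>+ Tot (map g ks)"
    by (elim disjE, simp_all)+
  then show ?case by (simp add: IH flip: idn_sum)
qed simp

text \<open>
  The hypothesis says that no two nonzero terms form an inversion, that is, are met in opposite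
  orders by the two orders of summation.
\<close>

lemma interchange_idn:
  fixes js :: "'j::linorder list" and ks :: "'k::linorder list"
  assumes [simp]: "\<And>j k. x j k \<in> Ob" and s: "sorted_wrt (<) js" "sorted_wrt (<) ks"
    and z: "\<And>j j' k k'. j < j' \<Longrightarrow> k < k' \<Longrightarrow> x j k' = zero \<or> x j' k = zero"
  shows "interchange x js ks = idn (Tot (map (\<lambda>j. Tot (map (x j) ks)) js))"
  using s(1)
proof (induction js)
  case (Cons j js)
  have c: "Tot (map (\<lambda>k. Tot (map (\<lambda>j. x j k) js)) ks) = Tot (map (\<lambda>j. Tot (map (x j) ks)) js)"
    using Cons interchange_type(3)[of x js ks] by simp
  \<comment> \<open>Written as \<open>?z\<close>, the second row vanishes by definition wherever \<open>merge_idn\<close> asks it to.\<close>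
  let ?z = "\<lambda>k. if \<exists>k' > k. x j k' \<noteq> zero then zero else Tot (map (\<lambda>j. x j k) js)"
  have "x j' k = zero" if "j' \<in> set js" "k < k'" "x j k' \<noteq> zero" for j' k k'
    using z[of j j' k k'] that Cons.prems by auto
  then have "Tot (map (\<lambda>j. x j k) js) = ?z k" for k
    using Tot_zero[of "map (\<lambda>j. x j k) js"] by auto
  then have e: "?z = (\<lambda>k. Tot (map (\<lambda>j. x j k) js))" by (rule ext[OF sym])
  have "merge (map (x j) ks) (map ?z ks) = idn (Tot (map (x j) ks) \<^bold>+ Tot (map ?z ks))"
    by (rule merge_idn) (use s in auto)
  then have "merge (map (x j) ks) (map (\<lambda>k. Tot (map (\<lambda>j. x j k) js)) ks)
      = idn (Tot (map (x j) ks) \<^bold>+ Tot (map (\<lambda>j. Tot (map (x j) ks)) js))"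
    unfolding e c .
  then show ?case using Cons by (simp flip: idn_sum)
qed simp

lemma distr_zero [simp]: "set bs \<subseteq> Ob \<Longrightarrow> distr zero bs = idn zero"
  by (induction bs) auto

lemma distr_one [simp]: "set bs \<subseteq> Ob \<Longrightarrow> distr one bs = idn (Tot bs)"
  by (induction bs) (auto simp flip: idn_sum)

lemma distr_filter:
  assumes [simp]: "a \<in> Ob" "\<And>i. b i \<in> Ob" and z: "\<And>i. \<not> Q i \<Longrightarrow> b i = zero"
  shows "distr a (map b is) = distr a (map b (filter Q is))"
proof (induction "is")
  case (Cons i "is")
  have t: "Tot (map b is) = Tot (map b (filter Q is))" by (rule Tot_filter) (use z in auto)
  show ?case using z[of i] by (cases "Q i") (simp_all add: t Cons)
qed simp

text \<open>
  Distributing over a sum with at most one nonzero term is trivial by the compatibility of \<open>del\<close>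
  with \<open>zero\<close>.
\<close>

lemma distr_single:
  assumes [simp]: "a \<in> Ob" "\<And>i. b i \<in> Ob" and z: "\<And>i. i \<noteq> m \<Longrightarrow> b i = zero" and d: "distinct is"
  shows "distr a (map b is) = idn (a \<^bold>* Tot (map b is))"
proof -
  have f: "filter (\<lambda>i. i = m) is = [] \<or> filter (\<lambda>i. i = m) is = [m]"
    using d by (induction "is") (auto simp: filter_empty_conv)
  have "distr a (map b is) = distr a (map b (filter (\<lambda>i. i = m) is))" by (rule distr_filter) (use z in auto)
  moreover have "Tot (map b is) = Tot (map b (filter (\<lambda>i. i = m) is))" by (rule Tot_filter) (use z in auto)
  ultimately show ?thesis using f by auto
qed

text \<open>
  The first hypothesis on the entries makes every distributivity trivial, the second rules out
  inversions among the terms of the double sum.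
\<close>

lemma assoc_entry_idn:
  fixes ps :: "'p::linorder list" and qs :: "'q::linorder list"
  assumes [simp]: "\<And>p. u p \<in> Ob" "\<And>p q. v p q \<in> Ob" "\<And>q. w q \<in> Ob"
    and s: "sorted_wrt (<) ps" "sorted_wrt (<) qs"
    and d: "\<And>p. u p = zero \<or> u p = one \<or> (\<exists>q0. \<forall>q. q \<noteq> q0 \<longrightarrow> v p q \<^bold>* w q = zero)"
    and z: "\<And>p p' q q'. p < p' \<Longrightarrow> q < q' \<Longrightarrow> u p \<^bold>* v p q' \<^bold>* w q' = zero \<or> u p' \<^bold>* v p' q \<^bold>* w q = zero"
  shows "assoc_entry u v w ps qs = idn (Tot (map (\<lambda>p. u p \<^bold>* Tot (map (\<lambda>q. v p q \<^bold>* w q) qs)) ps))"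
proof -
  have dq: "distinct qs" using s(2) strict_sorted_iff by auto
  have D: "distr (u p) (map (\<lambda>q. v p q \<^bold>* w q) qs) = idn (u p \<^bold>* Tot (map (\<lambda>q. v p q \<^bold>* w q) qs))" for p
  proof -
    consider "u p = zero" | "u p = one" | q0 where "\<And>q. q \<noteq> q0 \<Longrightarrow> v p q \<^bold>* w q = zero" using d[of p] by blast
    then show ?thesis
    proof cases
      case 3
      then show ?thesis by (intro distr_single[where m = q0]) (use dq in auto)
    qed simp_all
  qed
  have c: "Tot (map (\<lambda>q. u p \<^bold>* v p q \<^bold>* w q) qs) = u p \<^bold>* Tot (map (\<lambda>q. v p q \<^bold>* w q) qs)" for p
    using arg_cong[where f = cod, OF D[of p]] by (simp add: comp_def)
  have "interchange (\<lambda>p q. (u p \<^bold>* v p q) \<^bold>* w q) ps qs = idn (Tot (map (\<lambda>p. Tot (map (\<lambda>q. (u p \<^bold>* v p q) \<^bold>* w q) qs)) ps))"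
    by (rule interchange_idn) (use s z in simp_all)
  then show ?thesis by (simp add: assoc_entry_def D c)
qed

text \<open>
  Restriction to the support: this is how an associativity isomorphism of block matrices is
  reduced to a block.
\<close>

lemma assoc_entry_filter:
  assumes [simp]: "\<And>p. u p \<in> Ob" "\<And>p q. v p q \<in> Ob" "\<And>q. w q \<in> Ob" "distinct ps"
    and P: "\<And>p. \<not> P p \<Longrightarrow> u p = zero" and Q: "\<And>p q. P p \<Longrightarrow> \<not> Q q \<Longrightarrow> v p q = zero"
  shows "assoc_entry u v w ps qs = assoc_entry u v w (filter P ps) (filter Q qs)"
proof -
  have z: "(u p \<^bold>* v p q) \<^bold>* w q = zero" if "\<not> (P p \<and> Q q)" for p q
    using that P Q by (cases "P p") auto
  have "interchange (\<lambda>p q. (u p \<^bold>* v p q) \<^bold>* w q) ps qs = interchange (\<lambda>p q. (u p \<^bold>* v p q) \<^bold>* w q) (filter P ps) (filter Q qs)"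
    by (rule interchange_filter) (use z in auto)
  moreover have "distr (u p) (map (\<lambda>q. v p q \<^bold>* w q) qs) = distr (u p) (map (\<lambda>q. v p q \<^bold>* w q) (filter Q qs))" for p
  proof (cases "P p")
    case True
    then show ?thesis by (intro distr_filter) (use Q in auto)
  qed (simp add: P)
  moreover have "Tot_ar (map (\<lambda>p. distr (u p) (map (\<lambda>q. v p q \<^bold>* w q) (filter Q qs))) ps)
     = Tot_ar (map (\<lambda>p. distr (u p) (map (\<lambda>q. v p q \<^bold>* w q) (filter Q qs))) (filter P ps))"
    by (rule Tot_ar_filter) (use P in auto)
  ultimately show ?thesis by (simp add: assoc_entry_def)
qed

lemma assoc_entry_map:
  "assoc_entry u v w (map f ps) (map g qs) = assoc_entry (\<lambda>p. u (f p)) (\<lambda>p q. v (f p) (g q)) (\<lambda>q. w (g q)) ps qs"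
  by (simp add: assoc_entry_def interchange_map comp_def)

end

end

section \<open>The ring completion of a semiring\<close>

text \<open>
  Evaluates an operation on equivalence classes that is given as a union over all representatives.
\<close>

lemma UN_const2:
  assumes "X \<noteq> {}" "Y \<noteq> {}" "\<And>p q. p \<in> X \<Longrightarrow> q \<in> Y \<Longrightarrow> f p q = K"
  shows "(\<Union>p\<in>X. \<Union>q\<in>Y. f p q) = K"
  using assms by auto

context semiring
begin

lemma equiv_gr_rel: "equiv (carrier R \<times> carrier R) (gr_rel R)"
proof (rule equivI)
  show "refl_on (carrier R \<times> carrier R) (gr_rel R)"
    unfolding refl_on_def gr_rel_def by auto
  show "gr_rel R \<subseteq> (carrier R \<times> carrier R) \<times> carrier R \<times> carrier R" by (auto simp: gr_rel_def)
  show "sym (gr_rel R)"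
    unfolding sym_def gr_rel_def by auto metis
  show "trans (gr_rel R)"
    unfolding trans_def
  proof (clarify)
    fix a b c d g h
    assume "((a, b), (c, d)) \<in> gr_rel R" "((c, d), (g, h)) \<in> gr_rel R"
    then obtain e e' where m [simp]: "a \<in> carrier R" "b \<in> carrier R" "c \<in> carrier R" "d \<in> carrier R"
      "g \<in> carrier R" "h \<in> carrier R" "e \<in> carrier R" "e' \<in> carrier R"
      and 1: "(a \<oplus> d) \<oplus> e = (c \<oplus> b) \<oplus> e" and 2: "(c \<oplus> h) \<oplus> e' = (g \<oplus> d) \<oplus> e'"
      unfolding gr_rel_def by auto
    let ?e = "(c \<oplus> d) \<oplus> (e \<oplus> e')"
    have "(a \<oplus> h) \<oplus> ?e = ((a \<oplus> d) \<oplus> e) \<oplus> ((c \<oplus> h) \<oplus> e')" by (simp add: a_ac)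
    also have "\<dots> = ((c \<oplus> b) \<oplus> e) \<oplus> ((g \<oplus> d) \<oplus> e')" by (simp only: 1 2)
    also have "\<dots> = (g \<oplus> b) \<oplus> ?e" by (simp add: a_ac)
    finally show "((a, b), (g, h)) \<in> gr_rel R"
      unfolding gr_rel_def by (auto intro!: bexI[of _ ?e])
  qed
qed

text \<open>
  The class of the formal difference \<open>a - b\<close>.
\<close>

definition diff_class :: "'a \<Rightarrow> 'a \<Rightarrow> ('a \<times> 'a) set" where
  "diff_class a b = gr_rel R `` {(a, b)}"

lemma diff_class_eqI:
  assumes "a \<in> carrier R" "b \<in> carrier R" "c \<in> carrier R" "d \<in> carrier R" "e \<in> carrier R"
    "(a \<oplus> d) \<oplus> e = (c \<oplus> b) \<oplus> e"
  shows "diff_class a b = diff_class c d"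
  unfolding diff_class_def
  by (rule equiv_class_eq[OF equiv_gr_rel]) (use assms in \<open>auto simp: gr_rel_def\<close>)

lemma diff_class_memD:
  assumes "p \<in> diff_class a b"
  obtains c d e where "p = (c, d)" "a \<in> carrier R" "b \<in> carrier R" "c \<in> carrier R" "d \<in> carrier R" "e \<in> carrier R"
    "(a \<oplus> d) \<oplus> e = (c \<oplus> b) \<oplus> e"
  using assms unfolding diff_class_def gr_rel_def by auto

lemma diff_class_self: "a \<in> carrier R \<Longrightarrow> b \<in> carrier R \<Longrightarrow> (a, b) \<in> diff_class a b"
  unfolding diff_class_def gr_rel_def by auto

lemma carrier_completionE:
  assumes "X \<in> carrier (ring_completion R)"
  obtains a b where "a \<in> carrier R" "b \<in> carrier R" "X = diff_class a b"
  using assms unfolding ring_completion_def diff_class_def by (auto elim!: quotientE)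

lemma diff_class_carrier:
  "a \<in> carrier R \<Longrightarrow> b \<in> carrier R \<Longrightarrow> diff_class a b \<in> carrier (ring_completion R)"
  unfolding ring_completion_def diff_class_def by (auto intro: quotientI)

lemma add_diff_class:
  assumes [simp]: "a \<in> carrier R" "b \<in> carrier R" "c \<in> carrier R" "d \<in> carrier R"
  shows "diff_class a b \<oplus>\<^bsub>ring_completion R\<^esub> diff_class c d = diff_class (a \<oplus> c) (b \<oplus> d)"
proof -
  have "(\<Union>p\<in>diff_class a b. \<Union>q\<in>diff_class c d. diff_class (fst p \<oplus> fst q) (snd p \<oplus> snd q))
     = diff_class (a \<oplus> c) (b \<oplus> d)"
  proof (rule UN_const2)
    show "diff_class a b \<noteq> {}" "diff_class c d \<noteq> {}" using diff_class_self[of a b] diff_class_self[of c d] by auto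
    fix p q assume "p \<in> diff_class a b" "q \<in> diff_class c d"
    then obtain a' b' e c' d' e' where p: "p = (a', b')" "q = (c', d')" and [simp]: "a' \<in> carrier R" "b' \<in> carrier R" "e \<in> carrier R"
      "c' \<in> carrier R" "d' \<in> carrier R" "e' \<in> carrier R"
      and e: "(a \<oplus> b') \<oplus> e = (a' \<oplus> b) \<oplus> e" "(c \<oplus> d') \<oplus> e' = (c' \<oplus> d) \<oplus> e'"
      by (elim diff_class_memD) metis
    have "((a \<oplus> c) \<oplus> (b' \<oplus> d')) \<oplus> (e \<oplus> e') = ((a \<oplus> b') \<oplus> e) \<oplus> ((c \<oplus> d') \<oplus> e')" by (simp add: a_ac)
    also have "\<dots> = ((a' \<oplus> b) \<oplus> e) \<oplus> ((c' \<oplus> d) \<oplus> e')" by (simp only: e)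
    also have "\<dots> = ((a' \<oplus> c') \<oplus> (b \<oplus> d)) \<oplus> (e \<oplus> e')" by (simp add: a_ac)
    finally show "diff_class (fst p \<oplus> fst q) (snd p \<oplus> snd q) = diff_class (a \<oplus> c) (b \<oplus> d)"
      unfolding p by (intro sym[OF diff_class_eqI[of _ _ _ _ "e \<oplus> e'"]]) simp_all
  qed
  then show ?thesis
    unfolding ring_completion_def by (simp add: diff_class_def case_prod_unfold)
qed

lemma mult_diff_class:
  assumes [simp]: "a \<in> carrier R" "b \<in> carrier R" "c \<in> carrier R" "d \<in> carrier R"
  shows "diff_class a b \<otimes>\<^bsub>ring_completion R\<^esub> diff_class c d
    = diff_class ((a \<otimes> c) \<oplus> (b \<otimes> d)) ((a \<otimes> d) \<oplus> (b \<otimes> c))"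
proof -
  let ?m = "\<lambda>p q. diff_class ((fst p \<otimes> fst q) \<oplus> (snd p \<otimes> snd q)) ((fst p \<otimes> snd q) \<oplus> (snd p \<otimes> fst q))"
  have "(\<Union>p\<in>diff_class a b. \<Union>q\<in>diff_class c d. ?m p q) = ?m (a, b) (c, d)"
  proof (rule UN_const2)
    show "diff_class a b \<noteq> {}" "diff_class c d \<noteq> {}" using diff_class_self[of a b] diff_class_self[of c d] by auto
    fix p q assume "p \<in> diff_class a b" "q \<in> diff_class c d"
    then obtain a' b' e c' d' e' where p: "p = (a', b')" "q = (c', d')" and [simp]: "a' \<in> carrier R" "b' \<in> carrier R" "e \<in> carrier R"
      "c' \<in> carrier R" "d' \<in> carrier R" "e' \<in> carrier R"
      and e: "(a \<oplus> b') \<oplus> e = (a' \<oplus> b) \<oplus> e" "(c \<oplus> d') \<oplus> e' = (c' \<oplus> d) \<oplus> e'"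
      by (elim diff_class_memD) metis
    let ?x = "(a \<oplus> b') \<oplus> e" and ?y = "(a' \<oplus> b) \<oplus> e"
    have "(((a \<otimes> c) \<oplus> (b \<otimes> d)) \<oplus> ((a' \<otimes> d) \<oplus> (b' \<otimes> c))) \<oplus> ((e \<otimes> c) \<oplus> (e \<otimes> d)) = (?x \<otimes> c) \<oplus> (?y \<otimes> d)"
      by (simp add: a_ac l_distr)
    also have "\<dots> = (?y \<otimes> c) \<oplus> (?x \<otimes> d)" by (simp only: e)
    also have "\<dots> = (((a' \<otimes> c) \<oplus> (b' \<otimes> d)) \<oplus> ((a \<otimes> d) \<oplus> (b \<otimes> c))) \<oplus> ((e \<otimes> c) \<oplus> (e \<otimes> d))"
      by (simp add: a_ac l_distr)
    finally have 1: "?m (a, b) (c, d) = ?m (a', b') (c, d)"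
      by (intro diff_class_eqI[of _ _ _ _ "(e \<otimes> c) \<oplus> (e \<otimes> d)"]) simp_all
    let ?x = "(c \<oplus> d') \<oplus> e'" and ?y = "(c' \<oplus> d) \<oplus> e'"
    have "(((a' \<otimes> c) \<oplus> (b' \<otimes> d)) \<oplus> ((a' \<otimes> d') \<oplus> (b' \<otimes> c'))) \<oplus> ((a' \<otimes> e') \<oplus> (b' \<otimes> e')) = (a' \<otimes> ?x) \<oplus> (b' \<otimes> ?y)"
      by (simp add: a_ac r_distr)
    also have "\<dots> = (a' \<otimes> ?y) \<oplus> (b' \<otimes> ?x)" by (simp only: e)
    also have "\<dots> = (((a' \<otimes> c') \<oplus> (b' \<otimes> d')) \<oplus> ((a' \<otimes> d) \<oplus> (b' \<otimes> c))) \<oplus> ((a' \<otimes> e') \<oplus> (b' \<otimes> e'))"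
      by (simp add: a_ac r_distr)
    finally have 2: "?m (a', b') (c, d) = ?m (a', b') (c', d')"
      by (intro diff_class_eqI[of _ _ _ _ "(a' \<otimes> e') \<oplus> (b' \<otimes> e')"]) simp_all
    show "?m p q = ?m (a, b) (c, d)" unfolding p by (rule sym[OF trans[OF 1 2]])
  qed
  then show ?thesis
    unfolding ring_completion_def by (simp add: diff_class_def case_prod_unfold)
qed

lemma completion_zero_one:
  "\<zero>\<^bsub>ring_completion R\<^esub> = diff_class \<zero> \<zero>" "\<one>\<^bsub>ring_completion R\<^esub> = diff_class \<one> \<zero>"
  by (simp_all add: ring_completion_def diff_class_def)

text \<open>
  Sums, products and invertibility of matrices make sense over any semiring, and it is as a
  semiring that the completion enters below.
\<close>

lemma semiring_ring_completion: "semiring (ring_completion R)"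
proof -
  let ?G = "ring_completion R"
  note dc = diff_class_carrier add_diff_class mult_diff_class completion_zero_one
  show ?thesis
  proof (unfold_locales, simp_all only: monoid_record_simps)
  qed (auto elim!: carrier_completionE simp: dc a_ac m_assoc l_distr r_distr)
qed

lemma to_completion_eq: "to_completion R a = diff_class a \<zero>"
  by (simp add: to_completion_def diff_class_def)

lemma to_completion_hom:
  assumes [simp]: "a \<in> carrier R" "b \<in> carrier R"
  shows "to_completion R a \<in> carrier (ring_completion R)"
    and "to_completion R (a \<oplus> b) = to_completion R a \<oplus>\<^bsub>ring_completion R\<^esub> to_completion R b"
    and "to_completion R (a \<otimes> b) = to_completion R a \<otimes>\<^bsub>ring_completion R\<^esub> to_completion R b"
  by (simp_all add: to_completion_eq diff_class_carrier add_diff_class mult_diff_class)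

lemma to_completion_zero_one:
  "to_completion R \<zero> = \<zero>\<^bsub>ring_completion R\<^esub>"
  "to_completion R \<one> = \<one>\<^bsub>ring_completion R\<^esub>"
  by (simp_all add: to_completion_eq completion_zero_one)

end

section \<open>The arrows of a fixed simplicial dimension\<close>

text \<open>
  Hom sets of an enriched category may overlap, so a simplex of a hom set is turned into an arrow
  by recording its source and target.
\<close>

definition arr_dom :: "'o \<times> 'o \<times> 'm \<Rightarrow> 'o" where "arr_dom = fst"
definition arr_cod :: "'o \<times> 'o \<times> 'm \<Rightarrow> 'o" where "arr_cod = (\<lambda>f. fst (snd f))"
definition arr_mor :: "'o \<times> 'o \<times> 'm \<Rightarrow> 'm" where "arr_mor = (\<lambda>f. snd (snd f))"

definition arrows :: "('o, 'm, 'z) scat_scheme \<Rightarrow> nat \<Rightarrow> ('o \<times> 'o \<times> 'm) set" where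
  "arrows C k = {(a, b, f). a \<in> sObj C \<and> b \<in> sObj C \<and> f \<in> sHom C k a b}"

definition arr_id :: "('o, 'm, 'z) scat_scheme \<Rightarrow> nat \<Rightarrow> 'o \<Rightarrow> 'o \<times> 'o \<times> 'm" where
  "arr_id C k a = (a, a, sId C k a)"

definition arr_comp :: "('o, 'm, 'z) scat_scheme \<Rightarrow> nat \<Rightarrow> 'o \<times> 'o \<times> 'm \<Rightarrow> 'o \<times> 'o \<times> 'm \<Rightarrow> 'o \<times> 'o \<times> 'm" where
  "arr_comp C k g f = (arr_dom f, arr_cod g, sComp C k (arr_mor g) (arr_mor f))"

definition arr_plus :: "('o, 'm, 'z) bimon_scheme \<Rightarrow> nat \<Rightarrow> 'o \<times> 'o \<times> 'm \<Rightarrow> 'o \<times> 'o \<times> 'm \<Rightarrow> 'o \<times> 'o \<times> 'm" where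
  "arr_plus R k f g = (rplus R (arr_dom f) (arr_dom g), rplus R (arr_cod f) (arr_cod g), rplusM R k (arr_mor f) (arr_mor g))"

definition arr_times :: "('o, 'm, 'z) bimon_scheme \<Rightarrow> nat \<Rightarrow> 'o \<times> 'o \<times> 'm \<Rightarrow> 'o \<times> 'o \<times> 'm \<Rightarrow> 'o \<times> 'o \<times> 'm" where
  "arr_times R k f g = (rtimes R (arr_dom f) (arr_dom g), rtimes R (arr_cod f) (arr_cod g), rtimesM R k (arr_mor f) (arr_mor g))"

text \<open>
  In dimension \<open>k\<close> the structure isomorphisms are the degenerate \<open>k\<close>-simplices on the given
  \<open>0\<close>-simplices. Their naturality there is the naturality condition of an enriched transformation.
\<close>

definition arr_gam :: "('o, 'm, 'z) bimon_scheme \<Rightarrow> nat \<Rightarrow> 'o \<Rightarrow> 'o \<Rightarrow> 'o \<times> 'o \<times> 'm" where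
  "arr_gam R k a b = (rplus R a b, rplus R b a, degens R k (rgam R a b))"

definition arr_del :: "('o, 'm, 'z) bimon_scheme \<Rightarrow> nat \<Rightarrow> 'o \<Rightarrow> 'o \<Rightarrow> 'o \<Rightarrow> 'o \<times> 'o \<times> 'm" where
  "arr_del R k a b c = (rtimes R a (rplus R b c), rplus R (rtimes R a b) (rtimes R a c), degens R k (rdelta R a b c))"

lemmas arr_defs = arr_dom_def arr_cod_def arr_mor_def arrows_def arr_id_def arr_comp_def
  arr_plus_def arr_times_def arr_gam_def arr_del_def

lemma (in scategory) degens_in:
  "x \<in> sObj C \<Longrightarrow> y \<in> sObj C \<Longrightarrow> f \<in> sHom C 0 x y \<Longrightarrow> degens C k f \<in> sHom C k x y"
  by (induction k) (auto intro!: degen_in)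

lemma (in scategory) degens_id: "x \<in> sObj C \<Longrightarrow> degens C k (sId C 0 x) = sId C k x"
  by (induction k) (simp_all add: degen_id)

lemma (in scategory) degens_comp:
  assumes "x \<in> sObj C" "y \<in> sObj C" "z \<in> sObj C" "f \<in> sHom C 0 x y" "g \<in> sHom C 0 y z"
  shows "degens C k (sComp C 0 g f) = sComp C k (degens C k g) (degens C k f)"
proof (induction k)
  case (Suc k)
  have "degens C k f \<in> sHom C k x y" "degens C k g \<in> sHom C k y z" using assms degens_in by auto
  with Suc assms show ?case by (simp add: degen_comp[of x y z])
qed simp

context permutative_category
begin

lemma plus_in: "a \<in> sObj R \<Longrightarrow> b \<in> sObj R \<Longrightarrow> a [+] b \<in> sObj R"
  using sfunctor.obj_in[OF plus_functor, of "(a, b)"] by (simp add: prod_cat_def)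

lemma plusM_in:
  "a \<in> sObj R \<Longrightarrow> a' \<in> sObj R \<Longrightarrow> b \<in> sObj R \<Longrightarrow> b' \<in> sObj R \<Longrightarrow> f \<in> sHom R k a a' \<Longrightarrow> g \<in> sHom R k b b'
    \<Longrightarrow> rplusM R k f g \<in> sHom R k (a [+] b) (a' [+] b')"
  using sfunctor.hom_in[OF plus_functor, of "(a, b)" "(a', b')" "(f, g)" k] by (simp add: prod_cat_def)

lemma plusM_id: "a \<in> sObj R \<Longrightarrow> b \<in> sObj R \<Longrightarrow> rplusM R k (sId R k a) (sId R k b) = sId R k (a [+] b)"
  using sfunctor.map_id[OF plus_functor, of "(a, b)" k] by (simp add: prod_cat_def)

lemma plusM_comp:
  assumes "a \<in> sObj R" "b \<in> sObj R" "c \<in> sObj R" "a' \<in> sObj R" "b' \<in> sObj R" "c' \<in> sObj R"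
    "f \<in> sHom R k a b" "g \<in> sHom R k b c" "f' \<in> sHom R k a' b'" "g' \<in> sHom R k b' c'"
  shows "rplusM R k (sComp R k g f) (sComp R k g' f') = sComp R k (rplusM R k g g') (rplusM R k f f')"
  using sfunctor.map_comp[OF plus_functor, of "(a, a')" "(b, b')" "(c, c')" "(f, f')" k "(g, g')"] assms
  by (simp add: prod_cat_def)

lemma plusM_face:
  assumes "a \<in> sObj R" "a' \<in> sObj R" "b \<in> sObj R" "b' \<in> sObj R"
    "f \<in> sHom R (Suc k) a a'" "g \<in> sHom R (Suc k) b b'" "i \<le> Suc k"
  shows "rplusM R k (sFace R k i f) (sFace R k i g) = sFace R k i (rplusM R (Suc k) f g)"
  using sfunctor.map_face[OF plus_functor, of "(a, b)" "(a', b')" "(f, g)" k i] assms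
  by (simp add: prod_cat_def)

lemma plusM_degen:
  assumes "a \<in> sObj R" "a' \<in> sObj R" "b \<in> sObj R" "b' \<in> sObj R"
    "f \<in> sHom R k a a'" "g \<in> sHom R k b b'" "i \<le> k"
  shows "rplusM R (Suc k) (sDegen R k i f) (sDegen R k i g) = sDegen R k i (rplusM R k f g)"
  using sfunctor.map_degen[OF plus_functor, of "(a, b)" "(a', b')" "(f, g)" k i] assms
  by (simp add: prod_cat_def)

lemma gam_siso: "a \<in> sObj R \<Longrightarrow> b \<in> sObj R \<Longrightarrow> siso R 0 (a [+] b) (b [+] a) (rgam R a b)"
  using snat_iso.component_iso[OF gam_iso, of "(a, b)"] by (simp add: prod_cat_def)

lemma gam_in: "a \<in> sObj R \<Longrightarrow> b \<in> sObj R \<Longrightarrow> rgam R a b \<in> sHom R 0 (a [+] b) (b [+] a)"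
  using gam_siso by (simp add: siso_def)

lemma gam_nat:
  assumes "a \<in> sObj R" "a' \<in> sObj R" "b \<in> sObj R" "b' \<in> sObj R"
    "f \<in> sHom R k a a'" "g \<in> sHom R k b b'"
  shows "sComp R k (degens R k (rgam R a' b')) (rplusM R k f g) = sComp R k (rplusM R k g f) (degens R k (rgam R a b))"
  using snat_iso.natural[OF gam_iso, of "(a, b)" "(a', b')" "(f, g)" k] assms
  by (simp add: prod_cat_def)

end

context strict_bimonoidal_category
begin

lemma times_in: "a \<in> sObj R \<Longrightarrow> b \<in> sObj R \<Longrightarrow> a [*] b \<in> sObj R"
  using sfunctor.obj_in[OF times_functor, of "(a, b)"] by (simp add: prod_cat_def)

lemma timesM_in:
  "a \<in> sObj R \<Longrightarrow> a' \<in> sObj R \<Longrightarrow> b \<in> sObj R \<Longrightarrow> b' \<in> sObj R \<Longrightarrow> f \<in> sHom R k a a' \<Longrightarrow> g \<in> sHom R k b b'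
    \<Longrightarrow> rtimesM R k f g \<in> sHom R k (a [*] b) (a' [*] b')"
  using sfunctor.hom_in[OF times_functor, of "(a, b)" "(a', b')" "(f, g)" k] by (simp add: prod_cat_def)

lemma timesM_id: "a \<in> sObj R \<Longrightarrow> b \<in> sObj R \<Longrightarrow> rtimesM R k (sId R k a) (sId R k b) = sId R k (a [*] b)"
  using sfunctor.map_id[OF times_functor, of "(a, b)" k] by (simp add: prod_cat_def)

lemma timesM_comp:
  assumes "a \<in> sObj R" "b \<in> sObj R" "c \<in> sObj R" "a' \<in> sObj R" "b' \<in> sObj R" "c' \<in> sObj R"
    "f \<in> sHom R k a b" "g \<in> sHom R k b c" "f' \<in> sHom R k a' b'" "g' \<in> sHom R k b' c'"
  shows "rtimesM R k (sComp R k g f) (sComp R k g' f') = sComp R k (rtimesM R k g g') (rtimesM R k f f')"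
  using sfunctor.map_comp[OF times_functor, of "(a, a')" "(b, b')" "(c, c')" "(f, f')" k "(g, g')"] assms
  by (simp add: prod_cat_def)

lemma timesM_face:
  assumes "a \<in> sObj R" "a' \<in> sObj R" "b \<in> sObj R" "b' \<in> sObj R"
    "f \<in> sHom R (Suc k) a a'" "g \<in> sHom R (Suc k) b b'" "i \<le> Suc k"
  shows "rtimesM R k (sFace R k i f) (sFace R k i g) = sFace R k i (rtimesM R (Suc k) f g)"
  using sfunctor.map_face[OF times_functor, of "(a, b)" "(a', b')" "(f, g)" k i] assms
  by (simp add: prod_cat_def)

lemma timesM_degen:
  assumes "a \<in> sObj R" "a' \<in> sObj R" "b \<in> sObj R" "b' \<in> sObj R"
    "f \<in> sHom R k a a'" "g \<in> sHom R k b b'" "i \<le> k"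
  shows "rtimesM R (Suc k) (sDegen R k i f) (sDegen R k i g) = sDegen R k i (rtimesM R k f g)"
  using sfunctor.map_degen[OF times_functor, of "(a, b)" "(a', b')" "(f, g)" k i] assms
  by (simp add: prod_cat_def)

lemma delta_siso: "a \<in> sObj R \<Longrightarrow> b \<in> sObj R \<Longrightarrow> c \<in> sObj R
    \<Longrightarrow> siso R 0 (a [*] (b [+] c)) ((a [*] b) [+] (a [*] c)) (rdelta R a b c)"
  using snat_iso.component_iso[OF delta_iso, of "(a, b, c)"] by (simp add: prod_cat_def)

lemma delta_in: "a \<in> sObj R \<Longrightarrow> b \<in> sObj R \<Longrightarrow> c \<in> sObj R
    \<Longrightarrow> rdelta R a b c \<in> sHom R 0 (a [*] (b [+] c)) ((a [*] b) [+] (a [*] c))"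
  using delta_siso by (simp add: siso_def)

lemma delta_nat:
  assumes "a \<in> sObj R" "a' \<in> sObj R" "b \<in> sObj R" "b' \<in> sObj R" "c \<in> sObj R" "c' \<in> sObj R"
    "f \<in> sHom R k a a'" "g \<in> sHom R k b b'" "h \<in> sHom R k c c'"
  shows "sComp R k (degens R k (rdelta R a' b' c')) (rtimesM R k f (rplusM R k g h))
    = sComp R k (rplusM R k (rtimesM R k f g) (rtimesM R k f h)) (degens R k (rdelta R a b c))"
  using snat_iso.natural[OF delta_iso, of "(a, b, c)" "(a', b', c')" "(f, g, h)" k] assms
  by (simp add: prod_cat_def)

lemma times_category_at:
  "times_category (sObj R) (arrows R k) arr_dom arr_cod (arr_id R k) (arr_comp R k) (rplus R) (arr_plus R k)
    (rzero R) (arr_gam R k) (rtimes R) (arr_times R k) (rone R) (arr_del R k)"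
proof (unfold_locales, unfold arr_defs, safe, simp_all add: id_in zero_in one_in plus_in times_in)
qed (auto simp: comp_id_left comp_id_right comp_in plusM_in plusM_id timesM_in timesM_id
    plus_assoc plus_assocM zero_plus plus_zero zero_plusM plus_zeroM gam_nat degens_in gam_in delta_in delta_nat
    times_assoc times_assocM one_times times_one one_timesM times_oneM zero_times times_zero zero_timesM times_zeroM
    right_distrib right_distribM plus_in times_in comp_assoc plusM_comp timesM_comp)

end

section \<open>Invertible arrows\<close>

context sum_category
begin

definition invertible :: "'a \<Rightarrow> bool" where
  "invertible f \<longleftrightarrow> f \<in> Ar \<and> (\<exists>g \<in> Ar. dom g = cod f \<and> cod g = dom f \<and> g \<cdot> f = idn (dom f) \<and> f \<cdot> g = idn (cod f))"

lemma invertible_Ar: "invertible f \<Longrightarrow> f \<in> Ar"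
  by (simp add: invertible_def)

lemma invertibleI:
  "f \<in> Ar \<Longrightarrow> g \<in> Ar \<Longrightarrow> dom g = cod f \<Longrightarrow> cod g = dom f \<Longrightarrow> g \<cdot> f = idn (dom f) \<Longrightarrow> f \<cdot> g = idn (cod f)
    \<Longrightarrow> invertible f"
  by (auto simp: invertible_def)

lemma invertible_idn [simp]: "a \<in> Ob \<Longrightarrow> invertible (idn a)"
  by (rule invertibleI[of _ "idn a"]) simp_all

lemma invertible_cmp:
  assumes "invertible f" "invertible g" "dom g = cod f" shows "invertible (g \<cdot> f)"
proof -
  obtain f' g' where [simp]: "f \<in> Ar" "g \<in> Ar" "f' \<in> Ar" "g' \<in> Ar" "dom f' = cod f" "cod f' = dom f" "dom g' = cod g" "cod g' = dom g"
    and f: "f' \<cdot> f = idn (dom f)" "f \<cdot> f' = idn (cod f)" and g: "g' \<cdot> g = idn (dom g)" "g \<cdot> g' = idn (cod g)"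
    using assms unfolding invertible_def by auto
  note [simp] = assms(3)
  have 1: "g' \<cdot> (g \<cdot> f) = f" using g(1) by (simp flip: cmp_assoc)
  have 2: "f \<cdot> (f' \<cdot> g') = g'" using f(2) by (simp flip: cmp_assoc)
  show ?thesis
    by (rule invertibleI[of _ "f' \<cdot> g'"]) (simp_all add: cmp_assoc 1 2 f g)
qed

lemma invertible_sum:
  assumes "invertible f" "invertible g" shows "invertible (f \<boxplus> g)"
proof -
  obtain f' g' where [simp]: "f \<in> Ar" "g \<in> Ar" "f' \<in> Ar" "g' \<in> Ar" "dom f' = cod f" "cod f' = dom f" "dom g' = cod g" "cod g' = dom g"
    and f [simp]: "f' \<cdot> f = idn (dom f)" "f \<cdot> f' = idn (cod f)" "g' \<cdot> g = idn (dom g)" "g \<cdot> g' = idn (cod g)"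
    using assms unfolding invertible_def by auto
  show ?thesis
    by (rule invertibleI[of _ "f' \<boxplus> g'"]) (simp_all add: sum_cmp idn_sum)
qed

lemma invertible_Tot_ar: "(\<And>f. f \<in> set fs \<Longrightarrow> invertible f) \<Longrightarrow> invertible (Tot_ar fs)"
  by (induction fs) (auto intro: invertible_sum)

end

lemma (in times_category) invertible_prod:
  assumes "invertible f" "invertible g" shows "invertible (f \<boxtimes> g)"
proof -
  obtain f' g' where [simp]: "f \<in> Ar" "g \<in> Ar" "f' \<in> Ar" "g' \<in> Ar" "dom f' = cod f" "cod f' = dom f" "dom g' = cod g" "cod g' = dom g"
    and f [simp]: "f' \<cdot> f = idn (dom f)" "f \<cdot> f' = idn (cod f)" "g' \<cdot> g = idn (dom g)" "g \<cdot> g' = idn (cod g)"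
    using assms unfolding invertible_def by auto
  show ?thesis
    by (rule invertibleI[of _ "f' \<boxtimes> g'"]) (simp_all add: prod_cmp idn_prod)
qed

context bimonoidal_coherence
begin

lemma invertible_gam [simp]: "a \<in> Ob \<Longrightarrow> b \<in> Ob \<Longrightarrow> invertible (gam a b)"
  by (rule invertibleI[of _ "gam b a"]) (simp_all add: gam_gam)

context
  notes image_subset_iff [simp]
begin

lemma invertible_merge:
  assumes [simp]: "\<And>k. f k \<in> Ob" "\<And>k. g k \<in> Ob"
  shows "invertible (merge (map f ks) (map g ks))"
proof (induction ks)
  case (Cons k ks)
  then show ?case by (auto intro!: invertible_cmp invertible_sum)
qed simp

lemma invertible_interchange:
  assumes [simp]: "\<And>j k. x j k \<in> Ob"
  shows "invertible (interchange x js ks)"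
proof (induction js)
  case (Cons j js)
  then show ?case by (auto intro!: invertible_cmp invertible_sum invertible_merge)
qed simp

lemma invertible_distr:
  assumes del: "\<And>a b c. a \<in> Ob \<Longrightarrow> b \<in> Ob \<Longrightarrow> c \<in> Ob \<Longrightarrow> invertible (del a b c)"
    and [simp]: "a \<in> Ob" "set bs \<subseteq> Ob"
  shows "invertible (distr a bs)"
  using assms(3)
proof (induction bs)
  case (Cons b bs)
  then show ?case using del by (auto intro!: invertible_cmp invertible_sum)
qed simp

lemma invertible_assoc_entry:
  assumes "\<And>a b c. a \<in> Ob \<Longrightarrow> b \<in> Ob \<Longrightarrow> c \<in> Ob \<Longrightarrow> invertible (del a b c)"
    and [simp]: "\<And>p. u p \<in> Ob" "\<And>p q. v p q \<in> Ob" "\<And>q. w q \<in> Ob"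
  shows "invertible (assoc_entry u v w ps qs)"
  unfolding assoc_entry_def
  by (auto intro!: invertible_cmp invertible_interchange invertible_Tot_ar invertible_distr assms(1) simp: comp_def)

end

end

section \<open>Isomorphisms in simplicially enriched categories\<close>

context scategory
begin

lemma siso_in: "siso C k x y f \<Longrightarrow> f \<in> sHom C k x y"
  by (simp add: siso_def)

lemma siso_id: "x \<in> sObj C \<Longrightarrow> siso C k x x (sId C k x)"
  unfolding siso_def using id_in comp_id_left by blast

lemma siso_face:
  assumes "x \<in> sObj C" "y \<in> sObj C" "siso C (Suc k) x y f" "i \<le> Suc k"
  shows "siso C k x y (sFace C k i f)"
proof -
  from assms obtain g where "f \<in> sHom C (Suc k) x y" "g \<in> sHom C (Suc k) y x"
    "sComp C (Suc k) g f = sId C (Suc k) x" "sComp C (Suc k) f g = sId C (Suc k) y" unfolding siso_def by blast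
  with assms show ?thesis unfolding siso_def
    by (metis face_in face_comp face_id)
qed

lemma siso_degen:
  assumes "x \<in> sObj C" "y \<in> sObj C" "siso C k x y f" "i \<le> k"
  shows "siso C (Suc k) x y (sDegen C k i f)"
proof -
  from assms obtain g where "f \<in> sHom C k x y" "g \<in> sHom C k y x"
    "sComp C k g f = sId C k x" "sComp C k f g = sId C k y" unfolding siso_def by blast
  with assms show ?thesis unfolding siso_def
    by (metis degen_in degen_comp degen_id)
qed

text \<open>
  Inverses are unique, so the definite description picks out any inverse that is exhibited.
\<close>

lemma sinv_eq:
  assumes x: "x \<in> sObj C" "y \<in> sObj C" and f: "f \<in> sHom C 0 x y" and g: "g \<in> sHom C 0 y x"
    "sComp C 0 g f = sId C 0 x" "sComp C 0 f g = sId C 0 y"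
  shows "sinv C x y f = g"
  unfolding sinv_def
proof (rule the_equality)
  show "g \<in> sHom C 0 y x \<and> sComp C 0 g f = sId C 0 x \<and> sComp C 0 f g = sId C 0 y" using g by simp
  fix h assume h: "h \<in> sHom C 0 y x \<and> sComp C 0 h f = sId C 0 x \<and> sComp C 0 f h = sId C 0 y"
  have "h = sComp C 0 h (sComp C 0 f g)" using h g x comp_id_right by metis
  also have "\<dots> = sComp C 0 (sComp C 0 h f) g" using h g x f by (intro comp_assoc) auto
  also have "\<dots> = g" using h g x comp_id_left by metis
  finally show "h = g" .
qed

lemma sinv_id: "x \<in> sObj C \<Longrightarrow> sinv C x x (sId C 0 x) = sId C 0 x"
  by (rule sinv_eq) (auto simp: id_in comp_id_left)

end

section \<open>The dimensions of a strict bimonoidal category\<close>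

text \<open>
  One category with sums and products for each dimension. Coherence is interpreted only in
  dimension \<open>0\<close>, where the associativity isomorphisms live.
\<close>

sublocale strict_bimonoidal_category \<subseteq> lev: times_category "sObj R" "arrows R k" arr_dom arr_cod "arr_id R k" "arr_comp R k"
   "rplus R" "arr_plus R k" "rzero R" "arr_gam R k" "rtimes R" "arr_times R k" "rone R" "arr_del R k" for k
  by (rule times_category_at)

context strict_bimonoidal_category
begin

lemma bimonoidal_coherence_at_0:
  "bimonoidal_coherence (sObj R) (arrows R 0) arr_dom arr_cod (arr_id R 0) (arr_comp R 0) (rplus R) (arr_plus R 0)
    (rzero R) (arr_gam R 0) (rtimes R) (arr_times R 0) (rone R) (arr_del R 0)"
proof -
  have "perm_category (sObj R) (arrows R 0) arr_dom arr_cod (arr_id R 0) (arr_comp R 0) (rplus R) (arr_plus R 0)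
    (rzero R) (arr_gam R 0)"
    by (unfold_locales, unfold arr_defs) (auto simp: gam_gam gam_zero gam_plus plus_assoc plus_in zero_in zero_plus plus_zero)
  moreover have "bimonoidal_coherence_axioms (sObj R) (arr_id R 0) (arr_comp R 0) (rplus R) (arr_plus R 0)
    (rzero R) (arr_gam R 0) (rtimes R) (arr_times R 0) (rone R) (arr_del R 0)"
    by (unfold bimonoidal_coherence_axioms_def, unfold arr_defs, simp)
      (auto simp: plus_in times_in delta_gam gam_times delta_plus delta_zero1 delta_zero2 delta_zero3 delta_one
      delta_times_left delta_times_right delta_plus_plus zero_times times_zero zero_plus plus_zero one_times times_assoc plus_assoc right_distrib zero_in one_in)
  ultimately show ?thesis
    using lev.times_category_axioms by (auto simp: bimonoidal_coherence_def)
qed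

end

sublocale strict_bimonoidal_category \<subseteq> lev0: bimonoidal_coherence "sObj R" "arrows R 0" arr_dom arr_cod "arr_id R 0" "arr_comp R 0"
   "rplus R" "arr_plus R 0" "rzero R" "arr_gam R 0" "rtimes R" "arr_times R 0" "rone R" "arr_del R 0"
  by (rule bimonoidal_coherence_at_0)

context strict_bimonoidal_category
begin

lemma osum_eq_Tot: "osum R as = lev.Tot as"
  by (simp add: osum_def lev.Tot_def)

lemma arr_simps [simp]:
  "arr_mor (arr_comp R k g f) = sComp R k (arr_mor g) (arr_mor f)"
  "arr_mor (arr_plus R k f g) = rplusM R k (arr_mor f) (arr_mor g)"
  "arr_mor (arr_times R k f g) = rtimesM R k (arr_mor f) (arr_mor g)"
  "arr_mor (arr_id R k a) = sId R k a"
  "arr_mor (x, y, h) = h" "arr_dom (x, y, h) = x" "arr_cod (x, y, h) = y"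
  "(x, y, h) \<in> arrows R k \<longleftrightarrow> x \<in> sObj R \<and> y \<in> sObj R \<and> h \<in> sHom R k x y"
  by (simp_all add: arr_defs)

lemma arr_eqI: "arr_dom f = arr_dom g \<Longrightarrow> arr_cod f = arr_cod g \<Longrightarrow> arr_mor f = arr_mor g \<Longrightarrow> f = g"
  by (auto simp: arr_defs prod_eq_iff)

lemma msum_eq_Tot_ar: "msum R k (map arr_mor fs) = arr_mor (lev.Tot_ar k fs)"
  by (induction fs) (simp_all add: msum_def)

lemma siso_iff_invertible:
  assumes "a \<in> sObj R" "b \<in> sObj R"
  shows "siso R k a b f \<longleftrightarrow> lev.invertible k (a, b, f)"
proof
  assume "siso R k a b f"
  then obtain g where "f \<in> sHom R k a b" "g \<in> sHom R k b a" "sComp R k g f = sId R k a" "sComp R k f g = sId R k b"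
    unfolding siso_def by blast
  with assms show "lev.invertible k (a, b, f)"
    by (intro lev.invertibleI[of _ _ "(b, a, g)"]) (auto simp: arr_comp_def arr_id_def)
next
  assume "lev.invertible k (a, b, f)"
  then obtain g where "f \<in> sHom R k a b" "g \<in> arrows R k" "arr_dom g = b" "arr_cod g = a"
    and 1: "arr_comp R k g (a, b, f) = arr_id R k a" "arr_comp R k (a, b, f) g = arr_id R k b"
    unfolding lev.invertible_def by auto
  then have "f \<in> sHom R k a b" "arr_mor g \<in> sHom R k b a"
     by (auto simp: arrows_def)
  with arg_cong[OF 1(1), of arr_mor] arg_cong[OF 1(2), of arr_mor] show "siso R k a b f"
    by (auto simp: siso_def)
qed

lemma invertible_del: "a \<in> sObj R \<Longrightarrow> b \<in> sObj R \<Longrightarrow> c \<in> sObj R \<Longrightarrow> lev.invertible 0 (arr_del R 0 a b c)"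
  using delta_siso[of a b c] siso_iff_invertible[of "a [*] (b [+] c)" "(a [*] b) [+] (a [*] c)" 0 "rdelta R a b c"]
  by (simp add: arr_del_def)

end

section \<open>Entries of matrices\<close>

text \<open>
  Entries are extended by \<open>0\<close>, and arrows between entries by the identity of \<open>0\<close>, to all pairs of
  indices. Families of entries are then total, as the results on sums expect, and the added
  summands are harmless.
\<close>

definition ent :: "('o, 'm, 'z) bimon_scheme \<Rightarrow> nat \<Rightarrow> 'o mat \<Rightarrow> nat \<Rightarrow> nat \<Rightarrow> 'o" where
  "ent R n U i j = (if i < n \<and> j < n then U $$ (i, j) else rzero R)"

definition ent_ar :: "('o, 'm, 'z) bimon_scheme \<Rightarrow> nat \<Rightarrow> nat \<Rightarrow> 'o mat \<Rightarrow> 'o mat \<Rightarrow> 'm mat \<Rightarrow> nat \<Rightarrow> nat \<Rightarrow> 'o \<times> 'o \<times> 'm" where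
  "ent_ar R n k U V \<phi> i j = (if i < n \<and> j < n then (U $$ (i, j), V $$ (i, j), \<phi> $$ (i, j)) else arr_id R k (rzero R))"

lemma ent_eqI:
  assumes "U \<in> carrier_mat n n" "V \<in> carrier_mat n n" "\<And>i j. ent R n U i j = ent R n V i j"
  shows "U = V"
proof (rule eq_matI)
  fix i j assume "i < dim_row V" "j < dim_col V"
  then show "U $$ (i, j) = V $$ (i, j)" using assms(3)[of i j] assms(1,2) by (simp add: ent_def)
qed (use assms in auto)

lemma ent_ar_eqI:
  assumes "\<phi> \<in> carrier_mat n n" "\<psi> \<in> carrier_mat n n" "\<And>i j. ent_ar R n k U V \<phi> i j = ent_ar R n k U' V' \<psi> i j"
  shows "\<phi> = \<psi>"
proof (rule eq_matI)
  fix i j assume "i < dim_row \<psi>" "j < dim_col \<psi>"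
  then show "\<phi> $$ (i, j) = \<psi> $$ (i, j)" using assms(3)[of i j] assms(1,2) by (simp add: ent_ar_def)
qed (use assms in auto)

lemma map_upt_cong: "(\<And>i. i < n \<Longrightarrow> f i = g i) \<Longrightarrow> map f [0..<n] = map g [0..<n]"
  by auto

context strict_bimonoidal_category
begin

abbreviation mob :: "nat \<Rightarrow> 'o mat set" where "mob n \<equiv> sObj (mat_cat R n)"
abbreviation mhom :: "nat \<Rightarrow> nat \<Rightarrow> 'o mat \<Rightarrow> 'o mat \<Rightarrow> 'm mat set" where "mhom n k \<equiv> sHom (mat_cat R n) k"

lemma mob_iff: "U \<in> mob n \<longleftrightarrow> U \<in> carrier_mat n n \<and> (\<forall>i<n. \<forall>j<n. U $$ (i, j) \<in> sObj R)"
  by (simp add: mat_cat_def)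

lemma mob_carrier: "U \<in> mob n \<Longrightarrow> U \<in> carrier_mat n n"
  by (simp add: mob_iff)

lemma mobI: "U \<in> carrier_mat n n \<Longrightarrow> (\<And>i j. ent R n U i j \<in> sObj R) \<Longrightarrow> U \<in> mob n"
  unfolding mob_iff ent_def by metis

lemma ent_Ob [simp]: "U \<in> mob n \<Longrightarrow> ent R n U i j \<in> sObj R"
  by (simp add: mob_iff ent_def)

lemma ent_ar_dom [simp]: "arr_dom (ent_ar R n k U V \<phi> i j) = ent R n U i j"
  and ent_ar_cod [simp]: "arr_cod (ent_ar R n k U V \<phi> i j) = ent R n V i j"
  by (simp_all add: ent_ar_def ent_def)

lemma mhom_iff:
  assumes "U \<in> mob n" "V \<in> mob n"
  shows "\<phi> \<in> mhom n k U V \<longleftrightarrow> \<phi> \<in> carrier_mat n n \<and> (\<forall>i j. lev.invertible k (ent_ar R n k U V \<phi> i j))"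
proof -
  have "(\<forall>i j. lev.invertible k (ent_ar R n k U V \<phi> i j)) \<longleftrightarrow>
     (\<forall>i<n. \<forall>j<n. lev.invertible k (U $$ (i, j), V $$ (i, j), \<phi> $$ (i, j)))"
    unfolding ent_ar_def if_distrib[of "lev.invertible k"] by auto
  moreover have "\<dots> \<longleftrightarrow> (\<forall>i<n. \<forall>j<n. siso R k (U $$ (i, j)) (V $$ (i, j)) (\<phi> $$ (i, j)))"
    using assms by (auto simp: siso_iff_invertible mob_iff)
  ultimately show ?thesis by (simp add: mat_cat_def)
qed

lemma mhom_carrier: "\<phi> \<in> mhom n k U V \<Longrightarrow> \<phi> \<in> carrier_mat n n"
  by (simp add: mat_cat_def)

lemma ent_ar_invertible: "U \<in> mob n \<Longrightarrow> V \<in> mob n \<Longrightarrow> \<phi> \<in> mhom n k U V \<Longrightarrow> lev.invertible k (ent_ar R n k U V \<phi> i j)"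
  by (simp add: mhom_iff)

lemma ent_ar_Ar [simp]: "U \<in> mob n \<Longrightarrow> V \<in> mob n \<Longrightarrow> \<phi> \<in> mhom n k U V \<Longrightarrow> ent_ar R n k U V \<phi> i j \<in> arrows R k"
  using ent_ar_invertible lev.invertible_Ar by blast

lemma ent_ar_comp:
  "ent_ar R n k U W (sComp (mat_cat R n) k \<psi> \<phi>) i j = arr_comp R k (ent_ar R n k V W \<psi> i j) (ent_ar R n k U V \<phi> i j)"
  by (rule arr_eqI) (auto simp: ent_ar_def mat_cat_def ent_def arr_comp_def arr_id_def
      comp_id_left[OF zero_in zero_in id_in[OF zero_in]])

lemma ent_ar_id: "U \<in> mob n \<Longrightarrow> ent_ar R n k U U (sId (mat_cat R n) k U) i j = arr_id R k (ent R n U i j)"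
  by (auto simp: ent_ar_def mat_cat_def ent_def arr_id_def)

lemma mat_comp_carrier: "sComp (mat_cat R n) k \<psi> \<phi> \<in> carrier_mat n n"
  and mat_id_carrier: "U \<in> mob n \<Longrightarrow> sId (mat_cat R n) k U \<in> carrier_mat n n"
  by (simp_all add: mat_cat_def)

lemma scategory_mat_cat: "scategory (mat_cat R n)"
proof
  fix U V W X k \<phi> \<psi> \<chi> and i j :: nat
  show "sId (mat_cat R n) k U \<in> mhom n k U U" if "U \<in> mob n"
    using that by (simp add: mhom_iff ent_ar_id mat_id_carrier)
  show "sComp (mat_cat R n) k \<psi> \<phi> \<in> mhom n k U W"
    if o: "U \<in> mob n" "V \<in> mob n" "W \<in> mob n" and h: "\<phi> \<in> mhom n k U V" "\<psi> \<in> mhom n k V W"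
    using o ent_ar_invertible[OF o(1,2) h(1)] ent_ar_invertible[OF o(2,3) h(2)]
    by (auto simp: mhom_iff mat_comp_carrier ent_ar_comp[where V = V] intro!: lev.invertible_cmp)
  show "sComp (mat_cat R n) k (sId (mat_cat R n) k V) \<phi> = \<phi>"
    if "U \<in> mob n" "V \<in> mob n" "\<phi> \<in> mhom n k U V"
    by (rule ent_ar_eqI[of _ n _ R k U V U V])
      (use that in \<open>auto simp: ent_ar_comp[where V = V] ent_ar_id mat_comp_carrier mhom_carrier\<close>)
  show "sComp (mat_cat R n) k \<phi> (sId (mat_cat R n) k U) = \<phi>"
    if "U \<in> mob n" "V \<in> mob n" "\<phi> \<in> mhom n k U V"
    by (rule ent_ar_eqI[of _ n _ R k U V U V])
      (use that in \<open>auto simp: ent_ar_comp[where V = U] ent_ar_id mat_comp_carrier mhom_carrier\<close>)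
  show "sComp (mat_cat R n) k \<chi> (sComp (mat_cat R n) k \<psi> \<phi>) = sComp (mat_cat R n) k (sComp (mat_cat R n) k \<chi> \<psi>) \<phi>"
    if "X \<in> mob n" "U \<in> mob n" "V \<in> mob n" "W \<in> mob n" "\<phi> \<in> mhom n k X U" "\<psi> \<in> mhom n k U V" "\<chi> \<in> mhom n k V W"
    using that
    by (intro ent_ar_eqI[of _ n _ R k X W X W] mat_comp_carrier)
      (simp add: ent_ar_comp[where U = X and V = V and W = W and \<psi> = \<chi>]
        ent_ar_comp[where U = X and V = U and W = V and \<psi> = \<psi> and \<phi> = \<phi>]
        ent_ar_comp[where U = X and V = U and W = W and \<phi> = \<phi>]
        ent_ar_comp[where U = U and V = V and W = W and \<psi> = \<chi> and \<phi> = \<psi>] lev.cmp_assoc)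
  \<comment> \<open>The simplicial identities and compatibilities hold entry by entry.\<close>
  have *: "U $$ (i, j) \<in> sObj R" if "U \<in> mob n" "i < n" "j < n" for U i j using that by (simp add: mob_iff)
  have **: "siso R k (U $$ (i, j)) (V $$ (i, j)) (\<phi> $$ (i, j))" "\<phi> $$ (i, j) \<in> sHom R k (U $$ (i, j)) (V $$ (i, j))"
    if "\<phi> \<in> mhom n k U V" "i < n" "j < n" for U V i j \<phi> k
    using that siso_in by (auto simp: mat_cat_def)
  have F: "sFace (mat_cat R n) k i \<phi> = map_mat (sFace R k i) \<phi>"
    "sDegen (mat_cat R n) k i \<phi> = map_mat (sDegen R k i) \<phi>"
    "sId (mat_cat R n) k U = map_mat (sId R k) U"
    "sComp (mat_cat R n) k \<psi> \<phi> = mat n n (\<lambda>ij. sComp R k (\<psi> $$ ij) (\<phi> $$ ij))" for k i \<phi> \<psi> U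
    by (simp_all add: mat_cat_def)
  show "sFace (mat_cat R n) k i \<phi> \<in> mhom n k U V"
    if "U \<in> mob n" "V \<in> mob n" "\<phi> \<in> mhom n (Suc k) U V" "i \<le> Suc k"
    using mhom_carrier[OF that(3)] siso_face[OF *[OF that(1)] *[OF that(2)] **(1)[OF that(3)] that(4)] by (simp add: mat_cat_def)
  show "sDegen (mat_cat R n) k i \<phi> \<in> mhom n (Suc k) U V"
    if "U \<in> mob n" "V \<in> mob n" "\<phi> \<in> mhom n k U V" "i \<le> k"
    using mhom_carrier[OF that(3)] siso_degen[OF *[OF that(1)] *[OF that(2)] **(1)[OF that(3)] that(4)] by (simp add: mat_cat_def)
  show "sFace (mat_cat R n) k i (sFace (mat_cat R n) (Suc k) j \<phi>) = sFace (mat_cat R n) k (j - 1) (sFace (mat_cat R n) (Suc k) i \<phi>)"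
    if "U \<in> mob n" "V \<in> mob n" "\<phi> \<in> mhom n (Suc (Suc k)) U V" "i < j" "j \<le> Suc (Suc k)"
    using mhom_carrier[OF that(3)] face_face[OF *[OF that(1)] *[OF that(2)] **(2)[OF that(3)] that(4,5)]
    by (intro eq_matI) (simp_all add: F)
  show "sFace (mat_cat R n) (Suc k) i (sDegen (mat_cat R n) (Suc k) j \<phi>) = sDegen (mat_cat R n) k (j - 1) (sFace (mat_cat R n) k i \<phi>)"
    if "U \<in> mob n" "V \<in> mob n" "\<phi> \<in> mhom n (Suc k) U V" "i < j" "j \<le> Suc k"
    using mhom_carrier[OF that(3)] face_degen_less[OF *[OF that(1)] *[OF that(2)] **(2)[OF that(3)] that(4,5)]
    by (intro eq_matI) (simp_all add: F)
  show "sFace (mat_cat R n) k i (sDegen (mat_cat R n) k j \<phi>) = \<phi>"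
    if "U \<in> mob n" "V \<in> mob n" "\<phi> \<in> mhom n k U V" "j \<le> k" "i = j \<or> i = Suc j"
    using mhom_carrier[OF that(3)] face_degen_eq[OF *[OF that(1)] *[OF that(2)] **(2)[OF that(3)] that(4,5)]
    by (intro eq_matI) (simp_all add: F)
  show "sFace (mat_cat R n) (Suc k) i (sDegen (mat_cat R n) (Suc k) j \<phi>) = sDegen (mat_cat R n) k j (sFace (mat_cat R n) k (i - 1) \<phi>)"
    if "U \<in> mob n" "V \<in> mob n" "\<phi> \<in> mhom n (Suc k) U V" "Suc j < i" "i \<le> Suc (Suc k)"
    using mhom_carrier[OF that(3)] face_degen_greater[OF *[OF that(1)] *[OF that(2)] **(2)[OF that(3)] that(4,5)]
    by (intro eq_matI) (simp_all add: F)
  show "sDegen (mat_cat R n) (Suc k) i (sDegen (mat_cat R n) k j \<phi>) = sDegen (mat_cat R n) (Suc k) (Suc j) (sDegen (mat_cat R n) k i \<phi>)"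
    if "U \<in> mob n" "V \<in> mob n" "\<phi> \<in> mhom n k U V" "i \<le> j" "j \<le> k"
    using mhom_carrier[OF that(3)] degen_degen[OF *[OF that(1)] *[OF that(2)] **(2)[OF that(3)] that(4,5)]
    by (intro eq_matI) (simp_all add: F)
  show "sFace (mat_cat R n) k i (sId (mat_cat R n) (Suc k) U) = sId (mat_cat R n) k U" if "U \<in> mob n" "i \<le> Suc k"
    using mob_carrier[OF that(1)] face_id[OF *[OF that(1)] that(2)] by (intro eq_matI) (simp_all add: F)
  show "sDegen (mat_cat R n) k i (sId (mat_cat R n) k U) = sId (mat_cat R n) (Suc k) U" if "U \<in> mob n" "i \<le> k"
    using mob_carrier[OF that(1)] degen_id[OF *[OF that(1)] that(2)] by (intro eq_matI) (simp_all add: F)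
  show "sFace (mat_cat R n) k i (sComp (mat_cat R n) (Suc k) \<psi> \<phi>) = sComp (mat_cat R n) k (sFace (mat_cat R n) k i \<psi>) (sFace (mat_cat R n) k i \<phi>)"
    if "U \<in> mob n" "V \<in> mob n" "W \<in> mob n" "\<phi> \<in> mhom n (Suc k) U V" "\<psi> \<in> mhom n (Suc k) V W" "i \<le> Suc k"
    using mhom_carrier[OF that(4)] mhom_carrier[OF that(5)]
      face_comp[OF *[OF that(1)] *[OF that(2)] *[OF that(3)] **(2)[OF that(4)] **(2)[OF that(5)] that(6)]
    by (intro eq_matI) (simp_all add: F)
  show "sDegen (mat_cat R n) k i (sComp (mat_cat R n) k \<psi> \<phi>) = sComp (mat_cat R n) (Suc k) (sDegen (mat_cat R n) k i \<psi>) (sDegen (mat_cat R n) k i \<phi>)"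
    if "U \<in> mob n" "V \<in> mob n" "W \<in> mob n" "\<phi> \<in> mhom n k U V" "\<psi> \<in> mhom n k V W" "i \<le> k"
    using mhom_carrier[OF that(4)] mhom_carrier[OF that(5)]
      degen_comp[OF *[OF that(1)] *[OF that(2)] *[OF that(3)] **(2)[OF that(4)] **(2)[OF that(5)] that(6)]
    by (intro eq_matI) (simp_all add: F)
qed

section \<open>Matrix multiplication\<close>

lemma mat_prod_carrier: "U \<in> carrier_mat n n \<Longrightarrow> V \<in> carrier_mat n n \<Longrightarrow> mat_prod R U V \<in> carrier_mat n n"
  and mat_prodM_carrier: "\<phi> \<in> carrier_mat n n \<Longrightarrow> \<psi> \<in> carrier_mat n n \<Longrightarrow> mat_prodM R k \<phi> \<psi> \<in> carrier_mat n n"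
  by (auto simp: mat_prod_def mat_prodM_def)

lemma ent_mat_prod:
  assumes U: "U \<in> mob n" and V: "V \<in> mob n"
  shows "ent R n (mat_prod R U V) i l = lev.Tot (map (\<lambda>j. ent R n U i j [*] ent R n V j l) [0..<n])"
proof (cases "i < n \<and> l < n")
  case True
  with mob_carrier[OF U] mob_carrier[OF V] show ?thesis
    by (auto simp: ent_def mat_prod_def osum_eq_Tot intro!: arg_cong[of _ _ lev.Tot])
next
  case False
  then have "ent R n U i j [*] ent R n V j l = rzero R" for j
    using ent_Ob[OF U, of i j] ent_Ob[OF V, of j l] by (auto simp: ent_def)
  with False show ?thesis by (auto simp: ent_def lev.Tot_zero image_subset_iff)
qed

lemma mat_prod_in:
  assumes "U \<in> mob n" "V \<in> mob n"
  shows "mat_prod R U V \<in> mob n"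
  by (rule mobI) (use assms in \<open>auto simp: mat_prod_carrier mob_carrier ent_mat_prod image_subset_iff\<close>)

lemma ent_ar_mat_prodM:
  assumes U: "U \<in> mob n" "U' \<in> mob n" and V: "V \<in> mob n" "V' \<in> mob n"
    and h: "\<phi> \<in> mhom n k U V" "\<psi> \<in> mhom n k U' V'"
  shows "ent_ar R n k (mat_prod R U U') (mat_prod R V V') (mat_prodM R k \<phi> \<psi>) i l
    = lev.Tot_ar k (map (\<lambda>j. arr_times R k (ent_ar R n k U V \<phi> i j) (ent_ar R n k U' V' \<psi> j l)) [0..<n])"
proof (rule arr_eqI)
  let ?f = "\<lambda>j. arr_times R k (ent_ar R n k U V \<phi> i j) (ent_ar R n k U' V' \<psi> j l)"
  have [simp]: "ent_ar R n k U V \<phi> i j \<in> arrows R k" "ent_ar R n k U' V' \<psi> i j \<in> arrows R k" for i j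
    using U V h by auto
  note [simp] = image_subset_iff comp_def
  show "arr_dom (ent_ar R n k (mat_prod R U U') (mat_prod R V V') (mat_prodM R k \<phi> \<psi>) i l) = arr_dom (lev.Tot_ar k (map ?f [0..<n]))"
    using U V h by (simp add: ent_mat_prod)
  show "arr_cod (ent_ar R n k (mat_prod R U U') (mat_prod R V V') (mat_prodM R k \<phi> \<psi>) i l) = arr_cod (lev.Tot_ar k (map ?f [0..<n]))"
    using U V h by (simp add: ent_mat_prod)
  show "arr_mor (ent_ar R n k (mat_prod R U U') (mat_prod R V V') (mat_prodM R k \<phi> \<psi>) i l) = arr_mor (lev.Tot_ar k (map ?f [0..<n]))"
  proof (cases "i < n \<and> l < n")
    case True
    then have "arr_mor (ent_ar R n k (mat_prod R U U') (mat_prod R V V') (mat_prodM R k \<phi> \<psi>) i l)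
      = msum R k (map (\<lambda>j. rtimesM R k (\<phi> $$ (i, j)) (\<psi> $$ (j, l))) [0..<n])"
      using mhom_carrier[OF h(1)] mhom_carrier[OF h(2)] by (auto simp: ent_ar_def mat_prodM_def)
    also have "\<dots> = msum R k (map arr_mor (map ?f [0..<n]))"
      using True by (auto simp: ent_ar_def intro!: arg_cong[of _ _ "msum R k"])
    finally show ?thesis by (simp only: msum_eq_Tot_ar)
  next
    case False
    \<comment> \<open>Outside the index range one factor of each summand is the identity of \<open>0\<close>.\<close>
    have "?f j = arr_id R k (rzero R)" for j
    proof (cases "i < n")
      case True
      with False have "ent_ar R n k U' V' \<psi> j l = arr_id R k (rzero R)" by (simp add: ent_ar_def)
      then show ?thesis by simp
    next
      case False
      then have "ent_ar R n k U V \<phi> i j = arr_id R k (rzero R)" by (simp add: ent_ar_def)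
      then show ?thesis by simp
    qed
    then have "lev.Tot_ar k (map ?f [0..<n]) = arr_id R k (rzero R)"
      using lev.Tot_ar_filter[of ?f k "\<lambda>_. False" "[0..<n]"] by simp
    with False show ?thesis by (auto simp: ent_ar_def)
  qed
qed

lemma mat_prodM_in:
  assumes "U \<in> mob n" "U' \<in> mob n" "V \<in> mob n" "V' \<in> mob n" "\<phi> \<in> mhom n k U V" "\<psi> \<in> mhom n k U' V'"
  shows "mat_prodM R k \<phi> \<psi> \<in> mhom n k (mat_prod R U U') (mat_prod R V V')"
proof -
  have "lev.invertible k (ent_ar R n k (mat_prod R U U') (mat_prod R V V') (mat_prodM R k \<phi> \<psi>) i l)" for i l
    unfolding ent_ar_mat_prodM[OF assms]
    by (rule lev.invertible_Tot_ar) (use ent_ar_invertible assms in \<open>auto intro!: lev.invertible_prod\<close>)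
  with assms show ?thesis
    by (simp add: mhom_iff mat_prod_in mat_prodM_carrier mhom_carrier)
qed

lemma mat_prodM_id:
  assumes "U \<in> mob n" "V \<in> mob n"
  shows "mat_prodM R k (sId (mat_cat R n) k U) (sId (mat_cat R n) k V) = sId (mat_cat R n) k (mat_prod R U V)"
proof (rule ent_ar_eqI)
  interpret M: scategory "mat_cat R n" by (rule scategory_mat_cat)
  show "ent_ar R n k (mat_prod R U V) (mat_prod R U V) (mat_prodM R k (sId (mat_cat R n) k U) (sId (mat_cat R n) k V)) i j
     = ent_ar R n k (mat_prod R U V) (mat_prod R U V) (sId (mat_cat R n) k (mat_prod R U V)) i j" for i j
    using assms by (simp add: ent_ar_mat_prodM[OF assms assms] M.id_in ent_ar_id mat_prod_in ent_mat_prod flip: lev.idn_prod)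
qed (use assms in \<open>auto simp: mat_prod_in mat_prodM_carrier mat_id_carrier\<close>)

lemma mat_prodM_comp:
  assumes U: "U \<in> mob n" "U' \<in> mob n" and V: "V \<in> mob n" "V' \<in> mob n" and W: "W \<in> mob n" "W' \<in> mob n"
    and f: "\<phi> \<in> mhom n k U V" "\<phi>' \<in> mhom n k U' V'" and g: "\<psi> \<in> mhom n k V W" "\<psi>' \<in> mhom n k V' W'"
  shows "mat_prodM R k (sComp (mat_cat R n) k \<psi> \<phi>) (sComp (mat_cat R n) k \<psi>' \<phi>') =
    sComp (mat_cat R n) k (mat_prodM R k \<psi> \<psi>') (mat_prodM R k \<phi> \<phi>')"
proof (rule ent_ar_eqI)
  interpret M: scategory "mat_cat R n" by (rule scategory_mat_cat)
  have c: "sComp (mat_cat R n) k \<psi> \<phi> \<in> mhom n k U W" "sComp (mat_cat R n) k \<psi>' \<phi>' \<in> mhom n k U' W'"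
    using U V W f g by (auto intro: M.comp_in)
  show "ent_ar R n k (mat_prod R U U') (mat_prod R W W') (mat_prodM R k (sComp (mat_cat R n) k \<psi> \<phi>) (sComp (mat_cat R n) k \<psi>' \<phi>')) i l
     = ent_ar R n k (mat_prod R U U') (mat_prod R W W') (sComp (mat_cat R n) k (mat_prodM R k \<psi> \<psi>') (mat_prodM R k \<phi> \<phi>')) i l" for i l
    unfolding ent_ar_mat_prodM[OF U W c] ent_ar_comp[where U = "mat_prod R U U'" and V = "mat_prod R V V'"]
      ent_ar_mat_prodM[OF U V f] ent_ar_mat_prodM[OF V W g]
    unfolding ent_ar_comp[where U = U and V = V] ent_ar_comp[where U = U' and V = V']
    using U V W f g by (simp add: lev.Tot_ar_cmp lev.prod_cmp)
qed (auto simp: mat_prodM_carrier mat_comp_carrier mhom_carrier[OF f(1)] mhom_carrier[OF f(2)])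

lemma Tot_Ob': "(\<And>j. j \<in> set js \<Longrightarrow> x j \<in> sObj R) \<Longrightarrow> lev.Tot (map x js) \<in> sObj R"
  by (rule lev.Tot_Ob) auto

lemma msum_in:
  assumes "\<And>j. j \<in> set js \<Longrightarrow> x j \<in> sObj R \<and> y j \<in> sObj R \<and> f j \<in> sHom R k (x j) (y j)"
  shows "msum R k (map f js) \<in> sHom R k (lev.Tot (map x js)) (lev.Tot (map y js))"
  using assms
proof (induction js)
  case (Cons j js)
  then have "lev.Tot (map x js) \<in> sObj R" "lev.Tot (map y js) \<in> sObj R" by (auto intro!: Tot_Ob')
  with Cons show ?case by (auto simp: msum_def intro!: plusM_in)
qed (simp add: msum_def id_in zero_in)

lemma msum_face:
  assumes "\<And>j. j \<in> set js \<Longrightarrow> x j \<in> sObj R \<and> y j \<in> sObj R \<and> f j \<in> sHom R (Suc k) (x j) (y j)" "i \<le> Suc k"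
  shows "msum R k (map (\<lambda>j. sFace R k i (f j)) js) = sFace R k i (msum R (Suc k) (map f js))"
  using assms(1)
proof (induction js)
  case (Cons j js)
  then have "lev.Tot (map x js) \<in> sObj R" "lev.Tot (map y js) \<in> sObj R" by (auto intro!: Tot_Ob')
  moreover have "msum R (Suc k) (map f js) \<in> sHom R (Suc k) (lev.Tot (map x js)) (lev.Tot (map y js))"
    using Cons by (intro msum_in) auto
  ultimately show ?case
    using Cons assms(2) plusM_face[of "x j" "y j" "lev.Tot (map x js)" "lev.Tot (map y js)" "f j" k "msum R (Suc k) (map f js)" i]
    by (simp add: msum_def)
qed (simp add: msum_def face_id zero_in assms(2))

lemma msum_degen:
  assumes "\<And>j. j \<in> set js \<Longrightarrow> x j \<in> sObj R \<and> y j \<in> sObj R \<and> f j \<in> sHom R k (x j) (y j)" "i \<le> k"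
  shows "msum R (Suc k) (map (\<lambda>j. sDegen R k i (f j)) js) = sDegen R k i (msum R k (map f js))"
  using assms(1)
proof (induction js)
  case (Cons j js)
  then have "lev.Tot (map x js) \<in> sObj R" "lev.Tot (map y js) \<in> sObj R" by (auto intro!: Tot_Ob')
  moreover have "msum R k (map f js) \<in> sHom R k (lev.Tot (map x js)) (lev.Tot (map y js))"
    using Cons by (intro msum_in) auto
  ultimately show ?case
    using Cons assms(2) plusM_degen[of "x j" "y j" "lev.Tot (map x js)" "lev.Tot (map y js)" "f j" k "msum R k (map f js)" i]
    by (simp add: msum_def)
qed (simp add: msum_def degen_id zero_in assms(2))

lemma mhom_entry:
  assumes "\<phi> \<in> mhom n k U V" "i < n" "j < n"
  shows "\<phi> $$ (i, j) \<in> sHom R k (U $$ (i, j)) (V $$ (i, j))"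
  using assms siso_in by (auto simp: mat_cat_def)

lemma mat_prodM_face_degen:
  assumes o: "U \<in> mob n" "U' \<in> mob n" "V \<in> mob n" "V' \<in> mob n"
  shows "\<phi> \<in> mhom n (Suc k) U V \<Longrightarrow> \<psi> \<in> mhom n (Suc k) U' V' \<Longrightarrow> i \<le> Suc k \<Longrightarrow>
      mat_prodM R k (sFace (mat_cat R n) k i \<phi>) (sFace (mat_cat R n) k i \<psi>) = sFace (mat_cat R n) k i (mat_prodM R (Suc k) \<phi> \<psi>)"
    and "\<phi> \<in> mhom n k U V \<Longrightarrow> \<psi> \<in> mhom n k U' V' \<Longrightarrow> i \<le> k \<Longrightarrow>
      mat_prodM R (Suc k) (sDegen (mat_cat R n) k i \<phi>) (sDegen (mat_cat R n) k i \<psi>) = sDegen (mat_cat R n) k i (mat_prodM R k \<phi> \<psi>)"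
proof -
  have *: "U $$ (a, j) \<in> sObj R" if "U \<in> mob n" "a < n" "j < n" for U a j using that by (simp add: mob_iff)
  {
    assume h: "\<phi> \<in> mhom n (Suc k) U V" "\<psi> \<in> mhom n (Suc k) U' V'" and i: "i \<le> Suc k"
    note d = carrier_matD[OF mhom_carrier[OF h(1)]] carrier_matD[OF mhom_carrier[OF h(2)]]
    have "msum R k (map (\<lambda>j. rtimesM R k (map_mat (sFace R k i) \<phi> $$ (a, j)) (map_mat (sFace R k i) \<psi> $$ (j, b))) [0..<n])
      = sFace R k i (msum R (Suc k) (map (\<lambda>j. rtimesM R (Suc k) (\<phi> $$ (a, j)) (\<psi> $$ (j, b))) [0..<n]))"
      if "a < n" "b < n" for a b
    proof -
      have "map (\<lambda>j. rtimesM R k (map_mat (sFace R k i) \<phi> $$ (a, j)) (map_mat (sFace R k i) \<psi> $$ (j, b))) [0..<n] =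
         map (\<lambda>j. sFace R k i (rtimesM R (Suc k) (\<phi> $$ (a, j)) (\<psi> $$ (j, b)))) [0..<n]"
        using timesM_face[OF *[OF o(1) that(1)] *[OF o(3) that(1)] *[OF o(2) _ that(2)] *[OF o(4) _ that(2)]
            mhom_entry[OF h(1) that(1)] mhom_entry[OF h(2) _ that(2)] i] d that by (intro map_upt_cong) simp
      also have "msum R k \<dots> = sFace R k i (msum R (Suc k) (map (\<lambda>j. rtimesM R (Suc k) (\<phi> $$ (a, j)) (\<psi> $$ (j, b))) [0..<n]))"
        by (rule msum_face[where x = "\<lambda>j. U $$ (a, j) [*] U' $$ (j, b)" and y = "\<lambda>j. V $$ (a, j) [*] V' $$ (j, b)"])
          (use that o * mhom_entry[OF h(1)] mhom_entry[OF h(2)] i in \<open>auto intro!: times_in timesM_in\<close>)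
      finally show ?thesis .
    qed
    then show "mat_prodM R k (sFace (mat_cat R n) k i \<phi>) (sFace (mat_cat R n) k i \<psi>) = sFace (mat_cat R n) k i (mat_prodM R (Suc k) \<phi> \<psi>)"
      using d by (intro eq_matI) (simp_all add: mat_prodM_def mat_cat_def)
  }
  {
    assume h: "\<phi> \<in> mhom n k U V" "\<psi> \<in> mhom n k U' V'" and i: "i \<le> k"
    note d = carrier_matD[OF mhom_carrier[OF h(1)]] carrier_matD[OF mhom_carrier[OF h(2)]]
    have "msum R (Suc k) (map (\<lambda>j. rtimesM R (Suc k) (map_mat (sDegen R k i) \<phi> $$ (a, j)) (map_mat (sDegen R k i) \<psi> $$ (j, b))) [0..<n])
      = sDegen R k i (msum R k (map (\<lambda>j. rtimesM R k (\<phi> $$ (a, j)) (\<psi> $$ (j, b))) [0..<n]))"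
      if "a < n" "b < n" for a b
    proof -
      have "map (\<lambda>j. rtimesM R (Suc k) (map_mat (sDegen R k i) \<phi> $$ (a, j)) (map_mat (sDegen R k i) \<psi> $$ (j, b))) [0..<n] =
         map (\<lambda>j. sDegen R k i (rtimesM R k (\<phi> $$ (a, j)) (\<psi> $$ (j, b)))) [0..<n]"
        using timesM_degen[OF *[OF o(1) that(1)] *[OF o(3) that(1)] *[OF o(2) _ that(2)] *[OF o(4) _ that(2)]
            mhom_entry[OF h(1) that(1)] mhom_entry[OF h(2) _ that(2)] i] d that by (intro map_upt_cong) simp
      also have "msum R (Suc k) \<dots> = sDegen R k i (msum R k (map (\<lambda>j. rtimesM R k (\<phi> $$ (a, j)) (\<psi> $$ (j, b))) [0..<n]))"
        by (rule msum_degen[where x = "\<lambda>j. U $$ (a, j) [*] U' $$ (j, b)" and y = "\<lambda>j. V $$ (a, j) [*] V' $$ (j, b)"])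
          (use that o * mhom_entry[OF h(1)] mhom_entry[OF h(2)] i in \<open>auto intro!: times_in timesM_in\<close>)
      finally show ?thesis .
    qed
    then show "mat_prodM R (Suc k) (sDegen (mat_cat R n) k i \<phi>) (sDegen (mat_cat R n) k i \<psi>) = sDegen (mat_cat R n) k i (mat_prodM R k \<phi> \<psi>)"
      using d by (intro eq_matI) (simp_all add: mat_prodM_def mat_cat_def)
  }
qed

lemma mat_prod_functor:
  "sfunctor (prod_cat (mat_cat R n) (mat_cat R n)) (mat_cat R n) (\<lambda>(U, V). mat_prod R U V) (\<lambda>k (\<phi>, \<psi>). mat_prodM R k \<phi> \<psi>)"
  by (unfold_locales; simp add: prod_cat_def split_beta mem_Times_iff)
    (auto simp: mat_prod_in mat_prodM_in mat_prodM_id mat_prodM_comp mat_prodM_face_degen)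

end

section \<open>The associativity isomorphism of matrix multiplication\<close>

text \<open>
  The degenerate \<open>k\<close>-simplex on an arrow of dimension \<open>0\<close>. It commutes with all operations, so it
  carries the associativity isomorphism of dimension \<open>0\<close> to the one formed in dimension \<open>k\<close>, whose
  naturality has been proved.
\<close>

definition arr_deg :: "('o, 'm, 'z) scat_scheme \<Rightarrow> nat \<Rightarrow> 'o \<times> 'o \<times> 'm \<Rightarrow> 'o \<times> 'o \<times> 'm" where
  "arr_deg C k f = (arr_dom f, arr_cod f, degens C k (arr_mor f))"

context strict_bimonoidal_category
begin

lemma degens_plus:
  assumes "a \<in> sObj R" "a' \<in> sObj R" "b \<in> sObj R" "b' \<in> sObj R" "f \<in> sHom R 0 a a'" "g \<in> sHom R 0 b b'"
  shows "degens R k (rplusM R 0 f g) = rplusM R k (degens R k f) (degens R k g)"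
proof (induction k)
  case (Suc k)
  have "degens R k f \<in> sHom R k a a'" "degens R k g \<in> sHom R k b b'" using assms degens_in by auto
  with Suc assms show ?case by (simp add: plusM_degen[of a a' b b', symmetric])
qed simp

lemma arr_deg_id [simp]: "a \<in> sObj R \<Longrightarrow> arr_deg R k (arr_id R 0 a) = arr_id R k a"
  by (auto simp: arr_deg_def arr_id_def degens_id)

lemma arr_deg_gam: "arr_deg R k (arr_gam R 0 a b) = arr_gam R k a b"
  and arr_deg_del: "arr_deg R k (arr_del R 0 a b c) = arr_del R k a b c"
  by (auto simp: arr_deg_def arr_gam_def arr_del_def)

lemma arr_deg_comp:
  "f \<in> arrows R 0 \<Longrightarrow> g \<in> arrows R 0 \<Longrightarrow> arr_dom g = arr_cod f
    \<Longrightarrow> arr_deg R k (arr_comp R 0 g f) = arr_comp R k (arr_deg R k g) (arr_deg R k f)"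
  by (auto simp: arr_deg_def arr_comp_def arrows_def degens_comp)

lemma arr_deg_plus:
  "f \<in> arrows R 0 \<Longrightarrow> g \<in> arrows R 0
    \<Longrightarrow> arr_deg R k (arr_plus R 0 f g) = arr_plus R k (arr_deg R k f) (arr_deg R k g)"
  by (auto simp: arr_deg_def arr_plus_def arrows_def degens_plus)

context
  notes image_subset_iff [simp]
begin

lemma arr_deg_Tot_ar:
  assumes [simp]: "\<And>i. f i \<in> arrows R 0"
  shows "arr_deg R k (lev.Tot_ar 0 (map f is)) = lev.Tot_ar k (map (\<lambda>i. arr_deg R k (f i)) is)"
  by (induction "is") (simp_all add: arr_deg_plus)

lemma arr_deg_merge:
  assumes [simp]: "\<And>i. f i \<in> sObj R" "\<And>i. g i \<in> sObj R"
  shows "arr_deg R k (lev.merge 0 (map f is) (map g is)) = lev.merge k (map f is) (map g is)"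
  by (induction "is") (simp_all add: arr_deg_plus arr_deg_comp arr_deg_gam)

lemma arr_deg_interchange:
  assumes [simp]: "\<And>i j. x i j \<in> sObj R"
  shows "arr_deg R k (lev.interchange 0 x js ks) = lev.interchange k x js ks"
  by (induction js) (simp_all add: arr_deg_plus arr_deg_comp arr_deg_merge)

lemma arr_deg_distr:
  assumes [simp]: "a \<in> sObj R" "\<And>i. b i \<in> sObj R"
  shows "arr_deg R k (lev.distr 0 a (map b is)) = lev.distr k a (map b is)"
  by (induction "is") (simp_all add: arr_deg_plus arr_deg_comp arr_deg_del)

lemma arr_deg_assoc_entry:
  assumes [simp]: "\<And>p. u p \<in> sObj R" "\<And>p q. v p q \<in> sObj R" "\<And>q. w q \<in> sObj R"
  shows "arr_deg R k (lev.assoc_entry 0 u v w ps qs) = lev.assoc_entry k u v w ps qs"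
  unfolding lev.assoc_entry_def
  by (subst arr_deg_comp) (simp_all add: arr_deg_interchange arr_deg_Tot_ar arr_deg_distr comp_def)

end

lemma arr_gam_mor: "arr_mor (arr_gam R 0 a b) = rgam R a b"
  and arr_del_mor: "arr_mor (arr_del R 0 a b c) = rdelta R a b c"
  by (simp_all add: arr_gam_def arr_del_def)

lemma merge_iso_eq: "merge_iso R xs ys = arr_mor (lev.merge 0 xs ys)"
  by (induction xs ys rule: lev.merge.induct) (simp_all add: osum_eq_Tot arr_gam_mor)

lemma interchange_iso_eq: "interchange_iso R x js ks = arr_mor (lev.interchange 0 x js ks)"
  by (induction js) (simp_all add: osum_eq_Tot merge_iso_eq)

lemma dist_iso_eq: "dist_iso R a bs = arr_mor (lev.distr 0 a bs)"
  by (induction bs) (simp_all add: osum_eq_Tot arr_del_mor)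

text \<open>
  The entry in row \<open>i\<close> and column \<open>l\<close> of the associativity isomorphism, in dimension \<open>k\<close>.
\<close>

abbreviation assoc_at :: "nat \<Rightarrow> nat \<Rightarrow> 'o mat \<Rightarrow> 'o mat \<Rightarrow> 'o mat \<Rightarrow> nat \<Rightarrow> nat \<Rightarrow> 'o \<times> 'o \<times> 'm" where
  "assoc_at n k U V W i l \<equiv> lev.assoc_entry k (ent R n U i) (ent R n V) (\<lambda>q. ent R n W q l) [0..<n] [0..<n]"

lemma mat_assoc_carrier: "U \<in> mob n \<Longrightarrow> W \<in> mob n \<Longrightarrow> mat_assoc R U V W \<in> carrier_mat n n"
  by (auto simp: mat_assoc_def dest!: mob_carrier)

lemma assoc_at_dom_cod:
  assumes "U \<in> mob n" "V \<in> mob n" "W \<in> mob n"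
  shows "assoc_at n k U V W i l \<in> arrows R k"
    "arr_dom (assoc_at n k U V W i l) = ent R n (mat_prod R U (mat_prod R V W)) i l"
    "arr_cod (assoc_at n k U V W i l) = ent R n (mat_prod R (mat_prod R U V) W) i l"
  using assms by (simp_all add: ent_mat_prod mat_prod_in)

lemma ent_ar_mat_assoc:
  assumes U: "U \<in> mob n" and V: "V \<in> mob n" and W: "W \<in> mob n"
  shows "ent_ar R n 0 (mat_prod R U (mat_prod R V W)) (mat_prod R (mat_prod R U V) W) (mat_assoc R U V W) i l
    = assoc_at n 0 U V W i l"
proof (cases "i < n \<and> l < n")
  case True
  have d: "dim_row U = n" "dim_col W = n" "dim_col U = n" "dim_col V = n"
    using mob_carrier[OF U] mob_carrier[OF W] mob_carrier[OF V] by auto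
  have "arr_mor (assoc_at n 0 U V W i l) = mat_assoc R U V W $$ (i, l)"
  proof -
    have "interchange_iso R (\<lambda>p q. (ent R n U i p [*] ent R n V p q) [*] ent R n W q l) [0..<n] [0..<n] =
       interchange_iso R (\<lambda>p q. (U $$ (i, p) [*] V $$ (p, q)) [*] W $$ (q, l)) [0..<n] [0..<n]"
      using True unfolding interchange_iso_eq
      by (intro arg_cong[where f = arr_mor] lev.interchange_cong) (auto simp: ent_def)
    moreover have "map (\<lambda>p. dist_iso R (ent R n U i p) (map (\<lambda>q. ent R n V p q [*] ent R n W q l) [0..<n])) [0..<n]
       = map (\<lambda>p. dist_iso R (U $$ (i, p)) (map (\<lambda>q. V $$ (p, q) [*] W $$ (q, l)) [0..<n])) [0..<n]"
      using True by (auto simp: ent_def intro!: arg_cong[of _ _ "dist_iso R _"])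
    moreover have "arr_mor (assoc_at n 0 U V W i l) = sComp R 0
        (interchange_iso R (\<lambda>p q. (ent R n U i p [*] ent R n V p q) [*] ent R n W q l) [0..<n] [0..<n])
        (msum R 0 (map (\<lambda>p. dist_iso R (ent R n U i p) (map (\<lambda>q. ent R n V p q [*] ent R n W q l) [0..<n])) [0..<n]))"
      by (simp add: lev.assoc_entry_def interchange_iso_eq msum_eq_Tot_ar[symmetric] comp_def dist_iso_eq)
    ultimately have "arr_mor (assoc_at n 0 U V W i l) = sComp R 0
        (interchange_iso R (\<lambda>p q. (U $$ (i, p) [*] V $$ (p, q)) [*] W $$ (q, l)) [0..<n] [0..<n])
        (msum R 0 (map (\<lambda>p. dist_iso R (U $$ (i, p)) (map (\<lambda>q. V $$ (p, q) [*] W $$ (q, l)) [0..<n])) [0..<n]))"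
      by (simp only:)
    with True show ?thesis by (simp add: mat_assoc_def d)
  qed
  with True show ?thesis
    by (intro arr_eqI) (simp_all only: ent_ar_dom ent_ar_cod assoc_at_dom_cod[OF U V W], simp add: ent_ar_def)
next
  case False
  \<comment> \<open>Outside the index range all terms of the double sum are \<open>0\<close>, so the right side is an identity
    too.\<close>
  have "assoc_at n 0 U V W i l = arr_id R 0 (lev.Tot (map (\<lambda>p. ent R n U i p [*] lev.Tot (map (\<lambda>q. ent R n V p q [*] ent R n W q l) [0..<n])) [0..<n]))"
  proof (rule lev0.assoc_entry_idn)
    have z: "ent R n U i p = rzero R \<or> (\<forall>q. ent R n V p q [*] ent R n W q l = rzero R)" for p
    proof (cases "i < n")
      case True
      with False have "ent R n W q l = rzero R" for q by (simp add: ent_def)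
      with V show ?thesis by simp
    qed (simp add: ent_def)
    then show "ent R n U i p = rzero R \<or> ent R n U i p = rone R \<or> (\<exists>q0. \<forall>q. q \<noteq> q0 \<longrightarrow> ent R n V p q [*] ent R n W q l = rzero R)" for p
      by blast
    have "ent R n U i p [*] (ent R n V p q [*] ent R n W q l) = rzero R" for p q
      using z[of p] U V W by (elim disjE) simp_all
    then show "ent R n U i p [*] (ent R n V p q' [*] ent R n W q' l) = rzero R \<or> ent R n U i p' [*] (ent R n V p' q [*] ent R n W q l) = rzero R" for p p' q q'
      by blast
  qed (use U V W in simp_all)
  also have "lev.Tot (map (\<lambda>p. ent R n U i p [*] lev.Tot (map (\<lambda>q. ent R n V p q [*] ent R n W q l) [0..<n])) [0..<n])
     = ent R n (mat_prod R U (mat_prod R V W)) i l"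
    using U V W by (simp add: ent_mat_prod mat_prod_in)
  finally have "assoc_at n 0 U V W i l = arr_id R 0 (ent R n (mat_prod R U (mat_prod R V W)) i l)" .
  moreover have "ent_ar R n 0 (mat_prod R U (mat_prod R V W)) (mat_prod R (mat_prod R U V) W) (mat_assoc R U V W) i l
      = arr_id R 0 (ent R n (mat_prod R U (mat_prod R V W)) i l)"
    using False by (auto simp: ent_ar_def ent_def)
  ultimately show ?thesis by (simp only:)
qed

lemma mat_assoc_in:
  assumes "U \<in> mob n" "V \<in> mob n" "W \<in> mob n"
  shows "mat_assoc R U V W \<in> mhom n 0 (mat_prod R U (mat_prod R V W)) (mat_prod R (mat_prod R U V) W)"
proof -
  have "lev.invertible 0 (assoc_at n 0 U V W i l)" for i l
    by (rule lev0.invertible_assoc_entry) (use assms invertible_del in auto)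
  with assms show ?thesis by (simp add: mhom_iff mat_prod_in mat_assoc_carrier ent_ar_mat_assoc)
qed

lemma degens_mat: "degens (mat_cat R n) k \<phi> = map_mat (degens R k) \<phi>"
  by (induction k) (auto simp: mat_cat_def)

lemma ent_ar_degens:
  assumes "\<phi> \<in> carrier_mat n n"
  shows "ent_ar R n k U V (degens (mat_cat R n) k \<phi>) i j = arr_deg R k (ent_ar R n 0 U V \<phi> i j)"
  using assms arr_deg_id[OF zero_in, of k] by (auto simp: ent_ar_def degens_mat arr_deg_def[of R k "(_, _)"])

text \<open>
  After the passage to dimension \<open>k\<close> by \<open>arr_deg_assoc_entry\<close>, this is \<open>assoc_entry_natural\<close> for
  each entry.
\<close>

lemma mat_assoc_natural:
  assumes o: "U \<in> mob n" "V \<in> mob n" "W \<in> mob n" "U' \<in> mob n" "V' \<in> mob n" "W' \<in> mob n"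
    and h: "\<phi> \<in> mhom n k U U'" "\<psi> \<in> mhom n k V V'" "\<chi> \<in> mhom n k W W'"
  shows "sComp (mat_cat R n) k (degens (mat_cat R n) k (mat_assoc R U' V' W')) (mat_prodM R k \<phi> (mat_prodM R k \<psi> \<chi>))
    = sComp (mat_cat R n) k (mat_prodM R k (mat_prodM R k \<phi> \<psi>) \<chi>) (degens (mat_cat R n) k (mat_assoc R U V W))"
proof (rule ent_ar_eqI)
  fix i l
  let ?S = "mat_prod R U (mat_prod R V W)" and ?S' = "mat_prod R U' (mat_prod R V' W')"
  let ?T = "mat_prod R (mat_prod R U V) W" and ?T' = "mat_prod R (mat_prod R U' V') W'"
  note c = mat_prod_in[OF o(2,3)] mat_prod_in[OF o(5,6)] mat_prod_in[OF o(1,2)] mat_prod_in[OF o(4,5)]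
    mat_prodM_in[OF o(2,3,5,6) h(2,3)] mat_prodM_in[OF o(1,2,4,5) h(1,2)]
  note n = lev.assoc_entry_natural[of "ent_ar R n k U U' \<phi> i" k "ent_ar R n k V V' \<psi>" "\<lambda>q. ent_ar R n k W W' \<chi> q l" "[0..<n]" "[0..<n]"]
  have "ent_ar R n k ?S ?T' (sComp (mat_cat R n) k (degens (mat_cat R n) k (mat_assoc R U' V' W')) (mat_prodM R k \<phi> (mat_prodM R k \<psi> \<chi>))) i l
    = arr_comp R k (ent_ar R n k ?S' ?T' (degens (mat_cat R n) k (mat_assoc R U' V' W')) i l) (ent_ar R n k ?S ?S' (mat_prodM R k \<phi> (mat_prodM R k \<psi> \<chi>)) i l)"
    by (rule ent_ar_comp)
  also have "\<dots> = arr_comp R k (assoc_at n k U' V' W' i l) (lev.Tot_ar k (map (\<lambda>p. arr_times R k (ent_ar R n k U U' \<phi> i p)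
      (lev.Tot_ar k (map (\<lambda>q. arr_times R k (ent_ar R n k V V' \<psi> p q) (ent_ar R n k W W' \<chi> q l)) [0..<n]))) [0..<n]))"
    using o h c by (simp add: ent_ar_degens mat_assoc_carrier ent_ar_mat_assoc arr_deg_assoc_entry ent_ar_mat_prodM)
  also have "\<dots> = arr_comp R k (lev.Tot_ar k (map (\<lambda>q. arr_times R k
      (lev.Tot_ar k (map (\<lambda>p. arr_times R k (ent_ar R n k U U' \<phi> i p) (ent_ar R n k V V' \<psi> p q)) [0..<n])) (ent_ar R n k W W' \<chi> q l)) [0..<n])) (assoc_at n k U V W i l)"
    using n o h by simp
  also have "\<dots> = arr_comp R k (ent_ar R n k ?T ?T' (mat_prodM R k (mat_prodM R k \<phi> \<psi>) \<chi>) i l) (ent_ar R n k ?S ?T (degens (mat_cat R n) k (mat_assoc R U V W)) i l)"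
    using o h c by (simp add: ent_ar_degens mat_assoc_carrier ent_ar_mat_assoc arr_deg_assoc_entry ent_ar_mat_prodM)
  also have "\<dots> = ent_ar R n k ?S ?T' (sComp (mat_cat R n) k (mat_prodM R k (mat_prodM R k \<phi> \<psi>) \<chi>) (degens (mat_cat R n) k (mat_assoc R U V W))) i l"
    by (rule ent_ar_comp[symmetric])
  finally show "ent_ar R n k ?S ?T' (sComp (mat_cat R n) k (degens (mat_cat R n) k (mat_assoc R U' V' W')) (mat_prodM R k \<phi> (mat_prodM R k \<psi> \<chi>))) i l
    = ent_ar R n k ?S ?T' (sComp (mat_cat R n) k (mat_prodM R k (mat_prodM R k \<phi> \<psi>) \<chi>) (degens (mat_cat R n) k (mat_assoc R U V W))) i l" .
qed (rule mat_comp_carrier)+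

lemma mat_assoc_pentagon:
  assumes o: "J \<in> mob n" "H \<in> mob n" "G \<in> mob n" "F \<in> mob n"
  shows "sComp (mat_cat R n) 0 (mat_assoc R (mat_prod R J H) G F) (mat_assoc R J H (mat_prod R G F)) =
    sComp (mat_cat R n) 0 (mat_prodM R 0 (mat_assoc R J H G) (sId (mat_cat R n) 0 F))
      (sComp (mat_cat R n) 0 (mat_assoc R J (mat_prod R H G) F) (mat_prodM R 0 (sId (mat_cat R n) 0 J) (mat_assoc R H G F)))"
proof (rule ent_ar_eqI)
  fix i l
  interpret M: scategory "mat_cat R n" by (rule scategory_mat_cat)
  let ?A = "mat_prod R J (mat_prod R H (mat_prod R G F))"
  let ?B = "mat_prod R (mat_prod R J H) (mat_prod R G F)"
  let ?C = "mat_prod R (mat_prod R (mat_prod R J H) G) F"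
  let ?D = "mat_prod R J (mat_prod R (mat_prod R H G) F)"
  let ?E = "mat_prod R (mat_prod R J (mat_prod R H G)) F"
  note c = mat_prod_in[OF o(1,2)] mat_prod_in[OF o(2,3)] mat_prod_in[OF o(3,4)] mat_assoc_in[OF o(2,3,4)] mat_assoc_in[OF o(1,2,3)]
    M.id_in[OF o(1), of 0] M.id_in[OF o(4), of 0]
  note c2 = mat_prod_in[OF c(1) o(3)] mat_prod_in[OF c(2) o(4)] mat_prod_in[OF o(1) c(2)] mat_prod_in[OF o(2) c(3)]
  have e: "ent R n (mat_prod R U V) = (\<lambda>i l. lev.Tot (map (\<lambda>j. ent R n U i j [*] ent R n V j l) [0..<n]))"
    if "U \<in> mob n" "V \<in> mob n" for U V using that by (auto simp: ent_mat_prod fun_eq_iff)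
  have "ent_ar R n 0 ?A ?C (sComp (mat_cat R n) 0 (mat_assoc R (mat_prod R J H) G F) (mat_assoc R J H (mat_prod R G F))) i l
    = arr_comp R 0 (assoc_at n 0 (mat_prod R J H) G F i l) (assoc_at n 0 J H (mat_prod R G F) i l)"
    using o c by (simp add: ent_ar_comp[where V = ?B] ent_ar_mat_assoc)
  also have "\<dots> = arr_comp R 0 (lev.Tot_ar 0 (map (\<lambda>r. arr_times R 0 (assoc_at n 0 J H G i r) (arr_id R 0 (ent R n F r l))) [0..<n]))
     (arr_comp R 0 (assoc_at n 0 J (mat_prod R H G) F i l)
     (lev.Tot_ar 0 (map (\<lambda>p. arr_times R 0 (arr_id R 0 (ent R n J i p)) (assoc_at n 0 H G F p l)) [0..<n])))"
    using o lev0.assoc_entry_pentagon[of "ent R n J i" "ent R n H" "ent R n G" "\<lambda>r. ent R n F r l" "[0..<n]" "[0..<n]" "[0..<n]"]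
    by (simp add: e)
  also have "\<dots> = arr_comp R 0 (ent_ar R n 0 ?E ?C (mat_prodM R 0 (mat_assoc R J H G) (sId (mat_cat R n) 0 F)) i l)
    (arr_comp R 0 (ent_ar R n 0 ?D ?E (mat_assoc R J (mat_prod R H G) F) i l)
     (ent_ar R n 0 ?A ?D (mat_prodM R 0 (sId (mat_cat R n) 0 J) (mat_assoc R H G F)) i l))"
    using o c c2 by (simp add: ent_ar_mat_assoc ent_ar_mat_prodM ent_ar_id)
  also have "\<dots> = ent_ar R n 0 ?A ?C (sComp (mat_cat R n) 0 (mat_prodM R 0 (mat_assoc R J H G) (sId (mat_cat R n) 0 F))
      (sComp (mat_cat R n) 0 (mat_assoc R J (mat_prod R H G) F) (mat_prodM R 0 (sId (mat_cat R n) 0 J) (mat_assoc R H G F)))) i l"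
    unfolding ent_ar_comp[where U = ?A and V = ?E and W = ?C] ent_ar_comp[where U = ?A and V = ?D and W = ?E] by (rule refl)
  finally show "ent_ar R n 0 ?A ?C (sComp (mat_cat R n) 0 (mat_assoc R (mat_prod R J H) G F) (mat_assoc R J H (mat_prod R G F))) i l
    = ent_ar R n 0 ?A ?C (sComp (mat_cat R n) 0 (mat_prodM R 0 (mat_assoc R J H G) (sId (mat_cat R n) 0 F))
      (sComp (mat_cat R n) 0 (mat_assoc R J (mat_prod R H G) F) (mat_prodM R 0 (sId (mat_cat R n) 0 J) (mat_assoc R H G F)))) i l" .
qed (rule mat_comp_carrier)+

text \<open>
  Morphisms of matrices consist of isomorphisms, and a choice of inverses of the entries is an
  inverse.
\<close>

lemma mhom_siso:
  assumes o: "U \<in> mob n" "V \<in> mob n" and h: "\<phi> \<in> mhom n k U V"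
  shows "siso (mat_cat R n) k U V \<phi>"
proof -
  let ?P = "\<lambda>i j g. siso R k (V $$ (i, j)) (U $$ (i, j)) g \<and> sComp R k g (\<phi> $$ (i, j)) = sId R k (U $$ (i, j)) \<and>
     sComp R k (\<phi> $$ (i, j)) g = sId R k (V $$ (i, j))"
  have "\<exists>g. ?P i j g" if "i < n" "j < n" for i j
  proof -
    have "siso R k (U $$ (i, j)) (V $$ (i, j)) (\<phi> $$ (i, j))" using h that by (simp add: mat_cat_def)
    then show ?thesis unfolding siso_def by blast
  qed
  then have g: "?P i j (SOME g. ?P i j g)" if "i < n" "j < n" for i j
    using that by (intro someI_ex[of "?P i j"]) blast
  let ?g = "mat n n (\<lambda>(i, j). SOME g. ?P i j g)"
  have "?g \<in> mhom n k V U" using g by (simp add: mat_cat_def)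
  moreover have "sComp (mat_cat R n) k ?g \<phi> = sId (mat_cat R n) k U" "sComp (mat_cat R n) k \<phi> ?g = sId (mat_cat R n) k V"
    using g mob_carrier[OF o(1)] mob_carrier[OF o(2)] by (auto simp: mat_cat_def intro!: eq_matI)
  ultimately show ?thesis using h unfolding siso_def by blast
qed

end

section \<open>Block diagonal families\<close>

text \<open>
  The total family of entries of a block diagonal matrix; \<open>z\<close> fills the off-diagonal blocks.
\<close>

definition blk :: "'x \<Rightarrow> nat \<Rightarrow> (nat \<Rightarrow> nat \<Rightarrow> 'x) \<Rightarrow> (nat \<Rightarrow> nat \<Rightarrow> 'x) \<Rightarrow> nat \<Rightarrow> nat \<Rightarrow> 'x" where
  "blk z n A B i j = (if i < n \<and> j < n then A i j else if n \<le> i \<and> n \<le> j then B (i - n) (j - n) else z)"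

lemma filter_upt_less: "filter (\<lambda>j. j < n) [0..<n + m] = [0..<n]"
  using upt_add_eq_append[of 0 n m] by simp

lemma filter_upt_ge: "filter (\<lambda>j. n \<le> j) [0..<n + m] = map ((+) n) [0..<m]"
proof -
  have "[n..<n + m] = map ((+) n) [0..<m]" by (rule nth_equalityI) auto
  moreover have "filter (\<lambda>j. n \<le> j) [0..<n] = []" "filter (\<lambda>j. n \<le> j) [n..<n + m] = [n..<n + m]"
    by (auto simp: filter_empty_conv filter_id_conv)
  ultimately show ?thesis using upt_add_eq_append[of 0 n m] by simp
qed

text \<open>
  The strict multiplicativity of block matrices. The sum \<open>T\<close> and the product \<open>mul\<close> are abstract,
  since this is needed for objects, for arrows, and for elements of a semiring; what these sums
  have in common is that zero terms can be dropped.
\<close>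

lemma blk_mult:
  fixes T :: "'x list \<Rightarrow> 'x" and mul :: "'x \<Rightarrow> 'x \<Rightarrow> 'x"
  assumes filt: "\<And>f P (js :: nat list). (\<And>j. f j \<in> X) \<Longrightarrow> (\<And>j. \<not> P j \<Longrightarrow> f j = z) \<Longrightarrow> T (map f js) = T (map f (filter P js))"
    and [simp]: "T [] = z" "z \<in> X" "\<And>a. a \<in> X \<Longrightarrow> mul z a = z" "\<And>a. a \<in> X \<Longrightarrow> mul a z = z"
      "\<And>a b. a \<in> X \<Longrightarrow> b \<in> X \<Longrightarrow> mul a b \<in> X"
    and [simp]: "\<And>i j. A i j \<in> X" "\<And>i j. A' i j \<in> X" "\<And>i j. B i j \<in> X" "\<And>i j. B' i j \<in> X"
  shows "T (map (\<lambda>j. mul (blk z n A B i j) (blk z n A' B' j l)) [0..<n + m])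
    = blk z n (\<lambda>i l. T (map (\<lambda>j. mul (A i j) (A' j l)) [0..<n])) (\<lambda>i l. T (map (\<lambda>j. mul (B i j) (B' j l)) [0..<m])) i l"
proof -
  have X [simp]: "blk z n A B i j \<in> X" "blk z n A' B' i j \<in> X" for i j by (simp_all add: blk_def)
  have zeros: "T (map (\<lambda>j. z) js) = z" for js :: "nat list" using filt[of "\<lambda>_. z" "\<lambda>_. False" js] by simp
  show ?thesis
  proof (cases "i < n")
    case True
    then have "T (map (\<lambda>j. mul (blk z n A B i j) (blk z n A' B' j l)) [0..<n + m])
      = T (map (\<lambda>j. mul (blk z n A B i j) (blk z n A' B' j l)) (filter (\<lambda>j. j < n) [0..<n + m]))"
      by (intro filt) (simp_all, simp add: blk_def)
    also have "\<dots> = T (map (\<lambda>j. if l < n then mul (A i j) (A' j l) else z) [0..<n])"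
      unfolding filter_upt_less by (rule arg_cong[of _ _ T]) (use True in \<open>auto simp: blk_def\<close>)
    finally show ?thesis using True by (simp add: blk_def zeros)
  next
    case False
    then have "T (map (\<lambda>j. mul (blk z n A B i j) (blk z n A' B' j l)) [0..<n + m])
      = T (map (\<lambda>j. mul (blk z n A B i j) (blk z n A' B' j l)) (filter (\<lambda>j. n \<le> j) [0..<n + m]))"
      by (intro filt) (simp_all, simp add: blk_def)
    also have "\<dots> = T (map (\<lambda>j. if n \<le> l then mul (B (i - n) j) (B' j (l - n)) else z) [0..<m])"
      unfolding filter_upt_ge map_map by (rule arg_cong[of _ _ T]) (use False in \<open>auto simp: blk_def\<close>)
    finally show ?thesis using False by (simp add: blk_def zeros)
  qed
qed

lemma blk_blk: "blk z (n + m) (blk z n A B) C = blk z n A (blk z m B C)"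
  by (auto simp: blk_def fun_eq_iff)

context bimonoidal_coherence
begin

lemma assoc_entry_cong:
  assumes "\<And>p. p \<in> set ps \<Longrightarrow> u p = u' p" "\<And>p q. p \<in> set ps \<Longrightarrow> q \<in> set qs \<Longrightarrow> v p q = v' p q" "\<And>q. q \<in> set qs \<Longrightarrow> w q = w' q"
  shows "assoc_entry u v w ps qs = assoc_entry u' v' w' ps qs"
proof -
  have "interchange (\<lambda>p q. (u p \<^bold>* v p q) \<^bold>* w q) ps qs = interchange (\<lambda>p q. (u' p \<^bold>* v' p q) \<^bold>* w' q) ps qs"
    by (rule interchange_cong) (use assms in auto)
  moreover have "map (\<lambda>p. distr (u p) (map (\<lambda>q. v p q \<^bold>* w q) qs)) ps = map (\<lambda>p. distr (u' p) (map (\<lambda>q. v' p q \<^bold>* w' q) qs)) ps"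
    using assms by (auto intro!: arg_cong[of _ _ "distr _"])
  ultimately show ?thesis unfolding assoc_entry_def by (simp only:)
qed

lemma assoc_entry_zero_right:
  assumes [simp]: "\<And>p. u p \<in> Ob" "\<And>p q. v p q \<in> Ob"
  shows "assoc_entry u v (\<lambda>_. zero) [0..<n] [0..<m] = idn zero"
proof -
  have "Tot (map (\<lambda>_. zero) js) = zero" for js :: "nat list" by (rule Tot_zero) auto
  moreover have "assoc_entry u v (\<lambda>_. zero) [0..<n] [0..<m] = idn (Tot (map (\<lambda>p. u p \<^bold>* Tot (map (\<lambda>q. v p q \<^bold>* zero) [0..<m])) [0..<n]))"
    by (rule assoc_entry_idn) simp_all
  ultimately show ?thesis by simp
qed

text \<open>
  Only the indices in the block of \<open>i\<close> support nonzero entries in row \<open>i\<close>, so \<open>assoc_entry_filter\<close>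
  cuts the sums down to that block.
\<close>

lemma assoc_entry_blk:
  assumes [simp]: "\<And>i j. U i j \<in> Ob" "\<And>i j. U' i j \<in> Ob" "\<And>i j. V i j \<in> Ob" "\<And>i j. V' i j \<in> Ob" "\<And>i j. W i j \<in> Ob" "\<And>i j. W' i j \<in> Ob"
  shows "assoc_entry (blk zero n U U' i) (blk zero n V V') (\<lambda>q. blk zero n W W' q l) [0..<n + m] [0..<n + m]
    = blk (idn zero) n (\<lambda>i l. assoc_entry (U i) V (\<lambda>q. W q l) [0..<n] [0..<n])
       (\<lambda>i l. assoc_entry (U' i) V' (\<lambda>q. W' q l) [0..<m] [0..<m]) i l"
proof -
  have X [simp]: "blk zero n U U' i j \<in> Ob" "blk zero n V V' i j \<in> Ob" "blk zero n W W' i j \<in> Ob" for i j by (simp_all add: blk_def)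
  show ?thesis
  proof (cases "i < n")
    case True
    then have "assoc_entry (blk zero n U U' i) (blk zero n V V') (\<lambda>q. blk zero n W W' q l) [0..<n + m] [0..<n + m]
      = assoc_entry (blk zero n U U' i) (blk zero n V V') (\<lambda>q. blk zero n W W' q l) (filter (\<lambda>j. j < n) [0..<n + m]) (filter (\<lambda>j. j < n) [0..<n + m])"
      by (intro assoc_entry_filter) (simp_all, simp_all add: blk_def)
    also have "\<dots> = assoc_entry (U i) V (\<lambda>q. if l < n then W q l else zero) [0..<n] [0..<n]"
      unfolding filter_upt_less by (rule assoc_entry_cong) (use True in \<open>auto simp: blk_def\<close>)
    finally show ?thesis using True by (simp add: blk_def assoc_entry_zero_right)
  next
    case False
    then have "assoc_entry (blk zero n U U' i) (blk zero n V V') (\<lambda>q. blk zero n W W' q l) [0..<n + m] [0..<n + m]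
      = assoc_entry (blk zero n U U' i) (blk zero n V V') (\<lambda>q. blk zero n W W' q l) (filter (\<lambda>j. n \<le> j) [0..<n + m]) (filter (\<lambda>j. n \<le> j) [0..<n + m])"
      by (intro assoc_entry_filter) (simp_all, simp_all add: blk_def)
    also have "\<dots> = assoc_entry (U' (i - n)) V' (\<lambda>q. if n \<le> l then W' q (l - n) else zero) [0..<m] [0..<m]"
      unfolding filter_upt_ge assoc_entry_map by (rule assoc_entry_cong) (use False in \<open>auto simp: blk_def\<close>)
    finally show ?thesis using False by (simp add: blk_def assoc_entry_zero_right)
  qed
qed

end

lemma (in sum_category) Tot_single:
  assumes "\<And>j. f j \<in> Ob" "\<And>j. j \<noteq> j' \<Longrightarrow> f j = zero" "j' \<in> set js" "distinct js"
  shows "Tot (map f js) = f j'"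
proof -
  have "filter (\<lambda>j. j = j') js = [j']" using assms(3,4) by (induction js) (auto simp: filter_empty_conv)
  moreover have "Tot (map f js) = Tot (map f (filter (\<lambda>j. j = j') js))" by (rule Tot_filter) (use assms in auto)
  ultimately show ?thesis using assms(1) by simp
qed

lemma (in sum_category) Tot_ar_single:
  assumes "\<And>j. f j \<in> Ar" "\<And>j. j \<noteq> j' \<Longrightarrow> f j = idn zero" "j' \<in> set js" "distinct js"
  shows "Tot_ar (map f js) = f j'"
proof -
  have "filter (\<lambda>j. j = j') js = [j']" using assms(3,4) by (induction js) (auto simp: filter_empty_conv)
  moreover have "Tot_ar (map f js) = Tot_ar (map f (filter (\<lambda>j. j = j') js))" by (rule Tot_ar_filter) (use assms in auto)
  ultimately show ?thesis using assms(1) by simp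
qed

section \<open>Permutation matrices\<close>

text \<open>
  Row \<open>i\<close> has its \<open>1\<close> in column \<open>s i\<close>, so that left multiplication by the matrix replaces row \<open>i\<close>
  by row \<open>s i\<close>.
\<close>

definition perm_mat :: "('o, 'm, 'z) bimon_scheme \<Rightarrow> nat \<Rightarrow> (nat \<Rightarrow> nat) \<Rightarrow> 'o mat" where
  "perm_mat R n s = mat n n (\<lambda>(i, j). if j = s i then rone R else rzero R)"

definition inverse_perms :: "nat \<Rightarrow> (nat \<Rightarrow> nat) \<Rightarrow> (nat \<Rightarrow> nat) \<Rightarrow> bool" where
  "inverse_perms n s t \<longleftrightarrow> (\<forall>i<n. s i < n \<and> t (s i) = i) \<and> (\<forall>j<n. t j < n \<and> s (t j) = j)"

lemma id_mat_eq_perm_mat: "id_mat R n = perm_mat R n (\<lambda>i. i)"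
  by (auto simp: id_mat_def perm_mat_def intro!: eq_matI)

context strict_bimonoidal_category
begin

lemma ent_perm_mat: "ent R n (perm_mat R n s) i j = (if i < n \<and> j < n \<and> j = s i then rone R else rzero R)"
  by (simp add: ent_def perm_mat_def)

lemma ent_perm_mat_inverse:
  assumes "inverse_perms n s t"
  shows "ent R n (perm_mat R n s) i j = (if i < n \<and> j < n \<and> i = t j then rone R else rzero R)"
  using assms unfolding ent_perm_mat inverse_perms_def by metis

lemma perm_mat_in [simp]: "perm_mat R n s \<in> mob n"
  by (rule mobI) (simp add: perm_mat_def, simp add: ent_perm_mat)

lemma perm_mat_times:
  assumes V: "V \<in> mob n" and s: "inverse_perms n s t"
  shows "ent R n (mat_prod R (perm_mat R n s) V) i l = (if i < n then ent R n V (s i) l else rzero R)"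
proof (cases "i < n")
  case True
  with s have si: "s i < n" by (auto simp: inverse_perms_def)
  have "lev.Tot (map (\<lambda>j. ent R n (perm_mat R n s) i j [*] ent R n V j l) [0..<n]) = ent R n (perm_mat R n s) i (s i) [*] ent R n V (s i) l"
    by (rule lev.Tot_single) (use V si in \<open>auto simp: ent_perm_mat\<close>)
  with True V si show ?thesis by (simp add: ent_mat_prod ent_perm_mat)
qed (simp add: ent_def)

lemma times_perm_mat:
  assumes V: "V \<in> mob n" and s: "inverse_perms n s t"
  shows "ent R n (mat_prod R V (perm_mat R n s)) i l = (if l < n then ent R n V i (t l) else rzero R)"
proof (cases "l < n")
  case True
  with s have tl: "t l < n" "s (t l) = l" by (auto simp: inverse_perms_def)
  have "lev.Tot (map (\<lambda>j. ent R n V i j [*] ent R n (perm_mat R n s) j l) [0..<n]) = ent R n V i (t l) [*] ent R n (perm_mat R n s) (t l) l"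
    by (rule lev.Tot_single) (use V tl in \<open>auto simp: ent_perm_mat_inverse[OF s]\<close>)
  with True V tl show ?thesis by (simp add: ent_mat_prod ent_perm_mat)
qed (simp add: ent_def)

lemma perm_mat_timesM:
  assumes U: "U \<in> mob n" and V: "V \<in> mob n" and h: "\<phi> \<in> mhom n k U V" and s: "inverse_perms n s t"
  shows "ent_ar R n k (mat_prod R (perm_mat R n s) U) (mat_prod R (perm_mat R n s) V) (mat_prodM R k (sId (mat_cat R n) k (perm_mat R n s)) \<phi>) i l
     = (if i < n then ent_ar R n k U V \<phi> (s i) l else arr_id R k (rzero R))"
proof (cases "i < n")
  case True
  interpret M: scategory "mat_cat R n" by (rule scategory_mat_cat)
  from True s have si: "s i < n" by (auto simp: inverse_perms_def)
  let ?f = "\<lambda>j. arr_times R k (arr_id R k (ent R n (perm_mat R n s) i j)) (ent_ar R n k U V \<phi> j l)"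
  have "lev.Tot_ar k (map ?f [0..<n]) = ?f (s i)"
    by (rule lev.Tot_ar_single) (use U V h si in \<open>auto simp: ent_perm_mat\<close>)
  with True U V h si show ?thesis by (simp add: ent_ar_mat_prodM M.id_in ent_ar_id) (simp add: ent_perm_mat)
qed (simp add: ent_ar_def)

lemma times_perm_matM:
  assumes U: "U \<in> mob n" and V: "V \<in> mob n" and h: "\<phi> \<in> mhom n k U V" and s: "inverse_perms n s t"
  shows "ent_ar R n k (mat_prod R U (perm_mat R n s)) (mat_prod R V (perm_mat R n s)) (mat_prodM R k \<phi> (sId (mat_cat R n) k (perm_mat R n s))) i l
     = (if l < n then ent_ar R n k U V \<phi> i (t l) else arr_id R k (rzero R))"
proof (cases "l < n")
  case True
  interpret M: scategory "mat_cat R n" by (rule scategory_mat_cat)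
  from True s have tl: "t l < n" "s (t l) = l" by (auto simp: inverse_perms_def)
  let ?f = "\<lambda>j. arr_times R k (ent_ar R n k U V \<phi> i j) (arr_id R k (ent R n (perm_mat R n s) j l))"
  have "lev.Tot_ar k (map ?f [0..<n]) = ?f (t l)"
    by (rule lev.Tot_ar_single) (use U V h tl in \<open>auto simp: ent_perm_mat_inverse[OF s]\<close>)
  with True U V h tl show ?thesis by (simp add: ent_ar_mat_prodM M.id_in ent_ar_id) (simp add: ent_perm_mat)
qed (simp add: ent_ar_def)

lemma inverse_perms_id: "inverse_perms n (\<lambda>i. i) (\<lambda>i. i)"
  by (simp add: inverse_perms_def)

lemma id_mat_in [simp]: "id_mat R n \<in> mob n"
  by (simp add: id_mat_eq_perm_mat)

lemma id_mat_times: "U \<in> mob n \<Longrightarrow> mat_prod R (id_mat R n) U = U"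
  and times_id_mat: "U \<in> mob n \<Longrightarrow> mat_prod R U (id_mat R n) = U"
  unfolding id_mat_eq_perm_mat
  by (auto intro!: ent_eqI[where n = n and R = R] mob_carrier
      simp: mat_prod_in perm_mat_times[OF _ inverse_perms_id] times_perm_mat[OF _ inverse_perms_id]) (auto simp: ent_def)

lemma id_mat_timesM: "U \<in> mob n \<Longrightarrow> V \<in> mob n \<Longrightarrow> \<phi> \<in> mhom n k U V \<Longrightarrow> mat_prodM R k (sId (mat_cat R n) k (id_mat R n)) \<phi> = \<phi>"
  and times_id_matM: "U \<in> mob n \<Longrightarrow> V \<in> mob n \<Longrightarrow> \<phi> \<in> mhom n k U V \<Longrightarrow> mat_prodM R k \<phi> (sId (mat_cat R n) k (id_mat R n)) = \<phi>"
  unfolding id_mat_eq_perm_mat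
   apply (rule ent_ar_eqI[where R = R and k = k and n = n and U = "mat_prod R (perm_mat R n (\<lambda>i. i)) U" and V = "mat_prod R (perm_mat R n (\<lambda>i. i)) V" and U' = U and V' = V])
     apply (simp add: mat_prodM_carrier mat_id_carrier mhom_carrier)
    apply (simp add: mhom_carrier)
   apply (subst perm_mat_timesM[OF _ _ _ inverse_perms_id])
      apply (auto simp: ent_ar_def)[4]
  apply (rule ent_ar_eqI[where R = R and k = k and n = n and U = "mat_prod R U (perm_mat R n (\<lambda>i. i))" and V = "mat_prod R V (perm_mat R n (\<lambda>i. i))" and U' = U and V' = V])
    apply (simp add: mat_prodM_carrier mat_id_carrier mhom_carrier)
   apply (simp add: mhom_carrier)
  apply (subst times_perm_matM[OF _ _ _ inverse_perms_id])
     apply (auto simp: ent_ar_def)[4]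
  done

text \<open>
  An associativity isomorphism can be an identity only if its source and target coincide, and
  these agree because the source and target of the identity entries do.
\<close>

lemma mat_assoc_idn:
  assumes o: "U \<in> mob n" "V \<in> mob n" "W \<in> mob n"
    and d: "\<And>i l p. ent R n U i p = rzero R \<or> ent R n U i p = rone R \<or> (\<exists>q0. \<forall>q. q \<noteq> q0 \<longrightarrow> ent R n V p q [*] ent R n W q l = rzero R)"
    and z: "\<And>i l p p' q q'. p < p' \<Longrightarrow> q < q' \<Longrightarrow> ent R n U i p [*] (ent R n V p q' [*] ent R n W q' l) = rzero R \<or> ent R n U i p' [*] (ent R n V p' q [*] ent R n W q l) = rzero R"
  shows "mat_assoc R U V W = sId (mat_cat R n) 0 (mat_prod R U (mat_prod R V W))" (is ?A)
    and "mat_prod R (mat_prod R U V) W = mat_prod R U (mat_prod R V W)" (is ?B)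
proof -
  have e: "assoc_at n 0 U V W i l = arr_id R 0 (ent R n (mat_prod R U (mat_prod R V W)) i l)" for i l
  proof -
    have "assoc_at n 0 U V W i l = arr_id R 0 (lev.Tot (map (\<lambda>p. ent R n U i p [*] lev.Tot (map (\<lambda>q. ent R n V p q [*] ent R n W q l) [0..<n])) [0..<n]))"
      by (rule lev0.assoc_entry_idn) (use o d z in auto)
    then show ?thesis using o by (simp add: ent_mat_prod mat_prod_in)
  qed
  show B: ?B
    using o assoc_at_dom_cod(3)[OF o, of 0] e
    by (intro ent_eqI[where n = n and R = R]) (auto simp: mat_prod_carrier mob_carrier mat_prod_in)
  show ?A
  proof (rule ent_ar_eqI)
    show "ent_ar R n 0 (mat_prod R U (mat_prod R V W)) (mat_prod R (mat_prod R U V) W) (mat_assoc R U V W) i l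
     = ent_ar R n 0 (mat_prod R U (mat_prod R V W)) (mat_prod R U (mat_prod R V W)) (sId (mat_cat R n) 0 (mat_prod R U (mat_prod R V W))) i l" for i l
      using o by (simp add: ent_ar_mat_assoc ent_ar_id mat_prod_in e)
  qed (use o in \<open>auto simp: mat_assoc_carrier mat_id_carrier mat_prod_in\<close>)
qed

text \<open>
  The entries of the left factor are \<open>0\<close> or \<open>1\<close>, which makes the distributivities trivial, and
  each row has at most one nonzero entry, which excludes inversions.
\<close>

lemma mat_assoc_perm_left:
  assumes o: "V \<in> mob n" "W \<in> mob n"
  shows "mat_assoc R (perm_mat R n s) V W = sId (mat_cat R n) 0 (mat_prod R (perm_mat R n s) (mat_prod R V W))"
    and "mat_prod R (mat_prod R (perm_mat R n s) V) W = mat_prod R (perm_mat R n s) (mat_prod R V W)"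
proof -
  note c = mat_assoc_idn[OF perm_mat_in[of n s] o]
  have d: "ent R n (perm_mat R n s) i p = rzero R \<or> ent R n (perm_mat R n s) i p = rone R \<or> (\<exists>q0. \<forall>q. q \<noteq> q0 \<longrightarrow> ent R n V p q [*] ent R n W q l = rzero R)" for i p l
    by (simp add: ent_perm_mat)
  have e: "ent R n (perm_mat R n s) i p [*] (ent R n V p q' [*] ent R n W q' l) = rzero R \<or> ent R n (perm_mat R n s) i p' [*] (ent R n V p' q [*] ent R n W q l) = rzero R"
    if "p < p'" "q < q'" for i l p p' q q'
    using that o by (cases "p = s i") (simp_all add: ent_perm_mat)
  show "mat_assoc R (perm_mat R n s) V W = sId (mat_cat R n) 0 (mat_prod R (perm_mat R n s) (mat_prod R V W))" by (rule c(1)[OF d e])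
  show "mat_prod R (mat_prod R (perm_mat R n s) V) W = mat_prod R (perm_mat R n s) (mat_prod R V W)" by (rule c(2)[OF d e])
qed

text \<open>
  For each column of the permutation matrix only one \<open>q\<close> contributes. Hence distributivity is over
  a single term, and there are no inversions.
\<close>

lemma mat_assoc_perm_right:
  assumes o: "U \<in> mob n" "V \<in> mob n" and s: "inverse_perms n s t"
  shows "mat_assoc R U V (perm_mat R n s) = sId (mat_cat R n) 0 (mat_prod R U (mat_prod R V (perm_mat R n s)))"
    and "mat_prod R (mat_prod R U V) (perm_mat R n s) = mat_prod R U (mat_prod R V (perm_mat R n s))"
proof -
  have z: "ent R n V p q [*] ent R n (perm_mat R n s) q l = rzero R" if "q \<noteq> t l" for p q l
    using that o by (auto simp: ent_perm_mat_inverse[OF s])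
  note c = mat_assoc_idn[OF o perm_mat_in[of n s]]
  have d: "ent R n U i p = rzero R \<or> ent R n U i p = rone R \<or> (\<exists>q0. \<forall>q. q \<noteq> q0 \<longrightarrow> ent R n V p q [*] ent R n (perm_mat R n s) q l = rzero R)" for i p l
    using z by blast
  have e: "ent R n U i p [*] (ent R n V p q' [*] ent R n (perm_mat R n s) q' l) = rzero R \<or> ent R n U i p' [*] (ent R n V p' q [*] ent R n (perm_mat R n s) q l) = rzero R"
    if "p < p'" "q < q'" for i l p p' q q'
    using z[of q l p'] z[of q' l p] that o by (cases "q = t l") auto
  show "mat_assoc R U V (perm_mat R n s) = sId (mat_cat R n) 0 (mat_prod R U (mat_prod R V (perm_mat R n s)))" by (rule c(1)[OF d e])
  show "mat_prod R (mat_prod R U V) (perm_mat R n s) = mat_prod R U (mat_prod R V (perm_mat R n s))" by (rule c(2)[OF d e])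
qed

text \<open>
  For each \<open>p\<close> only the term \<open>q = s p\<close> contributes, so an inversion is a pair \<open>p < p'\<close> in the
  support of a row of \<open>U\<close> with \<open>s p' < s p\<close>.
\<close>

lemma mat_assoc_perm_middle:
  assumes o: "U \<in> mob n" "W \<in> mob n"
    and m: "\<And>i p p'. p < p' \<Longrightarrow> ent R n U i p \<noteq> rzero R \<Longrightarrow> ent R n U i p' \<noteq> rzero R \<Longrightarrow> s p < s p'"
  shows "mat_assoc R U (perm_mat R n s) W = sId (mat_cat R n) 0 (mat_prod R U (mat_prod R (perm_mat R n s) W))"
    and "mat_prod R (mat_prod R U (perm_mat R n s)) W = mat_prod R U (mat_prod R (perm_mat R n s) W)"
proof -
  have z: "ent R n (perm_mat R n s) p q [*] ent R n W q l = rzero R" if "q \<noteq> s p" for p q l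
    using that o by (auto simp: ent_perm_mat)
  note c = mat_assoc_idn[OF o(1) perm_mat_in[of n s] o(2)]
  have d: "ent R n U i p = rzero R \<or> ent R n U i p = rone R \<or> (\<exists>q0. \<forall>q. q \<noteq> q0 \<longrightarrow> ent R n (perm_mat R n s) p q [*] ent R n W q l = rzero R)" for i p l
    using z by blast
  have e: "ent R n U i p [*] (ent R n (perm_mat R n s) p q' [*] ent R n W q' l) = rzero R \<or> ent R n U i p' [*] (ent R n (perm_mat R n s) p' q [*] ent R n W q l) = rzero R"
    if pq: "p < p'" "q < q'" for i l p p' q q'
  proof (rule ccontr)
    assume "\<not> ?thesis"
    then have n: "ent R n U i p [*] (ent R n (perm_mat R n s) p q' [*] ent R n W q' l) \<noteq> rzero R"
      "ent R n U i p' [*] (ent R n (perm_mat R n s) p' q [*] ent R n W q l) \<noteq> rzero R" by auto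
    have "q' = s p" by (rule ccontr) (use n(1) z[of q' p l] o in simp)
    moreover have "q = s p'" by (rule ccontr) (use n(2) z[of q p' l] o in simp)
    moreover have "ent R n U i p \<noteq> rzero R" "ent R n U i p' \<noteq> rzero R"
      by (rule notI, use n(1) o in simp)+ (rule notI, use n(2) o in simp)
    ultimately show False using m[of p p' i] pq by auto
  qed
  show "mat_assoc R U (perm_mat R n s) W = sId (mat_cat R n) 0 (mat_prod R U (mat_prod R (perm_mat R n s) W))" by (rule c(1)[OF d e])
  show "mat_prod R (mat_prod R U (perm_mat R n s)) W = mat_prod R U (mat_prod R (perm_mat R n s) W)" by (rule c(2)[OF d e])
qed

end

context strict_bimonoidal_category
begin

section \<open>Block sums\<close>

lemma block_sum_carrier: "U \<in> carrier_mat n n \<Longrightarrow> V \<in> carrier_mat m m \<Longrightarrow> block_sum R U V \<in> carrier_mat (n + m) (n + m)"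
  and block_sumM_carrier: "\<phi> \<in> carrier_mat n n \<Longrightarrow> \<psi> \<in> carrier_mat m m \<Longrightarrow> block_sumM R k \<phi> \<psi> \<in> carrier_mat (n + m) (n + m)"
  by (auto simp: block_sum_def block_sumM_def)

lemma ent_block_sum:
  assumes "U \<in> carrier_mat n n" "V \<in> carrier_mat m m"
  shows "ent R (n + m) (block_sum R U V) = blk (rzero R) n (ent R n U) (ent R m V)"
  using assms by (auto simp: fun_eq_iff ent_def blk_def block_sum_def)

lemma ent_ar_block_sumM:
  assumes "U \<in> carrier_mat n n" "V \<in> carrier_mat m m" "U' \<in> carrier_mat n n" "V' \<in> carrier_mat m m"
    "\<phi> \<in> carrier_mat n n" "\<psi> \<in> carrier_mat m m"
  shows "ent_ar R (n + m) k (block_sum R U V) (block_sum R U' V') (block_sumM R k \<phi> \<psi>)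
    = blk (arr_id R k (rzero R)) n (ent_ar R n k U U' \<phi>) (ent_ar R m k V V' \<psi>)"
  using assms by (auto simp: fun_eq_iff ent_ar_def blk_def block_sum_def block_sumM_def arr_id_def)

lemma block_sum_in: "U \<in> mob n \<Longrightarrow> V \<in> mob m \<Longrightarrow> block_sum R U V \<in> mob (n + m)"
  by (rule mobI) (auto simp: block_sum_carrier mob_carrier ent_block_sum, simp add: blk_def)

lemma block_sumM_in:
  assumes "U \<in> mob n" "V \<in> mob m" "U' \<in> mob n" "V' \<in> mob m" "\<phi> \<in> mhom n k U U'" "\<psi> \<in> mhom m k V V'"
  shows "block_sumM R k \<phi> \<psi> \<in> mhom (n + m) k (block_sum R U V) (block_sum R U' V')"
proof -
  have "lev.invertible k (blk (arr_id R k (rzero R)) n (ent_ar R n k U U' \<phi>) (ent_ar R m k V V' \<psi>) i j)" for i j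
    using assms ent_ar_invertible by (auto simp: blk_def)
  then show ?thesis
    using assms by (simp add: mhom_iff block_sum_in block_sumM_carrier mhom_carrier ent_ar_block_sumM mob_carrier)
qed

lemma block_sumM_id:
  assumes "U \<in> mob n" "V \<in> mob m"
  shows "block_sumM R k (sId (mat_cat R n) k U) (sId (mat_cat R m) k V) = sId (mat_cat R (n + m)) k (block_sum R U V)"
proof (rule ent_ar_eqI)
  show "ent_ar R (n + m) k (block_sum R U V) (block_sum R U V) (block_sumM R k (sId (mat_cat R n) k U) (sId (mat_cat R m) k V)) i j =
    ent_ar R (n + m) k (block_sum R U V) (block_sum R U V) (sId (mat_cat R (n + m)) k (block_sum R U V)) i j" for i j
    using assms by (simp add: ent_ar_block_sumM mob_carrier mat_id_carrier ent_ar_id block_sum_in ent_block_sum) (simp add: blk_def ent_ar_id)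
qed (use assms in \<open>auto simp: block_sumM_carrier mat_id_carrier block_sum_in\<close>)

lemma block_sumM_comp:
  assumes U: "U \<in> mob n" "U' \<in> mob m" and V: "V \<in> mob n" "V' \<in> mob m" and W: "W \<in> mob n" "W' \<in> mob m"
    and f: "\<phi> \<in> mhom n k U V" "\<phi>' \<in> mhom m k U' V'" and g: "\<psi> \<in> mhom n k V W" "\<psi>' \<in> mhom m k V' W'"
  shows "block_sumM R k (sComp (mat_cat R n) k \<psi> \<phi>) (sComp (mat_cat R m) k \<psi>' \<phi>') =
    sComp (mat_cat R (n + m)) k (block_sumM R k \<psi> \<psi>') (block_sumM R k \<phi> \<phi>')"
proof (rule ent_ar_eqI)
  show "ent_ar R (n + m) k (block_sum R U U') (block_sum R W W') (block_sumM R k (sComp (mat_cat R n) k \<psi> \<phi>) (sComp (mat_cat R m) k \<psi>' \<phi>')) i j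
    = ent_ar R (n + m) k (block_sum R U U') (block_sum R W W') (sComp (mat_cat R (n + m)) k (block_sumM R k \<psi> \<psi>') (block_sumM R k \<phi> \<phi>')) i j" for i j
    unfolding ent_ar_comp[where U = "block_sum R U U'" and V = "block_sum R V V'" and W = "block_sum R W W'"]
    using assms by (simp add: ent_ar_block_sumM mob_carrier mhom_carrier mat_comp_carrier)
      (simp add: blk_def ent_ar_comp[where V = V and U = U] ent_ar_comp[where V = V' and U = U'])
qed (use assms in \<open>auto simp: block_sumM_carrier mhom_carrier mat_comp_carrier\<close>)

lemma block_sumM_face:
  assumes "\<phi> \<in> carrier_mat n n" "\<psi> \<in> carrier_mat m m" "i \<le> Suc k"
  shows "block_sumM R k (sFace (mat_cat R n) k i \<phi>) (sFace (mat_cat R m) k i \<psi>) = sFace (mat_cat R (n + m)) k i (block_sumM R (Suc k) \<phi> \<psi>)"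
  using assms by (auto simp: mat_cat_def block_sumM_def face_id zero_in intro!: eq_matI)

lemma block_sumM_degen:
  assumes "\<phi> \<in> carrier_mat n n" "\<psi> \<in> carrier_mat m m" "i \<le> k"
  shows "block_sumM R (Suc k) (sDegen (mat_cat R n) k i \<phi>) (sDegen (mat_cat R m) k i \<psi>) = sDegen (mat_cat R (n + m)) k i (block_sumM R k \<phi> \<psi>)"
  using assms by (auto simp: mat_cat_def block_sumM_def degen_id zero_in intro!: eq_matI)

lemma block_sum_prod:
  assumes U: "U \<in> mob n" "U' \<in> mob m" and V: "V \<in> mob n" "V' \<in> mob m"
  shows "mat_prod R (block_sum R U U') (block_sum R V V') = block_sum R (mat_prod R U V) (mat_prod R U' V')"
proof (rule ent_eqI)
  fix i l
  have "lev.Tot (map (\<lambda>j. blk (rzero R) n (ent R n U) (ent R m U') i j [*] blk (rzero R) n (ent R n V) (ent R m V') j l) [0..<n + m])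
    = blk (rzero R) n (\<lambda>i l. lev.Tot (map (\<lambda>j. ent R n U i j [*] ent R n V j l) [0..<n]))
      (\<lambda>i l. lev.Tot (map (\<lambda>j. ent R m U' i j [*] ent R m V' j l) [0..<m])) i l"
    by (rule blk_mult[where X = "sObj R"]) (use assms in \<open>auto intro: lev.Tot_filter\<close>)
  then show "ent R (n + m) (mat_prod R (block_sum R U U') (block_sum R V V')) i l = ent R (n + m) (block_sum R (mat_prod R U V) (mat_prod R U' V')) i l"
    using assms by (simp add: ent_mat_prod block_sum_in ent_block_sum mob_carrier mat_prod_carrier) (simp add: blk_def ent_mat_prod)
qed (use assms in \<open>auto simp: block_sum_in block_sum_carrier mat_prod_carrier mob_carrier\<close>)

lemma block_sumM_prod:
  assumes U: "U1 \<in> mob n" "U1' \<in> mob m" "U2 \<in> mob n" "U2' \<in> mob m" and V: "V1 \<in> mob n" "V1' \<in> mob m" "V2 \<in> mob n" "V2' \<in> mob m"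
    and f: "\<phi> \<in> mhom n k U1 U2" "\<phi>' \<in> mhom m k U1' U2'" and g: "\<psi> \<in> mhom n k V1 V2" "\<psi>' \<in> mhom m k V1' V2'"
  shows "mat_prodM R k (block_sumM R k \<phi> \<phi>') (block_sumM R k \<psi> \<psi>') = block_sumM R k (mat_prodM R k \<phi> \<psi>) (mat_prodM R k \<phi>' \<psi>')"
proof (rule ent_ar_eqI)
  fix i l
  let ?S = "block_sum R (mat_prod R U1 V1) (mat_prod R U1' V1')" and ?T = "block_sum R (mat_prod R U2 V2) (mat_prod R U2' V2')"
  have "lev.Tot_ar k (map (\<lambda>j. arr_times R k (blk (arr_id R k (rzero R)) n (ent_ar R n k U1 U2 \<phi>) (ent_ar R m k U1' U2' \<phi>') i j)
        (blk (arr_id R k (rzero R)) n (ent_ar R n k V1 V2 \<psi>) (ent_ar R m k V1' V2' \<psi>') j l)) [0..<n + m])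
    = blk (arr_id R k (rzero R)) n (\<lambda>i l. lev.Tot_ar k (map (\<lambda>j. arr_times R k (ent_ar R n k U1 U2 \<phi> i j) (ent_ar R n k V1 V2 \<psi> j l)) [0..<n]))
      (\<lambda>i l. lev.Tot_ar k (map (\<lambda>j. arr_times R k (ent_ar R m k U1' U2' \<phi>' i j) (ent_ar R m k V1' V2' \<psi>' j l)) [0..<m])) i l"
    by (rule blk_mult[where X = "arrows R k"]) (use assms in \<open>auto intro: lev.Tot_ar_filter\<close>)
  then have "ent_ar R (n + m) k (mat_prod R (block_sum R U1 U1') (block_sum R V1 V1')) (mat_prod R (block_sum R U2 U2') (block_sum R V2 V2'))
      (mat_prodM R k (block_sumM R k \<phi> \<phi>') (block_sumM R k \<psi> \<psi>')) i l
     = ent_ar R (n + m) k ?S ?T (block_sumM R k (mat_prodM R k \<phi> \<psi>) (mat_prodM R k \<phi>' \<psi>')) i l"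
    using assms by (simp add: ent_ar_mat_prodM[OF block_sum_in block_sum_in block_sum_in block_sum_in block_sumM_in block_sumM_in]
      ent_ar_block_sumM mob_carrier mhom_carrier mat_prod_carrier mat_prodM_carrier) (simp add: blk_def ent_ar_mat_prodM)
  then show "ent_ar R (n + m) k ?S ?T (mat_prodM R k (block_sumM R k \<phi> \<phi>') (block_sumM R k \<psi> \<psi>')) i l
     = ent_ar R (n + m) k ?S ?T (block_sumM R k (mat_prodM R k \<phi> \<psi>) (mat_prodM R k \<phi>' \<psi>')) i l"
    using assms by (simp add: block_sum_prod)
qed (use f g in \<open>auto simp: block_sumM_carrier mat_prodM_carrier mhom_carrier\<close>)

lemma block_sum_assoc:
  assumes "U \<in> carrier_mat n n" "V \<in> carrier_mat m m" "W \<in> carrier_mat p p"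
  shows "block_sum R (block_sum R U V) W = block_sum R U (block_sum R V W)"
proof (rule ent_eqI[where n = "n + m + p" and R = R])
  show "ent R (n + m + p) (block_sum R (block_sum R U V) W) i j = ent R (n + m + p) (block_sum R U (block_sum R V W)) i j" for i j
    using assms ent_block_sum[of U n "block_sum R V W" "m + p"] by (simp add: ent_block_sum block_sum_carrier blk_blk add.assoc[symmetric])
  show "block_sum R (block_sum R U V) W \<in> carrier_mat (n + m + p) (n + m + p)"
    by (rule block_sum_carrier[OF block_sum_carrier[OF assms(1,2)] assms(3)])
  show "block_sum R U (block_sum R V W) \<in> carrier_mat (n + m + p) (n + m + p)"
    using block_sum_carrier[OF assms(1) block_sum_carrier[OF assms(2,3)]] by (simp add: add.assoc)
qed

lemma block_sumM_assoc:
  assumes "\<phi> \<in> carrier_mat n n" "\<psi> \<in> carrier_mat m m" "\<chi> \<in> carrier_mat p p"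
  shows "block_sumM R k (block_sumM R k \<phi> \<psi>) \<chi> = block_sumM R k \<phi> (block_sumM R k \<psi> \<chi>)"
  using assms by (auto simp: block_sumM_def intro!: eq_matI)

lemma block_sum_empty:
  assumes "E \<in> carrier_mat 0 0" "U \<in> carrier_mat n n"
  shows "block_sum R E U = U" "block_sum R U E = U"
  using assms by (auto simp: block_sum_def intro!: eq_matI)

lemma block_sumM_empty:
  assumes "E \<in> carrier_mat 0 0" "\<phi> \<in> carrier_mat n n"
  shows "block_sumM R k E \<phi> = \<phi>" "block_sumM R k \<phi> E = \<phi>"
  using assms by (auto simp: block_sumM_def intro!: eq_matI)

text \<open>
  The compatibility of the strict functor \<open>\<boxplus>\<close> with associativity, and the only point where the
  associativity isomorphisms of the blocks need not be identities.
\<close>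

lemma mat_assoc_block_sum:
  assumes o: "U \<in> mob n" "V \<in> mob n" "W \<in> mob n" "U' \<in> mob m" "V' \<in> mob m" "W' \<in> mob m"
  shows "mat_assoc R (block_sum R U U') (block_sum R V V') (block_sum R W W') = block_sumM R 0 (mat_assoc R U V W) (mat_assoc R U' V' W')"
proof (rule ent_ar_eqI)
  fix i l
  let ?S = "block_sum R (mat_prod R U (mat_prod R V W)) (mat_prod R U' (mat_prod R V' W'))"
  let ?T = "block_sum R (mat_prod R (mat_prod R U V) W) (mat_prod R (mat_prod R U' V') W')"
  have S: "?S = mat_prod R (block_sum R U U') (mat_prod R (block_sum R V V') (block_sum R W W'))"
    and T: "?T = mat_prod R (mat_prod R (block_sum R U U') (block_sum R V V')) (block_sum R W W')"
    by (simp_all only: block_sum_prod[OF o(1,4) mat_prod_in[OF o(2,3)] mat_prod_in[OF o(5,6)]] block_sum_prod[OF o(2,5,3,6)]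
      block_sum_prod[OF mat_prod_in[OF o(1,2)] mat_prod_in[OF o(4,5)] o(3,6)] block_sum_prod[OF o(1,4,2,5)])
  have "ent_ar R (n + m) 0 ?S ?T (mat_assoc R (block_sum R U U') (block_sum R V V') (block_sum R W W')) i l
    = assoc_at (n + m) 0 (block_sum R U U') (block_sum R V V') (block_sum R W W') i l"
    unfolding S T by (rule ent_ar_mat_assoc) (use o in \<open>auto intro: block_sum_in\<close>)
  also have "\<dots> = blk (arr_id R 0 (rzero R)) n (assoc_at n 0 U V W) (assoc_at m 0 U' V' W') i l"
    unfolding ent_block_sum[OF mob_carrier[OF o(1)] mob_carrier[OF o(4)]] ent_block_sum[OF mob_carrier[OF o(2)] mob_carrier[OF o(5)]] ent_block_sum[OF mob_carrier[OF o(3)] mob_carrier[OF o(6)]]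
    by (rule lev0.assoc_entry_blk) (use o in auto)
  also have "\<dots> = ent_ar R (n + m) 0 ?S ?T (block_sumM R 0 (mat_assoc R U V W) (mat_assoc R U' V' W')) i l"
    using o by (simp add: ent_ar_block_sumM mob_carrier mat_prod_carrier mat_assoc_carrier) (simp add: blk_def ent_ar_mat_assoc)
  finally show "ent_ar R (n + m) 0 ?S ?T (mat_assoc R (block_sum R U U') (block_sum R V V') (block_sum R W W')) i l
    = ent_ar R (n + m) 0 ?S ?T (block_sumM R 0 (mat_assoc R U V W) (mat_assoc R U' V' W')) i l" .
qed (use o in \<open>auto simp: block_sumM_carrier mat_assoc_carrier block_sum_in\<close>)

section \<open>Block permutation matrices\<close>

text \<open>
  The block permutation matrix has the identity matrix of size \<open>m\<close> in the upper right and that of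
  size \<open>n\<close> in the lower left corner.
\<close>

definition swap_index :: "nat \<Rightarrow> nat \<Rightarrow> nat \<Rightarrow> nat" where
  "swap_index n m i = (if i < m then n + i else i - m)"

definition swap_mat :: "nat \<Rightarrow> nat \<Rightarrow> 'o mat" where
  "swap_mat n m = perm_mat R (n + m) (swap_index n m)"

lemma inverse_perms_swap: "inverse_perms (n + m) (swap_index n m) (swap_index m n)"
  by (auto simp: inverse_perms_def swap_index_def)

lemma swap_mat_in [simp]: "swap_mat n m \<in> mob (n + m)"
  by (simp add: swap_mat_def)

lemma perm_mat_cong: "(\<And>i. i < n \<Longrightarrow> s i = t i) \<Longrightarrow> perm_mat R n s = perm_mat R n t"
  by (auto simp: perm_mat_def intro!: eq_matI)

lemma perm_mat_prod:
  assumes "inverse_perms n s t"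
  shows "mat_prod R (perm_mat R n s) (perm_mat R n s') = perm_mat R n (\<lambda>i. s' (s i))"
proof (rule ent_eqI)
  show "ent R n (mat_prod R (perm_mat R n s) (perm_mat R n s')) i j = ent R n (perm_mat R n (\<lambda>i. s' (s i))) i j" for i j
    using assms by (auto simp: perm_mat_times[OF perm_mat_in assms] ent_perm_mat inverse_perms_def)
qed (auto simp: mat_prod_carrier mob_carrier)

lemma block_sum_perm_mat:
  assumes "\<And>i. i < n \<Longrightarrow> s i < n"
  shows "block_sum R (perm_mat R n s) (perm_mat R m t) = perm_mat R (n + m) (\<lambda>i. if i < n then s i else n + t (i - n))"
  using assms by (auto simp: block_sum_def perm_mat_def intro!: eq_matI)

lemma block_sum_id_mat: "block_sum R (id_mat R n) (id_mat R m) = id_mat R (n + m)"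
  unfolding id_mat_eq_perm_mat by (simp add: block_sum_perm_mat) (rule perm_mat_cong, simp)

lemma swap_mat_swap_mat: "mat_prod R (swap_mat m n) (swap_mat n m) = id_mat R (n + m)"
proof -
  have "mat_prod R (swap_mat m n) (swap_mat n m) = perm_mat R (m + n) (\<lambda>i. swap_index n m (swap_index m n i))"
    unfolding swap_mat_def add.commute[of n m] by (rule perm_mat_prod[OF inverse_perms_swap])
  then show ?thesis
    unfolding id_mat_eq_perm_mat by (simp add: add.commute) (rule perm_mat_cong, auto simp: swap_index_def)
qed

text \<open>
  The braiding equations are equations between permutation matrices, hence between permutations.
\<close>

lemma swap_mat_left:
  "mat_prod R (block_sum R (id_mat R b) (swap_mat a c)) (block_sum R (swap_mat a b) (id_mat R c)) = swap_mat a (b + c)"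
proof -
  let ?s = "\<lambda>i. if i < b then i else b + swap_index a c (i - b)" and ?t = "\<lambda>i. if i < b then i else b + swap_index c a (i - b)"
  let ?s' = "\<lambda>i. if i < a + b then swap_index a b i else a + b + (i - (a + b))"
  have i: "inverse_perms (b + (a + c)) ?s ?t" by (auto simp: inverse_perms_def swap_index_def)
  have 1: "block_sum R (id_mat R b) (swap_mat a c) = perm_mat R (b + (a + c)) ?s"
    unfolding id_mat_eq_perm_mat swap_mat_def by (rule block_sum_perm_mat)
  have 2: "block_sum R (swap_mat a b) (id_mat R c) = perm_mat R (a + b + c) ?s'"
    unfolding id_mat_eq_perm_mat swap_mat_def by (rule block_sum_perm_mat) (auto simp: swap_index_def)
  have "a + b + c = b + (a + c)" by simp
  then show ?thesis
    unfolding 1 2 by (simp only: perm_mat_prod[OF i]) (simp add: swap_mat_def add.left_commute, rule perm_mat_cong, auto simp: swap_index_def)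
qed

lemma swap_mat_right:
  "mat_prod R (block_sum R (swap_mat a c) (id_mat R b)) (block_sum R (id_mat R a) (swap_mat b c)) = swap_mat (a + b) c"
proof -
  let ?s = "\<lambda>i. if i < a + c then swap_index a c i else a + c + (i - (a + c))"
  let ?t = "\<lambda>i. if i < a + c then swap_index c a i else a + c + (i - (a + c))"
  let ?s' = "\<lambda>i. if i < a then i else a + swap_index b c (i - a)"
  have i: "inverse_perms (a + c + b) ?s ?t" by (auto simp: inverse_perms_def swap_index_def)
  have 1: "block_sum R (swap_mat a c) (id_mat R b) = perm_mat R (a + c + b) ?s"
    unfolding id_mat_eq_perm_mat swap_mat_def by (rule block_sum_perm_mat) (auto simp: swap_index_def)
  have 2: "block_sum R (id_mat R a) (swap_mat b c) = perm_mat R (a + (b + c)) ?s'"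
    unfolding id_mat_eq_perm_mat swap_mat_def by (rule block_sum_perm_mat)
  have d: "a + (b + c) = a + c + b" "a + b + c = a + c + b" by simp_all
  show ?thesis
    unfolding 1 2 d perm_mat_prod[OF i] unfolding swap_mat_def d by (rule perm_mat_cong) (auto simp: swap_index_def)
qed

lemma blk_swap_index:
  assumes "i < n + m" "l < n + m"
  shows "blk z m B A i (swap_index m n l) = blk z n A B (swap_index n m i) l"
  using assms by (auto simp: blk_def swap_index_def)

lemma swap_mat_natural:
  assumes o: "U \<in> mob n" "V \<in> mob m"
  shows "mat_prod R (block_sum R V U) (swap_mat n m) = mat_prod R (swap_mat n m) (block_sum R U V)"
proof (rule ent_eqI)
  fix i l
  have VU: "block_sum R V U \<in> mob (n + m)" using block_sum_in[OF o(2,1)] by (simp add: add.commute)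
  note UV = block_sum_in[OF o]
  have e: "ent R (n + m) (block_sum R V U) = blk (rzero R) m (ent R m V) (ent R n U)"
    using ent_block_sum[of V m U n] o by (simp add: mob_carrier add.commute)
  show "ent R (n + m) (mat_prod R (block_sum R V U) (swap_mat n m)) i l = ent R (n + m) (mat_prod R (swap_mat n m) (block_sum R U V)) i l"
  proof (cases "i < n + m \<and> l < n + m")
    case True
    then show ?thesis
      using blk_swap_index[of i n m l] o
      by (simp add: swap_mat_def perm_mat_times[OF UV inverse_perms_swap] times_perm_mat[OF VU inverse_perms_swap] e ent_block_sum mob_carrier)
  qed (auto simp: ent_def)
next
  show "mat_prod R (block_sum R V U) (swap_mat n m) \<in> carrier_mat (n + m) (n + m)"
    using block_sum_in[OF o(2,1)] by (intro mat_prod_carrier mob_carrier[OF swap_mat_in] mob_carrier) (simp add: add.commute)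
  show "mat_prod R (swap_mat n m) (block_sum R U V) \<in> carrier_mat (n + m) (n + m)"
    by (intro mat_prod_carrier mob_carrier[OF swap_mat_in] mob_carrier block_sum_in o)
qed

lemma swap_mat_naturalM:
  assumes o: "U \<in> mob n" "V \<in> mob m" "U' \<in> mob n" "V' \<in> mob m" and h: "\<phi> \<in> mhom n k U U'" "\<psi> \<in> mhom m k V V'"
  shows "mat_prodM R k (block_sumM R k \<psi> \<phi>) (sId (mat_cat R (n + m)) k (swap_mat n m))
    = mat_prodM R k (sId (mat_cat R (n + m)) k (swap_mat n m)) (block_sumM R k \<phi> \<psi>)"
proof (rule ent_ar_eqI)
  fix i l
  have VU: "block_sum R V U \<in> mob (n + m)" "block_sum R V' U' \<in> mob (n + m)" "block_sumM R k \<psi> \<phi> \<in> mhom (n + m) k (block_sum R V U) (block_sum R V' U')"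
    using block_sum_in[OF o(2,1)] block_sum_in[OF o(4,3)] block_sumM_in[OF o(2,1,4,3) h(2,1)] by (simp_all add: add.commute)
  note UV = block_sum_in[OF o(1,2)] block_sum_in[OF o(3,4)] block_sumM_in[OF o h]
  have e: "ent_ar R (n + m) k (block_sum R V U) (block_sum R V' U') (block_sumM R k \<psi> \<phi>) = blk (arr_id R k (rzero R)) m (ent_ar R m k V V' \<psi>) (ent_ar R n k U U' \<phi>)"
    using ent_ar_block_sumM[of V m U n V' U' \<psi> \<phi> k] o h by (simp add: mob_carrier mhom_carrier add.commute)
  let ?S = "mat_prod R (swap_mat n m) (block_sum R U V)" and ?T = "mat_prod R (swap_mat n m) (block_sum R U' V')"
  have S: "mat_prod R (block_sum R V U) (swap_mat n m) = ?S" "mat_prod R (block_sum R V' U') (swap_mat n m) = ?T"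
    using o by (simp_all add: swap_mat_natural)
  show "ent_ar R (n + m) k ?S ?T (mat_prodM R k (block_sumM R k \<psi> \<phi>) (sId (mat_cat R (n + m)) k (swap_mat n m))) i l
    = ent_ar R (n + m) k ?S ?T (mat_prodM R k (sId (mat_cat R (n + m)) k (swap_mat n m)) (block_sumM R k \<phi> \<psi>)) i l"
  proof (cases "i < n + m \<and> l < n + m")
    case True
    then show ?thesis
      using blk_swap_index[of i n m l] times_perm_matM[OF VU inverse_perms_swap, of i l] perm_mat_timesM[OF UV inverse_perms_swap, of i l] o h
      by (simp add: S e ent_ar_block_sumM mob_carrier mhom_carrier flip: swap_mat_def)
  qed (auto simp: ent_ar_def)
qed (use h in \<open>auto simp: mat_prodM_carrier mat_id_carrier block_sumM_carrier[of \<psi> m \<phi> n, unfolded add.commute[of m n]] block_sumM_carrier mhom_carrier\<close>)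

text \<open>
  The block permutation is increasing on each of the two blocks, and a row of the left factor has
  its nonzero entries in one block.
\<close>

lemma swap_mat_assoc_middle:
  assumes o: "U \<in> mob m" "V \<in> mob n" "W \<in> mob (n + m)"
  shows "mat_assoc R (block_sum R U V) (swap_mat n m) W = sId (mat_cat R (n + m)) 0 (mat_prod R (block_sum R U V) (mat_prod R (swap_mat n m) W))"
    and "mat_prod R (mat_prod R (block_sum R U V) (swap_mat n m)) W = mat_prod R (block_sum R U V) (mat_prod R (swap_mat n m) W)"
proof -
  have UV: "block_sum R U V \<in> mob (n + m)" using block_sum_in[OF o(1,2)] by (simp add: add.commute)
  have e: "ent R (n + m) (block_sum R U V) = blk (rzero R) m (ent R m U) (ent R n V)"
    using ent_block_sum[of U m V n] o by (simp add: mob_carrier add.commute)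
  have "swap_index n m p < swap_index n m p'" if "p < p'" "ent R (n + m) (block_sum R U V) i p \<noteq> rzero R" "ent R (n + m) (block_sum R U V) i p' \<noteq> rzero R" for i p p'
    using that unfolding e by (auto simp: blk_def swap_index_def split: if_splits)
  then show "mat_assoc R (block_sum R U V) (swap_mat n m) W = sId (mat_cat R (n + m)) 0 (mat_prod R (block_sum R U V) (mat_prod R (swap_mat n m) W))"
    and "mat_prod R (mat_prod R (block_sum R U V) (swap_mat n m)) W = mat_prod R (block_sum R U V) (mat_prod R (swap_mat n m) W)"
    unfolding swap_mat_def by (intro mat_assoc_perm_middle UV o(3); blast)+
qed

end

section \<open>Matrices over a semiring\<close>

context semiring
begin

text \<open>
  A semiring is a category with sums and products in which all arrows are identities. This makes
  the results on finite sums available; for instance \<open>total_total\<close>, the interchange of summations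
  behind the associativity of matrix multiplication, is the statement that \<open>assoc_entry\<close> has equal
  source and target.
\<close>

lemma times_category_discrete:
  "times_category (carrier R) (carrier R) (\<lambda>x. x) (\<lambda>x. x) (\<lambda>x. x) (\<lambda>g f. f) (\<oplus>) (\<oplus>) \<zero> (\<lambda>a b. a \<oplus> b)
    (\<otimes>) (\<otimes>) \<one> (\<lambda>a b c. a \<otimes> (b \<oplus> c))"
  by unfold_locales (auto simp: a_ac m_assoc l_distr r_distr)

lemmas sum_category_discrete = times_category.axioms(1)[OF times_category_discrete]
lemmas total_Ob = sum_category.Tot_Ob[OF sum_category_discrete]
  and total_zero = sum_category.Tot_zero[OF sum_category_discrete]
  and total_filter = sum_category.Tot_filter[OF sum_category_discrete]
  and total_single = sum_category.Tot_single[OF sum_category_discrete]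
  and total_total = trans[OF times_category.assoc_entry_type(2)[OF times_category_discrete, symmetric] times_category.assoc_entry_type(3)[OF times_category_discrete]]

abbreviation total :: "'a list \<Rightarrow> 'a" where "total \<equiv> sum_category.Tot (\<oplus>) \<zero>"

lemma total_eq_foldr: "total as = foldr (\<oplus>) as \<zero>"
  by (rule sum_category.Tot_def[OF sum_category_discrete])

definition rmat :: "nat \<Rightarrow> 'a mat set" where
  "rmat n = {A \<in> carrier_mat n n. \<forall>i<n. \<forall>j<n. A $$ (i, j) \<in> carrier R}"

definition rent :: "nat \<Rightarrow> 'a mat \<Rightarrow> nat \<Rightarrow> nat \<Rightarrow> 'a" where
  "rent n A i j = (if i < n \<and> j < n then A $$ (i, j) else \<zero>)"

definition ring_block_mat :: "'a mat \<Rightarrow> 'a mat \<Rightarrow> 'a mat" where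
  "ring_block_mat A B = four_block_mat A (mat (dim_row A) (dim_col B) (\<lambda>_. \<zero>)) (mat (dim_row B) (dim_col A) (\<lambda>_. \<zero>)) B"

lemma rent_carrier [simp]: "A \<in> rmat n \<Longrightarrow> rent n A i j \<in> carrier R"
  by (simp add: rmat_def rent_def)

lemma rmat_carrier: "A \<in> rmat n \<Longrightarrow> A \<in> carrier_mat n n"
  by (simp add: rmat_def)

lemma rent_eqI:
  assumes "A \<in> carrier_mat n n" "B \<in> carrier_mat n n" "\<And>i j. rent n A i j = rent n B i j"
  shows "A = B"
proof (rule eq_matI)
  fix i j assume "i < dim_row B" "j < dim_col B"
  then show "A $$ (i, j) = B $$ (i, j)" using assms(3)[of i j] assms(1,2) by (simp add: rent_def)
qed (use assms in auto)

lemma rmatI: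
  assumes "A \<in> carrier_mat n n" "\<And>i j. rent n A i j \<in> carrier R"
  shows "A \<in> rmat n"
proof -
  have "A $$ (i, j) \<in> carrier R" if "i < n" "j < n" for i j
    using assms(2)[of i j] that by (simp add: rent_def)
  with assms(1) show ?thesis by (simp add: rmat_def)
qed

lemma finsum_eq_foldr:
  "distinct js \<Longrightarrow> (\<And>j. f j \<in> carrier R) \<Longrightarrow> finsum R f (set js) = foldr (\<oplus>) (map f js) \<zero>"
  by (induction js) (auto simp: finsum_insert)

lemma ring_mat_prod_carrier: "A \<in> carrier_mat n n \<Longrightarrow> B \<in> carrier_mat n n \<Longrightarrow> ring_mat_prod R A B \<in> carrier_mat n n"
  by (auto simp: ring_mat_prod_def)

lemma rent_prod:
  assumes A: "A \<in> rmat n" and B: "B \<in> rmat n"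
  shows "rent n (ring_mat_prod R A B) i l = total (map (\<lambda>j. rent n A i j \<otimes> rent n B j l) [0..<n])"
proof -
  show ?thesis
  proof (cases "i < n \<and> l < n")
    case True
    have "(\<Oplus>\<^bsub>R\<^esub>j\<in>{..<n}. A $$ (i, j) \<otimes> B $$ (j, l)) = (\<Oplus>\<^bsub>R\<^esub>j\<in>set [0..<n]. rent n A i j \<otimes> rent n B j l)"
      using True A B by (intro finsum_cong') (auto simp: rent_def rmat_def)
    also have "\<dots> = total (map (\<lambda>j. rent n A i j \<otimes> rent n B j l) [0..<n])"
      unfolding total_eq_foldr by (rule finsum_eq_foldr) (use A B in auto)
    finally show ?thesis
      using True rmat_carrier[OF A] rmat_carrier[OF B] by (auto simp: rent_def ring_mat_prod_def)
  next
    case False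
    then have "rent n A i j \<otimes> rent n B j l = \<zero>" for j
      using A B rent_carrier[OF A, of i j] rent_carrier[OF B, of j l] by (auto simp: rent_def)
    then show ?thesis using False by (auto simp: rent_def total_zero image_subset_iff)
  qed
qed

lemma ring_mat_prod_in: "A \<in> rmat n \<Longrightarrow> B \<in> rmat n \<Longrightarrow> ring_mat_prod R A B \<in> rmat n"
proof -
  assume "A \<in> rmat n" "B \<in> rmat n"
  then show ?thesis
    by (intro rmatI) (auto simp: ring_mat_prod_carrier rmat_carrier rent_prod image_subset_iff intro!: total_Ob)
qed

lemma ring_mat_prod_assoc:
  assumes "A \<in> rmat n" "B \<in> rmat n" "C \<in> rmat n"
  shows "ring_mat_prod R (ring_mat_prod R A B) C = ring_mat_prod R A (ring_mat_prod R B C)"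
proof (rule rent_eqI)
  fix i l
  have "total (map (\<lambda>p. rent n A i p \<otimes> total (map (\<lambda>q. rent n B p q \<otimes> rent n C q l) [0..<n])) [0..<n])
    = total (map (\<lambda>q. total (map (\<lambda>p. rent n A i p \<otimes> rent n B p q) [0..<n]) \<otimes> rent n C q l) [0..<n])"
    by (rule total_total) (use assms in auto)
  then show "rent n (ring_mat_prod R (ring_mat_prod R A B) C) i l = rent n (ring_mat_prod R A (ring_mat_prod R B C)) i l"
    using assms by (simp only: rent_prod ring_mat_prod_in)
qed (use assms in \<open>auto simp: ring_mat_prod_carrier rmat_carrier\<close>)

lemma ring_id_mat_in: "ring_id_mat R n \<in> rmat n"
  by (auto simp: ring_id_mat_def rmat_def)

lemma ring_id_mat_prod:
  assumes A: "A \<in> rmat n"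
  shows "ring_mat_prod R (ring_id_mat R n) A = A" "ring_mat_prod R A (ring_id_mat R n) = A"
proof -
  have r: "rent n (ring_id_mat R n) i j = (if i = j \<and> i < n then \<one> else \<zero>)" for i j
    by (auto simp: rent_def ring_id_mat_def)
  have "rent n (ring_mat_prod R (ring_id_mat R n) A) i l = rent n A i l" for i l
  proof (cases "i < n")
    case True
    have "total (map (\<lambda>j. rent n (ring_id_mat R n) i j \<otimes> rent n A j l) [0..<n]) = rent n (ring_id_mat R n) i i \<otimes> rent n A i l"
      by (rule total_single) (use A True in \<open>auto simp: r\<close>)
    then show ?thesis using A True by (simp only: rent_prod[OF ring_id_mat_in A]) (simp add: r)
  qed (simp add: rent_def)
  then show "ring_mat_prod R (ring_id_mat R n) A = A"
    using A ring_id_mat_in by (intro rent_eqI[where n = n]) (auto simp: ring_mat_prod_carrier rmat_carrier)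
  have "rent n (ring_mat_prod R A (ring_id_mat R n)) i l = rent n A i l" for i l
  proof (cases "l < n")
    case True
    have "total (map (\<lambda>j. rent n A i j \<otimes> rent n (ring_id_mat R n) j l) [0..<n]) = rent n A i l \<otimes> rent n (ring_id_mat R n) l l"
      by (rule total_single) (use A True in \<open>auto simp: r\<close>)
    then show ?thesis using A True by (simp only: rent_prod[OF A ring_id_mat_in]) (simp add: r)
  qed (simp add: rent_def)
  then show "ring_mat_prod R A (ring_id_mat R n) = A"
    using A ring_id_mat_in by (intro rent_eqI[where n = n]) (auto simp: ring_mat_prod_carrier rmat_carrier)
qed

lemma ring_invertible_matI:
  "B \<in> rmat n \<Longrightarrow> ring_mat_prod R A B = ring_id_mat R n \<Longrightarrow> ring_mat_prod R B A = ring_id_mat R n \<Longrightarrow> ring_invertible_mat R n A"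
  by (auto simp: ring_invertible_mat_def rmat_def)

lemma ring_invertible_matE:
  assumes "ring_invertible_mat R n A"
  obtains B where "B \<in> rmat n" "ring_mat_prod R A B = ring_id_mat R n" "ring_mat_prod R B A = ring_id_mat R n"
  using assms by (auto simp: ring_invertible_mat_def rmat_def)

lemma ring_invertible_prod:
  assumes A: "A \<in> rmat n" "ring_invertible_mat R n A" and B: "B \<in> rmat n" "ring_invertible_mat R n B"
  shows "ring_invertible_mat R n (ring_mat_prod R A B)"
proof -
  obtain A' where A': "A' \<in> rmat n" "ring_mat_prod R A A' = ring_id_mat R n" "ring_mat_prod R A' A = ring_id_mat R n"
    using A(2) by (rule ring_invertible_matE)
  obtain B' where B': "B' \<in> rmat n" "ring_mat_prod R B B' = ring_id_mat R n" "ring_mat_prod R B' B = ring_id_mat R n"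
    using B(2) by (rule ring_invertible_matE)
  note i = A(1) B(1) A'(1) B'(1) ring_mat_prod_in
  have "ring_mat_prod R (ring_mat_prod R A B) (ring_mat_prod R B' A') = ring_mat_prod R A (ring_mat_prod R (ring_mat_prod R B B') A')"
    by (simp only: ring_mat_prod_assoc[where n = n] i)
  moreover have "ring_mat_prod R (ring_mat_prod R B' A') (ring_mat_prod R A B) = ring_mat_prod R B' (ring_mat_prod R (ring_mat_prod R A' A) B)"
    by (simp only: ring_mat_prod_assoc[where n = n] i)
  ultimately show ?thesis
    by (intro ring_invertible_matI[of "ring_mat_prod R B' A'"]) (simp_all add: A' B' i ring_id_mat_prod)
qed

lemma ring_block_mat_in: "A \<in> rmat n \<Longrightarrow> B \<in> rmat m \<Longrightarrow> ring_block_mat A B \<in> rmat (n + m)"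
  by (auto simp: rmat_def ring_block_mat_def)

lemma rent_block: "A \<in> rmat n \<Longrightarrow> B \<in> rmat m \<Longrightarrow> rent (n + m) (ring_block_mat A B) = blk \<zero> n (rent n A) (rent m B)"
  by (auto simp: fun_eq_iff rent_def blk_def ring_block_mat_def rmat_def)

lemma ring_block_prod:
  assumes "A \<in> rmat n" "A' \<in> rmat m" "B \<in> rmat n" "B' \<in> rmat m"
  shows "ring_mat_prod R (ring_block_mat A A') (ring_block_mat B B') = ring_block_mat (ring_mat_prod R A B) (ring_mat_prod R A' B')"
proof (rule rent_eqI)
  fix i l
  have "total (map (\<lambda>j. blk \<zero> n (rent n A) (rent m A') i j \<otimes> blk \<zero> n (rent n B) (rent m B') j l) [0..<n + m])
    = blk \<zero> n (\<lambda>i l. total (map (\<lambda>j. rent n A i j \<otimes> rent n B j l) [0..<n])) (\<lambda>i l. total (map (\<lambda>j. rent m A' i j \<otimes> rent m B' j l) [0..<m])) i l"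
    by (rule blk_mult[where X = "carrier R"]) (use assms in \<open>auto intro: total_filter simp: total_eq_foldr[of "[]"]\<close>)
  also have "\<dots> = blk \<zero> n (rent n (ring_mat_prod R A B)) (rent m (ring_mat_prod R A' B')) i l"
    using assms by (simp only: blk_def rent_prod)
  finally show "rent (n + m) (ring_mat_prod R (ring_block_mat A A') (ring_block_mat B B')) i l = rent (n + m) (ring_block_mat (ring_mat_prod R A B) (ring_mat_prod R A' B')) i l"
    using assms by (simp only: rent_prod[OF ring_block_mat_in ring_block_mat_in] rent_block ring_mat_prod_in)
qed (use assms in \<open>auto intro!: ring_mat_prod_carrier rmat_carrier ring_block_mat_in ring_mat_prod_in\<close>)

lemma ring_block_id: "ring_block_mat (ring_id_mat R n) (ring_id_mat R m) = ring_id_mat R (n + m)"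
  by (auto simp: ring_block_mat_def ring_id_mat_def intro!: eq_matI)

lemma ring_invertible_block:
  assumes A: "A \<in> rmat n" "ring_invertible_mat R n A" and B: "B \<in> rmat m" "ring_invertible_mat R m B"
  shows "ring_invertible_mat R (n + m) (ring_block_mat A B)"
proof -
  obtain A' where A': "A' \<in> rmat n" "ring_mat_prod R A A' = ring_id_mat R n" "ring_mat_prod R A' A = ring_id_mat R n"
    using A(2) by (rule ring_invertible_matE)
  obtain B' where B': "B' \<in> rmat m" "ring_mat_prod R B B' = ring_id_mat R m" "ring_mat_prod R B' B = ring_id_mat R m"
    using B(2) by (rule ring_invertible_matE)
  have "ring_mat_prod R (ring_block_mat A B) (ring_block_mat A' B') = ring_id_mat R (n + m)"
    by (subst ring_block_prod[OF A(1) B(1) A'(1) B'(1)]) (simp add: A' B' ring_block_id)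
  moreover have "ring_mat_prod R (ring_block_mat A' B') (ring_block_mat A B) = ring_id_mat R (n + m)"
    by (subst ring_block_prod[OF A'(1) B'(1) A(1) B(1)]) (simp add: A' B' ring_block_id)
  ultimately show ?thesis by (intro ring_invertible_matI[OF ring_block_mat_in[OF A'(1) B'(1)]])
qed

end

section \<open>Path components\<close>

context strict_bimonoidal_category
begin

definition conn :: "('o \<times> 'o) set" where
  "conn = {(x, y). x \<in> sObj R \<and> y \<in> sObj R \<and> sHom R 0 x y \<noteq> {}}"

lemma path_rel_eq: "path_rel R = (conn \<union> conn\<inverse>)\<^sup>* \<inter> sObj R \<times> sObj R"
  by (simp only: path_rel_def conn_def Let_def)

lemma equiv_path_rel: "equiv (sObj R) (path_rel R)"
proof (rule equivI)
  show "refl_on (sObj R) (path_rel R)" by (auto simp: refl_on_def path_rel_eq)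
  show "path_rel R \<subseteq> sObj R \<times> sObj R" by (auto simp: path_rel_eq)
  have "sym ((conn \<union> conn\<inverse>)\<^sup>*)" by (intro sym_rtrancl) (auto simp: sym_def)
  then show "sym (path_rel R)" by (auto simp: path_rel_eq sym_def)
  show "trans (path_rel R)" by (auto simp: path_rel_eq trans_def)
qed

text \<open>
  A map on objects that can be extended to \<open>0\<close>-simplices preserves paths; applied to one variable
  at a time, it shows that sums and products are well defined on path components.
\<close>

lemma path_rel_map:
  assumes "\<And>x y f. x \<in> sObj R \<Longrightarrow> y \<in> sObj R \<Longrightarrow> f \<in> sHom R 0 x y \<Longrightarrow> \<exists>g. g \<in> sHom R 0 (F x) (F y)"
    and "\<And>x. x \<in> sObj R \<Longrightarrow> F x \<in> sObj R" and "(a, b) \<in> path_rel R"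
  shows "(F a, F b) \<in> path_rel R"
proof -
  have F_step: "(F x, F y) \<in> conn \<union> conn\<inverse>" if "(x, y) \<in> conn \<union> conn\<inverse>" for x y
    using that assms(1,2) unfolding conn_def by fastforce
  have "(a, b) \<in> (conn \<union> conn\<inverse>)\<^sup>*" using assms(3) by (simp add: path_rel_eq)
  then have "(F a, F b) \<in> (conn \<union> conn\<inverse>)\<^sup>*"
  proof (induction rule: rtrancl_induct)
    case (step x y)
    from this(3) F_step[OF this(2)] show ?case by (rule rtrancl_into_rtrancl)
  qed simp
  with assms(2,3) show ?thesis by (simp add: path_rel_eq)
qed

definition cls :: "'o \<Rightarrow> 'o set" where "cls a = path_rel R `` {a}"

lemma cls_eqI: "a \<in> sObj R \<Longrightarrow> b \<in> sObj R \<Longrightarrow> f \<in> sHom R 0 a b \<Longrightarrow> cls a = cls b"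
  unfolding cls_def by (rule equiv_class_eq[OF equiv_path_rel]) (auto simp: path_rel_eq conn_def)

lemma cls_self: "a \<in> sObj R \<Longrightarrow> a \<in> cls a"
  unfolding cls_def by (auto simp: path_rel_eq)

lemma cls_carrier: "a \<in> sObj R \<Longrightarrow> cls a \<in> carrier (pi0 R)"
  by (auto simp: pi0_def cls_def intro: quotientI)

lemma carrier_pi0E:
  assumes "X \<in> carrier (pi0 R)" obtains a where "a \<in> sObj R" "X = cls a"
  using assms by (auto simp: pi0_def cls_def elim!: quotientE)

lemma cls_plus:
  assumes "a \<in> sObj R" "b \<in> sObj R"
  shows "cls a \<oplus>\<^bsub>pi0 R\<^esub> cls b = cls (a [+] b)"
proof -
  have "(\<Union>p\<in>cls a. \<Union>q\<in>cls b. cls (p [+] q)) = cls (a [+] b)"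
  proof (rule UN_const2)
    fix p q assume "p \<in> cls a" "q \<in> cls b"
    then have p: "(a, p) \<in> path_rel R" "(b, q) \<in> path_rel R" by (auto simp: cls_def)
    then have o: "p \<in> sObj R" "q \<in> sObj R" by (auto simp: path_rel_eq)
    have "(a [+] b, p [+] b) \<in> path_rel R"
      by (rule path_rel_map[of "\<lambda>x. x [+] b"]) (use p o assms id_in[of b 0] in \<open>auto intro: plusM_in\<close>)
    moreover have "(p [+] b, p [+] q) \<in> path_rel R"
      by (rule path_rel_map[of "\<lambda>x. p [+] x"]) (use p o assms id_in[of p 0] in \<open>auto intro: plusM_in\<close>)
    ultimately have "(a [+] b, p [+] q) \<in> path_rel R" using equiv_path_rel by (meson equivE transD)
    then show "cls (p [+] q) = cls (a [+] b)" unfolding cls_def by (rule equiv_class_eq[OF equiv_path_rel, symmetric])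
  qed (use assms cls_self in auto)
  then show ?thesis by (simp add: pi0_def cls_def)
qed

lemma cls_times:
  assumes "a \<in> sObj R" "b \<in> sObj R"
  shows "cls a \<otimes>\<^bsub>pi0 R\<^esub> cls b = cls (a [*] b)"
proof -
  have "(\<Union>p\<in>cls a. \<Union>q\<in>cls b. cls (p [*] q)) = cls (a [*] b)"
  proof (rule UN_const2)
    fix p q assume "p \<in> cls a" "q \<in> cls b"
    then have p: "(a, p) \<in> path_rel R" "(b, q) \<in> path_rel R" by (auto simp: cls_def)
    then have o: "p \<in> sObj R" "q \<in> sObj R" by (auto simp: path_rel_eq)
    have "(a [*] b, p [*] b) \<in> path_rel R"
      by (rule path_rel_map[of "\<lambda>x. x [*] b"]) (use p o assms id_in[of b 0] in \<open>auto intro: timesM_in\<close>)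
    moreover have "(p [*] b, p [*] q) \<in> path_rel R"
      by (rule path_rel_map[of "\<lambda>x. p [*] x"]) (use p o assms id_in[of p 0] in \<open>auto intro: timesM_in\<close>)
    ultimately have "(a [*] b, p [*] q) \<in> path_rel R" using equiv_path_rel by (meson equivE transD)
    then show "cls (p [*] q) = cls (a [*] b)" unfolding cls_def by (rule equiv_class_eq[OF equiv_path_rel, symmetric])
  qed (use assms cls_self in auto)
  then show ?thesis by (simp add: pi0_def cls_def)
qed

lemma cls_zero_one: "\<zero>\<^bsub>pi0 R\<^esub> = cls (rzero R)" "\<one>\<^bsub>pi0 R\<^esub> = cls (rone R)"
  by (simp_all add: pi0_def cls_def)

text \<open>
  Commutativity and left distributivity, which hold in the category up to isomorphism, become
  equations between path components.
\<close>

lemma semiring_pi0: "semiring (pi0 R)"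
proof -
  have comm: "cls (a [+] b) = cls (b [+] a)" if "a \<in> sObj R" "b \<in> sObj R" for a b
    using that by (intro cls_eqI[OF _ _ gam_in]) auto
  have distrib: "cls (a [*] (b [+] c)) = cls (a [*] b [+] a [*] c)" if "a \<in> sObj R" "b \<in> sObj R" "c \<in> sObj R" for a b c
    using that by (intro cls_eqI[OF _ _ delta_in]) auto
  note c = cls_carrier cls_plus cls_times cls_zero_one
  show ?thesis
    by (unfold_locales, simp_all only: monoid_record_simps)
      (auto elim!: carrier_pi0E simp: c comm distrib)
qed

section \<open>General linear groups\<close>

definition pi0_completion :: "('o set \<times> 'o set) set ring" where "pi0_completion = ring_completion (pi0 R)"

text \<open>
  The image of an object in the ring completion of the semiring of path components.
\<close>

definition hcls :: "'o \<Rightarrow> ('o set \<times> 'o set) set" where "hcls a = to_completion (pi0 R) (cls a)"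

lemma semiring_pi0_completion: "semiring pi0_completion"
  unfolding pi0_completion_def by (rule semiring.semiring_ring_completion[OF semiring_pi0])

lemma hcls_in: "a \<in> sObj R \<Longrightarrow> hcls a \<in> carrier pi0_completion"
  using semiring.to_completion_hom(1)[OF semiring_pi0] cls_carrier unfolding hcls_def pi0_completion_def by blast

lemma hcls_hom:
  assumes "a \<in> sObj R" "b \<in> sObj R"
  shows "hcls (a [+] b) = hcls a \<oplus>\<^bsub>pi0_completion\<^esub> hcls b"
    "hcls (a [*] b) = hcls a \<otimes>\<^bsub>pi0_completion\<^esub> hcls b"
  using semiring.to_completion_hom[OF semiring_pi0 cls_carrier[OF assms(1)] cls_carrier[OF assms(2)]] assms
  unfolding hcls_def pi0_completion_def by (simp_all add: cls_plus cls_times)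

lemma hcls_zero_one: "hcls (rzero R) = \<zero>\<^bsub>pi0_completion\<^esub>" "hcls (rone R) = \<one>\<^bsub>pi0_completion\<^esub>"
  using semiring.to_completion_zero_one[OF semiring_pi0] unfolding hcls_def pi0_completion_def by (simp_all add: cls_zero_one)

abbreviation gob :: "nat \<Rightarrow> 'o mat set" where "gob n \<equiv> sObj (GL_cat R n)"

lemma gob_iff: "U \<in> gob n \<longleftrightarrow> U \<in> mob n \<and> ring_invertible_mat pi0_completion n (map_mat hcls U)"
proof -
  have "map_mat (\<lambda>a. path_rel R `` {a}) U \<in> GL_semiring (pi0 R) n \<longleftrightarrow> ring_invertible_mat pi0_completion n (map_mat hcls U)"
    if "U \<in> mob n"
  proof -
    have "map_mat (to_completion (pi0 R)) (map_mat cls U) = map_mat hcls U"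
      by (auto simp: hcls_def intro!: eq_matI)
    moreover have "map_mat cls U \<in> carrier_mat n n" "\<forall>i<n. \<forall>j<n. map_mat cls U $$ (i, j) \<in> carrier (pi0 R)"
      using that by (auto simp: mob_iff cls_carrier)
    ultimately show ?thesis by (simp add: GL_semiring_def pi0_completion_def flip: cls_def)
  qed
  then show ?thesis by (auto simp: GL_cat_def)
qed

lemma gob_mob: "U \<in> gob n \<Longrightarrow> U \<in> mob n"
  by (simp add: gob_iff)

lemma map_hcls_in: "U \<in> mob n \<Longrightarrow> map_mat hcls U \<in> semiring.rmat pi0_completion n"
  by (auto simp: semiring.rmat_def[OF semiring_pi0_completion] mob_iff hcls_in)

text \<open>
  The passage to the completion of \<open>\<pi>\<^sub>0\<close> is a homomorphism, so it is compatible with matrix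
  multiplication.
\<close>

lemma map_hcls_prod:
  assumes U: "U \<in> mob n" and V: "V \<in> mob n"
  shows "map_mat hcls (mat_prod R U V) = ring_mat_prod pi0_completion (map_mat hcls U) (map_mat hcls V)"
proof -
  interpret N: semiring pi0_completion by (rule semiring_pi0_completion)
  have r: "N.rent n (map_mat hcls U) i j = hcls (ent R n U i j)" if "U \<in> mob n" for U i j
    using that by (auto simp: N.rent_def ent_def mob_iff hcls_zero_one)
  have T: "hcls (lev.Tot (map f js)) = sum_category.Tot (add pi0_completion) (zero pi0_completion) (map (\<lambda>j. hcls (f j)) js)"
    if "\<And>j. f j \<in> sObj R" for f :: "nat \<Rightarrow> 'o" and js
    using that by (induction js) (simp_all add: N.total_eq_foldr hcls_zero_one hcls_hom Tot_Ob')
  show ?thesis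
  proof (rule N.rent_eqI)
    show "N.rent n (map_mat hcls (mat_prod R U V)) i l = N.rent n (ring_mat_prod pi0_completion (map_mat hcls U) (map_mat hcls V)) i l" for i l
      using U V by (simp add: r mat_prod_in ent_mat_prod T N.rent_prod map_hcls_in hcls_hom)
  qed (use U V in \<open>simp_all add: mat_prod_carrier N.ring_mat_prod_carrier mob_carrier\<close>)
qed

lemma map_hcls_block:
  assumes "U \<in> mob n" "V \<in> mob m"
  shows "map_mat hcls (block_sum R U V) = semiring.ring_block_mat pi0_completion (map_mat hcls U) (map_mat hcls V)"
  using assms unfolding semiring.ring_block_mat_def[OF semiring_pi0_completion]
  by (auto simp: block_sum_def mob_iff hcls_zero_one intro!: eq_matI)

lemma map_hcls_id: "map_mat hcls (id_mat R n) = ring_id_mat pi0_completion n"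
  by (auto simp: id_mat_def ring_id_mat_def hcls_zero_one intro!: eq_matI)

lemma gob_prod: "U \<in> gob n \<Longrightarrow> V \<in> gob n \<Longrightarrow> mat_prod R U V \<in> gob n"
  using semiring.ring_invertible_prod[OF semiring_pi0_completion]
  by (auto simp: gob_iff mat_prod_in map_hcls_prod map_hcls_in)

lemma gob_block: "U \<in> gob n \<Longrightarrow> V \<in> gob m \<Longrightarrow> block_sum R U V \<in> gob (n + m)"
  using semiring.ring_invertible_block[OF semiring_pi0_completion]
  by (auto simp: gob_iff block_sum_in map_hcls_block map_hcls_in)

text \<open>
  A strict inverse over the category maps to an inverse over the completion; this applies to
  permutation matrices.
\<close>

lemma gobI_inverse:
  assumes "U \<in> mob n" "V \<in> mob n" "mat_prod R U V = id_mat R n" "mat_prod R V U = id_mat R n"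
  shows "U \<in> gob n"
  unfolding gob_iff
  by (intro conjI semiring.ring_invertible_matI[OF semiring_pi0_completion map_hcls_in[OF assms(2)]] assms(1))
    (simp_all add: assms map_hcls_id flip: map_hcls_prod[OF assms(1,2)] map_hcls_prod[OF assms(2,1)])

lemma gob_id: "id_mat R n \<in> gob n"
  by (rule gobI_inverse[of _ _ "id_mat R n"]) (simp_all add: id_mat_times)

lemma gob_swap: "swap_mat n m \<in> gob (n + m)"
proof -
  have "swap_mat m n \<in> mob (n + m)" using swap_mat_in[of m n] by (simp only: add.commute[of n m])
  then show ?thesis
    using swap_mat_swap_mat[of m n] swap_mat_swap_mat[of n m]
    by (intro gobI_inverse[OF swap_mat_in]) (simp_all add: add.commute)
qed

end

section \<open>Full subcategories and empty categories\<close>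

lemma scategory_full_subcategory:
  assumes "scategory C" "S \<subseteq> sObj C"
  shows "scategory (C\<lparr>sObj := S\<rparr>)"
proof -
  interpret C: scategory C by fact
  have [simp, intro]: "x \<in> S \<Longrightarrow> x \<in> sObj C" for x using assms(2) by blast
  show ?thesis
    by unfold_locales (simp_all, (blast intro: C.id_in C.comp_in C.face_in C.degen_in
      C.comp_id_left C.comp_id_right C.comp_assoc C.face_face[unfolded One_nat_def] C.face_degen_less[unfolded One_nat_def] C.face_degen_eq C.face_degen_greater[unfolded One_nat_def]
      C.degen_degen C.face_id C.degen_id C.face_comp C.degen_comp)+)
qed

lemma sfunctor_empty: "sObj C = {} \<Longrightarrow> sfunctor C D Fo Fm"
  by unfold_locales auto

lemma snat_iso_empty: "sObj C = {} \<Longrightarrow> snat_iso C D Fo Fm Go Gm \<eta>"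
  by unfold_locales auto

lemma scategory_empty: "scategory empty_cat"
  by unfold_locales (auto simp: empty_cat_def)

lemma sObj_prod_cat [simp]: "sObj (prod_cat C D) = sObj C \<times> sObj D"
  by (simp add: prod_cat_def)

lemma sObj_empty_cat [simp]: "sObj empty_cat = {}"
  by (simp add: empty_cat_def)

context strict_bimonoidal_category
begin

lemma GL_sel [simp]:
  "sHom (GL_cat R n) = sHom (mat_cat R n)" "sId (GL_cat R n) = sId (mat_cat R n)" "sComp (GL_cat R n) = sComp (mat_cat R n)"
  "sFace (GL_cat R n) = sFace (mat_cat R n)" "sDegen (GL_cat R n) = sDegen (mat_cat R n)"
  by (simp_all add: GL_cat_def)

lemma degens_GL [simp]: "degens (GL_cat R n) k \<phi> = degens (mat_cat R n) k \<phi>"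
  by (induction k) simp_all

lemma siso_GL [simp]: "siso (GL_cat R n) = siso (mat_cat R n)"
  by (auto simp: siso_def fun_eq_iff)

lemma sinv_GL [simp]: "sinv (GL_cat R n) = sinv (mat_cat R n)"
  by (auto simp: sinv_def fun_eq_iff)

lemma scategory_GL: "scategory (GL_cat R n)"
  unfolding GL_cat_def by (rule scategory_full_subcategory[OF scategory_mat_cat]) auto

abbreviation idm :: "nat \<Rightarrow> 'o mat \<Rightarrow> 'm mat" where "idm k U \<equiv> map_mat (sId R k) U"

lemma sId_mat [simp]: "sId (mat_cat R n) k U = idm k U"
  by (simp add: mat_cat_def)

lemma idm_in: "U \<in> mob n \<Longrightarrow> idm k U \<in> mhom n k U U"
  using scategory.id_in[OF scategory_mat_cat] by fastforce

lemma idm_left: "U \<in> mob n \<Longrightarrow> V \<in> mob n \<Longrightarrow> \<phi> \<in> mhom n k U V \<Longrightarrow> sComp (mat_cat R n) k (idm k V) \<phi> = \<phi>"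
  using scategory.comp_id_left[OF scategory_mat_cat] by fastforce

lemma idm_right: "U \<in> mob n \<Longrightarrow> V \<in> mob n \<Longrightarrow> \<phi> \<in> mhom n k U V \<Longrightarrow> sComp (mat_cat R n) k \<phi> (idm k U) = \<phi>"
  using scategory.comp_id_right[OF scategory_mat_cat] by fastforce

lemma idm_idm: "U \<in> mob n \<Longrightarrow> sComp (mat_cat R n) k (idm k U) (idm k U) = idm k U"
  by (rule idm_left) (auto intro: idm_in)

lemma idm_siso: "U \<in> mob n \<Longrightarrow> siso (mat_cat R n) k U U (idm k U)"
  using scategory.siso_id[OF scategory_mat_cat] by fastforce

lemma degens_idm: "U \<in> mob n \<Longrightarrow> degens (mat_cat R n) k (idm 0 U) = idm k U"
  using scategory.degens_id[OF scategory_mat_cat] by fastforce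

lemma sinv_idm: "U \<in> mob n \<Longrightarrow> sinv (mat_cat R n) U U (idm 0 U) = idm 0 U"
  using scategory.sinv_id[OF scategory_mat_cat] by fastforce

lemmas idm_prod = mat_prodM_id[unfolded sId_mat]
lemmas idm_block = block_sumM_id[unfolded sId_mat]

text \<open>
  All structure isomorphisms below other than the associators are identities. For these, being a
  natural isomorphism amounts to the equality of two functors.
\<close>

lemma snat_iso_identity:
  assumes "\<And>x. x \<in> sObj C \<Longrightarrow> Fo x \<in> mob n \<and> Go x = Fo x \<and> \<eta> x = idm 0 (Fo x)"
    and "\<And>x y k f. x \<in> sObj C \<Longrightarrow> y \<in> sObj C \<Longrightarrow> f \<in> sHom C k x y \<Longrightarrow> Fm k f \<in> mhom n k (Fo x) (Fo y) \<and> Gm k f = Fm k f"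
  shows "snat_iso C (GL_cat R n) Fo Fm Go Gm \<eta>"
proof
  show "siso (GL_cat R n) 0 (Fo x) (Go x) (\<eta> x)" if "x \<in> sObj C" for x
    using assms(1)[OF that] by (simp add: idm_siso)
  show "sComp (GL_cat R n) k (degens (GL_cat R n) k (\<eta> y)) (Fm k f) = sComp (GL_cat R n) k (Gm k f) (degens (GL_cat R n) k (\<eta> x))"
    if "x \<in> sObj C" "y \<in> sObj C" "f \<in> sHom C k x y" for x y k f
    using assms(1)[OF that(1)] assms(1)[OF that(2)] assms(2)[OF that] by (simp add: degens_idm idm_left[of "Fo x"] idm_right[of _ _ "Fo y"])
qed

lemma GL_prod_functor:
  "sfunctor (prod_cat (GL_cat R n) (GL_cat R n)) (GL_cat R n) (\<lambda>(U, V). mat_prod R U V) (\<lambda>k (\<phi>, \<psi>). mat_prodM R k \<phi> \<psi>)"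
proof -
  interpret F: sfunctor "prod_cat (mat_cat R n) (mat_cat R n)" "mat_cat R n" "\<lambda>(U, V). mat_prod R U V" "\<lambda>k (\<phi>, \<psi>). mat_prodM R k \<phi> \<psi>"
    by (rule mat_prod_functor)
  have p: "sHom (prod_cat (GL_cat R n) (GL_cat R n)) = sHom (prod_cat (mat_cat R n) (mat_cat R n))"
    "sId (prod_cat (GL_cat R n) (GL_cat R n)) = sId (prod_cat (mat_cat R n) (mat_cat R n))"
    "sComp (prod_cat (GL_cat R n) (GL_cat R n)) = sComp (prod_cat (mat_cat R n) (mat_cat R n))"
    "sFace (prod_cat (GL_cat R n) (GL_cat R n)) = sFace (prod_cat (mat_cat R n) (mat_cat R n))"
    "sDegen (prod_cat (GL_cat R n) (GL_cat R n)) = sDegen (prod_cat (mat_cat R n) (mat_cat R n))"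
    by (simp_all add: prod_cat_def)
  have o: "x \<in> sObj (prod_cat (mat_cat R n) (mat_cat R n))" if "x \<in> sObj (prod_cat (GL_cat R n) (GL_cat R n))" for x
    using that gob_mob by auto
  show ?thesis
  proof
    show "(\<lambda>(U, V). mat_prod R U V) x \<in> gob n" if "x \<in> sObj (prod_cat (GL_cat R n) (GL_cat R n))" for x
      using that gob_prod by auto
  qed (unfold p GL_sel, (rule F.hom_in F.map_id F.map_comp F.map_face F.map_degen; (assumption | erule o))+)
qed

section \<open>The bicategory of free modules\<close>

lemma module_simps [simp]:
  "bObj (module_bicat R) = UNIV" "bHom (module_bicat R) n n = GL_cat R n" "bId (module_bicat R) = id_mat R"
  "bComp (module_bicat R) a b c = mat_prod R" "bComp2 (module_bicat R) a b c = mat_prodM R"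
  "bAssoc (module_bicat R) a b c d = mat_assoc R" "bLeft (module_bicat R) a b = idm 0" "bRight (module_bicat R) a b = idm 0"
  "f \<in> sObj (bHom (module_bicat R) n m) \<longleftrightarrow> n = m \<and> f \<in> gob n"
  by (simp_all add: module_bicat_def fun_eq_iff)

lemma module_hom_empty: "n \<noteq> m \<Longrightarrow> sObj (bHom (module_bicat R) n m) = {}"
  by (simp add: module_bicat_def)

text \<open>
  Between different objects the hom categories are empty, which settles every axiom there. For
  equal objects, the associativity isomorphism and its pentagon come from the previous sections,
  and the triangle holds since the associativity isomorphism with an identity matrix in the middle
  is an identity.
\<close>

lemma bicategory_module: "bicategory (module_bicat R)"
proof (rule bicategory.intro)
  fix a b c d e :: nat
  let ?B = "module_bicat R"
  show "scategory (bHom ?B a b)"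
    by (simp add: module_bicat_def scategory_GL scategory_empty)
  show "bId ?B a \<in> bMor ?B a a" by (simp add: gob_id)
  show "sfunctor (prod_cat (bHom ?B b c) (bHom ?B a b)) (bHom ?B a c) (\<lambda>(g, f). bComp ?B a b c g f) (\<lambda>k (\<psi>, \<phi>). bComp2 ?B a b c k \<psi> \<phi>)"
  proof (cases "a = b \<and> b = c")
    case True then show ?thesis using GL_prod_functor by simp
  qed (auto intro!: sfunctor_empty)
  show "snat_iso (prod_cat (bHom ?B c d) (prod_cat (bHom ?B b c) (bHom ?B a b))) (bHom ?B a d)
        (\<lambda>(h, g, f). bComp ?B a c d h (bComp ?B a b c g f)) (\<lambda>k (\<chi>, \<psi>, \<phi>). bComp2 ?B a c d k \<chi> (bComp2 ?B a b c k \<psi> \<phi>))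
        (\<lambda>(h, g, f). bComp ?B a b d (bComp ?B b c d h g) f) (\<lambda>k (\<chi>, \<psi>, \<phi>). bComp2 ?B a b d k (bComp2 ?B b c d k \<chi> \<psi>) \<phi>)
        (\<lambda>(h, g, f). bAssoc ?B a b c d h g f)"
  proof (cases "a = b \<and> b = c \<and> c = d")
    case True
    then have [simp]: "b = a" "c = a" "d = a" by auto
    show ?thesis
    proof
      fix x assume "x \<in> sObj (prod_cat (bHom ?B c d) (prod_cat (bHom ?B b c) (bHom ?B a b)))"
      then obtain h g f where x: "x = (h, g, f)" "h \<in> mob a" "g \<in> mob a" "f \<in> mob a" using gob_mob by auto
      then show "siso (bHom ?B a d) 0 ((\<lambda>(h, g, f). bComp ?B a c d h (bComp ?B a b c g f)) x)
        ((\<lambda>(h, g, f). bComp ?B a b d (bComp ?B b c d h g) f) x) ((\<lambda>(h, g, f). bAssoc ?B a b c d h g f) x)"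
        by (simp add: mhom_siso mat_assoc_in mat_prod_in)
    next
      fix x y k \<theta>
      assume "x \<in> sObj (prod_cat (bHom ?B c d) (prod_cat (bHom ?B b c) (bHom ?B a b)))"
        "y \<in> sObj (prod_cat (bHom ?B c d) (prod_cat (bHom ?B b c) (bHom ?B a b)))"
        and t: "\<theta> \<in> sHom (prod_cat (bHom ?B c d) (prod_cat (bHom ?B b c) (bHom ?B a b))) k x y"
      then obtain h g f h' g' f' where x: "x = (h, g, f)" "h \<in> mob a" "g \<in> mob a" "f \<in> mob a"
        and y: "y = (h', g', f')" "h' \<in> mob a" "g' \<in> mob a" "f' \<in> mob a" using gob_mob by auto
      from t x y obtain \<chi> \<psi> \<phi> where "\<theta> = (\<chi>, \<psi>, \<phi>)" "\<chi> \<in> mhom a k h h'" "\<psi> \<in> mhom a k g g'" "\<phi> \<in> mhom a k f f'"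
        by (auto simp: prod_cat_def)
      with x y mat_assoc_natural[OF x(2-4) y(2-4), of \<chi> k \<psi> \<phi>]
      show "sComp (bHom ?B a d) k (degens (bHom ?B a d) k ((\<lambda>(h, g, f). bAssoc ?B a b c d h g f) y))
          ((\<lambda>k (\<chi>, \<psi>, \<phi>). bComp2 ?B a c d k \<chi> (bComp2 ?B a b c k \<psi> \<phi>)) k \<theta>) =
        sComp (bHom ?B a d) k ((\<lambda>k (\<chi>, \<psi>, \<phi>). bComp2 ?B a b d k (bComp2 ?B b c d k \<chi> \<psi>) \<phi>) k \<theta>)
          (degens (bHom ?B a d) k ((\<lambda>(h, g, f). bAssoc ?B a b c d h g f) x))"
        by simp
    qed
  qed (auto intro!: snat_iso_empty)
  show "snat_iso (bHom ?B a b) (bHom ?B a b) (\<lambda>f. bComp ?B a b b (bId ?B b) f) (\<lambda>k \<phi>. bComp2 ?B a b b k (sId (bHom ?B b b) k (bId ?B b)) \<phi>)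
        (\<lambda>f. f) (\<lambda>k \<phi>. \<phi>) (bLeft ?B a b)"
  proof (cases "a = b")
    case True
    show ?thesis unfolding True module_simps
      by (rule snat_iso_identity) (auto simp: id_mat_times gob_mob dest: id_mat_timesM[unfolded sId_mat, OF gob_mob gob_mob])
  qed (auto intro!: snat_iso_empty module_hom_empty)
  show "snat_iso (bHom ?B a b) (bHom ?B a b) (\<lambda>f. bComp ?B a a b f (bId ?B a)) (\<lambda>k \<phi>. bComp2 ?B a a b k \<phi> (sId (bHom ?B a a) k (bId ?B a)))
        (\<lambda>f. f) (\<lambda>k \<phi>. \<phi>) (bRight ?B a b)"
  proof (cases "a = b")
    case True
    show ?thesis unfolding True module_simps
      by (rule snat_iso_identity) (auto simp: times_id_mat gob_mob dest: times_id_matM[unfolded sId_mat, OF gob_mob gob_mob])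
  qed (auto intro!: snat_iso_empty module_hom_empty)
  show "bVert ?B a e (bAssoc ?B a b c e (bComp ?B c d e j h) g f) (bAssoc ?B a c d e j h (bComp ?B a b c g f)) =
      bVert ?B a e (bComp2 ?B a b e 0 (bAssoc ?B b c d e j h g) (bId2 ?B a b f))
        (bVert ?B a e (bAssoc ?B a b d e j (bComp ?B b c d h g) f) (bComp2 ?B a d e 0 (bId2 ?B d e j) (bAssoc ?B a b c d h g f)))"
    if "f \<in> bMor ?B a b" "g \<in> bMor ?B b c" "h \<in> bMor ?B c d" "j \<in> bMor ?B d e" for f g h j
    using that mat_assoc_pentagon[of j a h g f] by (auto dest!: gob_mob)
  show "bVert ?B a c (bComp2 ?B a b c 0 (bRight ?B b c g) (bId2 ?B a b f)) (bAssoc ?B a b b c g (bId ?B b) f) = bComp2 ?B a b c 0 (bId2 ?B b c g) (bLeft ?B a b f)"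
    if "f \<in> bMor ?B a b" "g \<in> bMor ?B b c" for f g
  proof -
    from that have [simp]: "b = a" "c = a" and m: "f \<in> mob a" "g \<in> mob a" using gob_mob by auto
    have "mat_assoc R g (id_mat R a) f = idm 0 (mat_prod R g f)"
      using mat_assoc_perm_middle(1)[OF m(2,1), of "\<lambda>i. i"] id_mat_times[OF m(1)] by (simp add: id_mat_eq_perm_mat)
    then show ?thesis using m by (simp add: idm_prod[OF m(2,1)] idm_idm mat_prod_in)
  qed
qed

end

section \<open>The symmetric monoidal structure\<close>

context strict_bimonoidal_category
begin

text \<open>
  The constraints of the block sum are identities, since it preserves products and identity
  matrices strictly.
\<close>

definition box :: "(nat \<times> nat, 'o mat \<times> 'o mat, 'm mat \<times> 'm mat, nat, 'o mat, 'm mat) pfun" where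
  "box = \<lparr>p0 = (\<lambda>(a, b). a + b), p1 = (\<lambda>_ _ (U, V). block_sum R U V), p2 = (\<lambda>_ _ k (\<phi>, \<psi>). block_sumM R k \<phi> \<psi>),
    pComp = (\<lambda>_ _ _ (g, g') (f, f'). idm 0 (block_sum R (mat_prod R g f) (mat_prod R g' f'))),
    pUnit = (\<lambda>(a, b). idm 0 (id_mat R (a + b)))\<rparr>"

text \<open>
  Conjugation by the block permutation matrix exchanges the two blocks strictly, so the naturality
  2-cells are identities.
\<close>

definition braiding :: "(nat \<times> nat, 'o mat \<times> 'o mat, 'o mat, 'm mat) trafo" where
  "braiding = \<lparr>t1 = (\<lambda>(a, b). swap_mat a b), t2 = (\<lambda>(a, b) _ (U, V). idm 0 (mat_prod R (swap_mat a b) (block_sum R U V)))\<rparr>"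

lemma box_simps [simp]:
  "p0 box (a, b) = a + b" "p1 box x y (U, V) = block_sum R U V" "p2 box x y k (\<phi>, \<psi>) = block_sumM R k \<phi> \<psi>"
  "pComp box x y z (g, g') (f, f') = idm 0 (block_sum R (mat_prod R g f) (mat_prod R g' f'))"
  "pUnit box (a, b) = idm 0 (id_mat R (a + b))"
  "t1 braiding (a, b) = swap_mat a b" "t2 braiding (a, b) y (U, V) = idm 0 (mat_prod R (swap_mat a b) (block_sum R U V))"
  by (simp_all add: box_def braiding_def)

lemma prod_bicat_simps [simp]:
  "bObj (prod_bicat B C) = bObj B \<times> bObj C" "bHom (prod_bicat B C) (a, a') (b, b') = prod_cat (bHom B a b) (bHom C a' b')"
  "bId (prod_bicat B C) (a, a') = (bId B a, bId C a')"
  "bComp (prod_bicat B C) (a, a') (b, b') (c, c') (g, g') (f, f') = (bComp B a b c g f, bComp C a' b' c' g' f')"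
  "bComp2 (prod_bicat B C) (a, a') (b, b') (c, c') k (\<psi>, \<psi>') (\<phi>, \<phi>') = (bComp2 B a b c k \<psi> \<phi>, bComp2 C a' b' c' k \<psi>' \<phi>')"
  "bAssoc (prod_bicat B C) (a, a') (b, b') (c, c') (d, d') (h, h') (g, g') (f, f') = (bAssoc B a b c d h g f, bAssoc C a' b' c' d' h' g' f')"
  "bLeft (prod_bicat B C) (a, a') (b, b') (f, f') = (bLeft B a b f, bLeft C a' b' f')"
  "bRight (prod_bicat B C) (a, a') (b, b') (f, f') = (bRight B a b f, bRight C a' b' f')"
  by (simp_all add: prod_bicat_def)

lemma prod_cat_simps [simp]:
  "sHom (prod_cat C D) k (x, x') (y, y') = sHom C k x y \<times> sHom D k x' y'"
  "sId (prod_cat C D) k (x, x') = (sId C k x, sId D k x')"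
  "sComp (prod_cat C D) k (g, g') (f, f') = (sComp C k g f, sComp D k g' f')"
  "sFace (prod_cat C D) k i (f, f') = (sFace C k i f, sFace D k i f')"
  "sDegen (prod_cat C D) k i (f, f') = (sDegen C k i f, sDegen D k i f')"
  by (simp_all add: prod_cat_def)

lemma block_functor:
  "sfunctor (prod_cat (GL_cat R n) (GL_cat R m)) (GL_cat R (n + m)) (p1 box x y) (p2 box x y)"
proof
  fix z w v k f g and i :: nat
  let ?C = "prod_cat (GL_cat R n) (GL_cat R m)"
  show "p1 box x y z \<in> gob (n + m)" if "z \<in> sObj ?C"
    using that by (auto simp: gob_block)
  show "p2 box x y k f \<in> sHom (GL_cat R (n + m)) k (p1 box x y z) (p1 box x y w)" if "z \<in> sObj ?C" "w \<in> sObj ?C" "f \<in> sHom ?C k z w"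
    using that by (cases z; cases w; cases f) (auto intro!: block_sumM_in gob_mob)
  show "p2 box x y k (sId ?C k z) = sId (GL_cat R (n + m)) k (p1 box x y z)" if "z \<in> sObj ?C"
    using that by (cases z) (auto intro!: idm_block gob_mob)
  show "p2 box x y k (sComp ?C k g f) = sComp (GL_cat R (n + m)) k (p2 box x y k g) (p2 box x y k f)"
    if "z \<in> sObj ?C" "w \<in> sObj ?C" "v \<in> sObj ?C" "f \<in> sHom ?C k z w" "g \<in> sHom ?C k w v"
  proof -
    obtain z1 z2 w1 w2 v1 v2 f1 f2 g1 g2 where zw: "z = (z1, z2)" "w = (w1, w2)" "v = (v1, v2)" "f = (f1, f2)" "g = (g1, g2)"
      by (cases z; cases w; cases v; cases f; cases g)
    have m: "z1 \<in> mob n" "z2 \<in> mob m" "w1 \<in> mob n" "w2 \<in> mob m" "v1 \<in> mob n" "v2 \<in> mob m"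
      "f1 \<in> mhom n k z1 w1" "f2 \<in> mhom m k z2 w2" "g1 \<in> mhom n k w1 v1" "g2 \<in> mhom m k w2 v2"
      using that gob_mob by (auto simp: zw)
    show ?thesis
      using block_sumM_comp[OF m] by (simp add: zw)
  qed
  show "p2 box x y k (sFace ?C k i f) = sFace (GL_cat R (n + m)) k i (p2 box x y (Suc k) f)"
    if "z \<in> sObj ?C" "w \<in> sObj ?C" "f \<in> sHom ?C (Suc k) z w" "i \<le> Suc k"
    using that by (cases z; cases w; cases f) (auto intro!: block_sumM_face mhom_carrier)
  show "p2 box x y (Suc k) (sDegen ?C k i f) = sDegen (GL_cat R (n + m)) k i (p2 box x y k f)"
    if "z \<in> sObj ?C" "w \<in> sObj ?C" "f \<in> sHom ?C k z w" "i \<le> k"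
    using that by (cases z; cases w; cases f) (auto intro!: block_sumM_degen mhom_carrier)
qed

abbreviation MB :: "(nat, 'o mat, 'm mat) bicat" where "MB \<equiv> module_bicat R"

text \<open>
  With identity constraints, the unit axioms are equations between identities, and the
  associativity axiom is \<open>mat_assoc_block_sum\<close>.
\<close>

lemma box_pseudofunctor: "pseudofunctor (prod_bicat MB MB) MB box"
proof (rule pseudofunctor.intro)
  fix A B C D :: "nat \<times> nat"
  obtain a a' b b' c c' d d' where [simp]: "A = (a, a')" "B = (b, b')" "C = (c, c')" "D = (d, d')" by fastforce
  let ?P = "prod_bicat MB MB"
  show "p0 box A \<in> bObj MB" by simp
  show "sfunctor (bHom ?P A B) (bHom MB (p0 box A) (p0 box B)) (p1 box A B) (p2 box A B)"
  proof (cases "a = b \<and> a' = b'")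
    case True
    then show ?thesis using block_functor by simp
  qed (auto intro!: sfunctor_empty)
  show "snat_iso (prod_cat (bHom ?P B C) (bHom ?P A B)) (bHom MB (p0 box A) (p0 box C))
        (\<lambda>(g, f). bComp MB (p0 box A) (p0 box B) (p0 box C) (p1 box B C g) (p1 box A B f))
        (\<lambda>k (\<psi>, \<phi>). bComp2 MB (p0 box A) (p0 box B) (p0 box C) k (p2 box B C k \<psi>) (p2 box A B k \<phi>))
        (\<lambda>(g, f). p1 box A C (bComp ?P A B C g f)) (\<lambda>k (\<psi>, \<phi>). p2 box A C k (bComp2 ?P A B C k \<psi> \<phi>))
        (\<lambda>(g, f). pComp box A B C g f)"
  proof (cases "a = b \<and> a' = b' \<and> b = c \<and> b' = c'")
    case True
    then have [simp]: "b = a" "b' = a'" "c = a" "c' = a'" by auto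
    have "snat_iso (prod_cat (bHom ?P B C) (bHom ?P A B)) (GL_cat R (a + a'))
        (\<lambda>(g, f). bComp MB (p0 box A) (p0 box B) (p0 box C) (p1 box B C g) (p1 box A B f))
        (\<lambda>k (\<psi>, \<phi>). bComp2 MB (p0 box A) (p0 box B) (p0 box C) k (p2 box B C k \<psi>) (p2 box A B k \<phi>))
        (\<lambda>(g, f). p1 box A C (bComp ?P A B C g f)) (\<lambda>k (\<psi>, \<phi>). p2 box A C k (bComp2 ?P A B C k \<psi> \<phi>))
        (\<lambda>(g, f). pComp box A B C g f)"
    proof (rule snat_iso_identity, goal_cases)
      case (1 x)
      then obtain g g' f f' where "x = ((g, g'), (f, f'))" "g \<in> mob a" "g' \<in> mob a'" "f \<in> mob a" "f' \<in> mob a'" using gob_mob by auto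
      then show ?case by (simp add: block_sum_prod[of g a g' a' f f'] block_sum_in mat_prod_in)
    next
      case (2 x y k \<theta>)
      then obtain g g' f f' h h' j j' where x: "x = ((g, g'), (f, f'))" "g \<in> mob a" "g' \<in> mob a'" "f \<in> mob a" "f' \<in> mob a'"
        and y: "y = ((h, h'), (j, j'))" "h \<in> mob a" "h' \<in> mob a'" "j \<in> mob a" "j' \<in> mob a'" using gob_mob by auto
      with 2 obtain \<psi> \<psi>' \<phi> \<phi>' where t: "\<theta> = ((\<psi>, \<psi>'), (\<phi>, \<phi>'))" "\<psi> \<in> mhom a k g h" "\<psi>' \<in> mhom a' k g' h'" "\<phi> \<in> mhom a k f j" "\<phi>' \<in> mhom a' k f' j'"
        by auto
      from x y t show ?case
        by (auto simp: block_sumM_prod[OF x(2,3) y(2,3) x(4,5) y(4,5) t(2-5)] block_sum_prod[OF x(2,3,4,5)] block_sum_prod[OF y(2,3,4,5)]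
          intro!: block_sumM_in mat_prod_in mat_prodM_in)
    qed
    then show ?thesis by simp
  qed (auto intro!: snat_iso_empty)
  show "siso (bHom MB (p0 box A) (p0 box A)) 0 (bId MB (p0 box A)) (p1 box A A (bId ?P A)) (pUnit box A)"
    by (simp add: block_sum_id_mat idm_siso)
  show "bVert MB (p0 box A) (p0 box D) (pComp box A B D (bComp ?P B C D h g) f)
        (bVert MB (p0 box A) (p0 box D)
          (bComp2 MB (p0 box A) (p0 box B) (p0 box D) 0 (pComp box B C D h g) (bId2 MB (p0 box A) (p0 box B) (p1 box A B f)))
          (bAssoc MB (p0 box A) (p0 box B) (p0 box C) (p0 box D) (p1 box C D h) (p1 box B C g) (p1 box A B f))) =
      bVert MB (p0 box A) (p0 box D) (p2 box A D 0 (bAssoc ?P A B C D h g f))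
        (bVert MB (p0 box A) (p0 box D) (pComp box A C D h (bComp ?P A B C g f))
          (bComp2 MB (p0 box A) (p0 box C) (p0 box D) 0 (bId2 MB (p0 box C) (p0 box D) (p1 box C D h)) (pComp box A B C g f)))"
    if o: "f \<in> bMor ?P A B" "g \<in> bMor ?P B C" "h \<in> bMor ?P C D" for f g h
  proof -
    from o obtain f1 f2 g1 g2 h1 h2 where [simp]: "f = (f1, f2)" "g = (g1, g2)" "h = (h1, h2)" by (cases f; cases g; cases h)
    from o have [simp]: "b = a" "b' = a'" "c = a" "c' = a'" "d = a" "d' = a'" and m: "f1 \<in> mob a" "f2 \<in> mob a'" "g1 \<in> mob a" "g2 \<in> mob a'" "h1 \<in> mob a" "h2 \<in> mob a'"
      using gob_mob by auto
    let ?S = "block_sum R (mat_prod R h1 (mat_prod R g1 f1)) (mat_prod R h2 (mat_prod R g2 f2))"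
    let ?T = "block_sum R (mat_prod R (mat_prod R h1 g1) f1) (mat_prod R (mat_prod R h2 g2) f2)"
    let ?x = "block_sumM R 0 (mat_assoc R h1 g1 f1) (mat_assoc R h2 g2 f2)"
    have x: "?x \<in> mhom (a + a') 0 ?S ?T" using m by (intro block_sumM_in mat_assoc_in mat_prod_in)
    have S: "?S \<in> mob (a + a')" "?T \<in> mob (a + a')" using m by (auto intro!: block_sum_in mat_prod_in)
    have 1: "mat_prodM R 0 (idm 0 (block_sum R (mat_prod R h1 g1) (mat_prod R h2 g2))) (idm 0 (block_sum R f1 f2)) = idm 0 ?T"
      using m by (simp add: idm_prod[of _ "a + a'"] block_sum_in mat_prod_in block_sum_prod[of _ a _ a'])
    have 2: "mat_prodM R 0 (idm 0 (block_sum R h1 h2)) (idm 0 (block_sum R (mat_prod R g1 f1) (mat_prod R g2 f2))) = idm 0 ?S"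
      using m by (simp add: idm_prod[of _ "a + a'"] block_sum_in mat_prod_in block_sum_prod[of _ a _ a'])
    have 3: "mat_assoc R (block_sum R h1 h2) (block_sum R g1 g2) (block_sum R f1 f2) = ?x"
      using m by (intro mat_assoc_block_sum)
    show ?thesis
      using x S by (simp add: 1 2 3 idm_left[OF S x] idm_right[OF S x] idm_idm)
  qed
  show "bVert MB (p0 box A) (p0 box B) (p2 box A B 0 (bLeft ?P A B f))
        (bVert MB (p0 box A) (p0 box B) (pComp box A B B (bId ?P B) f)
          (bComp2 MB (p0 box A) (p0 box B) (p0 box B) 0 (pUnit box B) (bId2 MB (p0 box A) (p0 box B) (p1 box A B f)))) =
      bLeft MB (p0 box A) (p0 box B) (p1 box A B f)"
    and "bVert MB (p0 box A) (p0 box B) (p2 box A B 0 (bRight ?P A B f))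
        (bVert MB (p0 box A) (p0 box B) (pComp box A A B f (bId ?P A))
          (bComp2 MB (p0 box A) (p0 box A) (p0 box B) 0 (bId2 MB (p0 box A) (p0 box B) (p1 box A B f)) (pUnit box A))) =
      bRight MB (p0 box A) (p0 box B) (p1 box A B f)"
    if o: "f \<in> bMor ?P A B" for f
  proof -
    from o obtain f1 f2 where [simp]: "f = (f1, f2)" by (cases f)
    from o have [simp]: "b = a" "b' = a'" and m: "f1 \<in> mob a" "f2 \<in> mob a'" using gob_mob by auto
    note bm = block_sum_in[OF m]
    note [simp] = idm_block[OF m] idm_prod[OF id_mat_in bm] idm_prod[OF bm id_mat_in] id_mat_times[OF m(1)] id_mat_times[OF m(2)]
       times_id_mat[OF m(1)] times_id_mat[OF m(2)] id_mat_times[OF bm] times_id_mat[OF bm] idm_idm[OF bm]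
    show "bVert MB (p0 box A) (p0 box B) (p2 box A B 0 (bLeft ?P A B f))
        (bVert MB (p0 box A) (p0 box B) (pComp box A B B (bId ?P B) f)
          (bComp2 MB (p0 box A) (p0 box B) (p0 box B) 0 (pUnit box B) (bId2 MB (p0 box A) (p0 box B) (p1 box A B f)))) =
      bLeft MB (p0 box A) (p0 box B) (p1 box A B f)"
      by simp
    show "bVert MB (p0 box A) (p0 box B) (p2 box A B 0 (bRight ?P A B f))
        (bVert MB (p0 box A) (p0 box B) (pComp box A A B f (bId ?P A))
          (bComp2 MB (p0 box A) (p0 box A) (p0 box B) 0 (bId2 MB (p0 box A) (p0 box B) (p1 box A B f)) (pUnit box A))) =
      bRight MB (p0 box A) (p0 box B) (p1 box A B f)"
      by simp
  qed
qed

text \<open>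
  The target of the braiding, the block sum with its arguments exchanged.
\<close>

abbreviation xob where "xob \<equiv> pfun_comp MB box (pfun_twist MB)"

lemma xob_simps [simp]:
  "p0 xob (a, b) = b + a" "p1 xob A B (U, V) = block_sum R V U" "p2 xob A B k (\<phi>, \<psi>) = block_sumM R k \<psi> \<phi>"
  by (simp_all add: pfun_comp_def pfun_twist_def split_beta)

lemma xob_constraints:
  "g \<in> mob a \<Longrightarrow> g' \<in> mob b \<Longrightarrow> f \<in> mob a \<Longrightarrow> f' \<in> mob b \<Longrightarrow>
    pComp xob (a, b) (a, b) (a, b) (g, g') (f, f') = idm 0 (block_sum R (mat_prod R g' f') (mat_prod R g f))"
  "pUnit xob (a, b) = idm 0 (id_mat R (b + a))"
proof -
  assume m: "g \<in> mob a" "g' \<in> mob b" "f \<in> mob a" "f' \<in> mob b"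
  show "pComp xob (a, b) (a, b) (a, b) (g, g') (f, f') = idm 0 (block_sum R (mat_prod R g' f') (mat_prod R g f))"
    using m by (simp add: pfun_comp_def pfun_twist_def idm_block[OF mat_prod_in[OF m(2,4)] mat_prod_in[OF m(1,3)]]
      idm_idm[OF block_sum_in[OF mat_prod_in[OF m(2,4)] mat_prod_in[OF m(1,3)]]])
next
  show "pUnit xob (a, b) = idm 0 (id_mat R (b + a))"
    by (simp add: pfun_comp_def pfun_twist_def idm_block[OF id_mat_in id_mat_in] block_sum_id_mat idm_idm)
qed

text \<open>
  All 2-cells in the axiom for horizontal composition are identities: the naturality 2-cells by
  definition, and the three associativity isomorphisms because a permutation matrix stands on the
  left, in the middle or on the right. The strict equalities that these imply also identify all
  the composite 1-morphisms with one matrix \<open>?X\<close>.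
\<close>

lemma braiding_transformation: "transformation (prod_bicat MB MB) MB box xob braiding"
proof (rule transformation.intro)
  fix A B C :: "nat \<times> nat"
  obtain a a' b b' c c' where [simp]: "A = (a, a')" "B = (b, b')" "C = (c, c')" by fastforce
  have ba [simp]: "a' + a = a + a'" by simp
  let ?P = "prod_bicat MB MB"
  show "t1 braiding A \<in> bMor MB (p0 box A) (p0 xob A)" by (simp add: gob_swap)
  show "snat_iso (bHom ?P A B) (bHom MB (p0 box A) (p0 xob B))
        (\<lambda>f. bComp MB (p0 box A) (p0 xob A) (p0 xob B) (p1 xob A B f) (t1 braiding A))
        (\<lambda>k \<phi>. bComp2 MB (p0 box A) (p0 xob A) (p0 xob B) k (p2 xob A B k \<phi>) (sId (bHom MB (p0 box A) (p0 xob A)) k (t1 braiding A)))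
        (\<lambda>f. bComp MB (p0 box A) (p0 box B) (p0 xob B) (t1 braiding B) (p1 box A B f))
        (\<lambda>k \<phi>. bComp2 MB (p0 box A) (p0 box B) (p0 xob B) k (sId (bHom MB (p0 box B) (p0 xob B)) k (t1 braiding B)) (p2 box A B k \<phi>))
        (t2 braiding A B)"
  proof (cases "a = b \<and> a' = b'")
    case True
    then have [simp]: "b = a" "b' = a'" by auto
    have "snat_iso (bHom ?P A B) (GL_cat R (a + a'))
        (\<lambda>f. bComp MB (p0 box A) (p0 xob A) (p0 xob B) (p1 xob A B f) (t1 braiding A))
        (\<lambda>k \<phi>. bComp2 MB (p0 box A) (p0 xob A) (p0 xob B) k (p2 xob A B k \<phi>) (sId (bHom MB (p0 box A) (p0 xob A)) k (t1 braiding A)))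
        (\<lambda>f. bComp MB (p0 box A) (p0 box B) (p0 xob B) (t1 braiding B) (p1 box A B f))
        (\<lambda>k \<phi>. bComp2 MB (p0 box A) (p0 box B) (p0 xob B) k (sId (bHom MB (p0 box B) (p0 xob B)) k (t1 braiding B)) (p2 box A B k \<phi>))
        (t2 braiding A B)"
    proof (rule snat_iso_identity, goal_cases)
      case (1 x)
      then obtain f f' where "x = (f, f')" "f \<in> mob a" "f' \<in> mob a'" using gob_mob by auto
      then show ?case by (simp add: swap_mat_natural mat_prod_in block_sum_in)
    next
      case (2 x y k \<theta>)
      then obtain f f' g g' where x: "x = (f, f')" "f \<in> mob a" "f' \<in> mob a'" and y: "y = (g, g')" "g \<in> mob a" "g' \<in> mob a'" using gob_mob by auto
      with 2 obtain \<phi> \<phi>' where t: "\<theta> = (\<phi>, \<phi>')" "\<phi> \<in> mhom a k f g" "\<phi>' \<in> mhom a' k f' g'" by auto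
      from x y t show ?case
        using swap_mat_naturalM[OF x(2,3) y(2,3) t(2,3)] by (auto simp: swap_mat_natural intro!: mat_prodM_in block_sumM_in block_sum_in idm_in)
    qed
    then show ?thesis by simp
  qed (auto intro!: snat_iso_empty)
  show "bVert MB (p0 box A) (p0 xob C) (t2 braiding A C (bComp ?P A B C g f))
        (bVert MB (p0 box A) (p0 xob C)
          (bComp2 MB (p0 box A) (p0 xob A) (p0 xob C) 0 (pComp xob A B C g f) (bId2 MB (p0 box A) (p0 xob A) (t1 braiding A)))
          (bAssoc MB (p0 box A) (p0 xob A) (p0 xob B) (p0 xob C) (p1 xob B C g) (p1 xob A B f) (t1 braiding A))) =
      bVert MB (p0 box A) (p0 xob C)
        (bComp2 MB (p0 box A) (p0 box C) (p0 xob C) 0 (bId2 MB (p0 box C) (p0 xob C) (t1 braiding C)) (pComp box A B C g f))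
        (bVert MB (p0 box A) (p0 xob C)
          (sinv (bHom MB (p0 box A) (p0 xob C))
            (bComp MB (p0 box A) (p0 box C) (p0 xob C) (t1 braiding C) (bComp MB (p0 box A) (p0 box B) (p0 box C) (p1 box B C g) (p1 box A B f)))
            (bComp MB (p0 box A) (p0 box B) (p0 xob C) (bComp MB (p0 box B) (p0 box C) (p0 xob C) (t1 braiding C) (p1 box B C g)) (p1 box A B f))
            (bAssoc MB (p0 box A) (p0 box B) (p0 box C) (p0 xob C) (t1 braiding C) (p1 box B C g) (p1 box A B f)))
          (bVert MB (p0 box A) (p0 xob C)
            (bComp2 MB (p0 box A) (p0 box B) (p0 xob C) 0 (t2 braiding B C g) (bId2 MB (p0 box A) (p0 box B) (p1 box A B f)))
            (bVert MB (p0 box A) (p0 xob C)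
              (bAssoc MB (p0 box A) (p0 box B) (p0 xob B) (p0 xob C) (p1 xob B C g) (t1 braiding B) (p1 box A B f))
              (bComp2 MB (p0 box A) (p0 xob B) (p0 xob C) 0 (bId2 MB (p0 xob B) (p0 xob C) (p1 xob B C g)) (t2 braiding A B f)))))"
    if o: "f \<in> bMor ?P A B" "g \<in> bMor ?P B C" for f g
  proof -
    from o obtain f1 f2 g1 g2 where [simp]: "f = (f1, f2)" "g = (g1, g2)" by (cases f; cases g)
    from o have [simp]: "b = a" "b' = a'" "c = a" "c' = a'" and m: "f1 \<in> mob a" "f2 \<in> mob a'" "g1 \<in> mob a" "g2 \<in> mob a'"
      using gob_mob by auto
    let ?s = "swap_mat a a'" and ?f = "block_sum R f1 f2" and ?f' = "block_sum R f2 f1" and ?g = "block_sum R g1 g2" and ?g' = "block_sum R g2 g1"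
    let ?gf = "block_sum R (mat_prod R g1 f1) (mat_prod R g2 f2)" and ?gf' = "block_sum R (mat_prod R g2 f2) (mat_prod R g1 f1)"
    let ?X = "mat_prod R ?s ?gf"
    have s: "?s \<in> mob (a + a')" by simp
    have fg: "?f \<in> mob (a + a')" "?f' \<in> mob (a + a')" "?g \<in> mob (a + a')" "?g' \<in> mob (a + a')" "?gf \<in> mob (a + a')" "?gf' \<in> mob (a + a')"
      using block_sum_in[OF m(1,2)] block_sum_in[OF m(2,1)] block_sum_in[OF m(3,4)] block_sum_in[OF m(4,3)]
        block_sum_in[OF mat_prod_in[OF m(3,1)] mat_prod_in[OF m(4,2)]] block_sum_in[OF mat_prod_in[OF m(4,2)] mat_prod_in[OF m(3,1)]] by simp_all
    have X: "?X \<in> mob (a + a')" using s fg by (intro mat_prod_in)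
    \<comment> \<open>Every threefold composite in the axiom is equal to \<open>?X\<close>.\<close>
    have p: "mat_prod R ?g ?f = ?gf" "mat_prod R ?g' ?f' = ?gf'"
      using m by (simp_all add: block_sum_prod[of _ a _ a'] block_sum_prod[of _ a' _ a])
    have n: "mat_prod R ?f' ?s = mat_prod R ?s ?f" "mat_prod R ?g' ?s = mat_prod R ?s ?g" "mat_prod R ?gf' ?s = ?X"
      using m by (simp_all add: swap_mat_natural mat_prod_in)
    have q: "mat_prod R (mat_prod R ?s ?g) ?f = ?X"
      using mat_assoc_perm_left(2)[OF fg(3,1), of "swap_index a a'"] by (simp add: p flip: swap_mat_def)
    have r: "mat_prod R ?g' (mat_prod R ?s ?f) = ?X"
      using swap_mat_assoc_middle(2)[OF m(4,3) fg(1)] by (simp add: n q)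
    \<comment> \<open>Every associativity isomorphism reduces to the identity of \<open>?X\<close>.\<close>
    have a1: "mat_assoc R ?g' ?f' ?s = idm 0 ?X"
      using mat_assoc_perm_right(1)[OF fg(4,2) inverse_perms_swap] by (simp add: n r flip: swap_mat_def)
    have a2: "mat_assoc R ?s ?g ?f = idm 0 ?X"
      using mat_assoc_perm_left(1)[OF fg(3,1), of "swap_index a a'"] by (simp add: p flip: swap_mat_def)
    have a3: "mat_assoc R ?g' ?s ?f = idm 0 ?X"
      using swap_mat_assoc_middle(1)[OF m(4,3) fg(1)] by (simp add: r)
    have i: "mat_prodM R 0 (idm 0 ?gf') (idm 0 ?s) = idm 0 ?X" "mat_prodM R 0 (idm 0 ?s) (idm 0 ?gf) = idm 0 ?X"
      "mat_prodM R 0 (idm 0 (mat_prod R ?s ?g)) (idm 0 ?f) = idm 0 ?X" "mat_prodM R 0 (idm 0 ?g') (idm 0 (mat_prod R ?s ?f)) = idm 0 ?X"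
      using idm_prod[OF fg(6) s, of 0] idm_prod[OF s fg(5), of 0] idm_prod[OF mat_prod_in[OF s fg(3)] fg(1), of 0] idm_prod[OF fg(4) mat_prod_in[OF s fg(1)], of 0]
      by (simp_all add: n q r)
    show ?thesis
      using m by (simp add: xob_constraints p q a1 a2 a3 i sinv_idm[OF X] idm_idm[OF X])
  qed
  show "bVert MB (p0 box A) (p0 xob A) (t2 braiding A A (bId ?P A))
        (bComp2 MB (p0 box A) (p0 xob A) (p0 xob A) 0 (pUnit xob A) (bId2 MB (p0 box A) (p0 xob A) (t1 braiding A))) =
      bVert MB (p0 box A) (p0 xob A)
        (bComp2 MB (p0 box A) (p0 box A) (p0 xob A) 0 (bId2 MB (p0 box A) (p0 xob A) (t1 braiding A)) (pUnit box A))
        (bVert MB (p0 box A) (p0 xob A)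
          (sinv (bHom MB (p0 box A) (p0 xob A)) (bComp MB (p0 box A) (p0 box A) (p0 xob A) (t1 braiding A) (bId MB (p0 box A)))
            (t1 braiding A) (bRight MB (p0 box A) (p0 xob A) (t1 braiding A)))
          (bLeft MB (p0 box A) (p0 xob A) (t1 braiding A)))"
  proof -
    have s: "swap_mat a a' \<in> mob (a + a')" by simp
    show ?thesis
      by (simp add: xob_constraints block_sum_id_mat times_id_mat[OF s] id_mat_times[OF s] idm_prod[OF s id_mat_in] idm_prod[OF id_mat_in s] sinv_idm[OF s] idm_idm[OF s])
  qed
qed

lemma box_strict_assoc:
  "pfun_eq (prod_bicat (prod_bicat MB MB) MB) (pfun_comp MB box (pfun_prod box (pfun_id MB)))
      (pfun_comp MB (pfun_comp MB box (pfun_prod (pfun_id MB) box)) (pfun_rebracket MB))"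
  unfolding pfun_eq_def
proof (intro conjI ballI allI, goal_cases)
  case (1 A)
  then show ?case by (cases A; cases "fst A") (auto simp: pfun_comp_def pfun_prod_def pfun_id_def pfun_rebracket_def)
next
  case (2 A)
  then show ?case
    by (cases A; cases "fst A") (auto simp: pfun_comp_def pfun_prod_def pfun_id_def pfun_rebracket_def idm_block[OF id_mat_in id_mat_in] block_sum_id_mat idm_idm[OF id_mat_in] add.assoc)
next
  case (3 A B f)
  then show ?case
    by (cases A; cases "fst A"; cases B; cases "fst B"; cases f; cases "fst f")
      (auto simp: pfun_comp_def pfun_prod_def pfun_id_def pfun_rebracket_def block_sum_assoc dest!: gob_mob mob_carrier)
next
  case (4 A B f g k \<phi>)
  then show ?case
    by (cases A; cases "fst A"; cases B; cases "fst B"; cases f; cases "fst f"; cases g; cases "fst g"; cases \<phi>; cases "fst \<phi>")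
      (auto simp: pfun_comp_def pfun_prod_def pfun_id_def pfun_rebracket_def dest!: mhom_carrier intro!: block_sumM_assoc)
next
  case (5 A B C f g)
  obtain a b c f1 f2 f3 g1 g2 g3 a' b' c' a'' b'' c'' where [simp]: "A = ((a, b), c)" "B = ((a', b'), c')" "C = ((a'', b''), c'')" "f = ((f1, f2), f3)" "g = ((g1, g2), g3)"
    by (cases A; cases "fst A"; cases B; cases "fst B"; cases C; cases "fst C"; cases f; cases "fst f"; cases g; cases "fst g") auto
  from 5 have [simp]: "a' = a" "a'' = a" "b' = b" "b'' = b" "c' = c" "c'' = c" and m: "f1 \<in> mob a" "f2 \<in> mob b" "f3 \<in> mob c" "g1 \<in> mob a" "g2 \<in> mob b" "g3 \<in> mob c"
    using gob_mob by auto
  let ?x = "mat_prod R g1 f1" and ?y = "mat_prod R g2 f2" and ?z = "mat_prod R g3 f3"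
  have x: "?x \<in> mob a" "?y \<in> mob b" "?z \<in> mob c" using m by (auto intro: mat_prod_in)
  note xy = block_sum_in[OF x(1,2)] and yz = block_sum_in[OF x(2,3)]
  note xyz = block_sum_in[OF xy x(3)] and xyz' = block_sum_in[OF x(1) yz]
  have assoc: "block_sum R (block_sum R ?x ?y) ?z = block_sum R ?x (block_sum R ?y ?z)"
    by (rule block_sum_assoc[OF x[THEN mob_carrier]])
  have [simp]: "mat_prod R (block_sum R g1 g2) (block_sum R f1 f2) = block_sum R ?x ?y" "mat_prod R (block_sum R g2 g3) (block_sum R f2 f3) = block_sum R ?y ?z"
    using m by (simp_all add: block_sum_prod[of _ a _ b] block_sum_prod[of _ b _ c])
  show ?case
    by (simp add: pfun_comp_def pfun_prod_def pfun_id_def pfun_rebracket_def idm_block[OF xy x(3)] idm_block[OF x(1) yz] idm_block[OF x(2,3)]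
      idm_idm[OF xyz] idm_idm[OF xyz'] assoc add.assoc)
qed

text \<open>
  The unit object is \<open>0\<close>, whose only identity 1-morphism is the empty matrix, and block sum with
  it changes nothing.
\<close>

lemma box_strict_unit:
  "pfun_eq MB (pfun_comp MB box (pfun_insert_left MB 0)) (pfun_id MB)"
  "pfun_eq MB (pfun_comp MB box (pfun_insert_right MB 0)) (pfun_id MB)"
proof -
  have E: "id_mat R 0 \<in> carrier_mat 0 0" "idm k (id_mat R 0) \<in> carrier_mat 0 0" "mat_prod R (id_mat R 0) (id_mat R 0) \<in> carrier_mat 0 0" for k
    by (auto simp: id_mat_def mat_prod_def)
  note e = block_sum_empty[OF E(1)] block_sum_empty[OF E(3)] block_sumM_empty[OF E(2)]
  have c: "U \<in> carrier_mat n n" "idm k U \<in> carrier_mat n n" if "U \<in> mob n" for U n k using that mob_carrier by auto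
  note defs = pfun_eq_def pfun_comp_def pfun_insert_left_def pfun_insert_right_def pfun_id_def
  show "pfun_eq MB (pfun_comp MB box (pfun_insert_left MB 0)) (pfun_id MB)"
    "pfun_eq MB (pfun_comp MB box (pfun_insert_right MB 0)) (pfun_id MB)"
    by (auto simp: defs e(1,2)[OF c(1)[OF id_mat_in]] e(5,6)[OF c(2)[OF id_mat_in]] e(1,2)[OF mob_carrier[OF gob_mob]] e(5,6)[OF mhom_carrier]
      e(3,4)[OF mob_carrier[OF mat_prod_in[OF gob_mob gob_mob]]] e(5,6)[OF c(2)[OF mat_prod_in[OF gob_mob gob_mob]]]
      idm_idm[OF id_mat_in] idm_idm[OF mat_prod_in[OF gob_mob gob_mob]])
qed

lemma strict_symmetric_monoidal_module_bicat:
  "strict_symmetric_monoidal_bicategory MB box 0 braiding"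
proof (intro strict_symmetric_monoidal_bicategory.intro strict_symmetric_monoidal_bicategory_axioms.intro
    bicategory_module box_pseudofunctor braiding_transformation box_strict_assoc box_strict_unit)
qed (simp_all add: swap_mat_left swap_mat_right swap_mat_swap_mat)

end

theorem theorem4p7:
  fixes R :: "('o, 'm) bimon"
  assumes "strict_bimonoidal_category R"
  shows "\<exists>P u \<beta>. strict_symmetric_monoidal_bicategory (module_bicat R) P u \<beta> \<and>
    (\<forall>n m. p0 P (n, m) = n + m) \<and>
    (\<forall>n m. \<forall>U \<in> sObj (GL_cat R n). \<forall>V \<in> sObj (GL_cat R m).
      p1 P (n, m) (n, m) (U, V) = block_sum R U V) \<and>
    (\<forall>n m k. \<forall>U \<in> sObj (GL_cat R n). \<forall>U' \<in> sObj (GL_cat R n).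
      \<forall>V \<in> sObj (GL_cat R m). \<forall>V' \<in> sObj (GL_cat R m).
      \<forall>\<phi> \<in> sHom (GL_cat R n) k U U'. \<forall>\<psi> \<in> sHom (GL_cat R m) k V V'.
      p2 P (n, m) (n, m) k (\<phi>, \<psi>) = block_sumM R k \<phi> \<psi>)"
proof -
  interpret strict_bimonoidal_category R by fact
  show ?thesis
    using strict_symmetric_monoidal_module_bicat by (intro exI[of _ box] exI[of _ 0] exI[of _ braiding]) simp
qed

end
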